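(* Assume that $(f,F)$ satisfies $\mathbf{(H1^* )}$ and $\mathbf{(H2^* )}$ (both recalled in the context). Let $u_0\in(\mathbf{L}^\infty\cap\mathbf{L}^1\cap\mathbf{BV})(\mathbb{R}^N;\mathbb{R})$. Then the weak entropy solution $u$ of $$\partial_t u+\mathrm{Div}\, f(t,x,u)=F(t,x,u)\ \text{ on } (0,\infty)\times\mathbb{R}^N,\qquad u(0,x)=u_0(x),$$ satisfies $u(t)\in\mathbf{BV}(\mathbb{R}^N;\mathbb{R})$ for all $t>0$. Moreover, let $T_0>0$ and set $$\mathcal{U}=\|u\|_{\mathbf{L}^\infty([0,T_0]\times\mathbb{R}^N)},\quad U_t=\sup_{y\in\mathbb{R}^N}|u(t,y)|,\quad \mathcal{S}_{T_0}(u)=\bigcup_{t\in[0,T_0]}\mathrm{Supp}(u(t)),\quad \Sigma^u_{T_0}=[0,T_0]\times\mathcal{S}_{T_0}(u)\times[-\mathcal{U},\mathcal{U}],$$ $$\kappa_0^*=(2N+1)\,\|\nabla\partial_u f\|_{\mathbf{L}^\infty(\Sigma^u_{T_0};\mathbb{R}^{N\times N})}+\|\partial_u F\|_{\mathbf{L}^\infty(\Sigma^u_{T_0};\mathbb{R})}.$$ Then for all $T\in[0,T_0]$, with $W_N=\int_0^{\pi/2}(\cos\theta)^N\,d\theta$, $$\mathrm{TV}(u(T))\le \mathrm{TV}(u_0)\,e^{\kappa_0^*T}+N W_N\int_0^T e^{\kappa_0^*(T-t)}\int_{\mathbb{R}^N}\big\|\nabla(F-\mathrm{div} f)(t,x,\cdot)\big\|_{\mathbf{L}^\infty([-U_t,U_t])}\,dx\,dt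 .$$
   Context: $N$ is a positive integer, $\Omega=(0,\infty)\times\mathbb{R}^N\times\mathbb{R}$ with points $(t,x,u)$, and for $T,U>0$, $\Omega_T^U=[0,T]\times\mathbb{R}^N\times[-U,U]$. $\|\cdot\|$ is the Euclidean norm on vectors and the associated operator norm on matrices. For $f=f(t,x,u)\in\mathbb{R}^N$, $\mathrm{div} f$ and $\nabla f$ denote the partial divergence and gradient with respect to $x$ only ($t,u$ fixed), $\partial_u$ is the partial derivative in $u$, while for $u=u(t,x)$, $\mathrm{Div} f(t,x,u)=\mathrm{div} f+\partial_u f\cdot\nabla u$ is the total divergence. $\mathrm{Supp}$ is the support. $\mathbf{(H1^* )}$ for $(f,F)$: $f\in C^0(\Omega;\mathbb{R}^N)$, $F\in C^0(\Omega;\mathbb{R})$; $f,F$ have continuous derivatives $\partial_u f$, $\partial_u\nabla f$, $\nabla^2 f$, $\partial_u F$, $\nabla F$; and for all $U,T>0$: $\partial_u f\in\mathbf{L}^\infty(\Omega_T^U;\mathbb{R}^N)$, $F-\mathrm{div} f\in\mathbf{L}^\infty(\Omega_T^U;\mathbb{R})$, $\partial_u(F-\mathrm{div} f)\in\mathbf{L}^\infty(\Omega_T^U;\mathbb{R})$. $\mathbf{(H2^* )}$ for $(f,F)$: for all $U,T>0$, $\nabla\partial_u f\in\mathbf{L}^\infty(\Omega_T^U;\mathbb{R}^{N\times N})$, $\partial_u F\in\mathbf{L}^\infty(\Omega_T^U;\mathbb{R})$, and $\int_0^T\int_{\mathbb{R}^N}\|\nabla(F-\mathrm{div} f)(t,x,\cdot)\|_{\mathbf{L}^\infty([-U,U];\mathbb{R}^N)}\,dx\,dt<\infty$.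 Weak entropy solution (Kružkov): $u$ is bounded on $[0,T]\times\mathbb{R}^N$ for each $T>0$, and for all $k\in\mathbb{R}$ and all $\phi\in C_c^1((0,\infty)\times\mathbb{R}^N;[0,\infty))$, $$\int_0^\infty\!\!\int_{\mathbb{R}^N}\big[(u-k)\partial_t\phi+(f(t,x,u)-f(t,x,k))\cdot\nabla_x\phi+(F(t,x,u)-\mathrm{div} f(t,x,k))\phi\big]\,\mathrm{sign}(u-k)\,dx\,dt\ge0,$$ and $u(t)\to u_0$ in $\mathbf{L}^1_{loc}(\mathbb{R}^N)$ as $t\to0^+$. Under $\mathbf{(H1^* )}$, for any $u_0\in\mathbf{L}^\infty(\mathbb{R}^N;\mathbb{R})$ Kružkov's theorem gives a unique such solution in $\mathbf{L}^\infty([0,\infty);\mathbf{L}^1_{loc}(\mathbb{R}^N;\mathbb{R}))$, continuous from the right; $u(t)=u(t,\cdot)$ refers to this representative, and suprema of $|u(t,\cdot)|$ are essential suprema. $\mathbf{BV}(\mathbb{R}^N;\mathbb{R})$ is the set of $\mathbf{L}^1_{loc}$ functions with finite total variation $\mathrm{TV}$ (total mass of the distributional gradient, computed with the Euclidean norm). *)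

theory Defs
  imports "HOL-Analysis.Analysis"
begin

text \<open>Space is \<^typ>\<open>real ^ 'n\<close>, with the dimension $N$ being \<^term>\<open>CARD('n)\<close>. Derivatives are
  elements of the space of bounded linear maps, so that their norm is the operator norm.\<close>

section \<open>Derivatives\<close>

definition deriv_at :: "('a::real_normed_vector \<Rightarrow> 'b::real_normed_vector) \<Rightarrow> 'a \<Rightarrow> 'a \<Rightarrow>\<^sub>L 'b" where
  "deriv_at g x = Blinfun (frechet_derivative g (at x))"

definition grad :: "(real ^ 'n \<Rightarrow> real) \<Rightarrow> real ^ 'n \<Rightarrow> real ^ 'n" where
  "grad g x = (\<chi> j. blinfun_apply (deriv_at g x) (axis j 1))"

definition divergence :: "(real ^ 'n \<Rightarrow> real ^ 'n) \<Rightarrow> real ^ 'n \<Rightarrow> real" where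
  "divergence g x = (\<Sum>i\<in>UNIV. blinfun_apply (deriv_at g x) (axis i 1) $ i)"

definition D_x :: "(real \<Rightarrow> real ^ 'n \<Rightarrow> real \<Rightarrow> 'b::real_normed_vector)
    \<Rightarrow> real \<Rightarrow> real ^ 'n \<Rightarrow> real \<Rightarrow> (real ^ 'n) \<Rightarrow>\<^sub>L 'b" where
  "D_x g t x u = deriv_at (\<lambda>y. g t y u) x"

definition D_u :: "(real \<Rightarrow> real ^ 'n \<Rightarrow> real \<Rightarrow> 'b::real_normed_vector)
    \<Rightarrow> real \<Rightarrow> real ^ 'n \<Rightarrow> real \<Rightarrow> 'b" where
  "D_u g t x u = vector_derivative (\<lambda>w. g t x w) (at u)"

definition grad_x :: "(real \<Rightarrow> real ^ 'n \<Rightarrow> real \<Rightarrow> real) \<Rightarrow> real \<Rightarrow> real ^ 'n \<Rightarrow> real \<Rightarrow> real ^ 'n" where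
  "grad_x g t x u = grad (\<lambda>y. g t y u) x"

definition div_x :: "(real \<Rightarrow> real ^ 'n \<Rightarrow> real \<Rightarrow> real ^ 'n) \<Rightarrow> real \<Rightarrow> real ^ 'n \<Rightarrow> real \<Rightarrow> real" where
  "div_x f t x u = divergence (\<lambda>y. f t y u) x"

definition F_minus_div :: "(real \<Rightarrow> real ^ 'n \<Rightarrow> real \<Rightarrow> real ^ 'n) \<Rightarrow> (real \<Rightarrow> real ^ 'n \<Rightarrow> real \<Rightarrow> real)
    \<Rightarrow> real \<Rightarrow> real ^ 'n \<Rightarrow> real \<Rightarrow> real" where
  "F_minus_div f F t x u = F t x u - div_x f t x u"

section \<open>Function spaces\<close>

text \<open>For measurable $S$ and $g$ this is the essential supremum of $|g|$ over $S$ (and $0$ when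
  $S$ is a null set). Unlike \<open>esssup\<close> it remains meaningful without a measurability proof for $S$;
  this matters below, where $S$ involves an uncountable union of supports.\<close>

definition Linf_norm :: "'a::euclidean_space set \<Rightarrow> ('a \<Rightarrow> 'b::real_normed_vector) \<Rightarrow> ennreal" where
  "Linf_norm S g = Inf {C. AE p in lebesgue. p \<in> S \<longrightarrow> ennreal (norm (g p)) \<le> C}"

definition Linf :: "'a::euclidean_space set \<Rightarrow> ('a \<Rightarrow> 'b::real_normed_vector) \<Rightarrow> bool" where
  "Linf S g \<longleftrightarrow> set_borel_measurable lebesgue S g \<and> Linf_norm S g < \<infinity>"

definition L1_loc :: "(real ^ 'n \<Rightarrow> real) \<Rightarrow> bool" where
  "L1_loc g \<longleftrightarrow> (\<forall>K. compact K \<longrightarrow> g absolutely_integrable_on K)"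

definition tendsto_L1_loc :: "(real \<Rightarrow> real ^ 'n \<Rightarrow> real) \<Rightarrow> (real ^ 'n \<Rightarrow> real) \<Rightarrow> real filter \<Rightarrow> bool" where
  "tendsto_L1_loc u g A \<longleftrightarrow>
     (\<forall>K. compact K \<longrightarrow> ((\<lambda>s. LINT x:K|lebesgue. \<bar>u s x - g x\<bar>) \<longlongrightarrow> 0) A)"

text \<open>Support of a function determined up to null sets: the complement of the largest open set on
  which it vanishes almost everywhere.\<close>

definition ess_supp :: "(real ^ 'n \<Rightarrow> real) \<Rightarrow> (real ^ 'n) set" where
  "ess_supp g = - \<Union>{V. open V \<and> (AE x in lebesgue. x \<in> V \<longrightarrow> g x = 0)}"

definition C1_c :: "'a::euclidean_space set \<Rightarrow> ('a \<Rightarrow> 'b::real_normed_vector) \<Rightarrow> bool" where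
  "C1_c S \<phi> \<longleftrightarrow> (\<forall>p. \<phi> differentiable (at p)) \<and> continuous_on UNIV (deriv_at \<phi>)
     \<and> compact (closure {p. \<phi> p \<noteq> 0}) \<and> closure {p. \<phi> p \<noteq> 0} \<subseteq> S"

text \<open>The total mass of the distributional gradient. Negative integrals are truncated to $0$ by
  \<^const>\<open>ennreal\<close>, which does not affect the supremum since $\psi = 0$ is admissible.\<close>

definition TV :: "(real ^ 'n \<Rightarrow> real) \<Rightarrow> ennreal" where
  "TV g = (SUP \<psi> \<in> {\<psi> :: real ^ 'n \<Rightarrow> real ^ 'n. C1_c UNIV \<psi> \<and> (\<forall>x. norm (\<psi> x) \<le> 1)}.
             ennreal (LINT x|lebesgue. g x * divergence \<psi> x))"

definition BV :: "(real ^ 'n \<Rightarrow> real) \<Rightarrow> bool" where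
  "BV g \<longleftrightarrow> L1_loc g \<and> TV g < \<infinity>"

section \<open>Hypotheses on the flow and the source\<close>

definition Omega :: "(real \<times> (real ^ 'n) \<times> real) set" where
  "Omega = {0<..} \<times> UNIV \<times> UNIV"

definition Omega_box :: "real \<Rightarrow> real \<Rightarrow> (real \<times> (real ^ 'n) \<times> real) set" where
  "Omega_box T U = {0..T} \<times> UNIV \<times> {-U..U}"

definition has_continuous_D_u :: "(real \<Rightarrow> real ^ 'n \<Rightarrow> real \<Rightarrow> 'b::real_normed_vector) \<Rightarrow> bool" where
  "has_continuous_D_u g \<longleftrightarrow>
     (\<forall>(t, x, u) \<in> Omega. (\<lambda>w. g t x w) differentiable (at u))
     \<and> continuous_on Omega (\<lambda>(t, x, u). D_u g t x u)"

definition has_D_x :: "(real \<Rightarrow> real ^ 'n \<Rightarrow> real \<Rightarrow> 'b::real_normed_vector) \<Rightarrow> bool" where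
  "has_D_x g \<longleftrightarrow> (\<forall>(t, x, u) \<in> Omega. (\<lambda>y. g t y u) differentiable (at x))"

definition has_continuous_D_x :: "(real \<Rightarrow> real ^ 'n \<Rightarrow> real \<Rightarrow> 'b::real_normed_vector) \<Rightarrow> bool" where
  "has_continuous_D_x g \<longleftrightarrow> has_D_x g \<and> continuous_on Omega (\<lambda>(t, x, u). D_x g t x u)"

definition H1_star :: "(real \<Rightarrow> real ^ 'n \<Rightarrow> real \<Rightarrow> real ^ 'n)
    \<Rightarrow> (real \<Rightarrow> real ^ 'n \<Rightarrow> real \<Rightarrow> real) \<Rightarrow> bool" where
  "H1_star f F \<longleftrightarrow>
     continuous_on Omega (\<lambda>(t, x, u). f t x u) \<and> continuous_on Omega (\<lambda>(t, x, u). F t x u)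
     \<and> has_continuous_D_u f
     \<and> has_D_x f \<and> has_continuous_D_u (D_x f) \<and> has_continuous_D_x (D_x f)
     \<and> has_continuous_D_u F \<and> has_continuous_D_x F
     \<and> (\<forall>U>0. \<forall>T>0.
          Linf (Omega_box T U) (\<lambda>(t, x, u). D_u f t x u)
        \<and> Linf (Omega_box T U) (\<lambda>(t, x, u). F_minus_div f F t x u)
        \<and> Linf (Omega_box T U) (\<lambda>(t, x, u). D_u (F_minus_div f F) t x u))"

text \<open>Here \<^term>\<open>D_x (D_u f)\<close> exists on \<^const>\<open>Omega\<close> and agrees with \<^term>\<open>D_u (D_x f)\<close> by the
  theorem on mixed derivatives, under \<^const>\<open>H1_star\<close>.\<close>

definition H2_star :: "(real \<Rightarrow> real ^ 'n \<Rightarrow> real \<Rightarrow> real ^ 'n)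
    \<Rightarrow> (real \<Rightarrow> real ^ 'n \<Rightarrow> real \<Rightarrow> real) \<Rightarrow> bool" where
  "H2_star f F \<longleftrightarrow>
     (\<forall>U>0. \<forall>T>0.
          Linf (Omega_box T U) (\<lambda>(t, x, u). D_x (D_u f) t x u)
        \<and> Linf (Omega_box T U) (\<lambda>(t, x, u). D_u F t x u)
        \<and> (\<integral>\<^sup>+ t \<in> {0..T}. (\<integral>\<^sup>+ x. Linf_norm {-U..U} (\<lambda>w. grad_x (F_minus_div f F) t x w)
             \<partial>lebesgue) \<partial>lebesgue) < \<infinity>)"

section \<open>Entropy solutions\<close>

definition entropy_inequality :: "(real \<Rightarrow> real ^ 'n \<Rightarrow> real \<Rightarrow> real ^ 'n)
    \<Rightarrow> (real \<Rightarrow> real ^ 'n \<Rightarrow> real \<Rightarrow> real) \<Rightarrow> (real \<Rightarrow> real ^ 'n \<Rightarrow> real)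
    \<Rightarrow> real \<Rightarrow> (real \<Rightarrow> real ^ 'n \<Rightarrow> real) \<Rightarrow> bool" where
  "entropy_inequality f F u k \<phi> \<longleftrightarrow>
     (LINT (t, x) : {0<..} \<times> UNIV | lebesgue.
        ((u t x - k) * vector_derivative (\<lambda>s. \<phi> s x) (at t)
         + (f t x (u t x) - f t x k) \<bullet> grad (\<phi> t) x
         + (F t x (u t x) - div_x f t x k) * \<phi> t x) * sgn (u t x - k)) \<ge> 0"

text \<open>The last clause selects, among the functions \<open>u\<close> that agree almost everywhere, the one that is
  continuous from the right in time with values in $L^1_{loc}$, so that every \<open>u t\<close> with
  \<open>t \<ge> 0\<close> is determined up to a null set (and \<open>u 0\<close> is \<open>u0\<close>).\<close>

definition weak_entropy_solution :: "(real \<Rightarrow> real ^ 'n \<Rightarrow> real \<Rightarrow> real ^ 'n)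
    \<Rightarrow> (real \<Rightarrow> real ^ 'n \<Rightarrow> real \<Rightarrow> real) \<Rightarrow> (real ^ 'n \<Rightarrow> real)
    \<Rightarrow> (real \<Rightarrow> real ^ 'n \<Rightarrow> real) \<Rightarrow> bool" where
  "weak_entropy_solution f F u0 u \<longleftrightarrow>
     (\<forall>T>0. Linf ({0..T} \<times> UNIV) (\<lambda>(t, x). u t x))
     \<and> (\<forall>t\<ge>0. L1_loc (u t))
     \<and> (\<forall>k \<phi>. C1_c ({0<..} \<times> UNIV) (\<lambda>(t, x). \<phi> t x) \<and> (\<forall>t x. \<phi> t x \<ge> 0)
           \<longrightarrow> entropy_inequality f F u k \<phi>)
     \<and> tendsto_L1_loc u u0 (at_right 0)
     \<and> (\<forall>t\<ge>0. tendsto_L1_loc u (u t) (at_right t))"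

section \<open>Constants in the total variation estimate\<close>

text \<open>The norms converted to reals here are finite under the hypotheses \<^const>\<open>H1_star\<close>,
  \<^const>\<open>H2_star\<close> and \<^const>\<open>weak_entropy_solution\<close>.\<close>

definition U_max :: "(real \<Rightarrow> real ^ 'n \<Rightarrow> real) \<Rightarrow> real \<Rightarrow> real" where
  "U_max u T0 = enn2real (Linf_norm ({0..T0} \<times> UNIV) (\<lambda>(t, x). u t x))"

definition U_at :: "(real \<Rightarrow> real ^ 'n \<Rightarrow> real) \<Rightarrow> real \<Rightarrow> real" where
  "U_at u t = enn2real (Linf_norm UNIV (u t))"

definition supp_upto :: "(real \<Rightarrow> real ^ 'n \<Rightarrow> real) \<Rightarrow> real \<Rightarrow> (real ^ 'n) set" where
  "supp_upto u T0 = (\<Union>t\<in>{0..T0}. ess_supp (u t))"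

definition Sigma_upto :: "(real \<Rightarrow> real ^ 'n \<Rightarrow> real) \<Rightarrow> real \<Rightarrow> (real \<times> (real ^ 'n) \<times> real) set" where
  "Sigma_upto u T0 = {0..T0} \<times> supp_upto u T0 \<times> {- U_max u T0..U_max u T0}"

definition kappa0_star :: "(real \<Rightarrow> real ^ 'n \<Rightarrow> real \<Rightarrow> real ^ 'n)
    \<Rightarrow> (real \<Rightarrow> real ^ 'n \<Rightarrow> real \<Rightarrow> real) \<Rightarrow> (real \<Rightarrow> real ^ 'n \<Rightarrow> real) \<Rightarrow> real \<Rightarrow> real" where
  "kappa0_star f F u T0 =
     (2 * real CARD('n) + 1)
       * enn2real (Linf_norm (Sigma_upto u T0) (\<lambda>(t, x, w). D_x (D_u f) t x w))
     + enn2real (Linf_norm (Sigma_upto u T0) (\<lambda>(t, x, w). D_u F t x w))"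

definition W_const :: "nat \<Rightarrow> real" where
  "W_const N = integral {0..pi / 2} (\<lambda>\<theta>. cos \<theta> ^ N)"

end

theory Submission
 imports Defs
begin

text \<open>
The estimate comes from doubling the variables. Write \<open>G = F - div f\<close>. For almost every \<open>t\<close> the
solution is compared with its own translates through
\<open>E t = \<integral>\<integral> |u(t,x) - u(t,y)| \<Theta>(t,x,y) dx dy\<close>, where up to a cut-off in \<open>x\<close> the weight is
\<open>\<Theta> = exp(-K t) * bump (q e\<^bsup>2At\<^esup>) (x - y)\<close>, a kernel of radius \<open>q\<^bsup>-1/2\<^esup> e\<^bsup>-At\<^esup>\<close>. Kruzkov's inequalities for
\<open>u(t,x)\<close> with \<open>k = u(s,y)\<close> and for \<open>u(s,y)\<close> with \<open>k = u(t,x)\<close>, added and taken to the diagonal \<open>s = t\<close>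
(\<open>doubling\<close>), bound the growth of \<open>E\<close> by three terms. The difference of the fluxes at \<open>x\<close> and \<open>y\<close> is at
most \<open>A |x - y| |u(t,x) - u(t,y)|\<close> if \<open>A\<close> bounds \<open>\<nabla>\<partial>\<^sub>uf\<close>, and the shrinking of the kernel produces
exactly the opposite term. The zero order terms are absorbed by \<open>exp(-K t)\<close> with \<open>K = B + N A\<close>, where
\<open>B\<close> bounds \<open>\<partial>\<^sub>uF\<close> and \<open>N A\<close> bounds \<open>\<partial>\<^sub>u div f\<close>. The cut-off travels with the speed \<open>\<parallel>\<partial>\<^sub>uf\<parallel>\<close>, so
its derivative has the right sign. What remains is the source, \<open>|G(t,x,w) - G(t,y,w)|\<close> at \<open>w = u(t,y)\<close>
(\<open>energy_inequality\<close>).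

For a kernel of radius \<open>r\<close> the double integral of \<open>|g(x) - g(y)|\<close> is at most the first moment of the
kernel in a fixed direction times \<open>TV g\<close> (\<open>TV_upper\<close>), and asymptotically at least that as \<open>r\<close> tends
to \<open>0\<close> (\<open>TV_lower\<close>). That moment scales like \<open>r\<^bsup>N+1\<^esup>\<close>, so along the shrinking kernel it contributes
\<open>e\<^bsup>-(N+1)At\<^esup>\<close>. Dividing by it, and letting \<open>q\<close> tend to infinity, turns the inequality for \<open>E\<close> into one for
\<open>TV (u t)\<close> with the exponent \<open>B + N A + (N + 1) A = (2 N + 1) A + B\<close>, which is \<open>\<kappa>\<^sub>0\<^sup>*\<close>. The source
contributes \<open>\<integral>|\<nabla>G(t,y,u(t,y))| dy\<close> with the same moment as a factor (\<open>S_le\<close>), hence the constant \<open>1\<close>,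
and \<open>1 \<le> N W\<^sub>N\<close> (\<open>one_le_W_const\<close>).

For a pair with \<open>u(t,x) \<noteq> u(t,y)\<close> one of the two points lies in the support of \<open>u\<close>, so that for a
small kernel, and up to an error \<open>e\<close>, only the coefficients on \<open>\<Sigma>\<close> matter (\<open>TV_step_eps\<close>,
\<open>TV_step\<close>). This argument needs times strictly inside \<open>(0, T\<^sub>0)\<close>: the coefficients are continuous only for
\<open>t > 0\<close>, and the support is controlled only up to \<open>T\<^sub>0\<close>. Near both ends a cruder estimate with constants of
the whole slab is used (\<open>TV_initial\<close>, \<open>TV_coarse\<close>) on an interval whose length then tends to \<open>0\<close>
(\<open>TV_between\<close>). The range \<open>[-U\<^sub>t, U\<^sub>t]\<close> of the statement degenerates to the null set \<open>{0}\<close> when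
\<open>u(t) = 0\<close>; since \<open>TV (u t) = 0\<close> at such times, the estimate is started anew from the last of them
(\<open>TV_bound_Linf\<close>).
\<close>

section \<open>Calculus and integration of functions with bounded support\<close>

text \<open>Lebesgue measure restricted to the Borel sets serves throughout, since products of measures are
then Borel again; completed measures appear only where a definition refers to them. Besides \<open>LBINT\<close>, the integral of
a real function with respect to this measure, \<open>NBINT\<close> denotes that of a nonnegative extended one.\<close>

abbreviation nn_integral_lborel :: "('a::euclidean_space => ennreal) => ennreal" (binder "NBINT " 10) where
 "nn_integral_lborel f \<equiv> nn_integral lborel f"

abbreviation Borel :: "('a::topological_space => 'b::topological_space) => bool" where
 "Borel g \<equiv> g \<in> borel_measurable borel"

abbreviation borel2 :: "('a::topological_space \<times> 'b::topological_space) measure" where "borel2 \<equiv> borel \<Otimes>\<^sub>M borel"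

abbreviation lborel2 :: "('a::euclidean_space \<times> 'b::euclidean_space) measure" where "lborel2 \<equiv> lborel \<Otimes>\<^sub>M lborel"

definition pos_sq :: "real => real" where
 "pos_sq r = (max 0 r)\<^sup>2"

lemma pos_sq_nonneg [simp]: "0 <= pos_sq r"
 by (simp add: pos_sq_def)

lemma pos_sq_nonpos_eq_0 [simp]: "r <= 0 ==> pos_sq r = 0"
 by (simp add: pos_sq_def)

lemma pos_sq_le_1: "r <= 1 ==> pos_sq r <= 1"
 by (simp add: pos_sq_def max_def power_le_one)

lemma has_derivative_imp_continuous_on:
 assumes "!!x. (g has_derivative D x) (at x)"
 shows "continuous_on S g"
 using assms by (meson continuous_at_imp_continuous_on has_derivative_continuous)

lemma DERIV_pos_sq: "(pos_sq has_real_derivative 2 * max 0 r) (at r)"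
proof -
 consider "r > 0" | "r < 0" | "r = 0" by linarith
 then show ?thesis
 proof cases
  case 1
  have "((\<lambda>r. r\<^sup>2) has_real_derivative 2 * max 0 r) (at r)"
   using 1 by (auto intro!: derivative_eq_intros)
  moreover have "eventually (\<lambda>x. pos_sq x = x\<^sup>2) (nhds r)"
   using eventually_nhds_in_open[of "{0<..}" r] 1
   by (auto simp: pos_sq_def elim!: eventually_mono)
  ultimately show ?thesis by (subst DERIV_cong_ev) auto
 next
  case 2
  have "((\<lambda>r. 0) has_real_derivative 2 * max 0 r) (at r)"
   using 2 by (auto intro!: derivative_eq_intros)
  moreover have "eventually (\<lambda>x. pos_sq x = 0) (nhds r)"
   using eventually_nhds_in_open[of "{..<0}" r] 2
   by (auto simp: pos_sq_def elim!: eventually_mono)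
  ultimately show ?thesis by (subst DERIV_cong_ev) auto
 next
  case 3
  have "((\<lambda>x. (pos_sq x - pos_sq 0) / (x - 0)) \<longlongrightarrow> 0) (at 0)"
  proof (rule Lim_null_comparison)
   show "eventually (\<lambda>x. norm ((pos_sq x - pos_sq 0) / (x - 0)) <= \<bar>x\<bar>) (at 0)"
    by (intro always_eventually) (auto simp: pos_sq_def max_def power2_eq_square divide_simps abs_mult)
   show "((\<lambda>x::real. \<bar>x\<bar>) \<longlongrightarrow> 0) (at 0)"
    by (intro tendsto_eq_intros) auto
  qed
  with 3 show ?thesis by (simp add: has_field_derivative_iff)
 qed
qed

lemmas DERIV_pos_sq' [derivative_intros] = DERIV_chain2[OF DERIV_pos_sq]

lemma has_derivative_pos_sq [derivative_intros]:
 assumes "(g has_derivative g') (at x within s)"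
 shows "((\<lambda>x. pos_sq (g x)) has_derivative (\<lambda>h. 2 * max 0 (g x) * g' h)) (at x within s)"
 using has_derivative_compose[OF assms DERIV_pos_sq[unfolded has_field_derivative_def]] .

lemma continuous_on_pos_sq [continuous_intros]:
 "continuous_on S g ==> continuous_on S (\<lambda>x. pos_sq (g x))"
 unfolding pos_sq_def by (intro continuous_intros)

lemma measurable_pos_sq [measurable]: "Borel pos_sq"
 unfolding pos_sq_def by measurable

lemma deriv_at_eq:
 fixes g :: "'a::euclidean_space => 'b::real_normed_vector"
 assumes "(g has_derivative g') (at x)"
 shows "blinfun_apply (deriv_at g x) = g'"
proof -
 have "frechet_derivative g (at x) = g'"
  using frechet_derivative_at[OF assms] by simp
 then show ?thesis
  using assms by (simp add: deriv_at_def bounded_linear_Blinfun_apply has_derivative_bounded_linear)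
qed

lemma C1_cI:
 fixes \<phi> :: "'a::euclidean_space => 'b::real_normed_vector"
 assumes der: "!!p. (\<phi> has_derivative D p) (at p)"
  and cont: "!!h. continuous_on UNIV (\<lambda>p. D p h)"
  and supp: "compact K" "K \<subseteq> S" "!!p. p \<notin> K ==> \<phi> p = 0"
 shows "C1_c S \<phi>"
proof -
 have "{p. \<phi> p ~= 0} \<subseteq> K" using supp(3) by blast
 then have *: "closure {p. \<phi> p ~= 0} \<subseteq> K"
  by (simp add: closure_minimal compact_imp_closed supp(1))
 then have "compact (closure {p. \<phi> p ~= 0})"
  using supp(1) by (meson closed_closure compact_Int_closed compact_closure bounded_subset compact_imp_bounded closure_subset order_trans)
 moreover have "continuous_on UNIV (deriv_at \<phi>)"
  by (rule continuous_on_blinfun_componentwise) (simp add: deriv_at_eq[OF der] cont)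
 ultimately show ?thesis
  using * supp(2) der unfolding C1_c_def by (auto intro: differentiableI)
qed

lemma C1_cD:
 fixes \<phi> :: "'a::euclidean_space => 'b::real_normed_vector"
 assumes "C1_c S \<phi>"
 shows "(\<phi> has_derivative blinfun_apply (deriv_at \<phi> p)) (at p)"
  and "continuous_on UNIV (\<lambda>p. blinfun_apply (deriv_at \<phi> p) h)"
  and "continuous_on UNIV \<phi>"
  and "\<exists>R. \<forall>p. norm p > R --> \<phi> p = 0 \<and> blinfun_apply (deriv_at \<phi> p) h = 0"
proof -
 show d: "(\<phi> has_derivative blinfun_apply (deriv_at \<phi> p)) (at p)" for p
  using assms frechet_derivative_works[of \<phi> "at p"] deriv_at_eq
  unfolding C1_c_def by metis
 show "continuous_on UNIV (\<lambda>p. blinfun_apply (deriv_at \<phi> p) h)"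
  using assms unfolding C1_c_def by (intro continuous_intros) auto
 show "continuous_on UNIV \<phi>"
  using d by (rule has_derivative_imp_continuous_on)
 have "bounded {p. \<phi> p ~= 0}"
  using assms unfolding C1_c_def by (meson bounded_closure_image bounded_subset closure_subset compact_imp_bounded)
 then obtain R where R: "!!p. norm p > R ==> \<phi> p = 0"
  unfolding bounded_iff by (metis (mono_tags, lifting) linorder_not_le mem_Collect_eq)
 have "blinfun_apply (deriv_at \<phi> p) = (\<lambda>_. 0)" if "norm p > R" for p
 proof (rule deriv_at_eq)
  have "open {p::'a. norm p > R}" by (intro open_Collect_less continuous_intros)
  then show "(\<phi> has_derivative (\<lambda>_. 0)) (at p)"
   by (rule has_derivative_transform_within_open[OF has_derivative_const[of 0]]) (use R that in auto)
 qed
 with R show "\<exists>R. \<forall>p. norm p > R --> \<phi> p = 0 \<and> blinfun_apply (deriv_at \<phi> p) h = 0"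
  by (intro exI[of _ R]) auto
qed

lemma integrable_bounded_support:
 fixes g :: "'a::euclidean_space => 'b::{banach, second_countable_topology}"
 assumes "Borel g" "!!x. norm (g x) <= B" "!!x. norm x > R ==> g x = 0"
 shows "integrable lborel g"
 by (rule integrableI_bounded_set[of "cball 0 R" lborel g B])
   (use assms emeasure_bounded_finite[of "cball 0 R"] in \<open>auto simp: less_top[symmetric] not_le\<close>)

lemma continuous_bounded_support:
 fixes g :: "'a::euclidean_space => 'b::real_normed_vector"
 assumes "continuous_on UNIV g" "!!x. norm x > R ==> g x = 0"
 obtains B where "!!x. norm (g x) <= B" "0 <= B"
proof -
 have "compact (g ` cball 0 R)"
  using assms(1) by (intro compact_continuous_image) (auto intro: continuous_on_subset)
 then obtain B where B: "!!x. x \<in> cball 0 R ==> norm (g x) <= B"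
  using compact_imp_bounded[of "g ` cball 0 R"] unfolding bounded_iff by blast
 have "norm (g x) <= max 0 B" for x
  using B[of x] assms(2)[of x] by (cases "norm x > R") auto
 then show thesis by (intro that[of "max 0 B"]) auto
qed

lemma uniformly_continuous_support:
 fixes g :: "'a::euclidean_space => 'b::real_normed_vector"
 assumes "continuous_on UNIV g" "!!x. norm x > R ==> g x = 0" "0 < e"
 obtains d where "0 < d" "!!x y. dist x y < d ==> dist (g x) (g y) < e"
proof -
 have "uniformly_continuous_on (cball 0 (R + 1)) g"
  using assms(1) by (intro compact_uniformly_continuous) (auto intro: continuous_on_subset)
 then obtain d where d: "d > 0"
  "!!x y. x \<in> cball 0 (R+1) ==> y \<in> cball 0 (R+1) ==> dist y x < d ==> dist (g y) (g x) < e"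
  using \<open>0 < e\<close> unfolding uniformly_continuous_on_def by metis
 show thesis
 proof (rule that[of "min d 1"])
  fix x y :: 'a assume xy: "dist x y < min d 1"
  have n: "norm x <= norm y + 1" "norm y <= norm x + 1"
   using xy norm_triangle_ineq2[of x y] norm_triangle_ineq2[of y x]
   by (auto simp: dist_norm norm_minus_commute)
  consider "norm x <= R + 1 \<and> norm y <= R + 1" | "norm x > R \<and> norm y > R"
   using n by linarith
  then show "dist (g x) (g y) < e"
   by cases (use d xy assms(2,3) in \<open>auto simp: mem_cball dist_norm norm_minus_commute\<close>)
 qed (use d in auto)
qed

lemma lborel_integral_translation:
 fixes g :: "'a::euclidean_space => 'b::{banach, second_countable_topology}"
 assumes "Borel g"
 shows "(LBINT x. g (x + c)) = (LBINT x. g x)"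
proof -
 have "(LBINT x. g x) = (LINT x|distr lborel borel (\<lambda>x. c + x). g x)"
  by (simp add: lborel_distr_plus)
 also have "... = (LBINT x. g (c + x))"
  by (intro integral_distr) (use assms in auto)
 finally show ?thesis by (simp add: add.commute)
qed

lemma nn_integral_lborel_translation:
 fixes g :: "'a::euclidean_space => ennreal"
 assumes "Borel g"
 shows "(NBINT x. g (x + c)) = (NBINT x. g x)"
proof -
 have "(NBINT x. g x) = (\<integral>\<^sup>+x. g x \<partial>distr lborel borel (\<lambda>x. c + x))"
  by (simp add: lborel_distr_plus)
 also have "... = (NBINT x. g (c + x))"
  by (intro nn_integral_distr) (use assms in auto)
 finally show ?thesis by (simp add: add.commute)
qed

text \<open>By translation invariance every difference quotient has integral \<open>0\<close>, and the mean value theorem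
provides the dominating function.\<close>

lemma integral_derivative_eq_0:
 fixes \<phi> :: "'a::euclidean_space => real"
 assumes der: "!!x. (\<phi> has_derivative D x) (at x)"
  and cont: "continuous_on UNIV (\<lambda>x. D x e)"
  and supp: "!!x. norm x > R ==> \<phi> x = 0" "!!x. norm x > R ==> D x e = 0"
 shows "(LBINT x. D x e) = 0"
proof -
 obtain B where B: "!!x. norm (D x e) <= B" "0 <= B"
  using continuous_bounded_support[OF cont supp(2)] by blast
 have contp: "continuous_on UNIV \<phi>"
  using der by (rule has_derivative_imp_continuous_on)
 then have [measurable]: "Borel \<phi>"
  by (simp add: borel_measurable_continuous_onI)
 have lin: "linear (D x)" for x
  using der[of x] by (simp add: has_derivative_bounded_linear bounded_linear.linear)
 define q where "q n x = (\<phi> (x + (1 / real (Suc n)) *\<^sub>R e) - \<phi> x) * real (Suc n)" for n x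
 have lim: "(\<lambda>n. q n x) \<longlonglongrightarrow> D x e" for x
 proof -
  have "((\<lambda>s. \<phi> (x + s *\<^sub>R e)) has_derivative (\<lambda>s. D x (s *\<^sub>R e))) (at 0)"
   by (rule has_derivative_compose[of "\<lambda>s. x + s *\<^sub>R e" "\<lambda>s. s *\<^sub>R e" 0 UNIV \<phi> "D x"])
     (use der[of x] in \<open>auto intro!: derivative_eq_intros\<close>)
  then have "((\<lambda>s. \<phi> (x + s *\<^sub>R e)) has_real_derivative D x e) (at 0)"
   by (rule has_derivative_imp_has_field_derivative) (simp add: linear_cmul[OF lin])
  then have "((\<lambda>s. (\<phi> (x + s *\<^sub>R e) - \<phi> x) / s) \<longlongrightarrow> D x e) (at 0)"
   by (simp add: has_field_derivative_iff)
  moreover have "filterlim (\<lambda>n. 1 / real (Suc n)) (at 0) sequentially"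
   using LIMSEQ_inverse_real_of_nat by (auto simp: filterlim_at field_simps)
  ultimately have "(\<lambda>n. (\<phi> (x + (1 / real (Suc n)) *\<^sub>R e) - \<phi> x) / (1 / real (Suc n))) \<longlonglongrightarrow> D x e"
   by (rule filterlim_compose)
  then show ?thesis by (simp add: q_def)
 qed
 have bnd: "norm (q n x) <= B" for n x
 proof -
  have "\<exists>s\<in>{0<..<1}. \<phi> (x + 1 *\<^sub>R ((1 / real (Suc n)) *\<^sub>R e)) - \<phi> (x + 0 *\<^sub>R ((1 / real (Suc n)) *\<^sub>R e))
    = (1 - 0) * D (x + s *\<^sub>R ((1 / real (Suc n)) *\<^sub>R e)) ((1 / real (Suc n)) *\<^sub>R e)"
  proof -
   have *: "((\<lambda>s. \<phi> (x + s *\<^sub>R ((1 / real (Suc n)) *\<^sub>R e))) has_real_derivative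
     D (x + s *\<^sub>R ((1 / real (Suc n)) *\<^sub>R e)) ((1 / real (Suc n)) *\<^sub>R e)) (at s)" for s
    by (rule has_derivative_imp_has_field_derivative,
      rule has_derivative_compose[of "\<lambda>s. x + s *\<^sub>R ((1 / real (Suc n)) *\<^sub>R e)" "\<lambda>s. s *\<^sub>R ((1 / real (Suc n)) *\<^sub>R e)" s UNIV \<phi>])
      (use der in \<open>auto intro!: derivative_eq_intros simp: linear_cmul[OF lin]\<close>)
   show ?thesis
    using MVT2[of 0 1 "\<lambda>s. \<phi> (x + s *\<^sub>R ((1 / real (Suc n)) *\<^sub>R e))", OF _ *] by auto
  qed
  then obtain s where "\<phi> (x + (1 / real (Suc n)) *\<^sub>R e) - \<phi> x
    = D (x + s *\<^sub>R ((1 / real (Suc n)) *\<^sub>R e)) ((1 / real (Suc n)) *\<^sub>R e)" by auto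
  then have "q n x = D (x + s *\<^sub>R ((1 / real (Suc n)) *\<^sub>R e)) e"
   by (simp add: q_def linear_cmul[OF lin])
  then show ?thesis using B by simp
 qed
 have q0: "q n x = 0" if "norm x > R + norm e" for n x
 proof -
  have "norm ((1 / real (Suc n)) *\<^sub>R e) <= norm e"
   using mult_left_le_one_le[of "norm e" "1 / real (Suc n)"] by simp
  then have "norm (x + (1 / real (Suc n)) *\<^sub>R e) > R"
   using that norm_diff_ineq[of x "(1 / real (Suc n)) *\<^sub>R e"] by linarith
  moreover have "norm x > R" using that norm_ge_zero[of e] by linarith
  ultimately show ?thesis by (simp add: q_def supp)
 qed
 have meas_q [measurable]: "Borel (q n)" for n
  unfolding q_def by measurable
 have "(\<lambda>n. LBINT x. q n x) \<longlonglongrightarrow> (LBINT x. D x e)"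
 proof (rule integral_dominated_convergence[where w="\<lambda>x. B * indicator (cball 0 (R + norm e)) x"])
  show "integrable lborel (\<lambda>x. B * indicator (cball 0 (R + norm e)) x :: real)"
   by (rule integrable_bounded_support[where B=B and R="R + norm e"]) (use B in \<open>auto simp: indicator_def\<close>)
  show "AE x in lborel. norm (q n x) <= B * indicator (cball 0 (R + norm e)) x" for n
   using bnd q0 by (auto simp: indicator_def)
  show "AE x in lborel. (\<lambda>n. q n x) \<longlonglongrightarrow> D x e" using lim by auto
 qed (use cont in \<open>auto intro: borel_measurable_continuous_onI\<close>)
 moreover have "(LBINT x. q n x) = 0" for n
 proof -
  obtain B' where B': "!!x. norm (\<phi> x) <= B'"
   using continuous_bounded_support[OF contp supp(1)] by blast
  have i: "integrable lborel \<phi>"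
   by (rule integrable_bounded_support[OF _ B' supp(1)]) auto
  have i2: "integrable lborel (\<lambda>x. \<phi> (x + c))" for c
  proof (rule integrable_bounded_support[OF _ B', where R="R + norm c"])
   fix x :: 'a assume "norm x > R + norm c"
   then have "norm (x + c) > R" using norm_diff_ineq[of x c] by linarith
   then show "\<phi> (x + c) = 0" by (rule supp(1))
  next
   show "Borel (\<lambda>x. \<phi> (x + c))" by measurable
  qed
  show ?thesis
   unfolding q_def by (simp add: i i2 lborel_integral_translation)
 qed
 ultimately have "(\<lambda>n::nat. 0::real) \<longlonglongrightarrow> (LBINT x. D x e)" by simp
 then show ?thesis by (simp add: LIMSEQ_const_iff)
qed

section \<open>A bump and its first moment\<close>

text \<open>Kernels are left unnormalised: the estimates compare moments of the same kernel, and the \<open>C\<^sup>1\<close>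
function \<open>pos_sq\<close> makes \<open>bump q\<close> continuously differentiable with a radial, outward decreasing
profile supported in the ball of radius \<open>q\<^bsup>-1/2\<^esup>\<close>. \<open>bump_grad\<close> is its gradient with the sign
reversed, a nonnegative multiple of \<open>z\<close>.\<close>

definition bump :: "real => 'a::euclidean_space => real" where
 "bump q z = pos_sq (1 - q * (z \<bullet> z))"

definition bump_grad :: "real => 'a::euclidean_space => 'a" where
 "bump_grad q z = (4 * q * max 0 (1 - q * (z \<bullet> z))) *\<^sub>R z"

lemma bump_nonneg [simp]: "0 <= bump q z"
 by (simp add: bump_def)

lemma bump_le_1: "0 <= q ==> bump q z <= 1"
 by (simp add: bump_def pos_sq_le_1)

lemma bump_minus [simp]: "bump q (- z) = bump q z"
 by (simp add: bump_def)

lemma bump_commute: "bump q (x - y) = bump q (y - x)"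
 using bump_minus[of q "x - y"] by simp

lemma bump_eq_0: "1 <= q * (z \<bullet> z) ==> bump q z = 0"
 by (simp add: bump_def)

lemma bump_grad_eq_0: "1 <= q * (z \<bullet> z) ==> bump_grad q z = 0"
 by (simp add: bump_grad_def)

lemma outside_bump_radius: "0 < q ==> 1 / sqrt q <= norm z ==> 1 <= q * (z \<bullet> z)"
proof -
 assume q: "0 < q" and z: "1 / sqrt q <= norm z"
 have "(1 / sqrt q)\<^sup>2 <= (norm z)\<^sup>2" using q z by (intro power_mono) auto
 then show ?thesis using q by (simp add: power_divide dot_square_norm field_simps)
qed

lemma continuous_on_bump [continuous_intros]:
 "continuous_on S a ==> continuous_on S g ==> continuous_on S (\<lambda>x. bump (a x) (g x))"
 unfolding bump_def by (intro continuous_intros)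

lemma continuous_on_bump_grad [continuous_intros]:
 "continuous_on S g ==> continuous_on S (\<lambda>x. bump_grad q (g x))"
 unfolding bump_grad_def by (intro continuous_intros)

lemma measurable_bump [measurable]: "Borel (bump q)"
 by (intro borel_measurable_continuous_onI continuous_intros)

lemma has_derivative_bump [derivative_intros]:
 assumes "(g has_derivative g') (at x within S)"
 shows "((\<lambda>x. bump q (g x)) has_derivative (\<lambda>h. - (bump_grad q (g x) \<bullet> g' h))) (at x within S)"
 unfolding bump_def using assms
 by (auto intro!: derivative_eq_intros simp: bump_grad_def inner_commute algebra_simps)

lemma integrable_bump:
 assumes "0 < q"
 shows "integrable lborel (bump q :: 'a::euclidean_space => real)"
 by (rule integrable_bounded_support[where B=1 and R="1 / sqrt q"])
   (use assms bump_le_1[of q] in \<open>auto intro!: bump_eq_0 outside_bump_radius\<close>)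

lemma integral_pos_of_continuous:
 fixes g :: "'a::euclidean_space => real"
 assumes "continuous_on UNIV g" "integrable lborel g" "!!x. 0 <= g x" "0 < g x0"
 shows "0 < (LBINT x. g x)"
proof -
 have "(LBINT x. g x) ~= 0"
 proof
  assume "(LBINT x. g x) = 0"
  then have "AE x in lborel. g x = 0"
   using integral_nonneg_eq_0_iff_AE[of lborel g] assms by auto
  then have "AE x in lebesgue. x \<in> {x. g x = 0}"
   by (auto intro: AE_completion)
  moreover have "closed {x. g x = 0}"
   using assms(1) by (intro closed_Collect_eq continuous_intros)
  ultimately have "x0 \<in> {x. g x = 0}" by (rule mem_closed_if_AE_lebesgue[rotated])
  with assms(4) show False by simp
 qed
 moreover have "0 <= (LBINT x. g x)" using assms by (intro integral_nonneg_AE) auto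
 ultimately show ?thesis by simp
qed

definition mass :: "'a::euclidean_space itself => real => real" where
 "mass _ q = (LBINT z. bump q (z::'a))"

lemma mass_pos:
 assumes "0 < q"
 shows "0 < mass TYPE('a::euclidean_space) q"
proof -
 have "0 < bump q (0::'a)" by (simp add: bump_def pos_sq_def)
 then show ?thesis unfolding mass_def
  by (rule integral_pos_of_continuous[rotated 3])
    (use integrable_bump[OF assms] in \<open>auto intro!: continuous_intros\<close>)
qed

definition dir_moment :: "real => 'a::euclidean_space => real" where
 "dir_moment q e = (LBINT z. \<bar>z \<bullet> e\<bar> * bump q z)"

lemma integrable_mult_bump:
 fixes g :: "'a::euclidean_space => real"
 assumes "0 < q" "continuous_on UNIV g"
 shows "integrable lborel (\<lambda>z. g z * bump q z)"
proof -
 have *: "g z * bump q z = 0" if "norm z > 1 / sqrt q" for z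
  using bump_eq_0[OF outside_bump_radius, of q z] that assms by simp
 have c: "continuous_on UNIV (\<lambda>z. g z * bump q z)" using assms by (intro continuous_intros)
 obtain B where "!!z. norm (g z * bump q z) <= B"
  using continuous_bounded_support[OF c *] by blast
 then show ?thesis using c *
  by (intro integrable_bounded_support) (auto intro: borel_measurable_continuous_onI)
qed

lemma dir_moment_scaleR: "dir_moment q (c *\<^sub>R e) = \<bar>c\<bar> * dir_moment q e"
 unfolding dir_moment_def by (simp add: abs_mult mult.assoc)

lemma dir_moment_nonneg [simp]: "0 <= dir_moment q e"
 unfolding dir_moment_def by (intro integral_nonneg_AE) auto

lemma dir_moment_pos:
 fixes e :: "'a::euclidean_space"
 assumes "0 < q" "norm e = 1"
 shows "0 < dir_moment q e"
proof -
 define z where "z = (1 / (2 * sqrt q)) *\<^sub>R e"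
 have ee: "e \<bullet> e = 1" using assms by (simp add: dot_square_norm)
 have "0 < \<bar>z \<bullet> e\<bar> * bump q z"
 proof -
  have "q * (z \<bullet> z) = 1 / 4" using assms by (simp add: z_def ee field_simps)
  then have "bump q z > 0" by (simp add: bump_def pos_sq_def)
  moreover have "\<bar>z \<bullet> e\<bar> > 0" using assms by (simp add: z_def ee)
  ultimately show ?thesis by simp
 qed
 then show ?thesis unfolding dir_moment_def
  by (intro integral_pos_of_continuous[of _ z] integrable_mult_bump) (use assms in \<open>auto intro!: continuous_intros\<close>)
qed

text \<open>The argument for the uniqueness of Haar measure: integrating the indicator of \<open>A\<close> against that of the
unit ball, which is invariant under \<open>T\<close> and under reflection, and translating the variables one at a
time shows that the image measure is proportional to Lebesgue measure, and the ball fixes the factor.\<close>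

lemma distr_orthogonal_lborel:
 fixes T :: "real ^ 'n => real ^ 'n"
 assumes T: "orthogonal_transformation T"
 shows "distr lborel borel T = lborel"
proof (rule measure_eqI)
 obtain S where S: "!!x. S (T x) = x" "!!x. T (S x) = x"
  using orthogonal_transformation_bij[OF T] inv_f_f[of T] surj_f_inv_f[of T] unfolding bij_def by blast
 have lin: "linear T" using T orthogonal_transformation_linear by auto
 have nT: "norm (T x) = norm x" for x using T by (simp add: orthogonal_transformation)
 have [measurable]: "Borel T"
  using lin by (simp add: borel_measurable_continuous_onI linear_continuous_on linear_linear)
 show "sets (distr lborel borel T) = sets (lborel :: (real ^ 'n) measure)" by simp
 fix A assume "A \<in> sets (distr lborel borel T)"
 then have [measurable]: "A \<in> sets borel" by simp
 have [measurable]: "ball (0 :: real ^ 'n) 1 \<in> sets borel" by simp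
 let ?f = "indicator A :: _ => ennreal" and ?g = "indicator (ball 0 1) :: real ^ 'n => ennreal"
 have g_even: "?g (- x) = ?g x" and g_T: "?g (T x) = ?g x" for x
  by (auto simp: indicator_def nT)
 have "(NBINT x. ?f (T x)) * (NBINT y. ?g y) = (NBINT y. (NBINT x. ?f (T x) * ?g y))"
 proof -
  have "(NBINT x. ?f (T x) * ?g y) = (NBINT x. ?f (T x)) * ?g y" for y
   by (rule nn_integral_multc) measurable
  then show ?thesis by (simp only:) (rule nn_integral_cmult[symmetric], measurable)
 qed
 also have "... = (NBINT y. (NBINT x. ?f (T (x + S y)) * ?g y))"
  by (subst nn_integral_lborel_translation[of "\<lambda>x. ?f (T x) * ?g _"]) simp_all
 also have "... = (NBINT y. (NBINT x. ?f (T x + y) * ?g y))"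
  by (simp add: linear_add[OF lin] S)
 also have "... = (NBINT x. (NBINT y. ?f (T x + y) * ?g y))"
  by (rule lborel_pair.Fubini') measurable
 also have "... = (NBINT x. (NBINT y. ?f y * ?g (y - T x)))"
 proof (rule nn_integral_cong)
  fix x
  show "(NBINT y. ?f (T x + y) * ?g y) = (NBINT y. ?f y * ?g (y - T x))"
   using nn_integral_lborel_translation[of "\<lambda>y. ?f y * ?g (y - T x)" "T x"] by (simp add: add.commute)
 qed
 also have "... = (NBINT y. (NBINT x. ?f y * ?g (y - T x)))"
  by (rule lborel_pair.Fubini') measurable
 also have "... = (NBINT y. (NBINT x. ?f y * ?g (y - T (x + S y))))"
 proof (rule nn_integral_cong)
  fix y
  show "(NBINT x. ?f y * ?g (y - T x)) = (NBINT x. ?f y * ?g (y - T (x + S y)))"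
   using nn_integral_lborel_translation[of "\<lambda>x. ?f y * ?g (y - T x)" "S y"] by simp
 qed
 also have "... = (NBINT y. ?f y * (NBINT x. ?g x))"
  by (simp add: linear_add[OF lin] S g_even g_T nn_integral_cmult)
 also have "... = (NBINT y. ?f y) * (NBINT x. ?g x)"
  by (rule nn_integral_multc) measurable
 finally have *: "(NBINT x. ?f (T x)) * emeasure lborel (ball (0::real^'n) 1) = emeasure lborel A * emeasure lborel (ball (0::real^'n) 1)"
  by simp
 define b where "b = measure lborel (ball (0 :: real ^ 'n) 1)"
 have b: "0 < b" unfolding b_def using content_ball_pos[of 1 "0::real^'n"] by simp
 have eb: "emeasure lborel (ball (0::real^'n) 1) = ennreal b"
  unfolding b_def using emeasure_bounded_finite[of "ball (0::real^'n) 1"]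
  by (intro emeasure_eq_ennreal_measure) auto
 have "x = x * ennreal b * ennreal (1 / b)" for x
  using b by (simp add: mult.assoc ennreal_mult[symmetric])
 then have "(NBINT x. ?f (T x)) = emeasure lborel A"
  using * unfolding eb by metis
 moreover have "emeasure (distr lborel borel T) A = (NBINT x. ?f (T x))"
 proof -
  have "(NBINT x. ?f (T x)) = (\<integral>\<^sup>+x. ?f x \<partial>distr lborel borel T)"
   by (rule nn_integral_distr[symmetric]) auto
  then show ?thesis by simp
 qed
 ultimately show "emeasure (distr lborel borel T) A = emeasure lborel A" by simp
qed

lemma dir_moment_rotate:
 fixes e e' :: "real ^ 'n"
 assumes "norm e = norm e'"
 shows "dir_moment q e = dir_moment q e'"
proof -
 obtain T where T: "orthogonal_transformation T" "T e' = e"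
  using orthogonal_transformation_exists[OF assms[symmetric]] by blast
 have [measurable]: "Borel T"
  using orthogonal_transformation_linear[OF T(1)] by (simp add: borel_measurable_continuous_onI linear_continuous_on linear_linear)
 have T': "T x \<bullet> T y = x \<bullet> y" for x y using T by (simp add: orthogonal_transformation_def)
 have "dir_moment q e = (LINT z|distr lborel borel T. \<bar>z \<bullet> e\<bar> * bump q z)"
  by (simp add: dir_moment_def distr_orthogonal_lborel[OF T(1)])
 also have "... = (LBINT z. \<bar>T z \<bullet> e\<bar> * bump q (T z))"
  by (rule integral_distr) auto
 also have "... = dir_moment q e'"
  by (simp add: dir_moment_def T(2)[symmetric] bump_def T')
 finally show ?thesis .
qed

lemma dir_moment_eq_norm:
 fixes e e0 :: "real ^ 'n"
 assumes "norm e0 = 1"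
 shows "dir_moment q e = norm e * dir_moment q e0"
 using dir_moment_rotate[of e "norm e *\<^sub>R e0" q] assms by (simp add: dir_moment_scaleR)

text \<open>Substituting \<open>z\<close> by \<open>e\<^bsup>-a\<^esup>z\<close> costs \<open>e\<^bsup>-Na\<^esup>\<close> for the volume and \<open>e\<^bsup>-a\<^esup>\<close> for the factor \<open>|z \<bullet> e|\<close>.
This is where the summand \<open>N + 1\<close> of the final exponent comes from.\<close>

lemma dir_moment_exp:
 fixes e :: "'a::euclidean_space"
 assumes "0 < q"
 shows "dir_moment (q * exp (2 * a)) e = exp (- (real DIM('a) + 1) * a) * dir_moment q e"
proof -
 let ?c = "exp (- a)"
 have eq: "lborel = density (distr lborel borel (\<lambda>x::'a. 0 + ?c *\<^sub>R x)) (\<lambda>_. (\<bar>?c\<bar>::real) ^ DIM('a))"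
  using lborel_affine[of ?c 0] by simp
 have "dir_moment (q * exp (2 * a)) e = (LINT z|density (distr lborel borel (\<lambda>x::'a. 0 + ?c *\<^sub>R x)) (\<lambda>_. (\<bar>?c\<bar>::real) ^ DIM('a)). \<bar>z \<bullet> e\<bar> * bump (q * exp (2 * a)) z)"
  unfolding dir_moment_def by (subst eq) simp
 also have "... = (LBINT z. ?c ^ DIM('a) *\<^sub>R (\<bar>(?c *\<^sub>R z) \<bullet> e\<bar> * bump (q * exp (2 * a)) (?c *\<^sub>R z)))"
  by (subst integral_density) (auto simp: integral_distr)
 also have "... = (LBINT z. (?c ^ DIM('a) * ?c) * (\<bar>z \<bullet> e\<bar> * bump q z))"
 proof (intro Bochner_Integration.integral_cong refl)
  fix z :: 'a
  have "exp (2 * a) * (exp (- a) * exp (- a)) = 1" by (simp flip: exp_add)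
  moreover have "q * exp (2 * a) * ((?c *\<^sub>R z) \<bullet> (?c *\<^sub>R z)) = q * (z \<bullet> z) * (exp (2 * a) * (exp (- a) * exp (- a)))"
   by (simp only: inner_scaleR_left inner_scaleR_right ac_simps)
  ultimately have "q * exp (2 * a) * ((?c *\<^sub>R z) \<bullet> (?c *\<^sub>R z)) = q * (z \<bullet> z)"
   by simp
  then have "bump (q * exp (2 * a)) (?c *\<^sub>R z) = bump q z"
   by (simp only: bump_def)
  then show "?c ^ DIM('a) *\<^sub>R (\<bar>(?c *\<^sub>R z) \<bullet> e\<bar> * bump (q * exp (2 * a)) (?c *\<^sub>R z)) = (?c ^ DIM('a) * ?c) * (\<bar>z \<bullet> e\<bar> * bump q z)"
   by (simp add: abs_mult)
 qed
 also have "... = (?c ^ DIM('a) * ?c) * dir_moment q e"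
  by (simp add: dir_moment_def)
 also have "?c ^ DIM('a) * ?c = exp (- (real DIM('a) + 1) * a)"
  by (simp flip: exp_of_nat_mult exp_add) (simp add: algebra_simps)
 finally show ?thesis .
qed

lemma norm_moment_le:
 fixes e0 :: "real ^ 'n"
 assumes "0 < q" "norm e0 = 1"
 shows "(LBINT z. norm z * bump q (z :: real ^ 'n)) <= real CARD('n) * dir_moment q e0"
proof -
 have "(LBINT z. norm z * bump q (z :: real ^ 'n)) <= (LBINT z. (\<Sum>i\<in>(UNIV::'n set). \<bar>z \<bullet> (axis i 1 :: real ^ 'n)\<bar> * bump q z))"
 proof (rule Bochner_Integration.integral_mono)
  show "norm z * bump q z <= (\<Sum>i\<in>(UNIV::'n set). \<bar>z \<bullet> (axis i 1 :: real ^ 'n)\<bar> * bump q z)" for z :: "real ^ 'n"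
   using norm_le_l1_cart[of z] by (simp add: inner_axis sum_distrib_right[symmetric] mult_right_mono)
 qed (use assms in \<open>auto intro!: integrable_mult_bump Bochner_Integration.integrable_sum continuous_intros\<close>)
 also have "... = (\<Sum>i\<in>UNIV. dir_moment q (axis i 1 :: real ^ 'n))"
  unfolding dir_moment_def
  by (rule Bochner_Integration.integral_sum) (use assms in \<open>auto intro!: integrable_mult_bump continuous_intros\<close>)
 also have "... = real CARD('n) * dir_moment q e0"
  by (simp add: dir_moment_eq_norm[OF assms(2), of _ "axis _ 1"])
 finally show ?thesis .
qed

text \<open>\<open>1 / N\<close> is the integral of \<open>cos\<^bsup>N-1\<^esup> \<cdot> sin\<close> over the quarter period. In the difference with \<open>W\<^sub>N\<close> the
factors \<open>cos\<^bsup>N-1\<^esup> \<theta> - cos\<^bsup>N-1\<^esup> (\<pi>/4)\<close> and \<open>cos \<theta> - sin \<theta>\<close> have the same sign on either side of \<open>\<pi>/4\<close>, and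
the second one has integral \<open>0\<close>.\<close>

lemma one_le_W_const:
 assumes "0 < n"
 shows "1 <= real n * W_const n"
proof -
 obtain m where m: "n = Suc m" using assms by (cases n) auto
 let ?g = "\<lambda>\<theta>::real. cos \<theta> ^ m * (cos \<theta> - sin \<theta>)"
 have I1: "((\<lambda>\<theta>. cos \<theta> ^ m * sin \<theta>) has_integral (1 / real n)) {0..pi/2}"
 proof -
  have "((\<lambda>\<theta>. cos \<theta> ^ m * sin \<theta>) has_integral (- (cos (pi/2) ^ n / real n) - (- (cos 0 ^ n / real n)))) {0..pi/2}"
   by (rule fundamental_theorem_of_calculus)
     (auto intro!: derivative_eq_intros simp: m divide_simps simp flip: has_real_derivative_iff_has_vector_derivative,
     cases m, auto simp: algebra_simps)
  then show ?thesis using m by simp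
 qed
 have I2: "((\<lambda>\<theta>. cos \<theta> ^ n) has_integral W_const n) {0..pi/2}"
  unfolding W_const_def by (intro integrable_integral integrable_continuous_real continuous_intros)
 have I3: "((\<lambda>\<theta>. cos (pi/4) ^ m * (cos \<theta> - sin \<theta>)) has_integral (cos (pi/4) ^ m * (sin (pi/2) + cos (pi/2)) - cos (pi/4) ^ m * (sin 0 + cos 0))) {0..pi/2}"
  by (rule fundamental_theorem_of_calculus)
    (auto intro!: derivative_eq_intros simp: algebra_simps simp flip: has_real_derivative_iff_has_vector_derivative)
 have "0 <= W_const n - 1 / real n"
 proof (rule has_integral_le)
  show "((\<lambda>\<theta>. cos (pi/4) ^ m * (cos \<theta> - sin \<theta>)) has_integral 0) {0..pi/2}"
   using I3 by simp
  show "(?g has_integral (W_const n - 1 / real n)) {0..pi/2}"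
   using has_integral_diff[OF I2 I1] by (simp add: m algebra_simps)
  fix \<theta> :: real assume th: "\<theta> \<in> {0..pi/2}"
  show "cos (pi/4) ^ m * (cos \<theta> - sin \<theta>) <= ?g \<theta>"
  proof (cases "\<theta> <= pi/4")
   case True
   have "cos (pi/4) <= cos \<theta>" using th True by (intro cos_monotone_0_pi_le) auto
   moreover have "0 <= cos \<theta> - sin \<theta>"
   proof -
    have "sin \<theta> <= sin (pi/4)" using th True by (intro sin_monotone_2pi_le) auto
    then show ?thesis using \<open>cos (pi/4) <= cos \<theta>\<close> by (simp add: cos_45 sin_45)
   qed
   ultimately show ?thesis by (intro mult_right_mono power_mono) (auto simp: cos_45)
  next
   case False
   have c: "cos \<theta> <= cos (pi/4)" using th False by (intro cos_monotone_0_pi_le) auto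
   moreover have "cos \<theta> - sin \<theta> <= 0"
   proof -
    have "sin (pi/4) <= sin \<theta>" using th False by (intro sin_monotone_2pi_le) auto
    then show ?thesis using c by (simp add: cos_45 sin_45)
   qed
   moreover have "0 <= cos \<theta>" using th by (intro cos_ge_zero) auto
   ultimately show ?thesis by (intro mult_right_mono_neg power_mono) auto
  qed
 qed
 then show ?thesis using assms by (simp add: field_simps)
qed

section \<open>Mollification\<close>

definition moll :: "real => ('a::euclidean_space => real) => 'a => real" where
 "moll q g x = (LBINT y. g y * bump q (y - x)) / mass TYPE('a) q"

definition moll_grad :: "real => ('a::euclidean_space => real) => 'a => 'a" where
 "moll_grad q g x = (1 / mass TYPE('a) q) *\<^sub>R (LBINT y. g y *\<^sub>R bump_grad q (y - x))"

lemma integrable_mult_kernel: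
 fixes g :: "'a::euclidean_space => real" and k :: "'a => 'b::euclidean_space"
 assumes [measurable]: "Borel g" and U: "!!x. \<bar>g x\<bar> <= U"
  and k: "continuous_on UNIV k" "!!z. norm z > R ==> k z = 0"
 shows "integrable lborel (\<lambda>y. g y *\<^sub>R k (y - x))"
proof -
 obtain B where B: "!!z. norm (k z) <= B" "0 <= B" using continuous_bounded_support[OF k] by blast
 have [measurable]: "Borel k" using k by (simp add: borel_measurable_continuous_onI)
 show ?thesis
 proof (rule integrable_bounded_support[where B="U * B" and R="R + norm x"])
  show "norm (g y *\<^sub>R k (y - x)) <= U * B" for y
   using mult_mono[OF U B(1)] U[of y] by (simp add: order_trans[OF abs_ge_zero U])
  show "g y *\<^sub>R k (y - x) = 0" if "norm y > R + norm x" for y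
   using that norm_triangle_ineq2[of y x] by (simp add: k(2))
 qed measurable
qed

lemma bump_zero_outside: "0 < q ==> norm z > 1 / sqrt q ==> bump q z = 0"
 by (intro bump_eq_0 outside_bump_radius) auto

lemma bump_grad_zero_outside: "0 < q ==> norm z > 1 / sqrt q ==> bump_grad q z = 0"
 by (intro bump_grad_eq_0 outside_bump_radius) auto

lemma integrable_mult_bump_shift:
 fixes g :: "'a::euclidean_space => real"
 assumes "Borel g" "!!x. \<bar>g x\<bar> <= U" "0 < q"
 shows "integrable lborel (\<lambda>y. g y * bump q (y - x))"
proof -
 have "integrable lborel (\<lambda>y. g y *\<^sub>R bump q (y - x))"
  by (rule integrable_mult_kernel[OF assms(1,2)])
    (use assms(3) in \<open>auto intro!: continuous_intros bump_zero_outside\<close>)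
 then show ?thesis by simp
qed

lemma integrable_mult_bump_grad_shift:
 fixes g :: "'a::euclidean_space => real"
 assumes "Borel g" "!!x. \<bar>g x\<bar> <= U" "0 < q"
 shows "integrable lborel (\<lambda>y. g y *\<^sub>R bump_grad q (y - x))"
 by (rule integrable_mult_kernel[OF assms(1,2)])
   (use assms(3) in \<open>auto intro!: continuous_intros bump_grad_zero_outside\<close>)

lemma integral_bump_shift:
 fixes x :: "'a::euclidean_space"
 shows "(LBINT y. bump q (y - x)) = mass TYPE('a) q"
 unfolding mass_def using lborel_integral_translation[of "bump q" "- x"] by simp

text \<open>The modulus of continuity of \<open>bump_grad\<close> makes the first order remainder uniformly small, which is
what differentiating under the integral sign requires for a merely bounded \<open>g\<close>.\<close>

lemma bump_remainder:
 fixes z :: "'a::euclidean_space"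
 assumes "0 < q" "0 < e"
 obtains d where "0 < d" "!!h z::'a. norm h < d ==> \<bar>bump q (z - h) - bump q z - bump_grad q z \<bullet> h\<bar> <= e * norm h"
proof -
 obtain d where d: "0 < d" "!!x y::'a. dist x y < d ==> dist (bump_grad q x) (bump_grad q y) < e"
  by (rule uniformly_continuous_support[of "bump_grad q" "1 / sqrt q" e])
    (use assms in \<open>auto intro!: continuous_intros bump_grad_zero_outside\<close>)
 show thesis
 proof (rule that[OF d(1)])
  fix h z :: 'a assume h: "norm h < d"
  have *: "((\<lambda>s. bump q (z - s *\<^sub>R h)) has_real_derivative (bump_grad q (z - s *\<^sub>R h) \<bullet> h)) (at s)" for s
   by (rule has_derivative_imp_has_field_derivative) (auto intro!: derivative_eq_intros)
  obtain s where s: "0 < s" "s < 1" "bump q (z - h) - bump q z = bump_grad q (z - s *\<^sub>R h) \<bullet> h"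
   using MVT2[of 0 1 "\<lambda>s. bump q (z - s *\<^sub>R h)", OF _ *] by auto
  have "norm (s *\<^sub>R h) <= norm h" using s by (simp add: mult_left_le_one_le)
  then have "dist (z - s *\<^sub>R h) z < d" using h by (simp add: dist_norm)
  then have "norm (bump_grad q (z - s *\<^sub>R h) - bump_grad q z) < e"
   using d(2) by (metis dist_norm)
  moreover have "\<bar>bump q (z - h) - bump q z - bump_grad q z \<bullet> h\<bar> <= norm (bump_grad q (z - s *\<^sub>R h) - bump_grad q z) * norm h"
   unfolding s(3) inner_diff_left[symmetric] by (rule Cauchy_Schwarz_ineq2)
  ultimately show "\<bar>bump q (z - h) - bump q z - bump_grad q z \<bullet> h\<bar> <= e * norm h"
   by (smt (verit) mult_right_mono norm_ge_zero)
 qed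
qed

lemma integral_abs_le_bounded_support:
 fixes r :: "'a::euclidean_space => 'b::euclidean_space"
 assumes "!!y. norm (r y) <= c" "!!y. y \<notin> cball x R ==> r y = 0"
 shows "norm (LBINT y. r y) <= c * measure lborel (cball x R)"
proof (cases "integrable lborel r")
 case True
 have c0: "0 <= c" using order_trans[OF norm_ge_zero assms(1)] .
 have int: "integrable lborel (\<lambda>y. c * indicator (cball x R) y :: real)"
  using emeasure_bounded_finite[of "cball x R"]
  by (intro integrable_mult_right integrable_real_indicator) (auto simp: infinity_ennreal_def)
 have "norm (LBINT y. r y) <= (LBINT y. norm (r y))"
  by (rule integral_norm_bound)
 also have "... <= (LBINT y. c * indicator (cball x R) y)"
  by (rule Bochner_Integration.integral_mono[OF integrable_norm[OF True] int])
    (use assms c0 in \<open>auto simp: indicator_def\<close>)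
 finally show ?thesis by simp
next
 case False
 have "0 <= c" using order_trans[OF norm_ge_zero assms(1)] .
 with False show ?thesis by (simp add: not_integrable_integral_eq)
qed

lemma moll_has_derivative:
 fixes g :: "'a::euclidean_space => real"
 assumes g [measurable]: "Borel g" and U: "!!x. \<bar>g x\<bar> <= U" and q: "0 < q"
 shows "(moll q g has_derivative (\<lambda>h. moll_grad q g x \<bullet> h)) (at x)"
proof -
 let ?m = "mass TYPE('a) q"
 have m: "0 < ?m" using mass_pos q by blast
 have U0: "0 <= U" using order_trans[OF abs_ge_zero U] .
 let ?V = "measure lborel (cball x (1 / sqrt q + 1))"
 have "\<exists>d>0. \<forall>y. norm (y - x) < d --> norm (moll q g y - moll q g x - moll_grad q g x \<bullet> (y - x)) <= e * norm (y - x)"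
  if "0 < e" for e
 proof -
  define e' where "e' = e * ?m / (U * ?V + 1)"
  have VU: "0 < U * ?V + 1" using U0 by (simp add: add_nonneg_pos)
  have e': "0 < e'" using that m VU by (simp add: e'_def)
  obtain d where d: "0 < d"
   "!!h z::'a. norm h < d ==> \<bar>bump q (z - h) - bump q z - bump_grad q z \<bullet> h\<bar> <= e' * norm h"
   using bump_remainder[OF q e'] by blast
  show ?thesis
  proof (intro exI conjI allI impI)
   show "0 < min d 1" using d by simp
   fix y assume y: "norm (y - x) < min d 1"
   define h where "h = y - x"
   define r where "r w = g w * (bump q ((w - x) - h) - bump q (w - x) - bump_grad q (w - x) \<bullet> h)" for w
   have yx: "w - y = w - x - h" for w by (simp add: h_def)
   have "moll q g y - moll q g x - moll_grad q g x \<bullet> (y - x) = (LBINT w. r w) / ?m"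
   proof -
    have "(LBINT w. r w) = (LBINT w. g w * bump q (w - y) - g w * bump q (w - x) - (g w *\<^sub>R bump_grad q (w - x)) \<bullet> h)"
     by (simp add: r_def yx algebra_simps)
    also have "... = (LBINT w. g w * bump q (w - y)) - (LBINT w. g w * bump q (w - x)) - (LBINT w. g w *\<^sub>R bump_grad q (w - x)) \<bullet> h"
     using integrable_mult_bump_shift[OF g U q] integrable_mult_bump_grad_shift[OF g U q]
     by (simp add: integral_inner_left flip: inner_scaleR_left)
    finally show ?thesis using m by (simp add: moll_def moll_grad_def h_def[symmetric] diff_divide_distrib)
   qed
   also have "norm ... <= (U * (e' * norm h)) * ?V / ?m"
   proof -
    have "norm (LBINT w. r w) <= (U * (e' * norm h)) * ?V"
    proof (rule integral_abs_le_bounded_support)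
     show "norm (r w) <= U * (e' * norm h)" for w
      unfolding r_def using y d(2)[of h "w - x"] U[of w]
      by (auto simp: abs_mult h_def intro!: mult_mono U0)
     show "r w = 0" if "w \<notin> cball x (1 / sqrt q + 1)" for w
     proof -
      have w: "norm (w - x) > 1 / sqrt q + 1" using that by (simp add: dist_norm norm_minus_commute)
      moreover have "norm (w - x - h) > 1 / sqrt q"
       using w y norm_triangle_ineq2[of "w - x" h] by (simp add: h_def)
      ultimately show ?thesis using q
       by (simp add: r_def bump_zero_outside bump_grad_zero_outside)
     qed
    qed
    then show ?thesis using m by (simp add: divide_right_mono)
   qed
   also have "... = (U * ?V / (U * ?V + 1)) * (e * norm h)"
    using m by (simp add: e'_def)
   also have "... <= 1 * (e * norm h)"
    using VU that U0 by (intro mult_right_mono) (auto simp: divide_le_eq)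
   finally show "norm (moll q g y - moll q g x - moll_grad q g x \<bullet> (y - x)) <= e * norm (y - x)"
    by (simp add: h_def)
  qed
 qed
 then show ?thesis
  by (auto simp: has_derivative_at_alt bounded_linear_inner_right)
qed

lemma continuous_moll_grad:
 fixes g :: "'a::euclidean_space => real"
 assumes g [measurable]: "Borel g" and U: "!!x. \<bar>g x\<bar> <= U" and q: "0 < q"
 shows "continuous_on UNIV (moll_grad q g)"
proof -
 let ?m = "mass TYPE('a) q"
 have m: "0 < ?m" using mass_pos q by blast
 have U0: "0 <= U" using order_trans[OF abs_ge_zero U] .
 have "\<exists>d>0. \<forall>y. dist y x < d --> dist (moll_grad q g y) (moll_grad q g x) < e" if "0 < e" for e x
 proof -
  let ?V = "measure lborel (cball x (1 / sqrt q + 1))"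
  define e' where "e' = e * ?m / (U * ?V + 1)"
  have VU: "0 < U * ?V + 1" using U0 by (simp add: add_nonneg_pos)
  have e': "0 < e'" using that m VU by (simp add: e'_def)
  obtain d where d: "0 < d" "!!x y::'a. dist x y < d ==> dist (bump_grad q x) (bump_grad q y) < e'"
   by (rule uniformly_continuous_support[of "bump_grad q" "1 / sqrt q" e'])
     (use q e' in \<open>auto intro!: continuous_intros bump_grad_zero_outside\<close>)
  show ?thesis
  proof (intro exI conjI allI impI)
   show "0 < min d 1" using d by simp
   fix y assume y: "dist y x < min d 1"
   have "moll_grad q g y - moll_grad q g x = (1 / ?m) *\<^sub>R (LBINT w. g w *\<^sub>R (bump_grad q (w - y) - bump_grad q (w - x)))"
    using integrable_mult_bump_grad_shift[OF g U q]
    by (simp add: moll_grad_def scaleR_diff_right)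
   moreover have "norm (LBINT w. g w *\<^sub>R (bump_grad q (w - y) - bump_grad q (w - x))) <= (U * e') * ?V"
   proof (rule integral_abs_le_bounded_support)
    show "norm (g w *\<^sub>R (bump_grad q (w - y) - bump_grad q (w - x))) <= U * e'" for w
     using U[of w] d(2)[of "w - y" "w - x"] y
     by (auto simp: dist_norm norm_minus_commute U0 intro!: mult_mono less_imp_le[of "norm _" e'])
    show "g w *\<^sub>R (bump_grad q (w - y) - bump_grad q (w - x)) = 0" if "w \<notin> cball x (1 / sqrt q + 1)" for w
    proof -
     have w: "norm (w - x) > 1 / sqrt q + 1" using that by (simp add: dist_norm norm_minus_commute)
     moreover have "norm (w - y) > 1 / sqrt q"
      using w y norm_triangle_ineq[of "w - y" "y - x"] by (simp add: dist_norm)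
     ultimately show ?thesis using q by (simp add: bump_grad_zero_outside)
    qed
   qed
   ultimately have "dist (moll_grad q g y) (moll_grad q g x) <= (U * e') * ?V / ?m"
    using m by (simp add: dist_norm divide_right_mono)
   also have "... = (U * ?V / (U * ?V + 1)) * e" using m by (simp add: e'_def)
   also have "... < 1 * e"
    using VU that U0 by (intro mult_strict_right_mono) (auto simp: divide_less_eq)
   finally show "dist (moll_grad q g y) (moll_grad q g x) < e" by simp
  qed
 qed
 then show ?thesis by (auto simp: continuous_on_iff)
qed

lemma moll_minus_le:
 fixes g :: "'a::euclidean_space => real"
 assumes g [measurable]: "Borel g" and U: "!!x. \<bar>g x\<bar> <= U" and q: "0 < q"
  and e: "!!y. norm (y - x) <= 1 / sqrt q ==> \<bar>g y - c\<bar> <= e"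
 shows "\<bar>moll q g x - c\<bar> <= e"
proof -
 let ?m = "mass TYPE('a) q"
 have m: "0 < ?m" using mass_pos q by blast
 have i: "integrable lborel (\<lambda>y. bump q (y - x))"
  using integrable_mult_bump_shift[of "\<lambda>_. 1" 1] q by simp
 have "moll q g x - c = (LBINT y. (g y - c) * bump q (y - x)) / ?m"
  using integrable_mult_bump_shift[OF g U q] i m
  by (simp add: moll_def left_diff_distrib integral_bump_shift field_simps)
 moreover have "\<bar>LBINT y. (g y - c) * bump q (y - x)\<bar> <= (LBINT y. e * bump q (y - x))"
 proof (rule order_trans[OF integral_abs_bound Bochner_Integration.integral_mono])
  show "integrable lborel (\<lambda>y. \<bar>(g y - c) * bump q (y - x)\<bar>)"
   using integrable_mult_bump_shift[OF g U q] i by (simp add: left_diff_distrib)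
  show "integrable lborel (\<lambda>y. e * bump q (y - x))" using i by simp
  show "\<bar>(g y - c) * bump q (y - x)\<bar> <= e * bump q (y - x)" for y
   using e[of y] bump_zero_outside[OF q, of "y - x"]
   by (cases "norm (y - x) <= 1 / sqrt q") (auto simp: abs_mult mult_right_mono)
 qed
 ultimately show ?thesis using m by (simp add: integral_bump_shift abs_divide divide_le_eq)
qed

lemma moll_bounded:
 fixes g :: "'a::euclidean_space => real"
 assumes "Borel g" "!!x. \<bar>g x\<bar> <= U" "0 < q"
 shows "\<bar>moll q g x\<bar> <= U"
 using moll_minus_le[OF assms, of x 0 U] assms by simp

lemma moll_eq_0:
 fixes g :: "'a::euclidean_space => real"
 assumes "0 < q" "!!y. norm y > R ==> g y = 0" "norm x > R + 1 / sqrt q"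
 shows "moll q g x = 0"
proof -
 have "g y * bump q (y - x) = 0" for y
 proof (cases "norm y > R")
  case False
  then have "norm (y - x) > 1 / sqrt q" using assms(3) norm_triangle_ineq2[of x y] by (simp add: norm_minus_commute)
  then show ?thesis using assms(1) by (simp add: bump_zero_outside)
 qed (use assms in simp)
 then have "(\<lambda>y. g y * bump q (y - x)) = (\<lambda>_. 0)" by blast
 then show ?thesis unfolding moll_def by (simp only:) simp
qed

lemma moll_uniform:
 fixes g :: "'a::euclidean_space => real"
 assumes "continuous_on UNIV g" "!!x. norm x > R ==> g x = 0" "0 < e"
 obtains q where "1 <= q" "!!x. \<bar>moll q g x - g x\<bar> <= e"
proof -
 obtain d where d: "0 < d" "!!x y. dist x y < d ==> dist (g x) (g y) < e"
  using uniformly_continuous_support[OF assms] by blast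
 obtain B where B: "!!x. norm (g x) <= B" using continuous_bounded_support[OF assms(1,2)] by blast
 define q where "q = max 1 (4 / d\<^sup>2)"
 have q: "1 <= q" "4 / d\<^sup>2 <= q" by (auto simp: q_def)
 have "2 / d <= sqrt q" using q(2) d(1) real_le_rsqrt[of "2 / d" q] by (simp add: power_divide)
 then have "1 / sqrt q <= d / 2" using d(1) q(1) by (simp add: field_simps)
 then have qd: "1 / sqrt q < d" using d(1) by linarith
 have "\<bar>moll q g x - g x\<bar> <= e" for x
 proof (rule moll_minus_le)
  show "Borel g" using assms by (simp add: borel_measurable_continuous_onI)
  show "\<bar>g y\<bar> <= B" for y using B[of y] by simp
  show "\<bar>g y - g x\<bar> <= e" if "norm (y - x) <= 1 / sqrt q" for y
   using d(2)[of y x] that qd by (simp add: dist_norm)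
 qed (use q in auto)
 with q(1) show thesis by (rule that)
qed

lemma moll_adjoint:
 fixes g h :: "'a::euclidean_space => real"
 assumes g [measurable]: "Borel g" and U: "!!x. \<bar>g x\<bar> <= U" and q: "0 < q"
  and h [measurable]: "Borel h" and h0: "!!x. norm x > R ==> h x = 0"
  and B: "!!x. \<bar>h x\<bar> <= B"
 shows "(LBINT x. moll q g x * h x) = (LBINT x. g x * moll q h x)"
proof -
 let ?m = "mass TYPE('a) q"
 have "integrable lborel2 (\<lambda>(x, y). g y * h x * bump q (y - x))"
  unfolding lborel_prod
 proof (rule integrable_bounded_support[where B="U * B" and R="2 * R + 1 / sqrt q"])
  show "Borel (\<lambda>(x, y). g y * h x * bump q (y - x))"
   unfolding borel_prod[symmetric] by measurable
  show "norm (case p of (x, y) => g y * h x * bump q (y - x)) <= U * B" for p :: "'a \<times> 'a"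
  proof -
   obtain x y where p: "p = (x, y)" by (cases p)
   have "\<bar>g y * h x\<bar> * bump q (y - x) <= (U * B) * 1"
    using U[of y] B[of x] bump_le_1[of q "y - x"] q
    by (intro mult_mono) (auto simp: abs_mult intro!: mult_mono)
   then show ?thesis by (simp add: p abs_mult)
  qed
  show "(case p of (x, y) => g y * h x * bump q (y - x)) = 0" if p': "norm p > 2 * R + 1 / sqrt q" for p :: "'a \<times> 'a"
  proof -
   obtain x y where p: "p = (x, y)" by (cases p)
   show ?thesis
   proof (cases "norm x > R")
    case False
    then have "norm (y - x) > 1 / sqrt q"
     using norm_triangle_ineq2[of y x] norm_Pair_le[of x y] p' by (simp add: p)
    then show ?thesis using q by (simp add: p bump_zero_outside)
   qed (simp add: p h0)
  qed
 qed
 then have "(LBINT y. LBINT x. g y * h x * bump q (y - x)) = (LBINT x. LBINT y. g y * h x * bump q (y - x))"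
  by (rule lborel_pair.Fubini_integral)
 moreover have "(LBINT x. moll q g x * h x) = (LBINT x. LBINT y. g y * h x * bump q (y - x)) / ?m"
 proof -
  have "moll q g x * h x = (LBINT y. g y * h x * bump q (y - x)) / ?m" for x
   by (simp add: moll_def mult.assoc mult.left_commute[of _ "h x"] mult.commute[of _ "h x"])
  then show ?thesis by simp
 qed
 moreover have "(LBINT y. g y * moll q h y) = (LBINT y. LBINT x. g y * h x * bump q (y - x)) / ?m"
 proof -
  have "g y * moll q h y = (LBINT x. g y * h x * bump q (y - x)) / ?m" for y
   by (simp add: moll_def mult.assoc bump_commute)
  then show ?thesis by simp
 qed
 ultimately show ?thesis by simp
qed

lemma deriv_at_eq_0_outside:
 fixes \<phi> :: "'a::euclidean_space => 'b::real_normed_vector"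
 assumes "!!p. norm p > R ==> \<phi> p = 0" "norm p > R"
 shows "blinfun_apply (deriv_at \<phi> p) h = 0"
proof -
 have "open {p::'a. norm p > R}" by (intro open_Collect_less continuous_intros)
 then have "(\<phi> has_derivative (\<lambda>_. 0)) (at p)"
  by (rule has_derivative_transform_within_open[OF has_derivative_const[of 0]]) (use assms in auto)
 from deriv_at_eq[OF this] show ?thesis by simp
qed

lemma continuous_divergence:
 "C1_c S \<psi> ==> continuous_on UNIV (divergence \<psi>)"
 unfolding divergence_def by (intro continuous_intros C1_cD(2))

lemma divergence_eq_0_outside:
 assumes "!!p. norm p > R ==> \<psi> p = 0" "norm p > R"
 shows "divergence \<psi> p = 0"
 unfolding divergence_def by (simp add: deriv_at_eq_0_outside[of R \<psi>, OF assms])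

lemma integral_by_parts_divergence:
 fixes \<gamma> :: "real ^ 'n => real"
 assumes der: "!!x. (\<gamma> has_derivative (\<lambda>h. m x \<bullet> h)) (at x)" and m: "continuous_on UNIV m"
  and \<psi>: "C1_c UNIV \<psi>" "!!x. norm x > R ==> \<psi> x = 0"
 shows "(LBINT x. \<gamma> x * divergence \<psi> x) = - (LBINT x. m x \<bullet> \<psi> x)"
proof -
 define D where "D x = blinfun_apply (deriv_at \<psi> x)" for x
 have D: "(\<psi> has_derivative D x) (at x)" for x
  unfolding D_def by (rule C1_cD(1)[OF \<psi>(1)])
 have Dc: "continuous_on UNIV (\<lambda>x. D x h)" for h
  unfolding D_def by (rule C1_cD(2)[OF \<psi>(1)])
 have D0: "D x h = 0" if "norm x > R" for x h
  unfolding D_def by (rule deriv_at_eq_0_outside[of R \<psi>, OF \<psi>(2) that])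
 have \<gamma>c: "continuous_on UNIV \<gamma>"
  using der by (rule has_derivative_imp_continuous_on)
 have \<psi>c: "continuous_on UNIV \<psi>" by (rule C1_cD(3)[OF \<psi>(1)])
 let ?e = "\<lambda>i. axis i 1 :: real ^ 'n"
 have I: "(LBINT x. \<gamma> x * (D x (?e i) $ i) + (m x \<bullet> ?e i) * (\<psi> x $ i)) = 0" for i
 proof (rule integral_derivative_eq_0[where \<phi>="\<lambda>x. \<gamma> x * (\<psi> x $ i)" and D="\<lambda>x h. \<gamma> x * (D x h $ i) + (m x \<bullet> h) * (\<psi> x $ i)" and R=R])
  show "((\<lambda>x. \<gamma> x * (\<psi> x $ i)) has_derivative (\<lambda>h. \<gamma> x * (D x h $ i) + (m x \<bullet> h) * (\<psi> x $ i))) (at x)" for x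
   by (rule has_derivative_mult[OF der bounded_linear.has_derivative[OF bounded_linear_vec_nth D]])
  show "continuous_on UNIV (\<lambda>x. \<gamma> x * (D x (?e i) $ i) + (m x \<bullet> ?e i) * (\<psi> x $ i))"
   by (intro continuous_intros \<gamma>c Dc m \<psi>c)
 qed (use \<psi>(2) D0 in auto)
 have int: "integrable lborel h" if h: "continuous_on UNIV h" "!!x. norm x > R ==> h x = 0" for h :: "real ^ 'n => real"
 proof -
  obtain B where "!!x. norm (h x) <= B" using continuous_bounded_support[OF h] by blast
  then show ?thesis using h by (intro integrable_bounded_support) (auto intro: borel_measurable_continuous_onI)
 qed
 have "(LBINT x. \<gamma> x * divergence \<psi> x + m x \<bullet> \<psi> x) = (LBINT x. (\<Sum>i\<in>UNIV. \<gamma> x * (D x (?e i) $ i) + (m x \<bullet> ?e i) * (\<psi> x $ i)))"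
  by (simp add: divergence_def D_def sum.distrib sum_distrib_left inner_vec_def[of "m _" "\<psi> _"] inner_axis)
 also have "... = 0"
  by (subst Bochner_Integration.integral_sum)
    (auto simp: I D0 \<psi>(2) intro!: int continuous_intros \<gamma>c Dc m \<psi>c)
 finally have "(LBINT x. \<gamma> x * divergence \<psi> x + m x \<bullet> \<psi> x) = 0" .
 moreover have "integrable lborel (\<lambda>x. \<gamma> x * divergence \<psi> x)"
  by (intro int continuous_intros \<gamma>c continuous_divergence[OF \<psi>(1)]) (use divergence_eq_0_outside[of R \<psi>, OF \<psi>(2)] in auto)
 moreover have "integrable lborel (\<lambda>x. m x \<bullet> \<psi> x)"
  by (intro int continuous_intros m \<psi>c) (use \<psi>(2) in auto)
 ultimately show ?thesis by simp
qed

section \<open>Total variation and averaged differences\<close>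

lemma continuous_moll:
 fixes g :: "'a::euclidean_space => real"
 assumes "Borel g" "!!x. \<bar>g x\<bar> <= U" "0 < q"
 shows "continuous_on UNIV (moll q g)"
 using moll_has_derivative[OF assms]
 by (rule has_derivative_imp_continuous_on)

lemma nn_integral_shift_difference:
 fixes g :: "'a::euclidean_space => real"
 assumes [measurable]: "Borel g"
 shows "(NBINT y. ennreal (\<bar>g x - g y\<bar> * bump q (x - y))) = (NBINT z. ennreal (\<bar>g (x + z) - g x\<bar> * bump q z))"
proof -
 have "(NBINT y. ennreal (\<bar>g x - g y\<bar> * bump q (x - y))) = (NBINT z. ennreal (\<bar>g x - g (z + x)\<bar> * bump q (x - (z + x))))"
  by (rule nn_integral_lborel_translation[symmetric]) measurable
 then show ?thesis by (simp add: add.commute abs_minus_commute)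
qed

text \<open>Averaging does not increase \<open>L\<^sup>1\<close> norms of differences. The radius grows by \<open>1\<close> because the mollifier
looks at points at distance at most \<open>1\<close>.\<close>

lemma moll_difference_le:
 fixes g :: "'a::euclidean_space => real"
 assumes g [measurable]: "Borel g" and U: "!!x. \<bar>g x\<bar> <= U" and p: "1 <= p"
 shows "(NBINT x. (NBINT z. indicator (cball 0 R) x * ennreal (\<bar>moll p g (x + z) - moll p g x\<bar> * bump q z)))
   <= (NBINT x. (NBINT z. indicator (cball 0 (R + 1)) x * ennreal (\<bar>g (x + z) - g x\<bar> * bump q z)))"
proof -
 let ?m = "mass TYPE('a) p"
 have p0: "0 < p" using p by simp
 have m: "0 < ?m" using mass_pos p0 by blast
 define A where "A x z = ennreal (\<bar>g (x + z) - g x\<bar> * bump q z)" for x z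
 define k where "k w = ennreal (bump p (w::'a) / ?m)" for w
 define B where "B x = (NBINT z. A x z)" for x
 have [measurable]: "case_prod A \<in> borel_measurable borel2"
  unfolding A_def by measurable
 have [measurable]: "Borel k" unfolding k_def by measurable
 have [measurable]: "Borel B" unfolding B_def by measurable
 have [measurable]: "cball (0::'a) r \<in> sets borel" for r by simp
 have mg [measurable]: "Borel (moll p g)"
  by (intro borel_measurable_continuous_onI continuous_moll[OF g U p0])
 have moll_eq: "moll p g x = (LBINT w. g (x + w) * bump p w) / ?m" for x
  using lborel_integral_translation[of "\<lambda>y. g y * bump p (y - x)" x]
  by (simp add: moll_def add.commute)
 have int: "integrable lborel (\<lambda>w. g (x + w) * bump p w)" for x
  using integrable_mult_bump_shift[of "\<lambda>w. g (x + w)" U p 0] U p0 by simp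
 have pt: "ennreal \<bar>moll p g (x + z) - moll p g x\<bar> <= (NBINT w. ennreal (\<bar>g (x + z + w) - g (x + w)\<bar>) * k w)" for x z
 proof -
  have "moll p g (x + z) - moll p g x = (LBINT w. (g (x + z + w) - g (x + w)) * bump p w / ?m)"
   using int by (simp add: moll_eq left_diff_distrib diff_divide_distrib)
  also have "ennreal (norm ...) <= (NBINT w. ennreal (norm ((g (x + z + w) - g (x + w)) * bump p w / ?m)))"
   using int by (intro integral_norm_bound_ennreal) (simp add: left_diff_distrib diff_divide_distrib)
  also have "... = (NBINT w. ennreal (\<bar>g (x + z + w) - g (x + w)\<bar>) * k w)"
   using m by (intro nn_integral_cong) (simp add: k_def abs_mult ennreal_mult[symmetric])
  finally show ?thesis by simp
 qed
 have k1: "(NBINT w. k w) = 1"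
 proof -
  have "(NBINT w. k w) = ennreal (LBINT w. bump p (w::'a) / ?m)"
   unfolding k_def using m by (intro nn_integral_eq_integral) (auto intro!: integrable_bump p0)
  then show ?thesis using m by (simp add: mass_def)
 qed
 have "(NBINT x. (NBINT z. indicator (cball 0 R) x * ennreal (\<bar>moll p g (x + z) - moll p g x\<bar> * bump q z)))
   <= (NBINT x. (NBINT z. (NBINT w. indicator (cball 0 R) x * (A (x + w) z * k w))))"
 proof (intro nn_integral_mono)
  fix x z :: 'a
  have "indicator (cball 0 R) x * ennreal (\<bar>moll p g (x + z) - moll p g x\<bar> * bump q z)
    <= indicator (cball 0 R) x * ((NBINT w. ennreal (\<bar>g (x + z + w) - g (x + w)\<bar>) * k w) * ennreal (bump q z))"
   using pt[of x z] by (simp add: ennreal_mult mult_left_mono mult_right_mono)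
  also have "... = (NBINT w. indicator (cball 0 R) x * (A (x + w) z * k w))"
   by (simp add: A_def ennreal_mult add_ac mult_ac flip: nn_integral_cmult nn_integral_multc)
  finally show "indicator (cball 0 R) x * ennreal (\<bar>moll p g (x + z) - moll p g x\<bar> * bump q z) <= ..." .
 qed
 also have "... = (NBINT x. (NBINT w. (NBINT z. indicator (cball 0 R) x * (A (x + w) z * k w))))"
  by (intro nn_integral_cong lborel_pair.Fubini') measurable
 also have "... = (NBINT x. (NBINT w. k w * (indicator (cball 0 R) x * B (x + w))))"
  by (intro nn_integral_cong) (simp add: B_def nn_integral_cmult nn_integral_multc mult_ac)
 also have "... = (NBINT w. (NBINT x. k w * (indicator (cball 0 R) x * B (x + w))))"
  by (intro lborel_pair.Fubini') measurable
 also have "... <= (NBINT w. (NBINT x. k w * (indicator (cball 0 (R + 1)) (x + w) * B (x + w))))"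
 proof (intro nn_integral_mono)
  fix x w :: 'a
  show "k w * (indicator (cball 0 R) x * B (x + w)) <= k w * (indicator (cball 0 (R + 1)) (x + w) * B (x + w))"
  proof (cases "norm w <= 1")
   case True
   have "norm (x + w) <= R + 1" if "norm x <= R" using that True norm_triangle_ineq[of x w] by linarith
   then show ?thesis by (auto simp: indicator_def)
  next
   case False
   have "1 / sqrt p <= 1" using p by simp
   then have "norm w > 1 / sqrt p" using False by linarith
   then have "k w = 0" using p0 by (simp add: k_def bump_zero_outside)
   then show ?thesis by simp
  qed
 qed
 also have "... = (NBINT w. k w * (NBINT x. indicator (cball 0 (R + 1)) x * B x))"
 proof (rule nn_integral_cong)
  fix w :: 'a
  have "(NBINT x. k w * (indicator (cball 0 (R + 1)) (x + w) * B (x + w))) = k w * (NBINT x. indicator (cball 0 (R + 1)) (x + w) * B (x + w))"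
   by (rule nn_integral_cmult) measurable
  also have "(NBINT x. indicator (cball 0 (R + 1)) (x + w) * B (x + w)) = (NBINT x. indicator (cball 0 (R + 1)) x * B x)"
   by (rule nn_integral_lborel_translation) measurable
  finally show "(NBINT x. k w * (indicator (cball 0 (R + 1)) (x + w) * B (x + w))) = k w * (NBINT x. indicator (cball 0 (R + 1)) x * B x)" .
 qed
 also have "... = (NBINT x. indicator (cball 0 (R + 1)) x * B x)"
  by (simp add: nn_integral_multc k1)
 also have "... = (NBINT x. (NBINT z. indicator (cball 0 (R + 1)) x * A x z))"
  by (intro nn_integral_cong) (simp add: B_def nn_integral_cmult)
 finally show ?thesis unfolding A_def .
qed

text \<open>Up to an error, \<open>\<integral> g div \<phi>\<close> is \<open>- \<integral> \<nabla>\<gamma> \<bullet> \<phi>\<close> for a mollification \<open>\<gamma>\<close> of \<open>g\<close>, hence at most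
\<open>\<integral> |\<nabla>\<gamma>|\<close> over the ball. For fixed \<open>\<gamma>\<close> and a kernel of small radius the difference
\<open>\<gamma>(x + z) - \<gamma>(x)\<close> is \<open>\<nabla>\<gamma>(x) \<bullet> z\<close> up to \<open>o(|z|)\<close>, and the average of \<open>|\<nabla>\<gamma>(x) \<bullet> z|\<close> is
\<open>|\<nabla>\<gamma>(x)|\<close> times the moment. Finally \<open>moll_difference_le\<close> leads from \<open>\<gamma>\<close> back to \<open>g\<close>.\<close>

lemma TV_lower:
 fixes g :: "real ^ 'n => real"
 assumes g [measurable]: "Borel g" and U: "!!x. \<bar>g x\<bar> <= U"
  and \<phi>: "C1_c UNIV \<phi>" "!!x. norm (\<phi> x) <= 1" and R: "!!x. norm x > R ==> \<phi> x = 0"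
  and e0: "norm (e0 :: real ^ 'n) = 1" and e: "0 < e"
 shows "\<exists>q0>0. \<forall>q\<ge>q0. ennreal (dir_moment q e0 * ((LBINT x. g x * divergence \<phi> x) - e))
   <= (NBINT x. (NBINT y. indicator (cball 0 (R + 1)) x * ennreal (\<bar>g x - g y\<bar> * bump q (x - y))))"
proof -
 have U0: "0 <= U" using order_trans[OF abs_ge_zero U] .
 let ?D = "divergence \<phi>"
 have Dc: "continuous_on UNIV ?D" by (rule continuous_divergence[OF \<phi>(1)])
 have D0: "?D x = 0" if "norm x > R" for x by (rule divergence_eq_0_outside[of R \<phi>, OF R that])
 obtain B where B: "!!x. norm (?D x) <= B" using continuous_bounded_support[OF Dc D0] by blast
 have [measurable]: "Borel (?D)" using Dc by (simp add: borel_measurable_continuous_onI)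
 define V where "V = measure lborel (cball (0::real^'n) (R + 1))"
 define W where "W = measure lborel (cball (0::real^'n) R)"
 have V0: "0 <= V" "0 <= W" by (auto simp: V_def W_def)
 (* e1 and e2 below are chosen so that each of the two errors is at most e / 2, the second one after multiplication with the moment. *)
 define e1 where "e1 = e / (2 * (U * V + 1))"
 have UV: "0 < U * V + 1" using U0 V0 by (simp add: add_nonneg_pos)
 have e1: "0 < e1" using e UV by (simp add: e1_def)
 obtain p where p: "1 <= p" "!!x. \<bar>moll p ?D x - ?D x\<bar> <= e1"
  using moll_uniform[OF Dc D0 e1] by blast
 have p0: "0 < p" using p by simp
 have psq: "1 / sqrt p <= 1" using p by simp
 define \<gamma> where "\<gamma> = moll p g"
 define m where "m = moll_grad p g"
 have \<gamma>': "(\<gamma> has_derivative (\<lambda>h. m x \<bullet> h)) (at x)" for x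
  unfolding \<gamma>_def m_def by (rule moll_has_derivative[OF g U p0])
 have mc: "continuous_on UNIV m" unfolding m_def by (rule continuous_moll_grad[OF g U p0])
 have \<gamma>c: "continuous_on UNIV \<gamma>"
  using \<gamma>' by (rule has_derivative_imp_continuous_on)
 have [measurable]: "Borel \<gamma>" "Borel m"
  using mc \<gamma>c by (auto simp: borel_measurable_continuous_onI)
 have [measurable]: "cball (0::real^'n) r \<in> sets borel" for r by simp
 define M where "M = (LBINT x. norm (m x) * indicator (cball 0 R) x)"
 have cR: "compact (m ` cball 0 R)"
  using mc by (intro compact_continuous_image) (auto intro: continuous_on_subset)
 obtain Bm where Bm: "!!x. x \<in> cball 0 R ==> norm (m x) <= Bm"
  using compact_imp_bounded[OF cR] unfolding bounded_iff by blast
 have intM: "integrable lborel (\<lambda>x. norm (m x) * indicator (cball 0 R) x)"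
  by (rule integrable_bounded_support[where B="\<bar>Bm\<bar>" and R=R]) (use Bm in \<open>force simp: indicator_def\<close>)+
 have step1: "(LBINT x. g x * ?D x) <= M + e / 2"
 proof -
  have Dmc: "continuous_on UNIV (moll p ?D)"
   by (rule continuous_moll[of _ B]) (use B p0 in auto)
  then have [measurable]: "Borel (moll p ?D)" by (simp add: borel_measurable_continuous_onI)
  have Dm0: "moll p ?D x = 0" if "norm x > R + 1" for x
   by (rule moll_eq_0[OF p0 D0, of R]) (use that psq in auto)
  have i1: "integrable lborel (\<lambda>x. g x * ?D x)"
  proof (rule integrable_bounded_support[where B="U * B" and R=R])
   show "norm (g x * ?D x) <= U * B" for x
    using mult_mono[OF U[of x] B[of x] U0] by (simp add: abs_mult)
  qed (auto simp: D0)
  obtain B' where B': "!!x. norm (moll p ?D x) <= B'" using continuous_bounded_support[OF Dmc Dm0] by blast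
  have i2: "integrable lborel (\<lambda>x. g x * moll p ?D x)"
  proof (rule integrable_bounded_support[where B="U * B'" and R="R + 1"])
   show "norm (g x * moll p ?D x) <= U * B'" for x
    using mult_mono[OF U[of x] B'[of x] U0] by (simp add: abs_mult)
  qed (auto simp: Dm0)
  have "(LBINT x. g x * ?D x) - (LBINT x. g x * moll p ?D x) = (LBINT x. g x * (?D x - moll p ?D x))"
   using i1 i2 by (simp add: right_diff_distrib)
  also have "... <= norm ..." by simp
  also have "... <= (U * e1) * V"
   unfolding V_def
  proof (rule integral_abs_le_bounded_support)
   show "norm (g x * (?D x - moll p ?D x)) <= U * e1" for x
    using mult_mono[OF U[of x] p(2)[of x] U0] by (simp add: abs_mult abs_minus_commute)
   show "g x * (?D x - moll p ?D x) = 0" if "x \<notin> cball 0 (R + 1)" for x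
    using that D0[of x] Dm0[of x] by simp
  qed
  also have "... = (U * V / (U * V + 1)) * (e / 2)" by (simp add: e1_def mult_ac)
  also have "... <= 1 * (e / 2)" using UV e by (intro mult_right_mono) auto
  finally have "(LBINT x. g x * ?D x) <= (LBINT x. g x * moll p ?D x) + e / 2" by simp
  also have "(LBINT x. g x * moll p ?D x) = (LBINT x. \<gamma> x * ?D x)"
   unfolding \<gamma>_def by (rule moll_adjoint[OF g U p0, symmetric, where R=R and B=B]) (use D0 B in auto)
  also have "... = - (LBINT x. m x \<bullet> \<phi> x)"
   by (rule integral_by_parts_divergence[OF \<gamma>' mc \<phi>(1) R])
  also have "... <= norm (LBINT x. m x \<bullet> \<phi> x)" by simp
  also have "... <= M"
   unfolding M_def
  proof (rule Bochner_Integration.integral_norm_bound_integral)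
   have \<phi>c: "continuous_on UNIV \<phi>" by (rule C1_cD(3)[OF \<phi>(1)])
   have c: "continuous_on UNIV (\<lambda>x. m x \<bullet> \<phi> x)" using mc \<phi>c by (intro continuous_intros)
   have m\<phi>0: "m x \<bullet> \<phi> x = 0" if "norm x > R" for x using R[OF that] by simp
   obtain B'' where "!!x. norm (m x \<bullet> \<phi> x) <= B''"
    using continuous_bounded_support[OF c m\<phi>0] by blast
   then show "integrable lborel (\<lambda>x. m x \<bullet> \<phi> x)"
    using c R by (intro integrable_bounded_support[where R=R]) (auto intro: borel_measurable_continuous_onI)
   show "norm (m x \<bullet> \<phi> x) <= norm (m x) * indicator (cball 0 R) x" for x
    using Cauchy_Schwarz_ineq2[of "m x" "\<phi> x"] mult_left_mono[OF \<phi>(2)[of x] norm_ge_zero[of "m x"]] R[of x]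
    by (auto simp: indicator_def)
  qed (rule intM)
  finally show ?thesis by simp
 qed
 define N where "N = real CARD('n)"
 define e2 where "e2 = e / (2 * (N * W + 1))"
 have NW: "0 < N * W + 1" using V0 by (simp add: N_def add_nonneg_pos)
 have e2: "0 < e2" using e NW by (simp add: e2_def)
 obtain d where d: "0 < d" "!!x y. x \<in> cball 0 (R + 1) ==> y \<in> cball 0 (R + 1) ==> dist x y < d ==> dist (m x) (m y) < e2"
 proof -
  have "uniformly_continuous_on (cball 0 (R + 1)) m"
   using mc by (intro compact_uniformly_continuous) (auto intro: continuous_on_subset)
  then show thesis using e2 that unfolding uniformly_continuous_on_def by metis
 qed
 define r where "r = min (d / 2) 1"
 have r: "0 < r" "r < d" "r <= 1" using d by (auto simp: r_def)
 show ?thesis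
 proof (intro exI conjI allI impI)
  show "0 < 1 / r\<^sup>2" using r by simp
  fix q assume "1 / r\<^sup>2 <= q"
  then have q0: "0 < q" and "1 / r <= sqrt q"
   using r real_le_rsqrt[of "1 / r" q] by (auto simp: power_divide intro: less_le_trans[of 0 "1 / r\<^sup>2"])
  then have qr: "1 / sqrt q <= r" using r by (simp add: field_simps)
  let ?c = "dir_moment q e0"
  have c0: "0 < ?c" by (rule dir_moment_pos[OF q0 e0])
  have lin: "\<bar>\<gamma> (x + z) - \<gamma> x - m x \<bullet> z\<bar> <= e2 * norm z" if x: "norm x <= R" and z: "norm z <= r" for x z
  proof -
   have *: "((\<lambda>s. \<gamma> (x + s *\<^sub>R z)) has_real_derivative (m (x + s *\<^sub>R z) \<bullet> z)) (at s)" for s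
   proof -
    have "((\<lambda>s. \<gamma> (x + s *\<^sub>R z)) has_derivative (\<lambda>h. m (x + s *\<^sub>R z) \<bullet> (h *\<^sub>R z))) (at s)"
     by (rule has_derivative_compose[OF _ \<gamma>']) (auto intro!: derivative_eq_intros)
    then show ?thesis by (rule has_derivative_imp_has_field_derivative) simp
   qed
   obtain s where s: "0 < s" "s < 1" "\<gamma> (x + z) - \<gamma> x = m (x + s *\<^sub>R z) \<bullet> z"
    using MVT2[of 0 1 "\<lambda>s. \<gamma> (x + s *\<^sub>R z)", OF _ *] by auto
   have sz: "norm (s *\<^sub>R z) <= norm z" using s by (simp add: mult_left_le_one_le)
   have "norm (x + s *\<^sub>R z) <= R + 1" using norm_triangle_ineq[of x "s *\<^sub>R z"] sz x z r by linarith
   then have "dist (m (x + s *\<^sub>R z)) (m x) < e2"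
    using sz x z r by (intro d(2)) (auto simp: mem_cball_0 dist_norm[of "x + s *\<^sub>R z" x] simp del: mem_cball)
   then have "norm (m (x + s *\<^sub>R z) - m x) <= e2" by (simp add: dist_norm)
   then show ?thesis
    using Cauchy_Schwarz_ineq2[of "m (x + s *\<^sub>R z) - m x" z] mult_right_mono[of "norm (m (x + s *\<^sub>R z) - m x)" e2 "norm z"]
    by (simp add: s(3) inner_diff_left)
  qed
  have nm: "(NBINT z. ennreal (norm z * bump q (z::real^'n))) <= ennreal (N * ?c)"
  proof -
   have "(NBINT z. ennreal (norm z * bump q (z::real^'n))) = ennreal (LBINT z. norm z * bump q (z::real^'n))"
    by (rule nn_integral_eq_integral) (auto intro!: integrable_mult_bump q0 continuous_intros)
   then show ?thesis unfolding N_def using norm_moment_le[OF q0 e0] by (simp add: ennreal_leI)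
  qed
  have pt: "indicator (cball 0 R) x * ennreal (norm (m x) * ?c) <= (NBINT z. indicator (cball 0 R) x * ennreal (\<bar>\<gamma> (x + z) - \<gamma> x\<bar> * bump q z))
    + indicator (cball 0 R) x * ennreal (e2 * (N * ?c))" for x
  proof (cases "x \<in> cball 0 R")
   case True
   have "ennreal (norm (m x) * ?c) = ennreal (dir_moment q (m x))"
    by (simp add: dir_moment_eq_norm[OF e0, of q "m x"])
   also have "... = (NBINT z. ennreal (\<bar>z \<bullet> m x\<bar> * bump q z))"
    unfolding dir_moment_def
    by (rule nn_integral_eq_integral[symmetric]) (auto intro!: integrable_mult_bump q0 continuous_intros)
   also have "... <= (NBINT z. ennreal (\<bar>\<gamma> (x + z) - \<gamma> x\<bar> * bump q z) + ennreal e2 * ennreal (norm z * bump q z))"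
   proof (rule nn_integral_mono)
    fix z :: "real^'n"
    show "ennreal (\<bar>z \<bullet> m x\<bar> * bump q z) <= ennreal (\<bar>\<gamma> (x + z) - \<gamma> x\<bar> * bump q z) + ennreal e2 * ennreal (norm z * bump q z)"
    proof (cases "norm z <= r")
     case z: True
     have "\<bar>z \<bullet> m x\<bar> <= \<bar>\<gamma> (x + z) - \<gamma> x\<bar> + e2 * norm z"
      using lin[of x z] z True by (simp add: inner_commute)
     then have "\<bar>z \<bullet> m x\<bar> * bump q z <= \<bar>\<gamma> (x + z) - \<gamma> x\<bar> * bump q z + e2 * (norm z * bump q z)"
      using mult_right_mono[of "\<bar>z \<bullet> m x\<bar>" "\<bar>\<gamma> (x + z) - \<gamma> x\<bar> + e2 * norm z" "bump q z"]
      by (simp add: distrib_right mult.assoc)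
     then show ?thesis using e2 by (simp add: ennreal_mult[symmetric] ennreal_plus[symmetric] ennreal_leI del: ennreal_plus)
    next
     case False
     then show ?thesis using qr q0 by (simp add: bump_zero_outside)
    qed
   qed
   also have "... = (NBINT z. ennreal (\<bar>\<gamma> (x + z) - \<gamma> x\<bar> * bump q z)) + ennreal e2 * (NBINT z. ennreal (norm z * bump q (z::real^'n)))"
    by (simp add: nn_integral_add nn_integral_cmult)
   also have "... <= (NBINT z. ennreal (\<bar>\<gamma> (x + z) - \<gamma> x\<bar> * bump q z)) + ennreal (e2 * (N * ?c))"
    using mult_left_mono[OF nm, of "ennreal e2"] e2 c0 by (simp add: ennreal_mult N_def)
   finally show ?thesis using True by simp
  qed simp
  have "ennreal (M * ?c) = (NBINT x. indicator (cball 0 R) x * ennreal (norm (m x) * ?c))"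
  proof -
   have "(NBINT x. indicator (cball 0 R) x * ennreal (norm (m x) * ?c)) = (NBINT x. ennreal (norm (m x) * indicator (cball 0 R) x * ?c))"
    by (intro nn_integral_cong) (auto simp: indicator_def)
   also have "... = ennreal (LBINT x. norm (m x) * indicator (cball 0 R) x * ?c)"
    using intM c0 by (intro nn_integral_eq_integral) auto
   finally show ?thesis by (simp add: M_def)
  qed
  also have "... <= (NBINT x. (NBINT z. indicator (cball 0 R) x * ennreal (\<bar>\<gamma> (x + z) - \<gamma> x\<bar> * bump q z))
    + indicator (cball 0 R) x * ennreal (e2 * (N * ?c)))"
   by (rule nn_integral_mono) (rule pt)
  also have "... = (NBINT x. (NBINT z. indicator (cball 0 R) x * ennreal (\<bar>\<gamma> (x + z) - \<gamma> x\<bar> * bump q z)))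
    + (NBINT x. indicator (cball (0::real^'n) R) x * ennreal (e2 * (N * ?c)))"
   by (rule nn_integral_add) measurable
  also have "(NBINT x. indicator (cball (0::real^'n) R) x * ennreal (e2 * (N * ?c))) = ennreal (W * (e2 * (N * ?c)))"
  proof -
   have "emeasure lborel (cball (0::real^'n) R) = ennreal W"
    unfolding W_def using emeasure_bounded_finite[of "cball (0::real^'n) R"]
    by (intro emeasure_eq_ennreal_measure) auto
   then show ?thesis using V0 e2 c0 by (simp add: nn_integral_multc ennreal_mult N_def)
  qed
  finally have 1: "ennreal (M * ?c) <= (NBINT x. (NBINT z. indicator (cball 0 R) x * ennreal (\<bar>\<gamma> (x + z) - \<gamma> x\<bar> * bump q z))) + ennreal (W * (e2 * (N * ?c)))" .
  have "(NBINT x. (NBINT z. indicator (cball 0 R) x * ennreal (\<bar>\<gamma> (x + z) - \<gamma> x\<bar> * bump q z)))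
   <= (NBINT x. (NBINT z. indicator (cball 0 (R + 1)) x * ennreal (\<bar>g (x + z) - g x\<bar> * bump q z)))"
   unfolding \<gamma>_def by (rule moll_difference_le[OF g U p(1)])
  also have "... = (NBINT x. (NBINT y. indicator (cball 0 (R + 1)) x * ennreal (\<bar>g x - g y\<bar> * bump q (x - y))))" (is "_ = ?E")
   by (simp add: nn_integral_cmult nn_integral_shift_difference)
  finally have 2: "ennreal (M * ?c) <= ?E + ennreal (W * (e2 * (N * ?c)))"
   using 1 by (meson add_right_mono order_trans)
  have "W * (e2 * (N * ?c)) = (N * W / (N * W + 1)) * (e / 2 * ?c)" by (simp add: e2_def mult_ac)
  also have "... <= 1 * (e / 2 * ?c)" using NW e c0 by (intro mult_right_mono) auto
  finally have 3: "W * (e2 * (N * ?c)) <= e / 2 * ?c" by simp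
  show "ennreal (?c * ((LBINT x. g x * ?D x) - e)) <= ?E"
  proof (cases "?E = top")
   case False
   then obtain E where E: "?E = ennreal E" "0 <= E" by (cases ?E) auto
   have "0 <= W * (e2 * (N * ?c))" using V0 e2 c0 by (simp add: N_def)
   then have "M * ?c <= E + W * (e2 * (N * ?c))"
    using 2 E by (simp add: ennreal_plus[symmetric] del: ennreal_plus)
   moreover have "?c * ((LBINT x. g x * ?D x) - e) <= ?c * (M + e / 2 - e)"
    using step1 c0 by (intro mult_left_mono) auto
   ultimately have "?c * ((LBINT x. g x * ?D x) - e) <= E" using 3 by (simp add: algebra_simps)
   then show ?thesis using E by (simp add: ennreal_leI)
  qed simp
 qed
qed

text \<open>A measurable function is an almost everywhere limit of continuous ones; truncating these at \<open>\<plusminus>1\<close>,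
cutting them off and mollifying them finely keeps the bounds and the limit.\<close>

lemma C1_approximation:
 fixes S :: "'a::euclidean_space => real"
 assumes [measurable]: "Borel S" and S1: "!!p. \<bar>S p\<bar> <= 1" and S0: "!!p. norm p > R ==> S p = 0"
 obtains a :: "nat => 'a => real" and ga :: "nat => 'a => 'a" where
  "!!n p. (a n has_derivative (\<lambda>h. ga n p \<bullet> h)) (at p)" "!!n. continuous_on UNIV (ga n)"
  "!!n p. \<bar>a n p\<bar> <= 1" "!!n p. norm p > R + 2 ==> a n p = 0"
  "AE p in lborel. (\<lambda>n. a n p) \<longlonglongrightarrow> S p"
proof -
 have "S \<in> borel_measurable lebesgue" by (rule measurable_completion) simp
 then have "S measurable_on UNIV" by (intro lebesgue_measurable_imp_measurable_on) auto
 then obtain N G where N: "negligible N" and G: "!!n. continuous_on UNIV (G n)"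
   and lim: "!!x. x \<notin> N ==> (\<lambda>n. G n x) \<longlonglongrightarrow> S x"
  unfolding measurable_on_def by auto
 define cut where "cut x = max 0 (min 1 (R + 1 - norm x))" for x :: 'a
 define c where "c n x = cut x * max (- 1) (min 1 (G n x))" for n x
 have cut: "0 <= cut x" "cut x <= 1" for x by (auto simp: cut_def)
 have cc: "continuous_on UNIV (c n)" for n
  unfolding c_def cut_def by (intro continuous_intros G)
 have c1: "\<bar>c n x\<bar> <= 1" for n x
 proof -
  have "\<bar>c n x\<bar> = cut x * \<bar>max (- 1) (min 1 (G n x))\<bar>" using cut by (simp add: c_def abs_mult)
  also have "... <= 1 * 1" using cut by (intro mult_mono) auto
  finally show ?thesis by simp
 qed
 have c0: "c n x = 0" if "norm x > R + 1" for n x using that by (simp add: c_def cut_def)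
 have climit: "(\<lambda>n. c n x) \<longlonglongrightarrow> S x" if "x \<notin> N" for x
 proof -
  have "(\<lambda>n. c n x) \<longlonglongrightarrow> cut x * max (- 1) (min 1 (S x))"
   unfolding c_def using lim[OF that] by (intro tendsto_intros)
  moreover have "cut x * max (- 1) (min 1 (S x)) = S x"
  proof (cases "norm x > R")
   case False
   then have "cut x = 1" by (simp add: cut_def)
   then show ?thesis using S1[of x] by (simp add: abs_le_iff max_def min_def)
  qed (simp add: S0)
  ultimately show ?thesis by simp
 qed
 have "\<exists>q\<ge>1. \<forall>x. \<bar>moll q (c n) x - c n x\<bar> <= 1 / real (Suc n)" for n
 proof -
  have "0 < 1 / real (Suc n)" by simp
  from moll_uniform[OF cc c0[where n=n] this] show ?thesis by blast
 qed
 then have "\<forall>n. \<exists>q. 1 <= q \<and> (\<forall>x. \<bar>moll q (c n) x - c n x\<bar> <= 1 / real (Suc n))" by blast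
 from choice[OF this] obtain q where q: "!!n. 1 <= q n" "!!n x. \<bar>moll (q n) (c n) x - c n x\<bar> <= 1 / real (Suc n)"
  by blast
 have q0: "0 < q n" for n using q(1)[of n] by linarith
 have qs: "1 / sqrt (q n) <= 1" for n using q(1)[of n] by simp
 have cm: "Borel (c n)" for n using cc by (simp add: borel_measurable_continuous_onI)
 show thesis
 proof
  show "(moll (q n) (c n) has_derivative (\<lambda>h. moll_grad (q n) (c n) p \<bullet> h)) (at p)" for n p
   by (rule moll_has_derivative[OF cm c1 q0])
  show "continuous_on UNIV (moll_grad (q n) (c n))" for n
   by (rule continuous_moll_grad[OF cm c1 q0])
  show "\<bar>moll (q n) (c n) p\<bar> <= 1" for n p
   by (rule moll_bounded[OF cm c1 q0])
  show "moll (q n) (c n) p = 0" if "norm p > R + 2" for n p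
   by (rule moll_eq_0[OF q0 c0, of "R + 1"]) (use that qs[of n] in auto)
  have "AE p in lborel. p \<notin> N"
   using AE_not_in[of N lebesgue] N unfolding negligible_iff_null_sets AE_completion_iff by blast
  then show "AE p in lborel. (\<lambda>n. moll (q n) (c n) p) \<longlonglongrightarrow> S p"
  proof eventually_elim
   case (elim p)
   have "(\<lambda>n. moll (q n) (c n) p - c n p) \<longlonglongrightarrow> 0"
    by (rule Lim_null_comparison[OF always_eventually LIMSEQ_inverse_real_of_nat])
      (use q(2) in \<open>auto simp: inverse_eq_divide\<close>)
   from tendsto_add[OF this climit[OF elim]] show ?case by simp
  qed
 qed
qed

lemma integral_cbox_pair_eq:
 fixes h :: "real => 'a::euclidean_space => real"
 assumes h: "continuous_on UNIV (\<lambda>(\<theta>, z). h \<theta> z)"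
 shows "integral (cbox (0, l) (1, u)) (\<lambda>(\<theta>, z). h \<theta> z) =
   (LBINT z. indicator (cbox l u) z * (LBINT \<theta>. h \<theta> z * indicator {0..1} \<theta>))"
proof -
 let ?C = "cbox (0::real, l) (1, u)"
 have m [measurable]: "(\<lambda>(\<theta>, z). h \<theta> z) \<in> borel_measurable borel2"
  unfolding borel_prod using h by (rule borel_measurable_continuous_onI)
 have int: "integrable lborel (\<lambda>p. indicator ?C p *\<^sub>R (case p of (\<theta>, z) => h \<theta> z))"
  by (rule borel_integrable_compact) (use h in \<open>auto intro: continuous_on_subset\<close>)
 have "integral ?C (\<lambda>(\<theta>, z). h \<theta> z) = (LBINT p. indicator ?C p *\<^sub>R (case p of (\<theta>, z) => h \<theta> z))"
  using set_borel_integral_eq_integral(2)[of ?C "\<lambda>(\<theta>, z). h \<theta> z"] int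
  by (simp add: set_integrable_def set_lebesgue_integral_def)
 also have "... = (LINT p|lborel2. (case p of (\<theta>, z) => indicator (cbox l u) z * (h \<theta> z * indicator {0..1} \<theta>)))"
  unfolding lborel_prod
  by (intro Bochner_Integration.integral_cong) (auto simp: indicator_def cbox_Pair_eq split: prod.splits)
 also have "... = (LBINT z. LBINT \<theta>. indicator (cbox l u) z * (h \<theta> z * indicator {0..1} \<theta>))"
 proof (rule lborel_pair.integral_snd[symmetric])
  have "(\<lambda>p. indicator ?C p *\<^sub>R (case p of (\<theta>, z) => h \<theta> z)) = (\<lambda>(\<theta>, z). indicator (cbox l u) z * (h \<theta> z * indicator {0..1} \<theta>))"
   by (auto simp: indicator_def cbox_Pair_eq split: prod.splits)
  with int show "integrable lborel2 (\<lambda>(\<theta>, z). indicator (cbox l u) z * (h \<theta> z * indicator {0..1} \<theta>))"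
   by (simp add: lborel_prod)
 qed
 finally show ?thesis by simp
qed

lemma le_TV:
 assumes "C1_c UNIV \<psi>" "!!x. norm (\<psi> x) <= 1" and [measurable]: "Borel g"
 shows "ennreal (LBINT x. g x * divergence \<psi> x) <= TV g"
proof -
 have [measurable]: "divergence \<psi> \<in> borel_measurable borel"
  using continuous_divergence[OF assms(1)] by (simp add: borel_measurable_continuous_onI)
 have "(LBINT x. g x * divergence \<psi> x) = (LINT x|lebesgue. g x * divergence \<psi> x)"
  by (rule integral_completion[symmetric]) measurable
 then show ?thesis unfolding TV_def using assms by (auto intro!: SUP_upper)
qed

text \<open>\<open>\<Psi>(x) = \<integral> bump q z \<integral>\<^sub>0\<^sup>1 a(x - \<theta> z, z) z d\<theta> dz\<close>. The divergence of the inner integrand is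
\<open>- d/d\<theta> a(x - \<theta> z, z)\<close>, which integrates to \<open>a(x, z) - a(x - z, z)\<close>; and since \<open>|a| \<le> 1\<close> each
component \<open>\<Psi>(x) \<bullet> e\<close> is at most the moment of the kernel in the direction \<open>e\<close>.\<close>

lemma transport_field:
 fixes a :: "(real ^ 'n) \<times> (real ^ 'n) => real"
 assumes der: "!!p. (a has_derivative (\<lambda>h. ga p \<bullet> h)) (at p)" and gc: "continuous_on UNIV ga"
  and a1: "!!p. \<bar>a p\<bar> <= 1" and a0: "!!p. norm p > R ==> a p = 0" and q: "1 <= q" and e0: "norm (e0 :: real ^ 'n) = 1"
 obtains \<Psi> where "C1_c UNIV \<Psi>" "!!x. norm (\<Psi> x) <= dir_moment q e0"
  "!!x. divergence \<Psi> x = (LBINT z. bump q z * (a (x, z) - a (x - z, z)))"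
proof -
 have q0: "0 < q" using q by simp
 have qs: "1 / sqrt q <= 1" using q by simp
 have ac: "continuous_on UNIV a"
  using der by (rule has_derivative_imp_continuous_on)
 note [continuous_intros] = continuous_on_compose2[OF ac] continuous_on_compose2[OF gc]
 define one where "one = (1 :: real ^ 'n)"
 have in_box: "z \<in> cbox (- one) one" if "norm z <= 1" for z
  using that component_le_norm_cart[of z] by (auto simp: mem_box_cart one_def abs_le_iff intro: order_trans)
    (smt (verit) component_le_norm_cart)
 let ?C = "cbox (0 :: real, - one) (1, one)"
 define K where "K x = (\<lambda>(\<theta>, z). (a (x - \<theta> *\<^sub>R z, z) * bump q z) *\<^sub>R z)" for x
 define K' where "K' x h = (\<lambda>(\<theta>, z). ((fst (ga (x - \<theta> *\<^sub>R z, z)) \<bullet> h) * bump q z) *\<^sub>R z)" for x h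
 define KB where "KB x p = Blinfun (\<lambda>h. K' x h p)" for x p
 define \<Psi> where "\<Psi> x = integral ?C (K x)" for x
 define D where "D x h = integral ?C (K' x h)" for x h
 have "bounded_linear (\<lambda>h. K' x h p)" for x p
  unfolding K'_def by (cases p) (auto intro!: bounded_linear_scaleR_const bounded_linear_mult_const bounded_linear_inner_right)
 then have KB: "blinfun_apply (KB x p) h = K' x h p" for x p h
  unfolding KB_def by (simp add: bounded_linear_Blinfun_apply)
 have contK: "continuous_on S (K x)" for S x
  unfolding K_def split_beta by (intro continuous_intros) auto
 have contK': "continuous_on S (\<lambda>(x, p). K' x h p)" for S h
  unfolding K'_def split_beta by (intro continuous_intros) auto
 have contK'2: "continuous_on S (K' x h)" for S x h
  unfolding K'_def split_beta by (intro continuous_intros) auto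
 have contKB: "continuous_on S (\<lambda>(x, p). KB x p)" for S
  by (rule continuous_on_blinfun_componentwise) (use contK' in \<open>simp add: KB split_beta\<close>)
 have Kder: "((\<lambda>x. K x p) has_derivative blinfun_apply (KB x p)) (at x)" for x p
 proof -
  obtain \<theta> z where p: "p = (\<theta>, z)" by (cases p)
  have "((\<lambda>x. a (x - \<theta> *\<^sub>R z, z)) has_derivative (\<lambda>h. ga (x - \<theta> *\<^sub>R z, z) \<bullet> (h, 0))) (at x)"
   by (rule has_derivative_compose[OF _ der]) (auto intro!: derivative_eq_intros)
  then have "((\<lambda>x. (a (x - \<theta> *\<^sub>R z, z) * bump q z) *\<^sub>R z) has_derivative (\<lambda>h. ((ga (x - \<theta> *\<^sub>R z, z) \<bullet> (h, 0)) * bump q z) *\<^sub>R z)) (at x)"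
   by (auto intro!: derivative_eq_intros)
  then show ?thesis by (simp add: KB[abs_def] K_def K'_def p inner_Pair_0 has_derivative_eq_rhs inner_prod_def fun_eq_iff)
 qed
 have \<Psi>der: "(\<Psi> has_derivative D x) (at x)" for x
 proof -
  have "(\<Psi> has_derivative blinfun_apply (integral ?C (KB x))) (at x)"
   unfolding \<Psi>_def
   by (rule leibniz_rule[where U=UNIV and fx=KB]) (auto intro!: Kder contKB integrable_continuous contK)
  moreover have "blinfun_apply (integral ?C (KB x)) h = D x h" for h
  proof -
   have "KB x integrable_on ?C"
   proof (rule integrable_continuous)
    have "continuous_on ?C (\<lambda>p. (x, p))" by (intro continuous_intros)
    from continuous_on_compose2[OF contKB[of UNIV] this] show "continuous_on ?C (KB x)" by simp
   qed
   from integral_linear[OF this, of "\<lambda>L. blinfun_apply L h"]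
   show ?thesis by (simp add: o_def KB D_def blinfun.bounded_linear_left)
  qed
  then have "blinfun_apply (integral ?C (KB x)) = D x" by blast
  ultimately show ?thesis by simp
 qed
 have K0: "K x p = 0" if "norm x > R + 1" "p \<in> ?C" for x p
 proof -
  obtain \<theta> z where p: "p = (\<theta>, z)" by (cases p)
  have th: "0 <= \<theta>" "\<theta> <= 1" using that by (auto simp: p cbox_Pair_eq)
  show ?thesis
  proof (cases "norm z <= 1")
   case True
   have "norm (\<theta> *\<^sub>R z) <= 1" using th True by (simp add: mult_le_one)
   then have "norm (x - \<theta> *\<^sub>R z) > R" using that(1) norm_triangle_ineq2[of x "\<theta> *\<^sub>R z"] by linarith
   then have "norm (x - \<theta> *\<^sub>R z, z) > R" using norm_fst_le[of "x - \<theta> *\<^sub>R z" z] by linarith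
   then show ?thesis by (simp add: K_def p a0)
  next
   case False
   then have "norm z > 1 / sqrt q" using qs by linarith
   then show ?thesis using q0 by (simp add: K_def p bump_zero_outside)
  qed
 qed
 have C1: "C1_c UNIV \<Psi>"
 proof (rule C1_cI[OF \<Psi>der])
  show "continuous_on UNIV (\<lambda>p. D p h)" for h
   unfolding D_def by (rule integral_continuous_on_param) (rule contK')
  show "\<Psi> p = 0" if "p \<notin> cball 0 (R + 1)" for p
   unfolding \<Psi>_def using that by (subst integral_cong[of _ _ "\<lambda>_. 0"]) (auto simp: K0)
 qed auto
 have bumpbox: "indicator (cbox (- one) one) z * bump q z = bump q z" for z :: "real ^ 'n"
 proof (cases "norm z <= 1")
  case False
  then have "norm z > 1 / sqrt q" using qs by linarith
  then show ?thesis using q0 by (simp add: bump_zero_outside)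
 qed (use in_box in auto)
 have bound: "norm (\<Psi> x) <= dir_moment q e0" for x
 proof -
  define e where "e = \<Psi> x"
  have J: "integral ?C (\<lambda>(\<theta>, z). \<bar>z \<bullet> e\<bar> * bump q z) = dir_moment q e"
  proof -
   have "integral ?C (\<lambda>(\<theta>, z). \<bar>z \<bullet> e\<bar> * bump q z) = (LBINT z. indicator (cbox (- one) one) z * (LBINT \<theta>. (\<bar>z \<bullet> e\<bar> * bump q z) * indicator {0..1::real} \<theta>))"
    by (rule integral_cbox_pair_eq) (auto intro!: continuous_intros simp: split_beta)
   also have "... = (LBINT z. \<bar>z \<bullet> e\<bar> * (indicator (cbox (- one) one) z * bump q z))"
    by (intro Bochner_Integration.integral_cong) (auto simp: mult_ac)
   finally show ?thesis unfolding bumpbox dir_moment_def .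
  qed
  have "\<Psi> x \<bullet> e = integral ?C (\<lambda>p. K x p \<bullet> e)"
   using integral_linear[OF integrable_continuous[OF contK], of "\<lambda>v. v \<bullet> e" "(0, - one)" "(1, one)" x]
   by (simp add: \<Psi>_def o_def bounded_linear_inner_left)
  also have "... <= integral ?C (\<lambda>(\<theta>, z). \<bar>z \<bullet> e\<bar> * bump q z)"
  proof (rule integral_le)
   show "(\<lambda>p. K x p \<bullet> e) integrable_on ?C"
    by (intro integrable_continuous continuous_intros contK)
   show "(\<lambda>(\<theta>, z). \<bar>z \<bullet> e\<bar> * bump q z) integrable_on ?C"
    unfolding split_beta by (intro integrable_continuous continuous_intros)
   fix p assume "p \<in> ?C"
   obtain \<theta> z where p: "p = (\<theta>, z)" by (cases p)
   have "K x p \<bullet> e = a (x - \<theta> *\<^sub>R z, z) * ((z \<bullet> e) * bump q z)" by (simp add: K_def p)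
   also have "... <= \<bar>a (x - \<theta> *\<^sub>R z, z)\<bar> * (\<bar>z \<bullet> e\<bar> * bump q z)"
    using abs_ge_self[of "a (x - \<theta> *\<^sub>R z, z) * ((z \<bullet> e) * bump q z)"] by (simp add: abs_mult)
   also have "... <= 1 * (\<bar>z \<bullet> e\<bar> * bump q z)" by (rule mult_right_mono[OF a1]) simp
   finally show "K x p \<bullet> e <= (case p of (\<theta>, z) => \<bar>z \<bullet> e\<bar> * bump q z)" by (simp add: p)
  qed
  also have "... = norm e * dir_moment q e0" unfolding J by (rule dir_moment_eq_norm[OF e0])
  finally have "norm e * norm e <= norm e * dir_moment q e0"
   by (simp add: e_def dot_square_norm power2_eq_square)
  then show ?thesis by (cases "norm e = 0") (auto simp: e_def mult_le_cancel_left)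
 qed
 have div: "divergence \<Psi> x = (LBINT z. bump q z * (a (x, z) - a (x - z, z)))" for x
 proof -
  have "divergence \<Psi> x = (\<Sum>i\<in>UNIV. D x (axis i 1) $ i)"
   by (simp add: divergence_def deriv_at_eq[OF \<Psi>der])
  also have "... = (\<Sum>i\<in>UNIV. integral ?C (\<lambda>p. K' x (axis i 1) p $ i))"
   using integral_linear[OF integrable_continuous[OF contK'2], of "\<lambda>v. v $ i" "(0, - one)" "(1, one)" x for i]
   by (simp add: D_def o_def bounded_linear_vec_nth)
  also have "... = integral ?C (\<lambda>p. \<Sum>i\<in>UNIV. K' x (axis i 1) p $ i)"
   by (rule integral_sum[symmetric]) (auto intro!: integrable_continuous continuous_intros contK'2)
  also have "(\<lambda>p. \<Sum>i\<in>UNIV. K' x (axis i 1) p $ i) = (\<lambda>(\<theta>, z). bump q z * (fst (ga (x - \<theta> *\<^sub>R z, z)) \<bullet> z))"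
  proof (rule ext)
   fix p :: "real \<times> (real ^ 'n)"
   obtain \<theta> z where p: "p = (\<theta>, z)" by (cases p)
   have "(\<Sum>i\<in>UNIV. K' x (axis i 1) p $ i) = (\<Sum>i\<in>UNIV. bump q z * (fst (ga (x - \<theta> *\<^sub>R z, z)) $ i * z $ i))"
    by (simp add: K'_def p inner_axis mult_ac)
   then show "(\<Sum>i\<in>UNIV. K' x (axis i 1) p $ i) = (case p of (\<theta>, z) => bump q z * (fst (ga (x - \<theta> *\<^sub>R z, z)) \<bullet> z))"
    by (simp add: p inner_vec_def sum_distrib_left)
  qed
  also have "integral ?C ... = (LBINT z. indicator (cbox (- one) one) z * (LBINT \<theta>. bump q z * (fst (ga (x - \<theta> *\<^sub>R z, z)) \<bullet> z) * indicator {0..1} \<theta>))"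
   by (rule integral_cbox_pair_eq) (auto intro!: continuous_intros simp: split_beta)
  also have "... = (LBINT z. (indicator (cbox (- one) one) z * bump q z) * (a (x, z) - a (x - z, z)))"
  proof (rule Bochner_Integration.integral_cong[OF refl])
   fix z :: "real ^ 'n"
   have d: "((\<lambda>\<theta>. - a (x - \<theta> *\<^sub>R z, z)) has_real_derivative (fst (ga (x - \<theta> *\<^sub>R z, z)) \<bullet> z)) (at \<theta>)" for \<theta>
   proof -
    have "((\<lambda>\<theta>. a (x - \<theta> *\<^sub>R z, z)) has_derivative (\<lambda>h. ga (x - \<theta> *\<^sub>R z, z) \<bullet> (- (h *\<^sub>R z), 0))) (at \<theta>)"
     by (rule has_derivative_compose[OF _ der]) (auto intro!: derivative_eq_intros)
    then have "((\<lambda>\<theta>. - a (x - \<theta> *\<^sub>R z, z)) has_derivative (\<lambda>h. - (ga (x - \<theta> *\<^sub>R z, z) \<bullet> (- (h *\<^sub>R z), 0)))) (at \<theta>)"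
     by (rule has_derivative_minus)
    then show ?thesis by (rule has_derivative_imp_has_field_derivative) (simp add: inner_prod_def)
   qed
   have "(LBINT \<theta>. (fst (ga (x - \<theta> *\<^sub>R z, z)) \<bullet> z) * indicator {0..1} \<theta>) = a (x, z) - a (x - z, z)"
   proof -
    have "continuous_on UNIV (\<lambda>\<theta>. fst (ga (x - \<theta> *\<^sub>R z, z)) \<bullet> z)" by (intro continuous_intros) auto
    then have "isCont (\<lambda>\<theta>. fst (ga (x - \<theta> *\<^sub>R z, z)) \<bullet> z) \<theta>" for \<theta>
     by (simp add: continuous_on_eq_continuous_at)
    then show ?thesis using integral_FTC_Icc_real[OF zero_le_one d] by simp
   qed
   then show "indicator (cbox (- one) one) z * (LBINT \<theta>. bump q z * (fst (ga (x - \<theta> *\<^sub>R z, z)) \<bullet> z) * indicator {0..1} \<theta>) = (indicator (cbox (- one) one) z * bump q z) * (a (x, z) - a (x - z, z))"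
    by (simp add: mult.assoc)
  qed
  finally show ?thesis unfolding bumpbox .
 qed
 show thesis by (rule that[OF C1 bound div])
qed

text \<open>Duality: for \<open>|a| \<le> 1\<close> the integral of \<open>(g(x) - g(x + z)) bump q z a(x, z)\<close> equals \<open>\<integral> g div \<Psi>\<close> with
the field of \<open>transport_field\<close>, so it is at most the moment times \<open>TV g\<close>. Letting \<open>a\<close> tend to the sign
of \<open>g(x) - g(x + z)\<close> gives the absolute value.\<close>

lemma TV_upper:
 fixes g :: "real ^ 'n => real"
 assumes g [measurable]: "Borel g" and U: "!!x. \<bar>g x\<bar> <= U"
  and q: "1 <= q" and e0: "norm (e0 :: real ^ 'n) = 1" and R: "0 <= R"
 shows "(NBINT x. (NBINT y. indicator (cball 0 R) x * ennreal (\<bar>g x - g y\<bar> * bump q (x - y))))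
   <= ennreal (dir_moment q e0) * TV g"
proof -
 let ?c = "dir_moment q e0"
 have q0: "0 < q" using q by simp
 have qs: "1 / sqrt q <= 1" using q by simp
 have c0: "0 < ?c" by (rule dir_moment_pos[OF q0 e0])
 have U0: "0 <= U" using order_trans[OF abs_ge_zero U] .
 have [measurable]: "cball (0::real ^ 'n) r \<in> sets borel" for r by simp
 have bump0: "bump q z = 0" if "norm z > 1" for z :: "real ^ 'n"
  using that qs by (intro bump_zero_outside q0) linarith
 define S where "S = (\<lambda>(x, z). indicator (cball (0::real ^ 'n) R) x * indicator (cball (0::real ^ 'n) 1) z * sgn (g x - g (x + z)))"
 have Sm [measurable]: "Borel S" unfolding S_def borel_prod[symmetric] by measurable
 have Sm' [measurable]: "S \<in> borel_measurable borel2" using Sm by (simp only: borel_prod)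
 have S1: "\<bar>S p\<bar> <= 1" for p by (auto simp: S_def split_beta indicator_def sgn_real_def)
 have S0: "S p = 0" if "norm p > R + 1" for p
 proof -
  obtain x z where p: "p = (x, z)" by (cases p)
  have "norm x > R \<or> norm z > 1" using that norm_Pair_le[of x z] by (simp add: p) linarith
  then show ?thesis by (auto simp: S_def p)
 qed
 obtain a ga where der: "!!n p. (a n has_derivative (\<lambda>h. ga n p \<bullet> h)) (at p)" and gc: "!!n. continuous_on UNIV (ga n)"
  and a1: "!!n p. \<bar>a n p\<bar> <= 1" and a0: "!!n p. norm p > R + 1 + 2 ==> a n p = 0"
  and alim: "AE p in lborel. (\<lambda>n. a n p) \<longlonglongrightarrow> S p"
  by (rule C1_approximation[where R="R + 1", OF Sm S1 S0]) (assumption, rule that)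
 have ac: "continuous_on UNIV (a n)" for n
  using der by (rule has_derivative_imp_continuous_on)
 have am [measurable]: "a n \<in> borel_measurable borel2" for n
  using ac unfolding borel_prod by (simp add: borel_measurable_continuous_onI)
 define H where "H = (\<lambda>(x, z). (g x - g (x + z)) * bump q z)"
 have [measurable]: "H \<in> borel_measurable borel2" unfolding H_def by measurable
 have Hb: "\<bar>H p\<bar> <= 2 * U" for p
 proof -
  obtain x z where p: "p = (x, z)" by (cases p)
  have "\<bar>g x - g (x + z)\<bar> * bump q z <= (2 * U) * 1"
   using U[of x] U[of "x + z"] bump_le_1[of q z] q0 by (intro mult_mono) auto
  then show ?thesis by (simp add: H_def p abs_mult)
 qed
 have le: "(LBINT p. H p * a n p) <= ?c * t" if t: "TV g = ennreal t" "0 <= t" for n t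
 proof -
  obtain \<Psi> where \<Psi>: "C1_c UNIV \<Psi>" "!!x. norm (\<Psi> x) <= ?c"
   "!!x. divergence \<Psi> x = (LBINT z. bump q z * (a n (x, z) - a n (x - z, z)))"
   by (rule transport_field[where R="R + 1 + 2", OF der gc a1 a0 q e0]) (assumption, rule that)
  define \<psi> where "\<psi> x = (1 / ?c) *\<^sub>R \<Psi> x" for x
  have \<psi>d: "(\<psi> has_derivative (\<lambda>h. (1 / ?c) *\<^sub>R blinfun_apply (deriv_at \<Psi> x) h)) (at x)" for x
   unfolding \<psi>_def by (intro has_derivative_scaleR_right C1_cD(1)[OF \<Psi>(1)])
  have \<psi>c: "C1_c UNIV \<psi>"
  proof -
   have cl: "closure {p. \<psi> p ~= 0} = closure {p. \<Psi> p ~= 0}" using c0 by (simp add: \<psi>_def)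
   show ?thesis
   proof (rule C1_cI[OF \<psi>d])
    show "continuous_on UNIV (\<lambda>p. (1 / ?c) *\<^sub>R blinfun_apply (deriv_at \<Psi> p) h)" for h
     by (intro continuous_intros C1_cD(2)[OF \<Psi>(1)])
    show "compact (closure {p. \<Psi> p ~= 0})" using \<Psi>(1) by (simp add: C1_c_def)
    show "\<psi> p = 0" if "p \<notin> closure {p. \<Psi> p ~= 0}" for p
     using that closure_subset[of "{p. \<Psi> p ~= 0}"] by (auto simp: \<psi>_def)
   qed auto
  qed
  have \<psi>1: "norm (\<psi> x) <= 1" for x using \<Psi>(2)[of x] c0 by (simp add: \<psi>_def divide_le_eq)
  have \<psi>div: "divergence \<psi> x = divergence \<Psi> x / ?c" for x
   by (simp add: divergence_def deriv_at_eq[OF \<psi>d] sum_divide_distrib)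
  have "ennreal (LBINT x. g x * divergence \<psi> x) <= ennreal t"
   using le_TV[OF \<psi>c \<psi>1 g] t by simp
  then have "(LBINT x. g x * divergence \<psi> x) <= t" using t by (simp add: ennreal_le_iff)
  then have 1: "(LBINT x. g x * divergence \<Psi> x) <= ?c * t"
   using c0 by (simp add: \<psi>div divide_le_eq mult.commute)
  have int: "integrable lborel (\<lambda>(x, z). w x z * bump q z * b x z)"
   if [measurable]: "(\<lambda>(x, z). w x z) \<in> borel_measurable borel2" "(\<lambda>(x, z). b x z) \<in> borel_measurable borel2"
    and w: "!!x z. \<bar>w x z\<bar> <= U" and b: "!!x z. \<bar>b x z\<bar> <= 1" and b0: "!!x z. norm z <= 1 ==> norm (x, z) > R + 4 ==> b x z = 0"
   for w b :: "real ^ 'n => real ^ 'n => real"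
  proof (rule integrable_bounded_support[where B=U and R="R + 4"])
   show "Borel (\<lambda>(x, z). w x z * bump q z * b x z)"
    unfolding borel_prod[symmetric] by measurable
   fix p :: "(real ^ 'n) \<times> (real ^ 'n)"
   obtain x z where p: "p = (x, z)" by (cases p)
   have "\<bar>w x z\<bar> * bump q z * \<bar>b x z\<bar> <= U * 1 * 1"
    using w[of x z] bump_le_1[of q z] q0 b[of x z] U0 by (intro mult_mono) auto
   then show "norm (case p of (x, z) => w x z * bump q z * b x z) <= U" by (simp add: p abs_mult)
   show "(case p of (x, z) => w x z * bump q z * b x z) = 0" if "norm p > R + 4"
    using that b0[of z x] bump0[of z] by (cases "norm z > 1") (auto simp: p)
  qed
  have i1: "integrable lborel (\<lambda>(x, z). g x * bump q z * a n (x, z))"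
   by (rule int) (use U a1 a0 in auto)
  have i2: "integrable lborel (\<lambda>(x, z). g x * bump q z * a n (x - z, z))"
  proof (rule int)
   fix x z :: "real ^ 'n" assume z: "norm z <= 1" "norm (x, z) > R + 4"
   have "norm (x, z) <= norm (x - z, z) + norm (z, 0 :: real ^ 'n)"
    using norm_triangle_ineq[of "(x - z, z)" "(z, 0)"] by simp
   then show "a n (x - z, z) = 0" using z by (intro a0) (simp add: norm_Pair)
  qed (use U a1 in auto)
  have i3: "integrable lborel (\<lambda>(x, z). g (x + z) * bump q z * a n (x, z))"
   by (rule int) (use U a1 a0 in auto)
  have "(LBINT p. H p * a n p) = (LBINT p. (case p of (x, z) => g x * bump q z * a n (x, z)) - (case p of (x, z) => g (x + z) * bump q z * a n (x, z)))"
   by (intro Bochner_Integration.integral_cong) (auto simp: H_def algebra_simps)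
  also have "... = (LBINT p. (case p of (x, z) => g x * bump q z * a n (x, z))) - (LBINT p. (case p of (x, z) => g (x + z) * bump q z * a n (x, z)))"
   by (rule Bochner_Integration.integral_diff[OF i1 i3])
  also have "(LBINT p. (case p of (x, z) => g (x + z) * bump q z * a n (x, z))) = (LBINT z. (LBINT x. g (x + z) * bump q z * a n (x, z)))"
   using lborel_pair.integral_snd[of "\<lambda>x z. g (x + z) * bump q z * a n (x, z)"] i3 by (simp add: lborel_prod)
  also have "... = (LBINT z. (LBINT x. g x * bump q z * a n (x - z, z)))"
  proof (rule Bochner_Integration.integral_cong[OF refl])
   fix z
   show "(LBINT x. g (x + z) * bump q z * a n (x, z)) = (LBINT x. g x * bump q z * a n (x - z, z))"
    using lborel_integral_translation[of "\<lambda>x. g x * bump q z * a n (x - z, z)" z] by simp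
  qed
  also have "... = (LBINT p. (case p of (x, z) => g x * bump q z * a n (x - z, z)))"
   using lborel_pair.integral_snd[of "\<lambda>x z. g x * bump q z * a n (x - z, z)"] i2 by (simp add: lborel_prod)
  also have "(LBINT p. (case p of (x, z) => g x * bump q z * a n (x, z))) - (LBINT p. (case p of (x, z) => g x * bump q z * a n (x - z, z)))
    = (LBINT p. (case p of (x, z) => g x * bump q z * a n (x, z)) - (case p of (x, z) => g x * bump q z * a n (x - z, z)))"
   by (rule Bochner_Integration.integral_diff[OF i1 i2, symmetric])
  also have "... = (LBINT p. (case p of (x, z) => g x * (bump q z * (a n (x, z) - a n (x - z, z)))))"
   by (intro Bochner_Integration.integral_cong) (auto simp: algebra_simps)
  also have "... = (LBINT x. LBINT z. g x * (bump q z * (a n (x, z) - a n (x - z, z))))"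
  proof -
   have "integrable lborel2 (\<lambda>(x, z). g x * (bump q z * (a n (x, z) - a n (x - z, z))))"
   proof -
    have "(\<lambda>(x, z). g x * (bump q z * (a n (x, z) - a n (x - z, z))))
     = (\<lambda>p. (case p of (x, z) => g x * bump q z * a n (x, z)) - (case p of (x, z) => g x * bump q z * a n (x - z, z)))"
     by (auto simp: fun_eq_iff algebra_simps)
    then show ?thesis using Bochner_Integration.integrable_diff[OF i1 i2] by (simp only: lborel_prod)
   qed
   from lborel_pair.integral_fst[OF this] show ?thesis by (simp add: lborel_prod)
  qed
  also have "... = (LBINT x. g x * divergence \<Psi> x)" by (simp add: \<Psi>(3))
  finally show ?thesis using 1 by simp
 qed
 show ?thesis
 proof (cases "TV g = top")
  case True
  then show ?thesis using c0 by (simp add: ennreal_mult_top)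
 next
  case False
  then obtain t where t: "TV g = ennreal t" "0 <= t" by (cases "TV g") auto
  have lim: "(\<lambda>n. LBINT p. H p * a n p) \<longlonglongrightarrow> (LBINT p. H p * S p)"
  proof (rule integral_dominated_convergence[where w="\<lambda>p. 2 * U * indicator (cball 0 (R + 3)) p"])
   show "integrable lborel (\<lambda>p. 2 * U * indicator (cball 0 (R + 3)) p :: real)"
    by (rule integrable_bounded_support[where B="2 * U" and R="R + 3"]) (use U0 in \<open>auto simp: indicator_def\<close>)
   show "AE p in lborel. norm (H p * a n p) <= 2 * U * indicator (cball 0 (R + 3)) p" for n
   proof (rule AE_I2)
    fix p
    have "\<bar>H p\<bar> * \<bar>a n p\<bar> <= 2 * U * 1" by (intro mult_mono Hb a1) (use U0 in auto)
    then show "norm (H p * a n p) <= 2 * U * indicator (cball 0 (R + 3)) p"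
     using a0[of p n] by (auto simp: indicator_def abs_mult)
   qed
   show "AE p in lborel. (\<lambda>n. H p * a n p) \<longlonglongrightarrow> H p * S p"
    using alim by eventually_elim (rule tendsto_mult_left)
  qed (auto simp flip: borel_prod)
  have le2: "(LBINT p. H p * S p) <= ?c * t"
   by (rule LIMSEQ_le_const2[OF lim]) (use le[OF t] in auto)
  have HS: "H p * S p = (case p of (x, z) => indicator (cball 0 R) x * (\<bar>g (x + z) - g x\<bar> * bump q z))" for p
  proof -
   obtain x z where p: "p = (x, z)" by (cases p)
   have "(g x - g (x + z)) * sgn (g x - g (x + z)) = \<bar>g (x + z) - g x\<bar>" by (simp add: sgn_if)
   then show ?thesis using bump0[of z] by (cases "norm z > 1") (auto simp: H_def S_def p indicator_def mult_ac)
  qed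
  have intHS: "integrable lborel (\<lambda>p. H p * S p)"
  proof (rule integrable_bounded_support[where B="2 * U" and R="R + 1"])
   show "norm (H p * S p) <= 2 * U" for p
    using mult_mono[OF Hb[of p] S1[of p]] U0 by (simp add: abs_mult)
   show "Borel (\<lambda>p. H p * S p)"
    unfolding borel_prod[symmetric] by measurable
  qed (simp add: S0)
  have "(NBINT x. (NBINT y. indicator (cball 0 R) x * ennreal (\<bar>g x - g y\<bar> * bump q (x - y))))
    = (NBINT x. (NBINT z. indicator (cball 0 R) x * ennreal (\<bar>g (x + z) - g x\<bar> * bump q z)))"
   by (simp add: nn_integral_cmult nn_integral_shift_difference)
  also have "... = (NBINT x. (NBINT z. ennreal (H (x, z) * S (x, z))))"
   by (intro nn_integral_cong) (auto simp: HS indicator_def)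
  also have "... = (\<integral>\<^sup>+p. ennreal (H p * S p) \<partial>lborel2)"
   by (rule lborel.nn_integral_fst) measurable
  also have "... = ennreal (LBINT p. H p * S p)"
   unfolding lborel_prod using intHS by (rule nn_integral_eq_integral) (auto simp: HS)
  also have "... <= ennreal (?c * t)" by (rule ennreal_leI[OF le2])
  also have "... = ennreal ?c * TV g" using t c0 by (simp add: ennreal_mult)
  finally show ?thesis .
 qed
qed

section \<open>Doubling of the variables in Kruzkov's inequality\<close>

text \<open>A \<open>C\<^sup>1\<close> probability density on \<open>(0, \<eta>)\<close>. It is one-sided, so that the doubled time \<open>s\<close> approaches
\<open>t\<close> from the right, the side from which the solution is continuous.\<close>

definition delta :: "real => real => real" where
 "delta \<eta> r = pos_sq (r * (\<eta> - r)) / (LBINT s. pos_sq (s * (\<eta> - s)))"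

definition delta' :: "real => real => real" where
 "delta' \<eta> r = 2 * max 0 (r * (\<eta> - r)) * (\<eta> - 2 * r) / (LBINT s. pos_sq (s * (\<eta> - s)))"

lemma delta_zero: "0 < \<eta> ==> r <= 0 \<or> \<eta> <= r ==> delta \<eta> r = 0" "0 < \<eta> ==> r <= 0 \<or> \<eta> <= r ==> delta' \<eta> r = 0"
proof -
 assume "0 < \<eta>" "r <= 0 \<or> \<eta> <= r"
 then have "r * (\<eta> - r) <= 0" by (auto simp: mult_le_0_iff)
 then show "delta \<eta> r = 0" "delta' \<eta> r = 0" by (auto simp: delta_def delta'_def max_def)
qed

lemma delta_DERIV: "(delta \<eta> has_real_derivative delta' \<eta> r) (at r)"
 unfolding delta_def[abs_def] delta'_def divide_inverse
 by (auto intro!: derivative_eq_intros simp: algebra_simps)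

lemma continuous_on_delta: "continuous_on S (delta \<eta>)" "continuous_on S (delta' \<eta>)"
 unfolding delta_def[abs_def] delta'_def[abs_def] divide_inverse by (auto intro!: continuous_intros)

lemma measurable_delta [measurable]: "delta \<eta> \<in> borel_measurable borel" "delta' \<eta> \<in> borel_measurable borel"
 using continuous_on_delta by (auto intro: borel_measurable_continuous_onI)

lemma delta_integral:
 assumes "0 < \<eta>"
 shows "0 <= delta \<eta> r" "integrable lborel (delta \<eta>)" "(LBINT r. delta \<eta> r) = 1"
proof -
 let ?g = "\<lambda>s. pos_sq (s * (\<eta> - s))"
 have gc: "continuous_on UNIV ?g" by (intro continuous_intros)
 have g0: "?g s = 0" if "norm s > \<eta>" for s
 proof -
  have "s * (\<eta> - s) <= 0" using that assms by (auto simp: mult_le_0_iff)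
  then show ?thesis by simp
 qed
 have gi: "integrable lborel ?g"
 proof -
  obtain B where "!!s. norm (?g s) <= B" using continuous_bounded_support[OF gc g0] by blast
  then show ?thesis using gc g0 by (intro integrable_bounded_support) (auto intro: borel_measurable_continuous_onI)
 qed
 have "0 < ?g (\<eta> / 2)" using assms by (simp add: pos_sq_def)
 then have Z: "0 < (LBINT s. ?g s)" by (rule integral_pos_of_continuous[rotated 3]) (auto intro: gc gi)
 show "0 <= delta \<eta> r" using Z by (simp add: delta_def)
 show "integrable lborel (delta \<eta>)" unfolding delta_def[abs_def] using gi by simp
 show "(LBINT r. delta \<eta> r) = 1" unfolding delta_def using Z by simp
qed

lemma delta_bounded:
 assumes "0 < \<eta>"
 obtains M where "!!r. \<bar>delta \<eta> r\<bar> <= M" "!!r. \<bar>delta' \<eta> r\<bar> <= M" "0 <= M"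
proof -
 have 0: "delta \<eta> r = 0" "delta' \<eta> r = 0" if "norm r > \<eta>" for r
  using that assms by (auto intro!: delta_zero)
 obtain A where A: "!!r. norm (delta \<eta> r) <= A" "0 <= A" using continuous_bounded_support[OF continuous_on_delta(1) 0(1)] by blast
 obtain B where B: "!!r. norm (delta' \<eta> r) <= B" using continuous_bounded_support[OF continuous_on_delta(2) 0(2)] by blast
 show thesis
  by (rule that[of "max A B"]) (use A B in \<open>auto simp: le_max_iff_disj\<close>)
qed

lemma grad_eq:
 assumes "(g has_derivative (\<lambda>h. w \<bullet> h)) (at x)"
 shows "grad g x = w"
 unfolding grad_def by (simp add: deriv_at_eq[OF assms] inner_axis vec_eq_iff)

lemma integrable_bounded_support_pair:
 fixes h :: "'a::euclidean_space \<times> 'b::euclidean_space => real"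
 assumes "h \<in> borel_measurable borel2" "!!x y. \<bar>h (x, y)\<bar> <= B" "!!x y. \<not> (norm x <= R \<and> norm y <= R') ==> h (x, y) = 0"
 shows "integrable lborel2 h"
 unfolding lborel_prod
proof (rule integrable_bounded_support)
 show "Borel h" using assms(1) by (simp add: borel_prod)
 show "norm (h p) <= B" for p using assms(2) by (cases p) auto
 show "h p = 0" if "norm p > max 0 R + max 0 R'" for p
 proof -
  obtain x y where p: "p = (x, y)" by (cases p)
  have "norm p <= norm x + norm y" unfolding p by (rule norm_Pair_le)
  then have "\<not> (norm x <= R \<and> norm y <= R')" using that by linarith
  then show ?thesis using assms(3) p by blast
 qed
qed

lemma integrable_bounded_pair:
 fixes h :: "'a::euclidean_space \<times> 'b::euclidean_space => real"
 assumes "bounded A" "bounded B" and h: "h \<in> borel_measurable borel2" and M: "!!x y. \<bar>h (x, y)\<bar> <= M"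
  and 0: "!!x y. \<not> (x \<in> A \<and> y \<in> B) ==> h (x, y) = 0"
 shows "integrable lborel2 h"
proof -
 obtain R R' where "!!x. x \<in> A ==> norm x <= R" "!!y. y \<in> B ==> norm y <= R'"
  using assms(1,2) unfolding bounded_iff by auto
 then show ?thesis using 0 by (intro integrable_bounded_support_pair[OF h M, of R R']) blast
qed

lemma integral_product:
 fixes a :: "'a::euclidean_space => real" and b :: "'b::euclidean_space => real"
 assumes a: "integrable lborel a" and b: "integrable lborel b"
 shows "integrable lborel2 (\<lambda>(x, y). a x * b y)"
  "(LINT z|lborel2. (\<lambda>(x, y). a x * b y) z) = (LBINT x. a x) * (LBINT y. b y)"
proof -
 have [measurable]: "Borel a" "Borel b" using a b by (auto dest: borel_measurable_integrable)
 show i: "integrable lborel2 (\<lambda>(x, y). a x * b y)"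
  by (rule lborel_pair.Fubini_integrable) (use a b in \<open>auto simp: abs_mult\<close>)
 show "(LINT z|lborel2. (\<lambda>(x, y). a x * b y) z) = (LBINT x. a x) * (LBINT y. b y)"
  unfolding lborel_pair.integral_fst[OF i, symmetric] by simp
qed

text \<open>The right limit in $L^1_{loc}$ is stated for almost every \<open>s\<close>, because the section of a Borel version of
\<open>u\<close> agrees with \<open>u(s)\<close> only for almost every \<open>s\<close>.\<close>

abbreviation right_trace :: "(real => real ^ 'n => real) => real => (real ^ 'n => real) => bool" where
 "right_trace v c g \<equiv> \<forall>R. \<forall>e>0. \<exists>r>0. AE s in lborel. c < s \<and> s < c + r --> (LBINT y. indicator (cball 0 R) y * \<bar>v s y - g y\<bar>) <= e"

text \<open>The setting in which the doubling takes place: \<open>v\<close> is an everywhere defined Borel function, and \<open>d\<close>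
stands for \<open>div f\<close> as a function in its own right.\<close>

locale entropy_core =
 fixes f :: "real => real ^ 'n => real => real ^ 'n" and F d :: "real => real ^ 'n => real => real"
  and v :: "real => real ^ 'n => real" and Ts U :: real
 assumes f_cont: "continuous_on Omega (\<lambda>(t, x, w). f t x w)"
  and F_cont: "continuous_on Omega (\<lambda>(t, x, w). F t x w)"
  and d_cont: "continuous_on Omega (\<lambda>(t, x, w). d t x w)"
  and f_meas: "Borel (\<lambda>(t, x, w). f t x w)"
  and F_meas: "Borel (\<lambda>(t, x, w). F t x w)"
  and d_meas: "Borel (\<lambda>(t, x, w). d t x w)"
  and v_meas: "Borel (\<lambda>(t, x). v t x)"
  and v_bound: "\<bar>v t x\<bar> <= U"
  and entropy: "C1_c ({0<..<Ts} \<times> UNIV) (\<lambda>(t, x). \<phi> t x) ==> (!!t x. 0 <= \<phi> t x) ==>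
   0 <= (LBINT (t, x). ((v t x - k) * vector_derivative (\<lambda>s. \<phi> s x) (at t)
     + (f t x (v t x) - f t x k) \<bullet> grad (\<phi> t) x + (F t x (v t x) - d t x k) * \<phi> t x) * sgn (v t x - k))"
  and rcont: "AE t in lborel. 0 < t \<and> t < Ts --> right_trace v t (v t)"
begin

lemma U_nonneg: "0 <= U" using order_trans[OF abs_ge_zero v_bound] .

lemma v_measurable [measurable (raw)]:
 assumes "a \<in> borel_measurable M" "b \<in> borel_measurable M"
 shows "(\<lambda>z. v (a z) (b z)) \<in> borel_measurable M"
 using measurable_compose[OF borel_measurable_Pair[OF assms] v_meas] by simp

lemma
 assumes [measurable]: "a \<in> borel_measurable M" "b \<in> borel_measurable M" "c \<in> borel_measurable M"
 shows f_measurable [measurable (raw)]: "(\<lambda>z. f (a z) (b z) (c z)) \<in> borel_measurable M"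
  and F_measurable [measurable (raw)]: "(\<lambda>z. F (a z) (b z) (c z)) \<in> borel_measurable M"
  and d_measurable [measurable (raw)]: "(\<lambda>z. d (a z) (b z) (c z)) \<in> borel_measurable M"
proof -
 have *: "(\<lambda>z. (a z, b z, c z)) \<in> borel_measurable M" by (intro borel_measurable_Pair) auto
 show "(\<lambda>z. f (a z) (b z) (c z)) \<in> borel_measurable M" using measurable_compose[OF * f_meas] by simp
 show "(\<lambda>z. F (a z) (b z) (c z)) \<in> borel_measurable M" using measurable_compose[OF * F_meas] by simp
 show "(\<lambda>z. d (a z) (b z) (c z)) \<in> borel_measurable M" using measurable_compose[OF * d_meas] by simp
qed

lemma
 assumes "continuous_on S a" "continuous_on S b" "continuous_on S c" "!!z. z \<in> S ==> 0 < a z"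
 shows continuous_on_f: "continuous_on S (\<lambda>z. f (a z) (b z) (c z))"
  and continuous_on_F: "continuous_on S (\<lambda>z. F (a z) (b z) (c z))"
  and continuous_on_d: "continuous_on S (\<lambda>z. d (a z) (b z) (c z))"
proof -
 have *: "continuous_on S (\<lambda>z. (a z, b z, c z))" "(\<lambda>z. (a z, b z, c z)) ` S \<subseteq> Omega"
  using assms by (auto intro!: continuous_intros simp: Omega_def)
 show "continuous_on S (\<lambda>z. f (a z) (b z) (c z))" using continuous_on_compose2[OF f_cont *] by simp
 show "continuous_on S (\<lambda>z. F (a z) (b z) (c z))" using continuous_on_compose2[OF F_cont *] by simp
 show "continuous_on S (\<lambda>z. d (a z) (b z) (c z))" using continuous_on_compose2[OF d_cont *] by simp
qed

lemma entropy_ineq: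
 assumes der: "!!t x. ((\<lambda>(t, x). \<phi> t x) has_derivative (\<lambda>(\<tau>, \<xi>). \<phi>t t x * \<tau> + \<phi>x t x \<bullet> \<xi>)) (at (t, x))"
  and cont: "continuous_on UNIV (\<lambda>(t, x). \<phi>t t x)" "continuous_on UNIV (\<lambda>(t, x). \<phi>x t x)"
  and nonneg: "!!t x. 0 <= \<phi> t x"
  and zero: "!!t x. \<not> (\<alpha> <= t \<and> t <= \<beta> \<and> norm x <= R) ==> \<phi> t x = 0" and ab: "0 < \<alpha>" "\<beta> < Ts"
 shows "0 <= (LBINT (t, x). ((v t x - k) * \<phi>t t x
     + (f t x (v t x) - f t x k) \<bullet> \<phi>x t x + (F t x (v t x) - d t x k) * \<phi> t x) * sgn (v t x - k))"
proof -
 have "C1_c ({0<..<Ts} \<times> UNIV) (\<lambda>(t, x). \<phi> t x)"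
 proof (rule C1_cI)
  show "((\<lambda>(t, x). \<phi> t x) has_derivative (\<lambda>(\<tau>, \<xi>). \<phi>t (fst p) (snd p) * \<tau> + \<phi>x (fst p) (snd p) \<bullet> \<xi>)) (at p)" for p
   using der[of "fst p" "snd p"] by simp
  show "continuous_on UNIV (\<lambda>p. (\<lambda>(\<tau>, \<xi>). \<phi>t (fst p) (snd p) * \<tau> + \<phi>x (fst p) (snd p) \<bullet> \<xi>) h)" for h
   using cont by (cases h) (auto intro!: continuous_intros simp: split_beta)
  show "compact ({\<alpha>..\<beta>} \<times> cball (0 :: real ^ 'n) R)" by (intro compact_Times) auto
  show "{\<alpha>..\<beta>} \<times> cball (0 :: real ^ 'n) R \<subseteq> {0<..<Ts} \<times> UNIV" using ab by auto
  show "(case p of (t, x) => \<phi> t x) = 0" if "p \<notin> {\<alpha>..\<beta>} \<times> cball (0 :: real ^ 'n) R" for p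
   using that zero by (cases p) auto
 qed
 from entropy[OF this nonneg, of k]
 have "0 <= (LBINT (t, x). ((v t x - k) * vector_derivative (\<lambda>s. \<phi> s x) (at t)
     + (f t x (v t x) - f t x k) \<bullet> grad (\<phi> t) x + (F t x (v t x) - d t x k) * \<phi> t x) * sgn (v t x - k))" .
 moreover have "vector_derivative (\<lambda>s. \<phi> s x) (at t) = \<phi>t t x" for t x
 proof (rule vector_derivative_at)
  have "((\<lambda>s. (\<lambda>(t, x). \<phi> t x) (s, x)) has_derivative (\<lambda>\<tau>. (\<lambda>(\<tau>, \<xi>). \<phi>t t x * \<tau> + \<phi>x t x \<bullet> \<xi>) (\<tau>, 0))) (at t)"
   by (rule has_derivative_compose[where f="\<lambda>s. (s, x)" and x=t, OF _ der]) (auto intro!: derivative_eq_intros)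
  then show "((\<lambda>s. \<phi> s x) has_vector_derivative \<phi>t t x) (at t)"
   by (simp add: has_vector_derivative_def mult.commute)
 qed
 moreover have "grad (\<phi> t) x = \<phi>x t x" for t x
 proof (rule grad_eq)
  have "((\<lambda>y. (\<lambda>(t, x). \<phi> t x) (t, y)) has_derivative (\<lambda>\<xi>. (\<lambda>(\<tau>, \<xi>). \<phi>t t x * \<tau> + \<phi>x t x \<bullet> \<xi>) (0, \<xi>))) (at x)"
   by (rule has_derivative_compose[where f="\<lambda>y. (t, y)" and x=x, OF _ der]) (auto intro!: derivative_eq_intros)
  then show "(\<phi> t has_derivative (\<bullet>) (\<phi>x t x)) (at x)" by simp
 qed
 ultimately show ?thesis by simp
qed

end

lemma compact_norm_bound:
 assumes "compact K" "continuous_on K h"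
 obtains B where "0 <= B" "!!p. p \<in> K ==> norm (h p) <= B"
proof -
 have "bounded (h ` K)" using assms by (intro compact_imp_bounded compact_continuous_image)
 then obtain B where B: "!!p. p \<in> K ==> norm (h p) <= B" unfolding bounded_iff by blast
 show thesis by (rule that[of "max 0 B"]) (use B in \<open>auto simp: le_max_iff_disj\<close>)
qed

text \<open>Test functions of three variables, with a single time: the second time enters only through
\<open>delta \<eta> (s - t)\<close>. The functions \<open>\<Phi>t\<close>, \<open>\<Phi>x\<close>, \<open>\<Phi>y\<close> are the partial derivatives.\<close>

locale doubling_test = entropy_core f F d v Ts U
 for f :: "real => real ^ 'n => real => real ^ 'n" and F d v Ts U +
 fixes \<Phi> \<Phi>t :: "real => real ^ 'n => real ^ 'n => real" and \<Phi>x \<Phi>y :: "real => real ^ 'n => real ^ 'n => real ^ 'n"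
  and \<alpha> \<beta> R :: real
 assumes \<Phi>_der: "((\<lambda>(t, x, y). \<Phi> t x y) has_derivative (\<lambda>(\<tau>, \<xi>, \<upsilon>). \<Phi>t t x y * \<tau> + \<Phi>x t x y \<bullet> \<xi> + \<Phi>y t x y \<bullet> \<upsilon>)) (at (t, x, y))"
  and \<Phi>t_cont: "continuous_on UNIV (\<lambda>(t, x, y). \<Phi>t t x y)"
  and \<Phi>x_cont: "continuous_on UNIV (\<lambda>(t, x, y). \<Phi>x t x y)"
  and \<Phi>y_cont: "continuous_on UNIV (\<lambda>(t, x, y). \<Phi>y t x y)"
  and \<Phi>_nonneg: "0 <= \<Phi> t x y"
  and outside: "\<not> (\<alpha> <= t \<and> t <= \<beta> \<and> norm x <= R \<and> norm y <= R) ==> \<Phi> t x y = 0 \<and> \<Phi>t t x y = 0 \<and> \<Phi>x t x y = 0 \<and> \<Phi>y t x y = 0"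
  and times: "0 < \<alpha>" "\<beta> < Ts"
begin

abbreviation "slab \<equiv> {\<alpha>..\<beta>} \<times> cball (0 :: real ^ 'n) R \<times> {\<alpha>..\<beta> + 1} \<times> cball (0 :: real ^ 'n) R \<times> {-U..U} \<times> {-U..U}"

abbreviation "active t x y \<equiv> \<alpha> <= t \<and> t <= \<beta> \<and> norm x <= R \<and> norm y <= R"

lemma \<Phi>_cont: "continuous_on UNIV (\<lambda>(t, x, y). \<Phi> t x y)"
proof -
 have "isCont (\<lambda>(t, x, y). \<Phi> t x y) p" for p
  using has_derivative_continuous[OF \<Phi>_der, of "fst p" "fst (snd p)" "snd (snd p)"] by simp
 then show ?thesis by (simp add: continuous_on_eq_continuous_at)
qed

lemma continuous_on_test:
 assumes "continuous_on S a" "continuous_on S b" "continuous_on S c"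
 shows "continuous_on S (\<lambda>z. \<Phi> (a z) (b z) (c z))" "continuous_on S (\<lambda>z. \<Phi>t (a z) (b z) (c z))"
  "continuous_on S (\<lambda>z. \<Phi>x (a z) (b z) (c z))" "continuous_on S (\<lambda>z. \<Phi>y (a z) (b z) (c z))"
proof -
 have *: "continuous_on S (\<lambda>z. (a z, b z, c z))" "(\<lambda>z. (a z, b z, c z)) ` S \<subseteq> UNIV"
  using assms by (auto intro!: continuous_intros)
 show "continuous_on S (\<lambda>z. \<Phi> (a z) (b z) (c z))" using continuous_on_compose2[OF \<Phi>_cont *] by simp
 show "continuous_on S (\<lambda>z. \<Phi>t (a z) (b z) (c z))" using continuous_on_compose2[OF \<Phi>t_cont *] by simp
 show "continuous_on S (\<lambda>z. \<Phi>x (a z) (b z) (c z))" using continuous_on_compose2[OF \<Phi>x_cont *] by simp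
 show "continuous_on S (\<lambda>z. \<Phi>y (a z) (b z) (c z))" using continuous_on_compose2[OF \<Phi>y_cont *] by simp
qed

lemma measurable_test [measurable (raw)]:
 assumes [measurable]: "a \<in> borel_measurable M" "b \<in> borel_measurable M" "c \<in> borel_measurable M"
 shows "(\<lambda>z. \<Phi> (a z) (b z) (c z)) \<in> borel_measurable M" "(\<lambda>z. \<Phi>t (a z) (b z) (c z)) \<in> borel_measurable M"
  "(\<lambda>z. \<Phi>x (a z) (b z) (c z)) \<in> borel_measurable M" "(\<lambda>z. \<Phi>y (a z) (b z) (c z)) \<in> borel_measurable M"
proof -
 have *: "(\<lambda>z. (a z, b z, c z)) \<in> borel_measurable M" by (intro borel_measurable_Pair) auto
 note m = measurable_compose[OF * borel_measurable_continuous_onI]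
 show "(\<lambda>z. \<Phi> (a z) (b z) (c z)) \<in> borel_measurable M" using m[OF \<Phi>_cont] by simp
 show "(\<lambda>z. \<Phi>t (a z) (b z) (c z)) \<in> borel_measurable M" using m[OF \<Phi>t_cont] by simp
 show "(\<lambda>z. \<Phi>x (a z) (b z) (c z)) \<in> borel_measurable M" using m[OF \<Phi>x_cont] by simp
 show "(\<lambda>z. \<Phi>y (a z) (b z) (c z)) \<in> borel_measurable M" using m[OF \<Phi>y_cont] by simp
qed

text \<open>The integrand left after the addition of the two inequalities, with \<open>a = v(t,x)\<close>, \<open>b = v(s,y)\<close>.
Writing it with \<open>max\<close> and \<open>min\<close> removes the sign function and makes it continuous; the last summand
is the source.\<close>

definition Psi :: "real => real ^ 'n => real => real ^ 'n => real => real => real" where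
 "Psi t x s y a b = \<bar>a - b\<bar> * \<Phi>t t x y + (f t x (max a b) - f t x (min a b)) \<bullet> \<Phi>x t x y
   + (f s y (max a b) - f s y (min a b)) \<bullet> \<Phi>y t x y
   + ((F t x (max a b) - F t x (min a b)) + (d s y (max a b) - d s y (min a b))) * \<Phi> t x y
   + \<bar>(F t x b - d t x b) - (F s y b - d s y b)\<bar> * \<Phi> t x y"

lemma Psi_outside: "\<not> active t x y ==> Psi t x s y a b = 0"
 using outside[of t x y] by (simp add: Psi_def)

lemma measurable_Psi [measurable (raw)]:
 assumes [measurable]: "a \<in> borel_measurable M" "b \<in> borel_measurable M" "c \<in> borel_measurable M"
  "a' \<in> borel_measurable M" "b' \<in> borel_measurable M" "c' \<in> borel_measurable M"
 shows "(\<lambda>z. Psi (a z) (b z) (c z) (a' z) (b' z) (c' z)) \<in> borel_measurable M"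
 unfolding Psi_def by measurable

lemma Psi_cont: "continuous_on slab (\<lambda>(t, x, s, y, a, b). Psi t x s y a b)"
 unfolding Psi_def split_beta using times
 by (intro continuous_intros continuous_on_test continuous_on_f continuous_on_F continuous_on_d) auto

text \<open>The terms with \<open>\<delta>'\<close> cancel. Of the zero order terms, \<open>F(t,x,a) - F(s,y,b) + d(s,y,a) - d(t,x,b)\<close> is
rewritten as increments in the last argument plus \<open>G(t,x,b) - G(s,y,b)\<close>, and only the latter is
estimated by its absolute value.\<close>

lemma kruzkov_integrand_le:
 assumes "0 <= \<delta>"
 shows "((a - b) * (\<Phi>t t x y * \<delta> - \<Phi> t x y * \<delta>') + (f t x a - f t x b) \<bullet> (\<delta> *\<^sub>R \<Phi>x t x y) + (F t x a - d t x b) * (\<Phi> t x y * \<delta>)) * sgn (a - b)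
   + ((b - a) * (\<Phi> t x y * \<delta>') + (f s y b - f s y a) \<bullet> (\<delta> *\<^sub>R \<Phi>y t x y) + (F s y b - d s y a) * (\<Phi> t x y * \<delta>)) * sgn (b - a)
   <= \<delta> * Psi t x s y a b"
proof -
 let ?X = "(F t x b - d t x b) - (F s y b - d s y b)"
 have *: "\<sigma> * ?X * (\<Phi> t x y * \<delta>) <= \<bar>?X\<bar> * (\<Phi> t x y * \<delta>)" if "\<sigma> = 1 \<or> \<sigma> = -1" for \<sigma>
  using that assms \<Phi>_nonneg[of t x y] by (intro mult_right_mono) auto
 consider "a > b" | "a < b" | "a = b" by linarith
 then show ?thesis
 proof cases
  case 1
  then show ?thesis using *[of 1] by (simp add: Psi_def max_def min_def algebra_simps inner_diff_left)
 next
  case 2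
  then show ?thesis using *[of "-1"] by (simp add: Psi_def max_def min_def algebra_simps inner_diff_left)
 next
  case 3
  then show ?thesis using assms \<Phi>_nonneg[of t x y] by (simp add: Psi_def)
 qed
qed

lemma Psi_bounded:
 obtains C where "0 <= C" "!!t x s y a b. \<bar>a\<bar> <= U ==> \<bar>b\<bar> <= U ==> \<alpha> <= s ==> s <= \<beta> + 1 ==> \<bar>Psi t x s y a b\<bar> <= C"
proof -
 have K: "compact slab" by (intro compact_Times) auto
 obtain C where C: "!!p. p \<in> slab ==> norm ((\<lambda>(t, x, s, y, a, b). Psi t x s y a b) p) <= C"
  by (rule compact_norm_bound[OF K Psi_cont]) (rule that)
 show thesis
 proof (rule that[of "max 0 C"])
  fix t x s y a b assume *: "\<bar>a\<bar> <= U" "\<bar>b\<bar> <= U" "\<alpha> <= s" "s <= \<beta> + 1"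
  show "\<bar>Psi t x s y a b\<bar> <= max 0 C"
  proof (cases "active t x y")
   case True
   then have "(t, x, s, y, a, b) \<in> slab" using * by (auto simp: abs_le_iff)
   from C[OF this] show ?thesis by auto
  qed (simp add: Psi_outside)
 qed simp
qed

lemma doubled_integrable:
 assumes J: "continuous_on slab (\<lambda>(t, x, s, y, a, b). J t x s y a b)"
  and m: "(\<lambda>((t, x), (s, y)). J t x s y (v t x) (v s y) * \<sigma> (v t x - v s y)) \<in> borel_measurable borel2"
  and zero: "!!t x s y a b. \<not> (\<alpha> <= t \<and> t <= \<beta> \<and> norm x <= R \<and> norm y <= R \<and> 0 <= s - t \<and> s - t <= 1) ==> J t x s y a b = 0"
  and \<sigma>: "!!r. \<bar>\<sigma> r\<bar> <= (1 :: real)"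
 shows "integrable lborel2 (\<lambda>((t, x), (s, y)). J t x s y (v t x) (v s y) * \<sigma> (v t x - v s y))"
proof -
 have K: "compact slab" by (intro compact_Times) auto
 obtain M where M: "0 <= M" "!!p. p \<in> slab ==> norm ((\<lambda>(t, x, s, y, a, b). J t x s y a b) p) <= M"
  by (rule compact_norm_bound[OF K J]) (rule that)
 show ?thesis
 proof (rule integrable_bounded_pair[OF _ _ m])
  show "bounded ({\<alpha>..\<beta>} \<times> cball (0 :: real ^ 'n) R)" "bounded ({\<alpha>..\<beta> + 1} \<times> cball (0 :: real ^ 'n) R)"
   by (auto intro: bounded_Times)
  fix p p' :: "real \<times> (real ^ 'n)"
  obtain t x where p: "p = (t, x)" by (cases p)
  obtain s y where p': "p' = (s, y)" by (cases p')
  show "\<bar>(\<lambda>((t, x), (s, y)). J t x s y (v t x) (v s y) * \<sigma> (v t x - v s y)) (p, p')\<bar> <= M"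
  proof (cases "\<alpha> <= t \<and> t <= \<beta> \<and> norm x <= R \<and> norm y <= R \<and> 0 <= s - t \<and> s - t <= 1")
   case True
   then have "(t, x, s, y, v t x, v s y) \<in> slab" using v_bound[of t x] v_bound[of s y] by (auto simp: abs_le_iff)
   from M(2)[OF this] have "\<bar>J t x s y (v t x) (v s y)\<bar> * \<bar>\<sigma> (v t x - v s y)\<bar> <= M * 1"
    using M(1) \<sigma> by (intro mult_mono) auto
   then show ?thesis by (simp add: p p' abs_mult)
  next
   case False
   then show ?thesis using zero[OF False] M(1) by (simp add: p p')
  qed
  assume "\<not> (p \<in> {\<alpha>..\<beta>} \<times> cball 0 R \<and> p' \<in> {\<alpha>..\<beta> + 1} \<times> cball 0 R)"
  then have "\<not> (\<alpha> <= t \<and> t <= \<beta> \<and> norm x <= R \<and> norm y <= R \<and> 0 <= s - t \<and> s - t <= 1)" by (auto simp: p p')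
  from zero[OF this] show "(\<lambda>((t, x), (s, y)). J t x s y (v t x) (v s y) * \<sigma> (v t x - v s y)) (p, p') = 0" by (simp add: p p')
 qed
qed

lemma doubled_entropy:
 assumes \<eta>: "0 < \<eta>" "\<beta> + \<eta> < Ts" "\<eta> <= 1"
 shows "integrable lborel2 (\<lambda>((t, x), (s, y)). delta \<eta> (s - t) * Psi t x s y (v t x) (v s y))"
  and "0 <= (LINT z|lborel2. (\<lambda>((t, x), (s, y)). delta \<eta> (s - t) * Psi t x s y (v t x) (v s y)) z)"
proof -
 let ?Q = "\<lambda>((t, x), (s, y)). delta \<eta> (s - t) * Psi t x s y (v t x) (v s y)"
 let ?\<delta> = "delta \<eta>" and ?\<delta>' = "delta' \<eta>"
 note [continuous_intros] = continuous_on_compose2[OF continuous_on_delta(1)] continuous_on_compose2[OF continuous_on_delta(2)]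
 define J1 where "J1 t x s y a b = (a - b) * (\<Phi>t t x y * ?\<delta> (s - t) - \<Phi> t x y * ?\<delta>' (s - t)) + (f t x a - f t x b) \<bullet> (?\<delta> (s - t) *\<^sub>R \<Phi>x t x y)
   + (F t x a - d t x b) * (\<Phi> t x y * ?\<delta> (s - t))" for t x s y a b
 define J2 where "J2 t x s y a b = (b - a) * (\<Phi> t x y * ?\<delta>' (s - t)) + (f s y b - f s y a) \<bullet> (?\<delta> (s - t) *\<^sub>R \<Phi>y t x y)
   + (F s y b - d s y a) * (\<Phi> t x y * ?\<delta> (s - t))" for t x s y a b
 define I1 where "I1 t x s y = J1 t x s y (v t x) (v s y) * sgn (v t x - v s y)" for t x s y
 define I2 where "I2 t x s y = J2 t x s y (v t x) (v s y) * sgn (v s y - v t x)" for t x s y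
 have zero: "\<Phi> t x y = 0 \<and> \<Phi>t t x y = 0 \<and> \<Phi>x t x y = 0 \<and> \<Phi>y t x y = 0 \<or> ?\<delta> (s - t) = 0 \<and> ?\<delta>' (s - t) = 0"
  if "\<not> (\<alpha> <= t \<and> t <= \<beta> \<and> norm x <= R \<and> norm y <= R \<and> 0 <= s - t \<and> s - t <= \<eta>)" for t s x y
 proof (cases "0 <= s - t \<and> s - t <= \<eta>")
  case True
  then show ?thesis using that outside[of t x y] by blast
 next
  case False
  then show ?thesis using delta_zero[OF \<eta>(1), of "s - t"] by auto
 qed
 have zero1: "J1 t x s y a b = 0 \<and> J2 t x s y a b = 0 \<and> ?\<delta> (s - t) * Psi t x s y a b = 0"
  if "\<not> (\<alpha> <= t \<and> t <= \<beta> \<and> norm x <= R \<and> norm y <= R \<and> 0 <= s - t \<and> s - t <= 1)" for t x s y a b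
  using zero[of t x y s] that \<eta>(3) unfolding J1_def J2_def Psi_def by auto
 let ?sg = "\<lambda>r. sgn (- r) :: real"
 have i1: "integrable lborel2 (\<lambda>((t, x), (s, y)). I1 t x s y)"
  unfolding I1_def
 proof (rule doubled_integrable)
  show "continuous_on slab (\<lambda>(t, x, s, y, a, b). J1 t x s y a b)"
   unfolding J1_def split_beta using times by (intro continuous_intros continuous_on_test continuous_on_f continuous_on_F continuous_on_d) auto
  show "(\<lambda>((t, x), (s, y)). J1 t x s y (v t x) (v s y) * sgn (v t x - v s y)) \<in> borel_measurable borel2"
   unfolding J1_def split_beta borel_prod[symmetric] by measurable
 qed (use zero1 in \<open>auto simp: sgn_if\<close>)
 have i2: "integrable lborel2 (\<lambda>((t, x), (s, y)). I2 t x s y)"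
 proof -
  have "integrable lborel2 (\<lambda>((t, x), (s, y)). J2 t x s y (v t x) (v s y) * ?sg (v t x - v s y))"
  proof (rule doubled_integrable)
   show "continuous_on slab (\<lambda>(t, x, s, y, a, b). J2 t x s y a b)"
    unfolding J2_def split_beta using times by (intro continuous_intros continuous_on_test continuous_on_f continuous_on_F continuous_on_d) auto
   show "(\<lambda>((t, x), (s, y)). J2 t x s y (v t x) (v s y) * ?sg (v t x - v s y)) \<in> borel_measurable borel2"
    unfolding J2_def split_beta borel_prod[symmetric] by measurable
  qed (use zero1 in \<open>auto simp: sgn_if\<close>)
  then show ?thesis unfolding I2_def by simp
 qed
 have Qm: "?Q \<in> borel_measurable borel2" unfolding split_beta borel_prod[symmetric] by measurable
 show iQ: "integrable lborel2 ?Q"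
 proof -
  have "integrable lborel2 (\<lambda>((t, x), (s, y)). (?\<delta> (s - t) * Psi t x s y (v t x) (v s y)) * (\<lambda>_. 1) (v t x - v s y))"
  proof (rule doubled_integrable)
   have "continuous_on slab (\<lambda>p. ?\<delta> (fst (snd (snd p)) - fst p) * (\<lambda>(t, x, s, y, a, b). Psi t x s y a b) p)"
    by (intro continuous_intros Psi_cont) auto
   then show "continuous_on slab (\<lambda>(t, x, s, y, a, b). ?\<delta> (s - t) * Psi t x s y a b)"
    by (simp add: split_beta)
  qed (use zero1 Qm in auto)
  then show ?thesis by simp
 qed
 have E1: "0 <= (LBINT p. (case p of (t, x) => I1 t x s y))" for s y
  unfolding I1_def J1_def
 proof (rule entropy_ineq[where \<phi>="\<lambda>t x. \<Phi> t x y * ?\<delta> (s - t)" and \<alpha>=\<alpha> and \<beta>=\<beta> and R=R and \<phi>t="\<lambda>t x. \<Phi>t t x y * ?\<delta> (s - t) - \<Phi> t x y * ?\<delta>' (s - t)" and \<phi>x="\<lambda>t x. ?\<delta> (s - t) *\<^sub>R \<Phi>x t x y"])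
  fix t x
  have "((\<lambda>p. (\<lambda>(t, x, y). \<Phi> t x y) ((\<lambda>(t, x). (t, x, y)) p)) has_derivative (\<lambda>q. (\<lambda>(\<tau>, \<xi>, \<upsilon>). \<Phi>t t x y * \<tau> + \<Phi>x t x y \<bullet> \<xi> + \<Phi>y t x y \<bullet> \<upsilon>) ((\<lambda>(\<tau>, \<xi>). (\<tau>, \<xi>, 0)) q))) (at (t, x))"
  proof (rule has_derivative_compose[where x="(t, x)" and f="\<lambda>(t, x). (t, x, y)"])
   show "((\<lambda>(t, x). (t, x, y)) has_derivative (\<lambda>(\<tau>, \<xi>). (\<tau>, \<xi>, 0))) (at (t, x))"
    unfolding split_beta by (auto intro!: derivative_eq_intros)
  qed (simp only: prod.case, rule \<Phi>_der)
  then have 1: "((\<lambda>(t, x). \<Phi> t x y) has_derivative (\<lambda>(\<tau>, \<xi>). \<Phi>t t x y * \<tau> + \<Phi>x t x y \<bullet> \<xi>)) (at (t, x))"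
   by (simp add: split_beta')
  have 2: "((\<lambda>(t, x :: real ^ 'n). ?\<delta> (s - t)) has_derivative (\<lambda>(\<tau>, \<xi>). - ?\<delta>' (s - t) * \<tau>)) (at (t, x))"
  proof -
   have "((\<lambda>p :: real \<times> (real ^ 'n). ?\<delta> (s - fst p)) has_derivative (\<lambda>h. ?\<delta>' (s - fst (t, x)) * (- fst h))) (at (t, x))"
    by (rule has_derivative_compose[OF _ delta_DERIV[unfolded has_field_derivative_def]]) (auto intro!: derivative_eq_intros)
   then show ?thesis by (simp add: split_beta')
  qed
  show "((\<lambda>(t, x). \<Phi> t x y * ?\<delta> (s - t)) has_derivative (\<lambda>(\<tau>, \<xi>). (\<Phi>t t x y * ?\<delta> (s - t) - \<Phi> t x y * ?\<delta>' (s - t)) * \<tau> + (?\<delta> (s - t) *\<^sub>R \<Phi>x t x y) \<bullet> \<xi>)) (at (t, x))"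
   using has_derivative_mult[OF 1 2] by (simp add: split_beta' algebra_simps)
  show "0 <= \<Phi> t x y * ?\<delta> (s - t)" using \<Phi>_nonneg delta_integral(1)[OF \<eta>(1)] by simp
  show "\<Phi> t x y * ?\<delta> (s - t) = 0" if "\<not> (\<alpha> <= t \<and> t <= \<beta> \<and> norm x <= R)"
   using outside[of t x y] that by auto
 qed (auto intro!: continuous_intros continuous_on_test times simp: split_beta)
 have E2: "0 <= (LBINT p. (case p of (s, y) => I2 t x s y))" for t x
 proof (cases "\<alpha> <= t \<and> t <= \<beta> \<and> norm x <= R")
  case True
  show ?thesis unfolding I2_def J2_def
  proof (rule entropy_ineq[where \<phi>="\<lambda>s y. \<Phi> t x y * ?\<delta> (s - t)" and \<alpha>=\<alpha> and \<beta>="\<beta> + \<eta>" and R=R and \<phi>t="\<lambda>s y. \<Phi> t x y * ?\<delta>' (s - t)" and \<phi>x="\<lambda>s y. ?\<delta> (s - t) *\<^sub>R \<Phi>y t x y"])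
   fix s y
   have "((\<lambda>p. (\<lambda>(t, x, y). \<Phi> t x y) ((\<lambda>(s :: real, y). (t, x, y)) p)) has_derivative (\<lambda>q. (\<lambda>(\<tau>, \<xi>, \<upsilon>). \<Phi>t t x y * \<tau> + \<Phi>x t x y \<bullet> \<xi> + \<Phi>y t x y \<bullet> \<upsilon>) ((\<lambda>(\<tau>, \<upsilon>). (0, 0, \<upsilon>)) q))) (at (s, y))"
   proof (rule has_derivative_compose[where x="(s, y)" and f="\<lambda>(s :: real, y). (t, x, y)"])
    show "((\<lambda>(s :: real, y). (t, x, y)) has_derivative (\<lambda>(\<tau>, \<upsilon>). (0, 0, \<upsilon>))) (at (s, y))"
     unfolding split_beta by (auto intro!: derivative_eq_intros)
   qed (simp only: prod.case, rule \<Phi>_der)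
   then have 1: "((\<lambda>(s :: real, y). \<Phi> t x y) has_derivative (\<lambda>(\<tau>, \<upsilon>). \<Phi>y t x y \<bullet> \<upsilon>)) (at (s, y))"
    by (simp add: split_beta')
   have 2: "((\<lambda>(s, y :: real ^ 'n). ?\<delta> (s - t)) has_derivative (\<lambda>(\<tau>, \<xi>). ?\<delta>' (s - t) * \<tau>)) (at (s, y))"
   proof -
    have "((\<lambda>p :: real \<times> (real ^ 'n). ?\<delta> (fst p - t)) has_derivative (\<lambda>h. ?\<delta>' (fst (s, y) - t) * (fst h))) (at (s, y))"
     by (rule has_derivative_compose[OF _ delta_DERIV[unfolded has_field_derivative_def]]) (auto intro!: derivative_eq_intros)
    then show ?thesis by (simp add: split_beta')
   qed
   show "((\<lambda>(s, y). \<Phi> t x y * ?\<delta> (s - t)) has_derivative (\<lambda>(\<tau>, \<xi>). (\<Phi> t x y * ?\<delta>' (s - t)) * \<tau> + (?\<delta> (s - t) *\<^sub>R \<Phi>y t x y) \<bullet> \<xi>)) (at (s, y))"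
    using has_derivative_mult[OF 1 2] by (simp add: split_beta' algebra_simps)
   show "0 <= \<Phi> t x y * ?\<delta> (s - t)" using \<Phi>_nonneg delta_integral(1)[OF \<eta>(1)] by simp
   show "\<Phi> t x y * ?\<delta> (s - t) = 0" if "\<not> (\<alpha> <= s \<and> s <= \<beta> + \<eta> \<and> norm y <= R)"
    using zero[of t x y s] that True by force
  qed (use \<eta> times in \<open>auto intro!: continuous_intros continuous_on_test simp: split_beta\<close>)
 next
  case False
  then have "I2 t x s y = 0" for s y using outside[of t x y] unfolding I2_def J2_def by auto
  then show ?thesis by simp
 qed
 have "0 <= (LINT z|lborel2. (\<lambda>((t, x), (s, y)). I1 t x s y) z)"
 proof -
  have "0 <= (LINT p'|lborel. (LBINT p. (\<lambda>((t, x), (s, y)). I1 t x s y) (p, p')))"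
   by (rule integral_nonneg_AE[OF AE_I2]) (use E1 in \<open>simp add: split_beta\<close>)
  then show ?thesis using lborel_pair.integral_snd[of "\<lambda>p p'. (\<lambda>((t, x), (s, y)). I1 t x s y) (p, p')"] i1
   by (simp add: split_beta')
 qed
 moreover have "0 <= (LINT z|lborel2. (\<lambda>((t, x), (s, y)). I2 t x s y) z)"
 proof -
  have "0 <= (LBINT p. (LINT p'|lborel. (\<lambda>((t, x), (s, y)). I2 t x s y) (p, p')))"
   by (rule integral_nonneg_AE[OF AE_I2]) (use E2 in \<open>simp add: split_beta\<close>)
  then show ?thesis using lborel_pair.integral_fst[of "\<lambda>p p'. (\<lambda>((t, x), (s, y)). I2 t x s y) (p, p')"] i2
   by (simp add: split_beta')
 qed
 moreover have "(LINT z|lborel2. (\<lambda>((t, x), (s, y)). I1 t x s y) z + (\<lambda>((t, x), (s, y)). I2 t x s y) z) <= (LINT z|lborel2. ?Q z)"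
 proof (rule Bochner_Integration.integral_mono[OF Bochner_Integration.integrable_add[OF i1 i2] iQ])
  fix z :: "(real \<times> (real ^ 'n)) \<times> (real \<times> (real ^ 'n))"
  obtain t x s y where z: "z = ((t, x), (s, y))" by (metis prod.exhaust)
  show "(\<lambda>((t, x), (s, y)). I1 t x s y) z + (\<lambda>((t, x), (s, y)). I2 t x s y) z <= ?Q z"
   unfolding z I1_def I2_def J1_def J2_def using kruzkov_integrand_le[OF delta_integral(1)[OF \<eta>(1)], of "v t x" "v s y" t x y "s - t" "?\<delta>' (s - t)" s] by simp
 qed
 ultimately show "0 <= (LINT z|lborel2. ?Q z)"
  using i1 i2 by simp
qed

end

lemma AE_lborel_fst:
 assumes "AE t in lborel. P (t :: 'a::euclidean_space)"
 shows "AE p in lborel. P (fst (p :: 'a \<times> 'b::euclidean_space))"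
proof -
 obtain N where N: "{t. \<not> P t} \<subseteq> N" "emeasure lborel N = 0" "N \<in> sets lborel"
  using AE_E[OF assms] by auto
 have "AE p in lborel \<Otimes>\<^sub>M (lborel :: 'b measure). fst p \<notin> N"
 proof (rule lborel_pair.AE_pair_measure)
  show "{p \<in> space (lborel \<Otimes>\<^sub>M (lborel :: 'b measure)). fst p \<notin> N} \<in> sets (lborel \<Otimes>\<^sub>M (lborel :: 'b measure))"
   using N(3) by measurable
  have "AE t in lborel. t \<notin> N" using N by (intro AE_not_in) (auto simp: null_sets_def)
  then show "AE t in lborel. AE y in (lborel :: 'b measure). fst (t, y) \<notin> N" by eventually_elim simp
 qed
 then show ?thesis unfolding lborel_prod by eventually_elim (use N(1) in auto)
qed

lemma delta_translate:
 assumes "0 < \<eta>"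
 shows "(LBINT s. delta \<eta> (s - t)) = 1" "integrable lborel (\<lambda>s. delta \<eta> (s - t))"
proof -
 show 1: "(LBINT s. delta \<eta> (s - t)) = 1"
  using lborel_integral_translation[of "delta \<eta>" "- t"] delta_integral(3)[OF assms] by simp
 show "integrable lborel (\<lambda>s. delta \<eta> (s - t))"
  by (rule ccontr) (use 1 not_integrable_integral_eq in fastforce)
qed

lemma delta_mult_integrable:
 assumes "0 < \<eta>" "Borel h" and h: "!!s. \<bar>h s\<bar> <= (B :: real)"
 shows "integrable lborel (\<lambda>s. delta \<eta> (s - t) * h s)"
proof (rule Bochner_Integration.integrable_bound)
 show "integrable lborel (\<lambda>s. delta \<eta> (s - t) * B)" by (rule integrable_mult_left[OF delta_translate(2)[OF assms(1)]])
 show "(\<lambda>s. delta \<eta> (s - t) * h s) \<in> borel_measurable lborel" using assms(2) by measurable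
 have "norm (delta \<eta> (s - t) * h s) <= norm (delta \<eta> (s - t) * B)" for s
  using h[of s] by (auto simp: abs_mult intro!: mult_left_mono)
 then show "AE s in lborel. norm (delta \<eta> (s - t) * h s) <= norm (delta \<eta> (s - t) * B)" by simp
qed

context doubling_test
begin

text \<open>Near the diagonal \<open>Psi\<close> varies little by uniform continuity when \<open>b\<close> and \<open>b'\<close> are close; when they are
not, its bound \<open>M\<close> is dominated by a multiple of \<open>|b - b'|\<close>. So the error is integrable against right
continuity in \<open>L\<^sup>1\<close>.\<close>

lemma Psi_modulus:
 assumes "0 < e"
 obtains \<gamma> C where "0 < \<gamma>" "0 <= C" "!!t x s y a b b'. \<alpha> <= t ==> t <= \<beta> ==> norm x <= R ==> norm y <= R ==> t <= s ==> s < t + \<gamma> ==> s <= \<beta> + 1 ==>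
   \<bar>a\<bar> <= U ==> \<bar>b\<bar> <= U ==> \<bar>b'\<bar> <= U ==> Psi t x s y a b <= Psi t x t y a b' + (e + C * \<bar>b - b'\<bar>)"
proof -
 obtain M where M: "0 <= M" "!!t x s y a b. \<bar>a\<bar> <= U ==> \<bar>b\<bar> <= U ==> \<alpha> <= s ==> s <= \<beta> + 1 ==> \<bar>Psi t x s y a b\<bar> <= M"
  by (rule Psi_bounded) (rule that)
 have "uniformly_continuous_on slab (\<lambda>(t, x, s, y, a, b). Psi t x s y a b)"
  by (intro compact_uniformly_continuous Psi_cont compact_Times) auto
 then obtain \<gamma> where \<gamma>: "0 < \<gamma>" "!!p p'. p \<in> slab ==> p' \<in> slab ==> dist p' p < \<gamma> ==>
   dist ((\<lambda>(t, x, s, y, a, b). Psi t x s y a b) p') ((\<lambda>(t, x, s, y, a, b). Psi t x s y a b) p) < e"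
  using assms unfolding uniformly_continuous_on_def by blast
 show thesis
 proof (rule that[of "\<gamma> / 2" "4 * M / \<gamma>"])
  fix t s a b b' :: real and x y :: "real ^ 'n" assume *: "\<alpha> <= t" "t <= \<beta>" "norm x <= R" "norm y <= R" "t <= s" "s < t + \<gamma> / 2" "s <= \<beta> + 1" "\<bar>a\<bar> <= U" "\<bar>b\<bar> <= U" "\<bar>b'\<bar> <= U"
  show "Psi t x s y a b <= Psi t x t y a b' + (e + 4 * M / \<gamma> * \<bar>b - b'\<bar>)"
  proof (cases "\<bar>b - b'\<bar> < \<gamma> / 2")
   case True
   have "dist (t, x, s, y, a, b) (t, x, t, y, a, b') <= dist s t + dist b b'"
    unfolding dist_Pair_Pair by (simp add: sqrt_sum_squares_le_sum_abs)
     (use sqrt_sum_squares_le_sum_abs[of "dist s t" "dist b b'"] in simp)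
   also have "... < \<gamma>" using True * by (simp add: dist_real_def)
   finally have "dist (Psi t x s y a b) (Psi t x t y a b') < e"
    using \<gamma>(2)[of "(t, x, t, y, a, b')" "(t, x, s, y, a, b)"] * by (simp add: abs_le_iff)
   moreover have "0 <= 4 * M / \<gamma> * \<bar>b - b'\<bar>" using M \<gamma> by simp
   ultimately show ?thesis by (simp add: dist_real_def)
  next
   case False
   have "\<bar>Psi t x s y a b\<bar> <= M" "\<bar>Psi t x t y a b'\<bar> <= M" using M * by auto
   then have "Psi t x s y a b <= Psi t x t y a b' + 2 * M" by linarith
   also have "2 * M = 4 * M / \<gamma> * (\<gamma> / 2)" using \<gamma> by simp
   also have "... <= 4 * M / \<gamma> * \<bar>b - b'\<bar>" using False M \<gamma> by (intro mult_left_mono) auto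
   finally show ?thesis using assms by simp
  qed
 qed (use \<gamma> M in auto)
qed

lemma delta_convolve:
 assumes "0 < \<eta>" and h: "Borel h" "!!y. \<bar>h y\<bar> <= B" "!!y. norm y > R ==> h y = 0"
 shows "(LBINT p. delta \<eta> (fst p - t) * h (snd p :: real ^ 'n)) = (LBINT y. h y)"
proof -
 have "integrable lborel h" using h by (intro integrable_bounded_support[where B=B and R=R]) auto
 from integral_product(2)[OF delta_translate(2)[OF assms(1), of t] this] show ?thesis
  by (simp add: delta_translate(1)[OF assms(1)] lborel_prod split_beta')
qed

definition box_ind :: "real => real ^ 'n => real ^ 'n => real" where
 "box_ind t x y = indicator {\<alpha>..\<beta>} t * indicator (cball 0 R) x * indicator (cball 0 R) y"

lemma measurable_box_ind [measurable (raw)]: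
 assumes [measurable]: "a \<in> borel_measurable M" "b \<in> borel_measurable M" "c \<in> borel_measurable M"
 shows "(\<lambda>z. box_ind (a z) (b z) (c z)) \<in> borel_measurable M"
proof -
 have [measurable]: "cball (0 :: real ^ 'n) R \<in> sets borel" by simp
 show ?thesis unfolding box_ind_def by measurable
qed

lemma box_ind: "0 <= box_ind t x y" "box_ind t x y <= 1"
 by (auto simp: box_ind_def indicator_def)

text \<open>The averaged \<open>L\<^sup>1\<close> distance of \<open>v(s)\<close> and \<open>v(t)\<close> over the support of the test function, the total cost of
replacing \<open>s\<close> by \<open>t\<close> in \<open>v(s,y)\<close>.\<close>

definition err :: "real => real \<times> (real ^ 'n) => real" where
 "err \<eta> p = (LINT p'|lborel. delta \<eta> (fst p' - fst p) * (\<bar>v (fst p') (snd p') - v (fst p) (snd p')\<bar> * box_ind (fst p) (snd p) (snd p')))"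

lemma Psi_diag_integrable:
 "integrable lborel2 (\<lambda>((t, x), y). Psi t x t y (v t x) (v t y))"
 "integrable lborel (\<lambda>y. Psi t x t y (v t x) (v t y))"
proof -
 obtain M where M: "0 <= M" "!!t x s y a b. \<bar>a\<bar> <= U ==> \<bar>b\<bar> <= U ==> \<alpha> <= s ==> s <= \<beta> + 1 ==> \<bar>Psi t x s y a b\<bar> <= M"
  by (rule Psi_bounded) (rule that)
 have b: "\<bar>Psi t x t y (v t x) (v t y)\<bar> <= M" for t x y
 proof (cases "active t x y")
  case True
  then show ?thesis using M(2)[of "v t x" "v t y" t] v_bound by auto
 next
  case False
  then show ?thesis using M Psi_outside[OF False] by simp
 qed
 show "integrable lborel2 (\<lambda>((t, x), y). Psi t x t y (v t x) (v t y))"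
 proof (rule integrable_bounded_pair[where A="{\<alpha>..\<beta>} \<times> cball 0 R" and B="cball 0 R" and M=M])
  show "(\<lambda>((t, x), y). Psi t x t y (v t x) (v t y)) \<in> borel_measurable borel2"
   unfolding borel_prod[symmetric] split_beta by measurable
  show "\<bar>(\<lambda>((t, x), y). Psi t x t y (v t x) (v t y)) (p, y)\<bar> <= M" for p y using b by (simp add: split_beta)
  show "(\<lambda>((t, x), y). Psi t x t y (v t x) (v t y)) (p, y) = 0" if "\<not> (p \<in> {\<alpha>..\<beta>} \<times> cball 0 R \<and> y \<in> cball 0 R)" for p y
   using that by (cases p) (auto intro!: Psi_outside)
 qed (auto intro: bounded_Times)
 show "integrable lborel (\<lambda>y. Psi t x t y (v t x) (v t y))"
  by (rule integrable_bounded_support[where B=M and R=R]) (use b Psi_outside[of t x] in auto)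
qed

lemma err_tendsto:
 assumes \<eta>: "!!n. 0 < \<eta> n" "\<eta> \<longlonglongrightarrow> 0" "!!n. \<beta> + \<eta> n < Ts"
 shows "(\<lambda>n. LBINT p. err (\<eta> n) p) \<longlonglongrightarrow> 0"
proof -
 have U0: "0 <= U" by (rule U_nonneg)
 have [measurable]: "cball (0 :: real ^ 'n) R \<in> sets borel" by simp
 define V where "V = measure lborel (cball (0 :: real ^ 'n) R)"
 define m where "m t s = (LBINT y. indicator (cball 0 R) y * \<bar>v s y - v t y\<bar>)" for t s
 have diff: "\<bar>v s y - v t y\<bar> <= 2 * U" for s t y using v_bound[of s y] v_bound[of t y] by linarith
 have int: "integrable lborel (\<lambda>y. indicator (cball 0 R) y * \<bar>v s y - v t y\<bar>)" for t s
  by (rule integrable_bounded_support[where B="2 * U" and R=R])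
    (use diff in \<open>auto simp: indicator_def U0\<close>)
 have m: "0 <= m t s" "m t s <= 2 * U * V" for t s
 proof -
  show "0 <= m t s" unfolding m_def by (intro integral_nonneg_AE) auto
  have "norm (m t s) <= (2 * U) * V" unfolding m_def V_def
  proof (rule integral_abs_le_bounded_support)
   show "norm (indicator (cball 0 R) y * \<bar>v s y - v t y\<bar>) <= 2 * U" for y
    using diff[of s y t] U0 by (auto simp: indicator_def)
  qed auto
  then show "m t s <= 2 * U * V" by simp
 qed
 have [measurable]: "(\<lambda>(t, s). m t s) \<in> borel_measurable borel2"
  unfolding m_def by measurable
 have err_eq: "err e p = indicator {\<alpha>..\<beta>} (fst p) * indicator (cball 0 R) (snd p) * (LBINT s. delta e (s - fst p) * m (fst p) s)"
  if e: "0 < e" for e and p :: "real \<times> (real ^ 'n)"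
 proof -
  let ?h = "\<lambda>(s, y). delta e (s - fst p) * (\<bar>v s y - v (fst p) y\<bar> * box_ind (fst p) (snd p) y)"
  have iI: "integrable lborel (indicator (cball (0 :: real ^ 'n) R) :: _ => real)"
   by (rule integrable_bounded_support[where B=1 and R=R]) (auto simp: indicator_def)
  have "integrable lborel2 ?h"
  proof (rule Bochner_Integration.integrable_bound[OF integral_product(1)[OF delta_translate(2)[OF e, of "fst p"] integrable_mult_right[OF iI, of "2 * U"]]])
   show "?h \<in> borel_measurable lborel2" by measurable
   have "\<bar>v s y - v (fst p) y\<bar> * box_ind (fst p) (snd p) y <= 2 * U * indicator (cball 0 R) y" for s y
    using diff[of s y "fst p"] by (auto simp: box_ind_def indicator_def)
   then have "norm (?h (s, y)) <= norm (delta e (s - fst p) * (2 * U * indicator (cball 0 R) y))" for s y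
    using delta_integral(1)[OF e] box_ind(1)[of "fst p" "snd p" y] U0 by (auto simp: abs_mult intro!: mult_left_mono)
   then show "AE z in lborel2. norm (?h z) <= norm ((\<lambda>(s, y). delta e (s - fst p) * (2 * U * indicator (cball 0 R) y)) z)"
    by (intro AE_I2) (auto simp: split_beta)
  qed
  from lborel_pair.integral_fst[OF this]
  have "err e p = (LBINT s. LBINT y. delta e (s - fst p) * (\<bar>v s y - v (fst p) y\<bar> * box_ind (fst p) (snd p) y))"
   by (simp add: err_def lborel_prod split_beta')
  also have "... = (LBINT s. (indicator {\<alpha>..\<beta>} (fst p) * indicator (cball 0 R) (snd p)) * (delta e (s - fst p) * m (fst p) s))"
  proof (rule Bochner_Integration.integral_cong[OF refl])
   fix s
   have "(LBINT y. delta e (s - fst p) * (\<bar>v s y - v (fst p) y\<bar> * box_ind (fst p) (snd p) y))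
    = (LBINT y. (indicator {\<alpha>..\<beta>} (fst p) * indicator (cball 0 R) (snd p) * delta e (s - fst p)) * (indicator (cball 0 R) y * \<bar>v s y - v (fst p) y\<bar>))"
    by (intro Bochner_Integration.integral_cong) (auto simp: box_ind_def)
   then show "(LBINT y. delta e (s - fst p) * (\<bar>v s y - v (fst p) y\<bar> * box_ind (fst p) (snd p) y)) = (indicator {\<alpha>..\<beta>} (fst p) * indicator (cball 0 R) (snd p)) * (delta e (s - fst p) * m (fst p) s)"
    by (simp add: m_def)
  qed
  finally show ?thesis by simp
 qed
 have int_dm: "integrable lborel (\<lambda>s. delta e (s - t) * m t s)" if "0 < e" for e t
  by (rule delta_mult_integrable[OF that, where B="2 * U * V"]) (use m in auto)
 have shift1: "(LBINT s. delta e (s - t) * c) = c" "integrable lborel (\<lambda>s. delta e (s - t) * c)" if "0 < e" for e t c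
  using delta_translate[OF that, of t] by auto
 have bound: "norm (err e p) <= 2 * U * V * indicator ({\<alpha>..\<beta>} \<times> cball 0 R) p" if e: "0 < e" for e p
 proof -
  have "(LBINT s. delta e (s - fst p) * m (fst p) s) <= (LBINT s. delta e (s - fst p) * (2 * U * V))"
   by (rule Bochner_Integration.integral_mono[OF int_dm[OF e] shift1(2)[OF e]])
     (use m delta_integral(1)[OF e] in \<open>auto intro!: mult_left_mono\<close>)
  moreover have "0 <= (LBINT s. delta e (s - fst p) * m (fst p) s)"
   using m delta_integral(1)[OF e] by (intro integral_nonneg_AE AE_I2) auto
  ultimately show ?thesis
   unfolding err_eq[OF e] shift1(1)[OF e] by (cases p) (auto simp: indicator_def)
 qed
 have ptw: "AE p in lborel. (\<lambda>n. err (\<eta> n) p) \<longlonglongrightarrow> 0"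
  using AE_lborel_fst[OF rcont]
 proof eventually_elim
  case (elim p)
  show ?case
  proof (cases "\<alpha> <= fst p \<and> fst p <= \<beta>")
   case False
   then have "err (\<eta> n) p = 0" for n using err_eq[OF \<eta>(1)] by auto
   then show ?thesis by simp
  next
   case True
   let ?t = "fst p"
   show ?thesis
   proof (rule LIMSEQ_I)
    fix e :: real assume e: "0 < e"
    have "0 < ?t" "?t < Ts" using True times by auto
    then obtain r where r: "0 < r" "AE s in lborel. ?t < s \<and> s < ?t + r --> m ?t s <= e / 2"
     using elim half_gt_zero[OF e] unfolding m_def by blast
    obtain n0 where n0: "!!n. n \<ge> n0 ==> \<eta> n < r"
     using order_tendstoD(2)[OF \<eta>(2) r(1)] unfolding eventually_sequentially by blast
    show "\<exists>no. \<forall>n\<ge>no. norm (err (\<eta> n) p - 0) < e"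
    proof (intro exI allI impI)
     fix n assume n: "n \<ge> n0"
     have "(LBINT s. delta (\<eta> n) (s - ?t) * m ?t s) <= (LBINT s. delta (\<eta> n) (s - ?t) * (e / 2))"
     proof (rule integral_mono_AE[OF int_dm[OF \<eta>(1)] shift1(2)[OF \<eta>(1)]])
      show "AE s in lborel. delta (\<eta> n) (s - ?t) * m ?t s <= delta (\<eta> n) (s - ?t) * (e / 2)"
       using r(2)
      proof eventually_elim
       case (elim s)
       show ?case
       proof (cases "?t < s \<and> s < ?t + \<eta> n")
        case True
        then show ?thesis using elim n0[OF n] delta_integral(1)[OF \<eta>(1)] by (intro mult_left_mono) auto
       next
        case False
        then show ?thesis using delta_zero(1)[OF \<eta>(1), of "s - ?t" n] by auto
       qed
      qed
     qed
     then have 1: "(LBINT s. delta (\<eta> n) (s - ?t) * m ?t s) <= e / 2" by (simp only: shift1(1)[OF \<eta>(1)])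
     moreover have "0 <= (LBINT s. delta (\<eta> n) (s - ?t) * m ?t s)"
      using m delta_integral(1)[OF \<eta>(1)] by (intro integral_nonneg_AE AE_I2) auto
     ultimately show "norm (err (\<eta> n) p - 0) < e" using e by (auto simp: err_eq[OF \<eta>(1)] indicator_def)
    qed
   qed
  qed
 qed
 have "(\<lambda>n. LBINT p. err (\<eta> n) p) \<longlonglongrightarrow> (LINT p|(lborel :: (real \<times> (real ^ 'n)) measure). 0)"
 proof (rule integral_dominated_convergence[where w="\<lambda>p. 2 * U * V * indicator ({\<alpha>..\<beta>} \<times> cball 0 R) p"])
  show "err (\<eta> n) \<in> borel_measurable lborel" for n
  proof -
   have "(\<lambda>(p, p'). delta (\<eta> n) (fst p' - fst p) * (\<bar>v (fst p') (snd p') - v (fst p) (snd p')\<bar> * box_ind (fst p) (snd p) (snd p')))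
     \<in> borel_measurable (borel2 \<Otimes>\<^sub>M borel2)" by measurable
   then have "(\<lambda>(p, p'). delta (\<eta> n) (fst p' - fst p) * (\<bar>v (fst p') (snd p') - v (fst p) (snd p')\<bar> * box_ind (fst p) (snd p) (snd p')))
     \<in> borel_measurable lborel2" unfolding lborel_prod borel_prod by simp
   then show ?thesis unfolding err_def[abs_def] by (rule lborel.borel_measurable_lebesgue_integral)
  qed
  have "bounded ({\<alpha>..\<beta>} \<times> cball (0 :: real ^ 'n) R)" "closed ({\<alpha>..\<beta>} \<times> cball (0 :: real ^ 'n) R)"
   by (auto intro: bounded_Times closed_Times)
  then show "integrable lborel (\<lambda>p. 2 * U * V * indicator ({\<alpha>..\<beta>} \<times> cball (0 :: real ^ 'n) R) p :: real)"
   by (intro integrable_mult_right integrable_real_indicator emeasure_bounded_finite) auto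
  show "AE p in lborel. (\<lambda>n. err (\<eta> n) p) \<longlonglongrightarrow> 0" by (rule ptw)
  show "AE p in lborel. norm (err (\<eta> n) p) <= 2 * U * V * indicator ({\<alpha>..\<beta>} \<times> cball 0 R) p" for n
   using bound[OF \<eta>(1)] by (rule AE_I2)
 qed simp
 then show ?thesis by simp
qed

text \<open>After the modulus of \<open>Psi\<close> is inserted, the integral over \<open>s\<close> of the kernel is \<open>1\<close> and the errors are
\<open>e\<close> times a volume plus a multiple of \<open>err\<close>; first \<open>\<eta>\<close> and then \<open>e\<close> tends to \<open>0\<close>.\<close>

theorem doubling:
 "0 <= (LBINT t. LBINT x. LBINT y. Psi t x t y (v t x) (v t y))"
proof -
 let ?P = "\<lambda>((t, x), y). Psi t x t y (v t x) (v t y)"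
 define V where "V = (LINT z|lborel2. (\<lambda>((t, x), y). box_ind t x y) z)"
 have U0: "0 <= U" by (rule U_nonneg)
 have iP: "integrable lborel2 ?P" by (rule Psi_diag_integrable)
 have iB: "integrable lborel2 (\<lambda>((t, x), y). box_ind t x y)"
 proof (rule integrable_bounded_pair[where A="{\<alpha>..\<beta>} \<times> cball 0 R" and B="cball 0 R" and M=1])
  show "(\<lambda>((t, x), y). box_ind t x y) \<in> borel_measurable borel2"
   unfolding borel_prod[symmetric] split_beta by measurable
 qed (auto intro: bounded_Times simp: box_ind_def indicator_def)
 have V0: "0 <= V" unfolding V_def using box_ind by (intro integral_nonneg_AE AE_I2) (simp add: split_beta)
 have main: "0 <= (LINT z|lborel2. ?P z) + e * V" if e: "0 < e" for e
 proof -
  obtain \<gamma> C where \<gamma>: "0 < \<gamma>" "0 <= C" and mod: "!!t x s y a b b'. \<alpha> <= t ==> t <= \<beta> ==> norm x <= R ==> norm y <= R ==> t <= s ==> s < t + \<gamma> ==> s <= \<beta> + 1 ==>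
   \<bar>a\<bar> <= U ==> \<bar>b\<bar> <= U ==> \<bar>b'\<bar> <= U ==> Psi t x s y a b <= Psi t x t y a b' + (e + C * \<bar>b - b'\<bar>)"
   by (rule Psi_modulus[OF e]) (rule that)
  define c where "c = min 1 (min \<gamma> ((Ts - \<beta>) / 2))"
  have c: "0 < c" "c <= 1" "c <= \<gamma>" "\<beta> + c < Ts" using \<gamma> times by (auto simp: c_def min_def field_simps)
  define \<eta> where "\<eta> n = c / real (Suc n)" for n
  have \<eta>: "0 < \<eta> n" "\<eta> n <= c" for n using c by (auto simp: \<eta>_def divide_le_eq mult_left_le)
  have \<eta>lim: "\<eta> \<longlonglongrightarrow> 0"
   using tendsto_mult_right_zero[OF LIMSEQ_inverse_real_of_nat, of c] by (simp add: \<eta>_def[abs_def] divide_inverse)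
  have \<eta>T: "\<beta> + \<eta> n < Ts" "\<eta> n <= 1" for n using \<eta>(2)[of n] c by auto
  have step: "0 <= (LINT z|lborel2. ?P z) + e * V + C * (LBINT p. err (\<eta> n) p)" for n
  proof -
   let ?d = "\<lambda>p p'. delta (\<eta> n) (fst p' - fst p)"
   obtain D where D: "!!r. \<bar>delta (\<eta> n) r\<bar> <= D" "!!r. \<bar>delta' (\<eta> n) r\<bar> <= D" "0 <= D"
    by (rule delta_bounded[OF \<eta>(1)]) (rule that)
   obtain M where M: "0 <= M" "!!t x s y a b. \<bar>a\<bar> <= U ==> \<bar>b\<bar> <= U ==> \<alpha> <= s ==> s <= \<beta> + 1 ==> \<bar>Psi t x s y a b\<bar> <= M"
    by (rule Psi_bounded) (rule that)
   define h where "h p y = Psi (fst p) (snd p) (fst p) y (v (fst p) (snd p)) (v (fst p) y) + e * box_ind (fst p) (snd p) y" for p :: "real \<times> (real ^ 'n)" and y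
   define k where "k p p' = \<bar>v (fst p') (snd p') - v (fst p) (snd p')\<bar> * box_ind (fst p) (snd p) (snd p')" for p p' :: "real \<times> (real ^ 'n)"
   have [measurable]: "(\<lambda>(p, y). h p y) \<in> borel_measurable (borel2 \<Otimes>\<^sub>M borel)" unfolding h_def by measurable
   have h_out: "h p y = 0" if "\<not> (\<alpha> <= fst p \<and> fst p <= \<beta> \<and> norm (snd p) <= R \<and> norm y <= R)" for p y
    using that Psi_outside[OF that] by (auto simp: h_def box_ind_def)
   have h_b: "\<bar>h p y\<bar> <= M + e" for p y
   proof (cases "\<alpha> <= fst p \<and> fst p <= \<beta> \<and> norm (snd p) <= R \<and> norm y <= R")
    case True
    then have "\<bar>Psi (fst p) (snd p) (fst p) y (v (fst p) (snd p)) (v (fst p) y)\<bar> <= M"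
     by (intro M(2) v_bound) auto
    moreover have "\<bar>e * box_ind (fst p) (snd p) y\<bar> <= e" using e box_ind[of "fst p" "snd p" y] by (simp add: abs_mult)
    ultimately show ?thesis unfolding h_def by linarith
   qed (use h_out M e in auto)
   have k_b: "0 <= k p p'" "k p p' <= 2 * U * 1" for p p'
   proof -
    show "0 <= k p p'" using box_ind by (simp add: k_def)
    have "\<bar>v (fst p') (snd p') - v (fst p) (snd p')\<bar> <= 2 * U"
     using v_bound[of "fst p'" "snd p'"] v_bound[of "fst p" "snd p'"] by linarith
    then show "k p p' <= 2 * U * 1" unfolding k_def using box_ind U0 by (intro mult_mono) auto
   qed
   let ?A = "{\<alpha>..\<beta>} \<times> cball (0 :: real ^ 'n) R" and ?B = "{\<alpha>..\<beta> + 1} \<times> cball (0 :: real ^ 'n) R"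
   have AB: "bounded ?A" "bounded ?B" by (auto intro: bounded_Times)
   have out: "?d p p' = 0 \<or> \<not> (\<alpha> <= fst p \<and> fst p <= \<beta> \<and> norm (snd p) <= R \<and> norm (snd p') <= R)"
    if "\<not> (p \<in> ?A \<and> p' \<in> ?B)" for p p' :: "real \<times> (real ^ 'n)"
    using that delta_zero(1)[OF \<eta>(1), of "fst p' - fst p" n] \<eta>T(2)[of n] by (cases p; cases p') force
   have i1: "integrable lborel2 (\<lambda>(p, p'). ?d p p' * h p (snd p'))"
   proof (rule integrable_bounded_pair[OF AB, where M="D * (M + e)"])
    show "(\<lambda>(p, p'). ?d p p' * h p (snd p')) \<in> borel_measurable borel2"
     unfolding borel_prod[symmetric] by measurable
    show "\<bar>(\<lambda>(p, p'). ?d p p' * h p (snd p')) (p, p')\<bar> <= D * (M + e)" for p p'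
     using mult_mono[OF D(1)[of "fst p' - fst p"] h_b[of p "snd p'"] D(3) abs_ge_zero] by (simp add: abs_mult)
    show "(\<lambda>(p, p'). ?d p p' * h p (snd p')) (p, p') = 0" if "\<not> (p \<in> ?A \<and> p' \<in> ?B)" for p p'
     using out[OF that] h_out[of p "snd p'"] by auto
   qed
   have i2: "integrable lborel2 (\<lambda>(p, p'). ?d p p' * k p p')"
   proof (rule integrable_bounded_pair[OF AB, where M="D * (2 * U * 1)"])
    show "(\<lambda>(p, p'). ?d p p' * k p p') \<in> borel_measurable borel2"
     unfolding borel_prod[symmetric] k_def by measurable
    show "\<bar>(\<lambda>(p, p'). ?d p p' * k p p') (p, p')\<bar> <= D * (2 * U * 1)" for p p'
     using mult_mono[OF D(1)[of "fst p' - fst p"] k_b(2)[of p p'] D(3) k_b(1)[of p p']] k_b(1)[of p p'] by (simp add: abs_mult)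
    show "(\<lambda>(p, p'). ?d p p' * k p p') (p, p') = 0" if "\<not> (p \<in> ?A \<and> p' \<in> ?B)" for p p'
     using out[OF that] by (auto simp: k_def box_ind_def)
   qed
   have "0 <= (LINT z|lborel2. (\<lambda>((t, x), (s, y)). delta (\<eta> n) (s - t) * Psi t x s y (v t x) (v s y)) z)"
    by (rule doubled_entropy(2)[OF \<eta>(1) \<eta>T])
   also have "... <= (LINT z|lborel2. (\<lambda>(p, p'). ?d p p' * h p (snd p')) z + C * (\<lambda>(p, p'). ?d p p' * k p p') z)"
   proof (rule Bochner_Integration.integral_mono[OF doubled_entropy(1)[OF \<eta>(1) \<eta>T] Bochner_Integration.integrable_add[OF i1 integrable_mult_right[OF i2]]])
    fix z :: "(real \<times> (real ^ 'n)) \<times> (real \<times> (real ^ 'n))"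
    obtain t x s y where z: "z = ((t, x), (s, y))" by (metis prod.exhaust)
    have "delta (\<eta> n) (s - t) * Psi t x s y (v t x) (v s y) <= delta (\<eta> n) (s - t) * (h (t, x) y + C * k (t, x) (s, y))"
    proof (cases "0 < s - t \<and> s - t < \<eta> n \<and> active t x y")
     case True
     then have "Psi t x s y (v t x) (v s y) <= Psi t x t y (v t x) (v t y) + (e + C * \<bar>v s y - v t y\<bar>)"
      using \<eta>(2)[of n] \<eta>T[of n] c by (intro mod v_bound) auto
     also have "... = h (t, x) y + C * k (t, x) (s, y)" using True by (simp add: h_def k_def box_ind_def)
     finally show ?thesis by (intro mult_left_mono delta_integral(1)[OF \<eta>(1)])
    next
     case False
     then consider "s - t <= 0 \<or> \<eta> n <= s - t" | "\<not> active t x y" by linarith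
     then show ?thesis
     proof cases
      case 1
      then show ?thesis using delta_zero(1)[OF \<eta>(1), of "s - t" n] by simp
     next
      case 2
      then have "h (t, x) y = 0" "k (t, x) (s, y) = 0" "Psi t x s y (v t x) (v s y) = 0"
       using h_out[of "(t, x)" y] Psi_outside[OF 2] by (auto simp: k_def box_ind_def)
      then show ?thesis by simp
     qed
    qed
    then show "(\<lambda>((t, x), (s, y)). delta (\<eta> n) (s - t) * Psi t x s y (v t x) (v s y)) z <= (\<lambda>(p, p'). ?d p p' * h p (snd p')) z + C * (\<lambda>(p, p'). ?d p p' * k p p') z"
     unfolding z by (simp add: algebra_simps)
   qed
   also have "... = (LINT z|lborel2. (\<lambda>(p, p'). ?d p p' * h p (snd p')) z) + C * (LINT z|lborel2. (\<lambda>(p, p'). ?d p p' * k p p') z)"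
    by (subst Bochner_Integration.integral_add[OF i1 integrable_mult_right[OF i2]]) simp
   also have "(LINT z|lborel2. (\<lambda>(p, p'). ?d p p' * h p (snd p')) z) = (LBINT p. LINT p'|lborel. ?d p p' * h p (snd p'))"
    by (rule lborel_pair.integral_fst[OF i1, symmetric])
   also have "... = (LBINT p. LBINT y. h p y)"
   proof (rule Bochner_Integration.integral_cong[OF refl])
    fix p :: "real \<times> (real ^ 'n)"
    have "Borel (\<lambda>y. h p y)" unfolding h_def by measurable
    then show "(LINT p'|lborel. ?d p p' * h p (snd p')) = (LBINT y. h p y)"
     by (rule delta_convolve[OF \<eta>(1) _ h_b]) (use h_out[of p] in auto)
   qed
   also have "... = (LINT z|lborel2. (\<lambda>(p, y). h p y) z)"
   proof (rule lborel_pair.integral_fst)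
    have "(\<lambda>(p, y). h p y) = (\<lambda>z. ?P z + e * (\<lambda>((t, x), y). box_ind t x y) z)" by (auto simp: h_def fun_eq_iff)
    then show "integrable lborel2 (\<lambda>(p, y). h p y)"
     using Bochner_Integration.integrable_add[OF iP integrable_mult_right[OF iB, of e]] by (simp only:)
   qed
   also have "... = (LINT z|lborel2. ?P z + e * (\<lambda>((t, x), y). box_ind t x y) z)"
    by (intro Bochner_Integration.integral_cong refl) (auto simp: h_def)
   also have "... = (LINT z|lborel2. ?P z) + e * V"
    unfolding V_def by (subst Bochner_Integration.integral_add[OF iP integrable_mult_right[OF iB]]) simp
   also have "(LINT z|lborel2. (\<lambda>(p, p'). ?d p p' * k p p') z) = (LBINT p. LINT p'|lborel. ?d p p' * k p p')"
    by (rule lborel_pair.integral_fst[OF i2, symmetric])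
   also have "... = (LBINT p. err (\<eta> n) p)" by (simp add: err_def k_def)
   finally show ?thesis .
  qed
  have "(\<lambda>n. (LINT z|lborel2. ?P z) + e * V + C * (LBINT p. err (\<eta> n) p)) \<longlonglongrightarrow> (LINT z|lborel2. ?P z) + e * V + C * 0"
   by (intro tendsto_intros err_tendsto \<eta>(1) \<eta>lim \<eta>T(1))
  then have "0 <= (LINT z|lborel2. ?P z) + e * V + C * 0"
   by (rule LIMSEQ_le_const) (use step in auto)
  then show ?thesis by simp
 qed
 have "0 <= (LINT z|lborel2. ?P z)"
 proof (rule ccontr)
  assume neg: "\<not> ?thesis"
  define I where "I = (LINT z|lborel2. ?P z)"
  have I: "I < 0" using neg by (simp add: I_def)
  define e where "e = - I / (2 * (V + 1))"
  have e: "0 < e" using I V0 by (simp add: e_def divide_neg_pos)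
  have "e * V <= e * (V + 1)" using e by simp
  also have "... = - I / 2" using V0 by (simp add: e_def field_simps)
  finally show False using main[OF e] I unfolding I_def[symmetric] by linarith
 qed
 also have "(LINT z|lborel2. ?P z) = (LBINT p. LBINT y. ?P (p, y))"
  using lborel_pair.integral_fst[of "\<lambda>p y. ?P (p, y)"] iP by (simp add: split_beta')
 also have "... = (LBINT t. LBINT x. LBINT y. Psi t x t y (v t x) (v t y))"
 proof -
  have "integrable lborel2 (\<lambda>(t, x). LBINT y. Psi t x t y (v t x) (v t y))"
   using lborel_pair.integrable_fst[of "\<lambda>p y. ?P (p, y)"] iP by (simp add: split_beta' lborel_prod)
  from lborel_pair.integral_fst[OF this] show ?thesis by (simp add: lborel_prod split_beta')
 qed
 finally show ?thesis .
qed

end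

section \<open>The energy and its growth\<close>

text \<open>A \<open>C\<^sup>1\<close> monotone switch from \<open>0\<close> on \<open>(-\<infinity>, 0]\<close> to \<open>1\<close> on \<open>[1, \<infinity>)\<close>, and its derivative.\<close>

definition theta :: "real => real" where "theta r = 1 - pos_sq (1 - pos_sq r)"
definition theta' :: "real => real" where "theta' r = 4 * max 0 (1 - pos_sq r) * max 0 r"

lemma theta_DERIV: "(theta has_real_derivative theta' r) (at r)"
 unfolding theta_def[abs_def] theta'_def by (auto intro!: derivative_eq_intros)

lemma theta'_nonneg: "0 <= theta' r" by (simp add: theta'_def)

lemma theta_bounds: "0 <= theta r" "theta r <= 1"
 unfolding theta_def using pos_sq_le_1[of "1 - pos_sq r"] by auto

lemma theta_le_0: "r <= 0 ==> theta r = 0" "r <= 0 ==> theta' r = 0"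
 by (auto simp: theta_def theta'_def pos_sq_def max_def)

lemma theta_ge_1: "1 <= r ==> theta r = 1" "1 <= r ==> theta' r = 0"
proof -
 assume "1 <= r"
 then have "1 <= pos_sq r" by (simp add: pos_sq_def max_def one_le_power)
 then show "theta r = 1" "theta' r = 0" by (auto simp: theta_def theta'_def max_def)
qed

lemma theta_mono: "r <= s ==> theta r <= theta s"
 by (rule DERIV_nonneg_imp_nondecreasing[of r s theta]) (auto intro!: exI[of _ "theta' _"] theta_DERIV theta'_nonneg)

lemma continuous_on_theta [continuous_intros]:
 assumes "continuous_on S g"
 shows "continuous_on S (\<lambda>x. theta (g x))" "continuous_on S (\<lambda>x. theta' (g x))"
 unfolding theta_def theta'_def using assms by (auto intro!: continuous_intros)

lemma measurable_theta [measurable]: "Borel theta" "Borel theta'"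
 by (auto intro!: borel_measurable_continuous_onI continuous_intros)

lemma theta'_bounded: "theta' r <= 4"
proof -
 consider "r <= 0" | "0 < r \<and> r < 1" | "1 <= r" by linarith
 then show ?thesis
 proof cases
  case 2
  then have "max 0 (1 - pos_sq r) * max 0 r <= 1 * 1" by (intro mult_mono) auto
  then show ?thesis by (simp add: theta'_def)
 qed (auto simp: theta_le_0 theta_ge_1)
qed

text \<open>A density of mass \<open>1\<close> on \<open>(c, c + h)\<close>: as \<open>h\<close> tends to \<open>0\<close> it averages over times just after \<open>c\<close>.\<close>

definition avg :: "real => real => real => real" where
 "avg c h t = theta' ((t - c) / h) / h"

lemma avg_zero: "0 < h ==> t <= c \<or> c + h <= t ==> avg c h t = 0"
 unfolding avg_def by (auto simp: theta_le_0 theta_ge_1 divide_le_0_iff)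

lemma avg_nonneg: "0 < h ==> 0 <= avg c h t"
 unfolding avg_def using theta'_nonneg by simp

lemma measurable_avg [measurable]: "Borel (avg c h)"
 unfolding avg_def by measurable

lemma theta_scaled_DERIV:
 assumes "0 < h"
 shows "((\<lambda>t. theta ((t - c) / h)) has_real_derivative avg c h t) (at t)"
proof -
 have "((\<lambda>t. (t - c) / h) has_real_derivative 1 / h) (at t)" using assms by (auto intro!: derivative_eq_intros)
 from DERIV_chain2[OF theta_DERIV this] show ?thesis by (simp add: avg_def)
qed

lemma avg_integral:
 assumes "0 < h"
 shows "integrable lborel (avg c h)" "(LBINT t. avg c h t) = 1"
proof -
 have eq: "avg c h = (\<lambda>t. avg c h t * indicator {c..c + h} t)"
 proof (rule ext)
  fix t
  show "avg c h t = avg c h t * indicator {c..c + h} t"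
   by (cases "t <= c \<or> c + h <= t") (use avg_zero[OF assms, of t c] in \<open>auto simp: indicator_def\<close>)
 qed
 have "isCont (avg c h) t" for t
 proof -
  have "continuous_on UNIV (avg c h)" unfolding avg_def using assms by (intro continuous_intros) auto
  then show ?thesis by (simp add: continuous_on_eq_continuous_at)
 qed
 then have hb: "has_bochner_integral lborel (\<lambda>t. avg c h t * indicator {c..c + h} t) (theta ((c + h - c) / h) - theta ((c - c) / h))"
  using assms by (intro has_bochner_integral_FTC_Icc_real[OF _ theta_scaled_DERIV]) auto
 then have "has_bochner_integral lborel (avg c h) 1"
  unfolding eq[symmetric] using assms by (simp add: theta_le_0 theta_ge_1)
 then show "integrable lborel (avg c h)" "(LBINT t. avg c h t) = 1"
  by (auto simp: has_bochner_integral_iff)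
qed

lemma avg_tendsto:
 assumes [measurable]: "Borel e" and M: "!!t. \<bar>e t\<bar> <= M"
  and lim: "!!\<epsilon>. 0 < \<epsilon> ==> \<exists>r>0. AE t in lborel. c < t \<and> t < c + r --> \<bar>e t - l\<bar> <= \<epsilon>"
  and h: "!!n. 0 < h n" "h \<longlonglongrightarrow> 0"
 shows "(\<lambda>n. LBINT t. avg c (h n) t * e t) \<longlonglongrightarrow> l"
proof (rule LIMSEQ_I)
 fix \<epsilon> :: real assume "0 < \<epsilon>"
 then have e2: "0 < \<epsilon> / 2" by simp
 obtain r where r: "0 < r" "AE t in lborel. c < t \<and> t < c + r --> \<bar>e t - l\<bar> <= \<epsilon> / 2"
  using lim[OF e2] by blast
 obtain n0 where n0: "!!n. n \<ge> n0 ==> h n < r"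
  using order_tendstoD(2)[OF h(2) r(1)] unfolding eventually_sequentially by blast
 show "\<exists>no. \<forall>n\<ge>no. norm ((LBINT t. avg c (h n) t * e t) - l) < \<epsilon>"
 proof (intro exI allI impI)
  fix n assume n: "n0 <= n"
  have i1: "integrable lborel (\<lambda>t. avg c (h n) t * e t)"
  proof (rule Bochner_Integration.integrable_bound)
   show "integrable lborel (\<lambda>t. avg c (h n) t * M)" by (rule integrable_mult_left[OF avg_integral(1)[OF h(1)]])
   have "norm (avg c (h n) t * e t) <= norm (avg c (h n) t * M)" for t
    using mult_left_mono[OF order_trans[OF M[of t] abs_ge_self[of M]] avg_nonneg[OF h(1)[of n], of c t]] avg_nonneg[OF h(1)[of n], of c t]
    by (simp add: abs_mult)
   then show "AE t in lborel. norm (avg c (h n) t * e t) <= norm (avg c (h n) t * M)" by simp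
  qed measurable
  have i2: "integrable lborel (\<lambda>t. avg c (h n) t * l)"
   by (rule integrable_mult_left[OF avg_integral(1)[OF h(1)]])
  have "(LBINT t. avg c (h n) t * e t) - l = (LBINT t. avg c (h n) t * e t) - (LBINT t. avg c (h n) t * l)"
   using avg_integral(2)[OF h(1)] by simp
  also have "... = (LBINT t. avg c (h n) t * e t - avg c (h n) t * l)"
   using i1 i2 by simp
  finally have "norm ((LBINT t. avg c (h n) t * e t) - l) = norm (LBINT t. avg c (h n) t * e t - avg c (h n) t * l)" by simp
  also have "... <= (LBINT t. norm (avg c (h n) t * e t - avg c (h n) t * l))"
   by (rule integral_norm_bound)
  also have "... <= (LBINT t. avg c (h n) t * (\<epsilon> / 2))"
  proof (rule integral_mono_AE)
   show "integrable lborel (\<lambda>t. norm (avg c (h n) t * e t - avg c (h n) t * l))" using i1 i2 by simp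
   show "integrable lborel (\<lambda>t. avg c (h n) t * (\<epsilon> / 2))" by (rule integrable_mult_left[OF avg_integral(1)[OF h(1)]])
   show "AE t in lborel. norm (avg c (h n) t * e t - avg c (h n) t * l) <= avg c (h n) t * (\<epsilon> / 2)"
    using r(2)
   proof eventually_elim
    case (elim t)
    show ?case
    proof (cases "c < t \<and> t < c + h n")
     case True
     then have "\<bar>e t - l\<bar> <= \<epsilon> / 2" using elim n0[OF n] by auto
     moreover have "avg c (h n) t * e t - avg c (h n) t * l = avg c (h n) t * (e t - l)" by (simp add: algebra_simps)
     ultimately show ?thesis using avg_nonneg[OF h(1), of c n t] by (simp only: real_norm_def abs_mult abs_of_nonneg) (rule mult_left_mono)
    next
     case False
     then show ?thesis using avg_zero[OF h(1), of t c n] by auto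
    qed
   qed
  qed
  also have "... = \<epsilon> / 2" using avg_integral(2)[OF h(1)] by (simp only: integral_mult_left_zero)
  finally show "norm ((LBINT t. avg c (h n) t * e t) - l) < \<epsilon>" using \<open>0 < \<epsilon>\<close> by linarith
 qed
qed

lemma triple_iterated:
 fixes k :: "real => 'a::euclidean_space => 'b::euclidean_space => real"
 assumes "integrable lborel2 (\<lambda>((t, x), y). k t x y)"
 shows "(LINT z|lborel2. (\<lambda>((t, x), y). k t x y) z) = (LBINT t. LBINT x. LBINT y. k t x y)"
  "integrable lborel (\<lambda>t. LBINT x. LBINT y. k t x y)"
proof -
 let ?P = "\<lambda>((t, x), y). k t x y"
 have 1: "(LINT z|lborel2. ?P z) = (LBINT p. LBINT y. ?P (p, y))"
  using lborel_pair.integral_fst[of "\<lambda>p y. ?P (p, y)"] assms by (simp add: split_beta')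
 have i: "integrable lborel2 (\<lambda>(t, x). LBINT y. k t x y)"
  using lborel_pair.integrable_fst[of "\<lambda>p y. ?P (p, y)"] assms by (simp add: split_beta' lborel_prod)
 show "(LINT z|lborel2. ?P z) = (LBINT t. LBINT x. LBINT y. k t x y)"
  using 1 lborel_pair.integral_fst[OF i] by (simp add: lborel_prod split_beta')
 show "integrable lborel (\<lambda>t. LBINT x. LBINT y. k t x y)"
  by (rule lborel_pair.integrable_fst[OF i])
qed

text \<open>The three hypotheses on the coefficients concern pairs with \<open>v(t,x) \<noteq> v(t,y)\<close> only. That restriction
allows the constants to be taken near the support of the solution.\<close>

locale energy = entropy_core f F d v Ts U
 for f :: "real => real ^ 'n => real => real ^ 'n" and F d v Ts U +
 fixes a b Te A K L q Rc :: real
 assumes ab: "0 < a" "a < b" "b < Te" "Te < Ts"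
  and params: "0 <= A" "0 <= K" "0 <= L" "1 <= q"
  and hyp_f: "a <= t ==> t <= Te ==> norm x <= Rc ==> norm (x - y) <= 1 / sqrt q ==> v t x ~= v t y ==>
   norm ((f t x (max (v t x) (v t y)) - f t x (min (v t x) (v t y))) - (f t y (max (v t x) (v t y)) - f t y (min (v t x) (v t y)))) <= A * norm (x - y) * \<bar>v t x - v t y\<bar>"
  and hyp_L: "a <= t ==> t <= Te ==> norm x <= Rc ==> norm (x - y) <= 1 / sqrt q ==> v t x ~= v t y ==>
   norm (f t x (max (v t x) (v t y)) - f t x (min (v t x) (v t y))) <= L * \<bar>v t x - v t y\<bar>"
  and hyp_K: "a <= t ==> t <= Te ==> norm x <= Rc ==> norm (x - y) <= 1 / sqrt q ==> v t x ~= v t y ==>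
   (F t x (max (v t x) (v t y)) - F t x (min (v t x) (v t y))) + (d t y (max (v t x) (v t y)) - d t y (min (v t x) (v t y))) <= K * \<bar>v t x - v t y\<bar>"
begin

text \<open>\<open>psi\<close> cuts off to a backward cone of speed \<open>L\<close>; \<open>sqrt (1 + x \<bullet> x)\<close> is a smooth substitute for the norm
whose gradient has length below \<open>1\<close>. \<open>chi\<close> restricts to the times between \<open>a\<close> and \<open>b\<close>, switching on
after \<open>a\<close> and off after \<open>b\<close>, in accordance with right continuity.\<close>

definition qt :: "real => real" where "qt t = q * exp (2 * A * t)"
definition psi :: "real => real ^ 'n => real" where "psi t x = theta (Rc - L * t - sqrt (1 + x \<bullet> x))"
definition psi' :: "real => real ^ 'n => real" where "psi' t x = theta' (Rc - L * t - sqrt (1 + x \<bullet> x))"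
definition Theta :: "real => real ^ 'n => real ^ 'n => real" where
 "Theta t x y = exp (- K * t) * (bump (qt t) (x - y) * psi t x)"
definition chi :: "real => real => real" where "chi h t = theta ((t - a) / h) - theta ((t - b) / h)"
definition chi' :: "real => real => real" where "chi' h t = avg a h t - avg b h t"
definition Phi :: "real => real => real ^ 'n => real ^ 'n => real" where
 "Phi h t x y = chi h t * Theta t x y"
definition Phi_t :: "real => real => real ^ 'n => real ^ 'n => real" where
 "Phi_t h t x y = chi' h t * Theta t x y + chi h t * (- K * Theta t x y
   - exp (- K * t) * (A * (bump_grad (qt t) (x - y) \<bullet> (x - y)) * psi t x + L * bump (qt t) (x - y) * psi' t x))"
definition Phi_x :: "real => real => real ^ 'n => real ^ 'n => real ^ 'n" where
 "Phi_x h t x y = (chi h t * exp (- K * t)) *\<^sub>R (- psi t x *\<^sub>R bump_grad (qt t) (x - y) - (bump (qt t) (x - y) * psi' t x / sqrt (1 + x \<bullet> x)) *\<^sub>R x)"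
definition Phi_y :: "real => real => real ^ 'n => real ^ 'n => real ^ 'n" where
 "Phi_y h t x y = (chi h t * exp (- K * t) * psi t x) *\<^sub>R bump_grad (qt t) (x - y)"

lemma psi_outside:
 assumes "0 <= t" "norm x > Rc"
 shows "psi t x = 0" "psi' t x = 0"
proof -
 have "norm x <= sqrt (1 + x \<bullet> x)"
  by (simp add: norm_eq_sqrt_inner)
 moreover have "0 <= L * t" using assms params by simp
 ultimately have "Rc - L * t - sqrt (1 + x \<bullet> x) <= 0" using assms by linarith
 then show "psi t x = 0" "psi' t x = 0" by (auto simp: psi_def psi'_def theta_le_0)
qed

lemma qt_ge: "0 <= t ==> q <= qt t" "0 < qt t"
proof -
 show "0 < qt t" using params by (simp add: qt_def)
 assume "0 <= t"
 then have "1 <= exp (2 * A * t)" using params by simp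
 then show "q <= qt t" using params mult_left_mono[of 1 "exp (2 * A * t)" q] by (simp add: qt_def)
qed

lemma bump_qt_outside:
 assumes "0 <= t" "norm z > 1 / sqrt q"
 shows "bump (qt t) z = 0" "bump_grad (qt t) z = 0"
proof -
 have "1 / sqrt (qt t) <= 1 / sqrt q" using qt_ge[of t] assms params by (simp add: frac_le)
 then have "norm z > 1 / sqrt (qt t)" using assms by linarith
 then show "bump (qt t) z = 0" "bump_grad (qt t) z = 0"
  using qt_ge(2) by (auto intro: bump_zero_outside bump_grad_zero_outside)
qed

lemma q_radius: "1 / sqrt q <= 1" using params by simp

lemma chi_outside:
 assumes "0 < h" "\<not> (a <= t \<and> t <= b + h)"
 shows "chi h t = 0" "chi' h t = 0"
proof -
 consider "t < a" | "b + h < t" using assms by linarith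
 then have "chi h t = 0 \<and> chi' h t = 0"
 proof cases
  case 1
  then show ?thesis using assms ab by (auto simp: chi_def chi'_def theta_le_0 avg_zero divide_le_0_iff)
 next
  case 2
  then have "1 <= (t - a) / h" "1 <= (t - b) / h" using assms ab by (auto simp: le_divide_eq)
  then show ?thesis using 2 assms ab by (auto simp: chi_def chi'_def theta_ge_1 avg_zero)
 qed
 then show "chi h t = 0" "chi' h t = 0" by auto
qed

lemma chi_bounds:
 assumes "0 < h"
 shows "0 <= chi h t" "chi h t <= 1"
proof -
 have "(t - b) / h <= (t - a) / h" using assms ab by (simp add: divide_right_mono)
 then show "0 <= chi h t" using theta_mono unfolding chi_def by simp
 show "chi h t <= 1" using theta_bounds[of "(t - a) / h"] theta_bounds[of "(t - b) / h"] unfolding chi_def by linarith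
qed

lemma chi_DERIV: "0 < h ==> (chi h has_real_derivative chi' h t) (at t)"
 unfolding chi_def[abs_def] chi'_def by (rule DERIV_diff[OF theta_scaled_DERIV theta_scaled_DERIV])

lemma Theta_bounds:
 assumes "0 <= t"
 shows "0 <= Theta t x y" "Theta t x y <= 1"
proof -
 have b: "0 <= bump (qt t) (x - y)" "bump (qt t) (x - y) <= 1" using bump_le_1[of "qt t"] qt_ge(2)[of t] by auto
 have p: "0 <= psi t x" "psi t x <= 1" unfolding psi_def by (rule theta_bounds)+
 show "0 <= Theta t x y" unfolding Theta_def using b p by simp
 have "bump (qt t) (x - y) * psi t x <= 1 * 1" using b p by (intro mult_mono) auto
 moreover have "exp (- K * t) <= 1" using params assms by simp
 ultimately have "exp (- K * t) * (bump (qt t) (x - y) * psi t x) <= 1 * 1" using b p by (intro mult_mono) auto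
 then show "Theta t x y <= 1" by (simp add: Theta_def)
qed

lemma Theta_le: "Theta t x y <= exp (- K * t) * bump (qt t) (x - y)"
 unfolding Theta_def psi_def by (intro mult_left_mono) (simp_all add: mult_left_le theta_bounds)

lemma Theta_outside:
 assumes "0 <= t" "\<not> (norm x <= Rc \<and> norm y <= Rc + 1)"
 shows "Theta t x y = 0"
proof (cases "norm x <= Rc")
 case True
 then have "norm (x - y) > 1" using assms(2) norm_triangle_ineq2[of y x] by (simp add: norm_minus_commute)
 then have "norm (x - y) > 1 / sqrt q" using q_radius by linarith
 then show ?thesis using assms by (simp add: Theta_def bump_qt_outside)
qed (use assms psi_outside in \<open>simp add: Theta_def\<close>)

lemma continuous_on_Theta:
 assumes "continuous_on S t" "continuous_on S x" "continuous_on S y"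
 shows "continuous_on S (\<lambda>z. Theta (t z) (x z) (y z))"
 unfolding Theta_def psi_def bump_def qt_def using assms by (intro continuous_intros)

lemma measurable_Theta [measurable (raw)]:
 assumes "t \<in> borel_measurable M" "x \<in> borel_measurable M" "y \<in> borel_measurable M"
 shows "(\<lambda>z. Theta (t z) (x z) (y z)) \<in> borel_measurable M"
proof -
 have "continuous_on UNIV (\<lambda>z. Theta (fst z) (fst (snd z)) (snd (snd z)))"
  by (intro continuous_on_Theta continuous_intros)
 from measurable_compose[OF borel_measurable_Pair[OF assms(1) borel_measurable_Pair[OF assms(2,3)]] borel_measurable_continuous_onI[OF this]]
 show ?thesis by simp
qed

lemma doubling_test_Phi:
 assumes h: "0 < h" "b + h <= Te"
 shows "doubling_test f F d v Ts U (Phi h) (Phi_t h) (Phi_x h) (Phi_y h) a (b + h) (Rc + 1)"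
proof
 fix t :: real and x y :: "real ^ 'n"
 let ?p = "(t, x, y)"
 have pos: "0 < 1 + x \<bullet> x" using inner_ge_zero[of x] by linarith
 have D1: "((\<lambda>p :: real \<times> (real ^ 'n) \<times> (real ^ 'n). chi h (fst p)) has_derivative (\<lambda>k. chi' h t * fst k)) (at ?p)"
  using has_derivative_compose[of fst fst ?p UNIV "chi h" "(*) (chi' h t)"] chi_DERIV[OF h(1), of t]
  by (simp add: has_field_derivative_def bounded_linear_fst bounded_linear_imp_has_derivative)
 have D2: "((\<lambda>p :: real \<times> (real ^ 'n) \<times> (real ^ 'n). exp (- K * fst p)) has_derivative (\<lambda>k. - K * exp (- K * t) * fst k)) (at ?p)"
  by (auto intro!: derivative_eq_intros)
 have D3: "((\<lambda>p :: real \<times> (real ^ 'n) \<times> (real ^ 'n). bump (qt (fst p)) (fst (snd p) - snd (snd p))) has_derivative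
   (\<lambda>k. - A * (bump_grad (qt t) (x - y) \<bullet> (x - y)) * fst k - bump_grad (qt t) (x - y) \<bullet> (fst (snd k) - snd (snd k)))) (at ?p)"
  unfolding bump_def qt_def
  by (rule derivative_eq_intros refl)+ (auto simp: bump_grad_def fun_eq_iff algebra_simps inner_commute)
 have D4: "((\<lambda>p :: real \<times> (real ^ 'n) \<times> (real ^ 'n). psi (fst p) (fst (snd p))) has_derivative
   (\<lambda>k. psi' t x * (- L * fst k - (x \<bullet> fst (snd k)) / sqrt (1 + x \<bullet> x)))) (at ?p)"
 proof -
  have "((\<lambda>p :: real \<times> (real ^ 'n) \<times> (real ^ 'n). Rc - L * fst p - sqrt (1 + fst (snd p) \<bullet> fst (snd p))) has_derivative
   (\<lambda>k. - L * fst k - (x \<bullet> fst (snd k)) / sqrt (1 + x \<bullet> x))) (at ?p)"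
   using pos by (auto intro!: derivative_eq_intros simp: inner_commute divide_simps)
  from has_derivative_compose[OF this, of theta "(*) (psi' t x)"] theta_DERIV[of "Rc - L * t - sqrt (1 + x \<bullet> x)"]
  show ?thesis by (simp add: psi_def psi'_def has_field_derivative_def)
 qed
 have "((\<lambda>p. chi h (fst p) * (exp (- K * fst p) * (bump (qt (fst p)) (fst (snd p) - snd (snd p)) * psi (fst p) (fst (snd p))))) has_derivative
   (\<lambda>k. Phi_t h t x y * fst k + Phi_x h t x y \<bullet> fst (snd k) + Phi_y h t x y \<bullet> snd (snd k))) (at ?p)"
  by (rule has_derivative_eq_rhs[OF has_derivative_mult[OF D1 has_derivative_mult[OF D2 has_derivative_mult[OF D3 D4]]]])
    (simp add: fun_eq_iff Phi_t_def Phi_x_def Phi_y_def Theta_def algebra_simps inner_diff_left inner_diff_right)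
 then show "((\<lambda>(t, x, y). Phi h t x y) has_derivative (\<lambda>(\<tau>, \<xi>, \<upsilon>). Phi_t h t x y * \<tau> + Phi_x h t x y \<bullet> \<xi> + Phi_y h t x y \<bullet> \<upsilon>)) (at (t, x, y))"
  by (simp add: Phi_def Theta_def split_beta')
next
 have bg: "continuous_on UNIV (\<lambda>z :: real \<times> (real ^ 'n) \<times> (real ^ 'n). bump_grad (qt (fst z)) (fst (snd z) - snd (snd z)))"
  unfolding bump_grad_def qt_def by (intro continuous_intros)
 have pos: "0 < 1 + x \<bullet> x" for x :: "real ^ 'n" using inner_ge_zero[of x] by linarith
 have chi_c: "continuous_on UNIV (\<lambda>z :: real \<times> (real ^ 'n) \<times> (real ^ 'n). chi h (fst z))"
  unfolding chi_def using h by (intro continuous_intros) auto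
 have chi'_c: "continuous_on UNIV (\<lambda>z :: real \<times> (real ^ 'n) \<times> (real ^ 'n). chi' h (fst z))"
  unfolding chi'_def avg_def using h by (intro continuous_intros) auto
 note c = continuous_on_Theta bg chi_c chi'_c
 show "continuous_on UNIV (\<lambda>(t, x, y). Phi_t h t x y)"
  unfolding Phi_t_def split_beta psi_def psi'_def qt_def by (intro continuous_intros c[unfolded qt_def])
 show "continuous_on UNIV (\<lambda>(t, x, y). Phi_x h t x y)"
  unfolding Phi_x_def split_beta psi_def psi'_def qt_def using pos by (intro continuous_intros c[unfolded qt_def]) (auto simp: less_imp_neq[symmetric])
 show "continuous_on UNIV (\<lambda>(t, x, y). Phi_y h t x y)"
  unfolding Phi_y_def split_beta psi_def psi'_def qt_def by (intro continuous_intros c[unfolded qt_def])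
next
 fix t :: real and x y :: "real ^ 'n"
 show "0 <= Phi h t x y"
 proof (cases "a <= t")
  case True
  then show ?thesis unfolding Phi_def using chi_bounds[OF h(1)] Theta_bounds[of t] ab by simp
 next
  case False
  then show ?thesis using chi_outside[OF h(1), of t] by (simp add: Phi_def)
 qed
next
 fix t :: real and x y :: "real ^ 'n" assume *: "\<not> (a <= t \<and> t <= b + h \<and> norm x <= Rc + 1 \<and> norm y <= Rc + 1)"
 show "Phi h t x y = 0 \<and> Phi_t h t x y = 0 \<and> Phi_x h t x y = 0 \<and> Phi_y h t x y = 0"
 proof (cases "a <= t \<and> t <= b + h")
  case False
  then show ?thesis using chi_outside[OF h(1) False] by (simp add: Phi_def Phi_t_def Phi_x_def Phi_y_def)
 next
  case True
  then have t: "0 <= t" using ab by simp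
  show ?thesis
  proof (cases "norm x <= Rc")
   case x: True
   then have "norm y > Rc + 1" using * True by auto
   then have "norm (x - y) > 1" using x norm_triangle_ineq2[of y x] by (simp add: norm_minus_commute)
   then have "norm (x - y) > 1 / sqrt q" using q_radius by linarith
   from bump_qt_outside[OF t this] show ?thesis by (simp add: Phi_def Phi_t_def Phi_x_def Phi_y_def Theta_def)
  next
   case False
   then have "norm x > Rc" by simp
   from psi_outside[OF t this] show ?thesis by (simp add: Phi_def Phi_t_def Phi_x_def Phi_y_def Theta_def)
  qed
 qed
next
 show "0 < a" "b + h < Ts" using ab h by auto
qed

text \<open>The heart of the estimate. The radial derivative of the kernel satisfies
\<open>bump_grad z \<bullet> z = |bump_grad z| |z|\<close>, so the time derivative of the shrinking radius compensates the
flux difference; the speed of the cone compensates the flux through its boundary, and \<open>exp(-K t)\<close> the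
zero order terms.\<close>

lemma Psi_le:
 assumes h: "0 < h" "b + h <= Te" and t: "a <= t" "t <= b + h"
 shows "doubling_test.Psi f F d (Phi h) (Phi_t h) (Phi_x h) (Phi_y h) t x t y (v t x) (v t y)
  <= chi' h t * (\<bar>v t x - v t y\<bar> * Theta t x y) + chi h t * (\<bar>(F t x (v t y) - d t x (v t y)) - (F t y (v t y) - d t y (v t y))\<bar> * Theta t x y)"
proof -
 interpret dt: doubling_test f F d v Ts U "Phi h" "Phi_t h" "Phi_x h" "Phi_y h" a "b + h" "Rc + 1"
  by (rule doubling_test_Phi[OF h])
 let ?M = "max (v t x) (v t y)" and ?m = "min (v t x) (v t y)" and ?z = "x - y" and ?e = "exp (- K * t)"
 let ?fx = "f t x ?M - f t x ?m" and ?fy = "f t y ?M - f t y ?m"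
 let ?FD = "(F t x ?M - F t x ?m) + (d t y ?M - d t y ?m)"
 let ?bg = "bump_grad (qt t) ?z" and ?b = "bump (qt t) ?z"
 have t0: "0 <= t" using t ab by simp
 have chi0: "0 <= chi h t" by (rule chi_bounds[OF h(1)])
 have p: "0 <= psi t x" "0 <= psi' t x" unfolding psi_def psi'_def by (auto simp: theta_bounds theta'_nonneg)
 have key: "\<bar>v t x - v t y\<bar> * (- K * Theta t x y - ?e * (A * (?bg \<bullet> ?z) * psi t x + L * ?b * psi' t x))
   + ?fx \<bullet> (?e *\<^sub>R (- psi t x *\<^sub>R ?bg - (?b * psi' t x / sqrt (1 + x \<bullet> x)) *\<^sub>R x)) + ?fy \<bullet> ((?e * psi t x) *\<^sub>R ?bg) + ?FD * Theta t x y <= 0"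
 proof (cases "v t x ~= v t y \<and> norm x <= Rc \<and> norm ?z <= 1 / sqrt q")
  case True
  have tT: "t <= Te" using t h by simp
  have bgz: "?bg \<bullet> ?z = norm ?bg * norm ?z"
  proof -
   have "0 <= 4 * qt t * max 0 (1 - qt t * (?z \<bullet> ?z))" using qt_ge(2)[of t] by simp
   then show ?thesis by (simp add: bump_grad_def dot_square_norm power2_eq_square)
  qed
  have 1: "- ((?fx - ?fy) \<bullet> ?bg) <= A * \<bar>v t x - v t y\<bar> * (?bg \<bullet> ?z)"
  proof -
   have "- ((?fx - ?fy) \<bullet> ?bg) <= norm (?fx - ?fy) * norm ?bg"
    using Cauchy_Schwarz_ineq2[of "?fx - ?fy" ?bg] by linarith
   also have "... <= (A * norm ?z * \<bar>v t x - v t y\<bar>) * norm ?bg"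
    using True t tT by (intro mult_right_mono hyp_f) auto
   finally show ?thesis unfolding bgz by (simp add: mult_ac)
  qed
  have 2: "- (?fx \<bullet> x) / sqrt (1 + x \<bullet> x) <= L * \<bar>v t x - v t y\<bar>"
  proof -
   have nx: "norm x <= sqrt (1 + x \<bullet> x)" by (simp add: norm_eq_sqrt_inner)
   have s0: "0 < sqrt (1 + x \<bullet> x)" by (simp add: add_pos_nonneg)
   have "- (?fx \<bullet> x) <= norm ?fx * norm x" using Cauchy_Schwarz_ineq2[of ?fx x] by linarith
   also have "... <= (L * \<bar>v t x - v t y\<bar>) * sqrt (1 + x \<bullet> x)"
    using True t tT nx params by (intro mult_mono hyp_L) auto
   finally show ?thesis using s0 by (simp only: pos_divide_le_eq)
  qed
  have 3: "?FD <= K * \<bar>v t x - v t y\<bar>" using True t tT by (intro hyp_K) auto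
  have "\<bar>v t x - v t y\<bar> * (- K * Theta t x y - ?e * (A * (?bg \<bullet> ?z) * psi t x + L * ?b * psi' t x))
   + ?fx \<bullet> (?e *\<^sub>R (- psi t x *\<^sub>R ?bg - (?b * psi' t x / sqrt (1 + x \<bullet> x)) *\<^sub>R x)) + ?fy \<bullet> ((?e * psi t x) *\<^sub>R ?bg) + ?FD * Theta t x y
   = (?e * psi t x) * (- ((?fx - ?fy) \<bullet> ?bg) - A * \<bar>v t x - v t y\<bar> * (?bg \<bullet> ?z))
    + (?e * ?b * psi' t x) * (- (?fx \<bullet> x) / sqrt (1 + x \<bullet> x) - L * \<bar>v t x - v t y\<bar>)
    + Theta t x y * (?FD - K * \<bar>v t x - v t y\<bar>)"
   by (simp add: inner_diff_left inner_diff_right algebra_simps diff_divide_distrib)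
  also have "... <= 0"
  proof -
   have "(?e * psi t x) * (- ((?fx - ?fy) \<bullet> ?bg) - A * \<bar>v t x - v t y\<bar> * (?bg \<bullet> ?z)) <= 0"
    using 1 p by (intro mult_nonneg_nonpos) auto
   moreover have "(?e * ?b * psi' t x) * (- (?fx \<bullet> x) / sqrt (1 + x \<bullet> x) - L * \<bar>v t x - v t y\<bar>) <= 0"
    using 2 p by (intro mult_nonneg_nonpos) auto
   moreover have "Theta t x y * (?FD - K * \<bar>v t x - v t y\<bar>) <= 0"
    using 3 Theta_bounds(1)[OF t0] by (intro mult_nonneg_nonpos) auto
   ultimately show ?thesis by linarith
  qed
  finally show ?thesis .
 next
  case False
  then consider "v t x = v t y" | "norm x > Rc" | "norm ?z > 1 / sqrt q" by linarith
  then show ?thesis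
  proof cases
   case 2
   then show ?thesis using psi_outside[OF t0 2] by (simp add: Theta_def)
  next
   case 3
   then show ?thesis using bump_qt_outside[OF t0 3] by (simp add: Theta_def)
  qed simp
 qed
 have "dt.Psi t x t y (v t x) (v t y) = chi' h t * (\<bar>v t x - v t y\<bar> * Theta t x y)
   + chi h t * (\<bar>(F t x (v t y) - d t x (v t y)) - (F t y (v t y) - d t y (v t y))\<bar> * Theta t x y)
   + chi h t * (\<bar>v t x - v t y\<bar> * (- K * Theta t x y - ?e * (A * (?bg \<bullet> ?z) * psi t x + L * ?b * psi' t x))
   + ?fx \<bullet> (?e *\<^sub>R (- psi t x *\<^sub>R ?bg - (?b * psi' t x / sqrt (1 + x \<bullet> x)) *\<^sub>R x)) + ?fy \<bullet> ((?e * psi t x) *\<^sub>R ?bg) + ?FD * Theta t x y)"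
  unfolding dt.Psi_def Phi_def Phi_t_def Phi_x_def Phi_y_def
  by (simp add: algebra_simps)
 also have "... <= chi' h t * (\<bar>v t x - v t y\<bar> * Theta t x y) + chi h t * (\<bar>(F t x (v t y) - d t x (v t y)) - (F t y (v t y) - d t y (v t y))\<bar> * Theta t x y)"
  using mult_nonneg_nonpos[OF chi0 key] by linarith
 finally show ?thesis .
qed

definition E :: "real => (real ^ 'n => real) => real" where
 "E t g = (LBINT x. LBINT y. \<bar>g x - g y\<bar> * Theta t x y)"

definition G_diff :: "real => real ^ 'n => real ^ 'n => real" where
 "G_diff t x y = \<bar>(F t x (v t y) - d t x (v t y)) - (F t y (v t y) - d t y (v t y))\<bar>"

definition S :: "real => real" where
 "S t = (LBINT x. LBINT y. G_diff t x y * Theta t x y)"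

definition vol :: real where "vol = measure lborel (cball (0 :: real ^ 'n) (Rc + 1))"

lemma vol_nonneg: "0 <= vol" by (simp add: vol_def)

lemma measurable_cball_R [measurable]: "cball (0 :: real ^ 'n) r \<in> sets borel" by simp

lemma integrable_cball: "integrable lborel (indicator (cball (0 :: real ^ 'n) (Rc + 1)) :: _ => real)"
 using emeasure_bounded_finite[of "cball (0 :: real ^ 'n) (Rc + 1)"]
 by (intro integrable_real_indicator) (auto simp: infinity_ennreal_def)

lemma box_pair_bound:
 fixes k :: "real ^ 'n => real ^ 'n => real"
 assumes "(\<lambda>(x, y). k x y) \<in> borel_measurable borel2" "!!x y. \<bar>k x y\<bar> <= M" "!!x y. \<not> (norm x <= Rc \<and> norm y <= Rc + 1) ==> k x y = 0"
 shows "integrable lborel2 (\<lambda>(x, y). k x y)"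
  "(LBINT x. LBINT y. k x y) = (LINT z|lborel2. (\<lambda>(x, y). k x y) z)"
  "\<bar>LBINT x. LBINT y. k x y\<bar> <= M * vol * vol"
proof -
 have M0: "0 <= M" using order_trans[OF abs_ge_zero assms(2)] .
 show i: "integrable lborel2 (\<lambda>(x, y). k x y)"
  by (rule integrable_bounded_support_pair[where B=M and R=Rc and R'="Rc + 1"]) (use assms in auto)
 show "(LBINT x. LBINT y. k x y) = (LINT z|lborel2. (\<lambda>(x, y). k x y) z)"
  by (rule lborel_pair.integral_fst[OF i])
 have inner: "norm (LBINT y. k x y) <= M * vol" for x
  unfolding vol_def by (rule integral_abs_le_bounded_support) (use assms in auto)
 have "norm (LBINT x. LBINT y. k x y) <= (M * vol) * vol"
  unfolding vol_def
 proof (rule integral_abs_le_bounded_support)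
  show "norm (LBINT y. k x y) <= M * measure lborel (cball (0 :: real ^ 'n) (Rc + 1))" for x
   using inner by (simp add: vol_def)
  show "(LBINT y. k x y) = 0" if "x \<notin> cball 0 (Rc + 1)" for x
   using assms(3)[of x] that by simp
 qed
 then show "\<bar>LBINT x. LBINT y. k x y\<bar> <= M * vol * vol" by simp
qed

lemma E_integrand:
 assumes [measurable]: "Borel g" and g: "!!x. \<bar>g x\<bar> <= U" and t: "0 <= t"
 shows "(\<lambda>(x, y). \<bar>g x - g y\<bar> * Theta t x y) \<in> borel_measurable borel2"
  "\<bar>\<bar>g x - g y\<bar> * Theta t x y\<bar> <= 2 * U" "\<not> (norm x <= Rc \<and> norm y <= Rc + 1) ==> \<bar>g x - g y\<bar> * Theta t x y = 0"
proof -
 show "(\<lambda>(x, y). \<bar>g x - g y\<bar> * Theta t x y) \<in> borel_measurable borel2" by measurable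
 have "\<bar>g x - g y\<bar> <= 2 * U" using g[of x] g[of y] by linarith
 then have "\<bar>g x - g y\<bar> * Theta t x y <= 2 * U * 1" using Theta_bounds[OF t] U_nonneg by (intro mult_mono) auto
 then show "\<bar>\<bar>g x - g y\<bar> * Theta t x y\<bar> <= 2 * U" using Theta_bounds[OF t] by (simp add: abs_mult)
 show "\<not> (norm x <= Rc \<and> norm y <= Rc + 1) ==> \<bar>g x - g y\<bar> * Theta t x y = 0"
  using Theta_outside[OF t] by simp
qed

text \<open>\<open>||g(x) - g(y)| - |g'(x) - g'(y)|| \<le> |g(x) - g'(x)| + |g(y) - g'(y)|\<close>, and each of the two summands
integrates to a volume times the \<open>L\<^sup>1\<close> distance.\<close>

lemma E_diff:
 assumes g [measurable]: "Borel g" "!!x. \<bar>g x\<bar> <= U"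
  and g' [measurable]: "Borel g'" "!!x. \<bar>g' x\<bar> <= U"
  and t: "0 <= t" "0 <= t'" and e: "!!x y. \<bar>Theta t x y - Theta t' x y\<bar> <= e"
 shows "\<bar>E t g - E t' g'\<bar> <= 2 * vol * (LBINT y. indicator (cball 0 (Rc + 1)) y * \<bar>g y - g' y\<bar>) + 2 * U * e * vol * vol"
proof -
 let ?I = "\<lambda>x :: real ^ 'n. indicator (cball 0 (Rc + 1)) x :: real" and ?D = "\<lambda>x. \<bar>g x - g' x\<bar>"
 have U0: "0 <= U" by (rule U_nonneg)
 have e0: "0 <= e" using order_trans[OF abs_ge_zero e] .
 have D: "?D x <= 2 * U" for x using g(2)[of x] g'(2)[of x] by linarith
 have i1: "integrable lborel (\<lambda>x. ?I x * ?D x)"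
  by (rule integrable_bounded_support[where B="2 * U" and R="Rc + 1"]) (use D U0 in \<open>auto simp: indicator_def\<close>)
 have E1: "integrable lborel2 (\<lambda>(x, y). \<bar>g x - g y\<bar> * Theta t x y)"
  by (rule box_pair_bound(1)[OF E_integrand[OF g t(1)]])
 have E2: "integrable lborel2 (\<lambda>(x, y). \<bar>g' x - g' y\<bar> * Theta t' x y)"
  by (rule box_pair_bound(1)[OF E_integrand[OF g' t(2)]])
 have iI: "integrable lborel ?I" by (rule integrable_cball)
 note p1 = integral_product[OF i1 iI] and p2 = integral_product[OF iI i1] and p3 = integral_product[OF iI iI]
 let ?k = "\<lambda>z. (\<lambda>(x, y). \<bar>g x - g y\<bar> * Theta t x y) z - (\<lambda>(x, y). \<bar>g' x - g' y\<bar> * Theta t' x y) z"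
 let ?w = "\<lambda>z. (\<lambda>(x, y). (?I x * ?D x) * ?I y) z + (\<lambda>(x, y). ?I x * (?I y * ?D y)) z + (2 * U * e) * (\<lambda>(x, y). ?I x * ?I y) z"
 have ik: "integrable lborel2 ?k" by (rule Bochner_Integration.integrable_diff[OF E1 E2])
 have iw: "integrable lborel2 ?w"
  by (intro Bochner_Integration.integrable_add integrable_mult_right p1 p2 p3)
 have "E t g = (LINT z|lborel2. (\<lambda>(x, y). \<bar>g x - g y\<bar> * Theta t x y) z)"
  unfolding E_def by (rule box_pair_bound(2)[OF E_integrand[OF g t(1)]])
 moreover have "E t' g' = (LINT z|lborel2. (\<lambda>(x, y). \<bar>g' x - g' y\<bar> * Theta t' x y) z)"
  unfolding E_def by (rule box_pair_bound(2)[OF E_integrand[OF g' t(2)]])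
 ultimately have "E t g - E t' g' = (LINT z|lborel2. ?k z)"
  using Bochner_Integration.integral_diff[OF E1 E2] by (simp only:)
 then have "\<bar>E t g - E t' g'\<bar> <= (LINT z|lborel2. norm (?k z))"
  using integral_norm_bound[of "lborel2" ?k] by simp
 also have "... <= (LINT z|lborel2. ?w z)"
 proof (rule Bochner_Integration.integral_mono[OF integrable_norm[OF ik] iw])
  fix z :: "(real ^ 'n) \<times> (real ^ 'n)"
  obtain x y where z: "z = (x, y)" by (cases z)
  show "norm (?k z) <= ?w z"
  proof (cases "norm x <= Rc + 1 \<and> norm y <= Rc + 1")
   case True
   have "?k z = (\<bar>g x - g y\<bar> - \<bar>g' x - g' y\<bar>) * Theta t x y + \<bar>g' x - g' y\<bar> * (Theta t x y - Theta t' x y)"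
    by (simp add: z algebra_simps)
   then have "\<bar>?k z\<bar> <= \<bar>\<bar>g x - g y\<bar> - \<bar>g' x - g' y\<bar>\<bar> * Theta t x y + \<bar>g' x - g' y\<bar> * \<bar>Theta t x y - Theta t' x y\<bar>"
    using abs_triangle_ineq[of "(\<bar>g x - g y\<bar> - \<bar>g' x - g' y\<bar>) * Theta t x y" "\<bar>g' x - g' y\<bar> * (Theta t x y - Theta t' x y)"] Theta_bounds(1)[OF t(1), of x y]
    by (simp add: abs_mult)
   also have "\<bar>\<bar>g x - g y\<bar> - \<bar>g' x - g' y\<bar>\<bar> * Theta t x y <= (?D x + ?D y) * 1"
    using Theta_bounds[OF t(1), of x y] by (intro mult_mono) auto
   also have "\<bar>g' x - g' y\<bar> * \<bar>Theta t x y - Theta t' x y\<bar> <= (2 * U) * e"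
   proof -
    have "\<bar>g' x - g' y\<bar> <= 2 * U" using g'(2)[of x] g'(2)[of y] by linarith
    then show ?thesis using e U0 by (intro mult_mono) auto
   qed
   finally show ?thesis using True by (simp add: z)
  next
   case False
   then have "\<not> (norm x <= Rc \<and> norm y <= Rc + 1)" by auto
   then have "?k z = 0" using Theta_outside[OF t(1)] Theta_outside[OF t(2)] by (simp add: z)
   then show ?thesis using U0 e0 by (simp add: z)
  qed
 qed
 also have "... = (LBINT y. ?I y * ?D y) * vol + vol * (LBINT y. ?I y * ?D y) + (2 * U * e) * (vol * vol)"
  using p1 p2 p3 by (simp add: vol_def)
 finally show ?thesis by (simp add: algebra_simps)
qed

lemma Theta_modulus:
 assumes "0 < e"
 obtains r where "0 < r" "!!t t' x y. a <= t ==> t <= Te ==> a <= t' ==> t' <= Te ==> \<bar>t - t'\<bar> < r ==> \<bar>Theta t x y - Theta t' x y\<bar> <= e"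
proof -
 let ?K = "{a..Te} \<times> cball (0 :: real ^ 'n) Rc \<times> cball (0 :: real ^ 'n) (Rc + 1)"
 have "uniformly_continuous_on ?K (\<lambda>z. Theta (fst z) (fst (snd z)) (snd (snd z)))"
  by (intro compact_uniformly_continuous continuous_on_Theta continuous_intros compact_Times) auto
 then obtain r where r: "0 < r" "!!z z'. z \<in> ?K ==> z' \<in> ?K ==> dist z' z < r ==>
   dist (Theta (fst z') (fst (snd z')) (snd (snd z'))) (Theta (fst z) (fst (snd z)) (snd (snd z))) < e"
  using assms unfolding uniformly_continuous_on_def by blast
 show thesis
 proof (rule that[OF r(1)])
  fix t t' x y assume t: "a <= t" "t <= Te" "a <= t'" "t' <= Te" "\<bar>t - t'\<bar> < r"
  show "\<bar>Theta t x y - Theta t' x y\<bar> <= e"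
  proof (cases "norm x <= Rc \<and> norm y <= Rc + 1")
   case True
   have "dist (t, x, y) (t', x, y) < r" using t by (simp add: dist_Pair_Pair dist_real_def)
   then show ?thesis using r(2)[of "(t', x, y)" "(t, x, y)"] t True by (simp add: dist_real_def)
  next
   case False
   then show ?thesis using Theta_outside[of t x y] Theta_outside[of t' x y] t ab assms by auto
  qed
 qed
qed

lemma E_tendsto:
 assumes c: "a <= c" "c < Te" and g [measurable]: "Borel g" and gU: "!!x. \<bar>g x\<bar> <= U"
  and conv: "right_trace v c g"
  and e: "0 < \<epsilon>"
 shows "\<exists>r>0. AE t in lborel. c < t \<and> t < c + r --> \<bar>E t (v t) - E c g\<bar> <= \<epsilon>"
proof -
 have U0: "0 <= U" by (rule U_nonneg)
 define c1 where "c1 = 2 * vol + 1"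
 define c2 where "c2 = 2 * U * vol * vol + 1"
 define e1 where "e1 = \<epsilon> / (2 * c1)"
 define e2 where "e2 = \<epsilon> / (2 * c2)"
 have p: "0 < c1" "0 < c2" unfolding c1_def c2_def using vol_nonneg U0 by (auto intro!: add_nonneg_pos mult_nonneg_nonneg)
 have e12: "0 < e1" "0 < e2" using e p by (auto simp: e1_def e2_def)
 obtain r1 where r1: "0 < r1" "AE s in lborel. c < s \<and> s < c + r1 --> (LBINT y. indicator (cball 0 (Rc + 1)) y * \<bar>v s y - g y\<bar>) <= e1"
  using conv e12(1) by blast
 obtain r2 where r2: "0 < r2" "!!t t' x y. a <= t ==> t <= Te ==> a <= t' ==> t' <= Te ==> \<bar>t - t'\<bar> < r2 ==> \<bar>Theta t x y - Theta t' x y\<bar> <= e2"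
  by (rule Theta_modulus[OF e12(2)]) (rule that)
 show ?thesis
 proof (intro exI conjI)
  show "0 < min r1 (min r2 (Te - c))" using r1 r2 c by simp
  show "AE t in lborel. c < t \<and> t < c + min r1 (min r2 (Te - c)) --> \<bar>E t (v t) - E c g\<bar> <= \<epsilon>"
   using r1(2)
  proof eventually_elim
   case (elim t)
   show ?case
   proof
    assume t: "c < t \<and> t < c + min r1 (min r2 (Te - c))"
    then have m: "(LBINT y. indicator (cball 0 (Rc + 1)) y * \<bar>v t y - g y\<bar>) <= e1" using elim by auto
    have "\<bar>E t (v t) - E c g\<bar> <= 2 * vol * (LBINT y. indicator (cball 0 (Rc + 1)) y * \<bar>v t y - g y\<bar>) + 2 * U * e2 * vol * vol"
    proof (rule E_diff)
     show "\<bar>Theta t x y - Theta c x y\<bar> <= e2" for x y using t c by (intro r2(2)) auto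
    qed (use v_bound gU t c ab in auto)
    also have "... <= 2 * vol * e1 + 2 * U * e2 * vol * vol" using m vol_nonneg by (intro add_right_mono mult_left_mono) auto
    also have "2 * vol * e1 <= c1 * e1" using e12 by (simp add: c1_def distrib_right)
    also have "c1 * e1 = \<epsilon> / 2" using p by (simp add: e1_def)
    also have "2 * U * e2 * vol * vol <= c2 * e2" using e12 by (simp add: c2_def distrib_right mult_ac)
    also have "c2 * e2 = \<epsilon> / 2" using p by (simp add: e2_def)
    finally show "\<bar>E t (v t) - E c g\<bar> <= \<epsilon>" by simp
   qed
  qed
 qed
qed

lemma G_diff_bound:
 obtains B where "0 <= B" "!!t x y. a <= t ==> t <= Te ==> norm x <= Rc + 1 ==> norm y <= Rc + 1 ==> G_diff t x y <= B"
proof -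
 let ?K = "{a..Te} \<times> cball (0 :: real ^ 'n) (Rc + 1) \<times> {-U..U}"
 have K: "compact ?K" by (intro compact_Times) auto
 have "continuous_on ?K (\<lambda>z. F (fst z) (fst (snd z)) (snd (snd z)) - d (fst z) (fst (snd z)) (snd (snd z)))"
  using ab by (intro continuous_intros continuous_on_F continuous_on_d) auto
 then obtain B where B: "0 <= B" "!!z. z \<in> ?K ==> norm (F (fst z) (fst (snd z)) (snd (snd z)) - d (fst z) (fst (snd z)) (snd (snd z))) <= B"
  by (rule compact_norm_bound[OF K]) (rule that)
 show thesis
 proof (rule that[of "2 * B"])
  fix t x y assume t: "a <= t" "t <= Te" "norm (x :: real ^ 'n) <= Rc + 1" "norm (y :: real ^ 'n) <= Rc + 1"
  have w: "- U <= v t y" "v t y <= U" using v_bound[of t y] by auto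
  have "(t, x, v t y) \<in> ?K" "(t, y, v t y) \<in> ?K" using t w by auto
  from B(2)[OF this(1)] B(2)[OF this(2)] show "G_diff t x y <= 2 * B" unfolding G_diff_def by simp
 qed (use B in simp)
qed

lemma G_integrand:
 obtains B where "0 <= B" "!!t x y. a <= t ==> t <= Te ==> (\<lambda>(x, y). G_diff t x y * Theta t x y) \<in> borel_measurable borel2"
  "!!t x y. a <= t ==> t <= Te ==> \<bar>G_diff t x y * Theta t x y\<bar> <= B"
  "!!t x y. a <= t ==> t <= Te ==> \<not> (norm x <= Rc \<and> norm y <= Rc + 1) ==> G_diff t x y * Theta t x y = 0"
  "!!t x y. a <= t ==> t <= Te ==> 0 <= G_diff t x y * Theta t x y"
proof -
 obtain B where B: "0 <= B" "!!t x y. a <= t ==> t <= Te ==> norm x <= Rc + 1 ==> norm y <= Rc + 1 ==> G_diff t x y <= B"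
  by (rule G_diff_bound) (rule that)
 show thesis
 proof (rule that[OF B(1)])
  fix t x y assume t: "a <= t" "t <= Te"
  then have t0: "0 <= t" using ab by simp
  show "(\<lambda>(x, y). G_diff t x y * Theta t x y) \<in> borel_measurable borel2" unfolding G_diff_def by measurable
  show z: "\<not> (norm x <= Rc \<and> norm y <= Rc + 1) ==> G_diff t x y * Theta t x y = 0"
   using Theta_outside[OF t0] by simp
  show n: "0 <= G_diff t x y * Theta t x y" using Theta_bounds[OF t0] by (simp add: G_diff_def)
  show "\<bar>G_diff t x y * Theta t x y\<bar> <= B"
  proof (cases "norm x <= Rc \<and> norm y <= Rc + 1")
   case True
   then have "G_diff t x y * Theta t x y <= B * 1" using B t Theta_bounds[OF t0] by (intro mult_mono B(2)) auto
   then show ?thesis using n by simp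
  next
   case False
   show ?thesis unfolding z[OF False] using B by simp
  qed
 qed
qed

text \<open>The derivative of the time cut-off \<open>chi\<close> turns \<open>Psi_le\<close> into a comparison of averages of \<open>E\<close> taken just
after \<open>b\<close> and just after \<open>a\<close>, which converge to \<open>E b gb\<close> and \<open>E a ga\<close> by right continuity.\<close>

theorem energy_inequality:
 assumes ga: "Borel ga" "!!x. \<bar>ga x\<bar> <= U"
  "right_trace v a ga"
  and gb: "Borel gb" "!!x. \<bar>gb x\<bar> <= U"
  "right_trace v b gb"
 shows "E b gb <= E a ga + (LBINT t. indicator {a..b} t * S t)"
proof -
 have U0: "0 <= U" by (rule U_nonneg)
 obtain B where B: "0 <= B" and GT: "!!t x y. a <= t ==> t <= Te ==> (\<lambda>(x, y). G_diff t x y * Theta t x y) \<in> borel_measurable borel2"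
  "!!t x y. a <= t ==> t <= Te ==> \<bar>G_diff t x y * Theta t x y\<bar> <= B"
  "!!t x y. a <= t ==> t <= Te ==> \<not> (norm x <= Rc \<and> norm y <= Rc + 1) ==> G_diff t x y * Theta t x y = 0"
  "!!t x y. a <= t ==> t <= Te ==> 0 <= G_diff t x y * Theta t x y"
  by (rule G_integrand) (rule that)
 define MS where "MS = B * vol * vol"
 have MS0: "0 <= MS" using B vol_nonneg by (simp add: MS_def)
 have SB: "0 <= S t" "S t <= MS" if t: "a <= t" "t <= Te" for t
 proof -
  show "0 <= S t" unfolding S_def using GT(4)[OF t] by (intro integral_nonneg_AE AE_I2)
  show "S t <= MS" using box_pair_bound(3)[OF GT(1-3)[OF t]] unfolding S_def MS_def by linarith
 qed
 have EB: "\<bar>E t (v t)\<bar> <= 2 * U * vol * vol" if t: "a <= t" for t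
  unfolding E_def by (rule box_pair_bound(3)[OF E_integrand]) (use t ab v_bound in auto)
 have Em [measurable]: "Borel (\<lambda>t. E t (v t))" unfolding E_def by measurable
 have Sm [measurable]: "Borel S" unfolding S_def[abs_def] G_diff_def by measurable
 define e where "e t = indicator {a..Te} t * E t (v t)" for t
 define S' where "S' t = indicator {a..Te} t * S t" for t
 have [measurable]: "Borel e" "Borel S'" unfolding e_def[abs_def] S'_def[abs_def] by measurable
 have eB: "\<bar>e t\<bar> <= 2 * U * vol * vol" for t using EB[of t] U0 vol_nonneg by (auto simp: e_def indicator_def)
 have S'B: "0 <= S' t" "S' t <= MS" for t using SB[of t] MS0 by (auto simp: S'_def indicator_def)
 define h where "h n = (Te - b) / real (Suc n)" for n
 have h: "0 < h n" "b + h n <= Te" for n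
 proof -
  show "0 < h n" using ab by (simp add: h_def)
  have "h n <= Te - b" using ab by (simp add: h_def divide_le_eq mult_left_le)
  then show "b + h n <= Te" by simp
 qed
 have hlim: "h \<longlonglongrightarrow> 0"
  using tendsto_mult_right_zero[OF LIMSEQ_inverse_real_of_nat, of "Te - b"] by (simp add: h_def[abs_def] divide_inverse)
 have iS: "integrable lborel (\<lambda>t. indicator {a..b} t * S t)"
  by (rule integrable_bounded_support[where B=MS and R="\<bar>a\<bar> + \<bar>b\<bar>"]) (use SB MS0 ab in \<open>auto simp: indicator_def\<close>)
 have step: "0 <= (LBINT t. avg a (h n) t * e t) - (LBINT t. avg b (h n) t * e t) + ((LBINT t. indicator {a..b} t * S t) + MS * h n)" for n
 proof -
  interpret dt: doubling_test f F d v Ts U "Phi (h n)" "Phi_t (h n)" "Phi_x (h n)" "Phi_y (h n)" a "b + h n" "Rc + 1"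
   by (rule doubling_test_Phi[OF h])
  let ?Z1 = "\<lambda>t x y. chi' (h n) t * (\<bar>v t x - v t y\<bar> * Theta t x y)" and ?Z2 = "\<lambda>t x y. chi (h n) t * (G_diff t x y * Theta t x y)"
  have chim [measurable]: "chi (h n) \<in> borel_measurable borel" "chi' (h n) \<in> borel_measurable borel"
   unfolding chi_def[abs_def] chi'_def[abs_def] by measurable
  let ?A = "{a..b + h n} \<times> cball (0 :: real ^ 'n) Rc" and ?B = "cball (0 :: real ^ 'n) (Rc + 1)"
  have AB: "bounded ?A" "bounded ?B" by (auto intro: bounded_Times)
  have far: "\<not> (a <= t \<and> t <= b + h n) \<or> \<not> (norm x <= Rc \<and> norm y <= Rc + 1)"
   if "\<not> (p \<in> ?A \<and> y \<in> ?B)" "p = (t, x)" for p t x and y :: "real ^ 'n"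
   using that by auto
  have chi'b: "\<bar>chi' (h n) t\<bar> <= 8 / h n" for t
  proof -
   have "avg c (h n) t <= 4 / h n" for c unfolding avg_def using h(1)[of n] by (intro divide_right_mono theta'_bounded) simp
   from this[of a] this[of b] avg_nonneg[OF h(1), of a n t] avg_nonneg[OF h(1), of b n t] show ?thesis unfolding chi'_def by (simp add: abs_le_iff)
  qed
  have i1: "integrable lborel2 (\<lambda>((t, x), y). ?Z1 t x y)"
  proof (rule integrable_bounded_pair[OF AB, where M="8 / h n * (2 * U)"])
   show "(\<lambda>((t, x), y). ?Z1 t x y) \<in> borel_measurable borel2"
    unfolding borel_prod[symmetric] split_beta by measurable
   fix p :: "real \<times> (real ^ 'n)" and y :: "real ^ 'n"
   obtain t x where p: "p = (t, x)" by (cases p)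
   show "\<bar>(\<lambda>((t, x), y). ?Z1 t x y) (p, y)\<bar> <= 8 / h n * (2 * U)"
   proof (cases "a <= t \<and> t <= b + h n")
    case True
    then have "\<bar>\<bar>v t x - v t y\<bar> * Theta t x y\<bar> <= 2 * U" using ab v_bound by (intro E_integrand(2)) auto
    then have "\<bar>chi' (h n) t\<bar> * \<bar>\<bar>v t x - v t y\<bar> * Theta t x y\<bar> <= 8 / h n * (2 * U)"
     using chi'b h(1)[of n] by (intro mult_mono) auto
    then show ?thesis by (simp add: p abs_mult)
   next
    case False
    then show ?thesis using chi_outside(2)[OF h(1) False] h(1)[of n] U0 by (simp add: p)
   qed
   assume "\<not> (p \<in> ?A \<and> y \<in> ?B)"
   from far[OF this p] show "(\<lambda>((t, x), y). ?Z1 t x y) (p, y) = 0"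
    using chi_outside(2)[OF h(1), of t n] Theta_outside[of t x y] ab by (cases "a <= t \<and> t <= b + h n") (auto simp: p)
  qed
  have i2: "integrable lborel2 (\<lambda>((t, x), y). ?Z2 t x y)"
  proof (rule integrable_bounded_pair[OF AB, where M="1 * B"])
   show "(\<lambda>((t, x), y). ?Z2 t x y) \<in> borel_measurable borel2"
    unfolding borel_prod[symmetric] split_beta G_diff_def by measurable
   fix p :: "real \<times> (real ^ 'n)" and y :: "real ^ 'n"
   obtain t x where p: "p = (t, x)" by (cases p)
   show "\<bar>(\<lambda>((t, x), y). ?Z2 t x y) (p, y)\<bar> <= 1 * B"
   proof (cases "a <= t \<and> t <= b + h n")
    case True
    then have "\<bar>G_diff t x y * Theta t x y\<bar> <= B" using h(2)[of n] by (intro GT(2)) auto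
    then have "\<bar>chi (h n) t\<bar> * \<bar>G_diff t x y * Theta t x y\<bar> <= 1 * B"
     using chi_bounds[OF h(1), of n t] by (intro mult_mono) auto
    then show ?thesis by (simp add: p abs_mult)
   next
    case False
    then show ?thesis using chi_outside(1)[OF h(1) False] B by (simp add: p)
   qed
   assume "\<not> (p \<in> ?A \<and> y \<in> ?B)"
   from far[OF this p] show "(\<lambda>((t, x), y). ?Z2 t x y) (p, y) = 0"
    using chi_outside(1)[OF h(1), of t n] Theta_outside[of t x y] ab by (cases "a <= t \<and> t <= b + h n") (auto simp: p)
  qed
  have iI: "integrable lborel (indicator {b..b + h n} :: real => real)"
   using h(1)[of n] by (intro integrable_real_indicator) auto
  have "0 <= (LBINT t. LBINT x. LBINT y. dt.Psi t x t y (v t x) (v t y))" by (rule dt.doubling)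
  also have "... = (LINT z|lborel2. (\<lambda>((t, x), y). dt.Psi t x t y (v t x) (v t y)) z)"
   by (rule triple_iterated(1)[OF dt.Psi_diag_integrable(1), symmetric])
  also have "... <= (LINT z|lborel2. (\<lambda>((t, x), y). ?Z1 t x y) z + (\<lambda>((t, x), y). ?Z2 t x y) z)"
  proof (rule Bochner_Integration.integral_mono[OF dt.Psi_diag_integrable(1) Bochner_Integration.integrable_add[OF i1 i2]])
   fix z :: "(real \<times> (real ^ 'n)) \<times> (real ^ 'n)"
   obtain t x y where z: "z = ((t, x), y)" by (metis prod.exhaust)
   show "(\<lambda>((t, x), y). dt.Psi t x t y (v t x) (v t y)) z <= (\<lambda>((t, x), y). ?Z1 t x y) z + (\<lambda>((t, x), y). ?Z2 t x y) z"
   proof (cases "a <= t \<and> t <= b + h n")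
    case True
    then show ?thesis using Psi_le[OF h, of t n x y] by (simp add: z G_diff_def)
   next
    case False
    have "dt.Psi t x t y (v t x) (v t y) = 0" using False by (intro dt.Psi_outside) auto
    then show ?thesis using chi_outside[OF h(1) False] by (simp add: z)
   qed
  qed
  also have "... = (LINT z|lborel2. (\<lambda>((t, x), y). ?Z1 t x y) z) + (LINT z|lborel2. (\<lambda>((t, x), y). ?Z2 t x y) z)"
   by (rule Bochner_Integration.integral_add[OF i1 i2])
  also have "(LINT z|lborel2. (\<lambda>((t, x), y). ?Z1 t x y) z) = (LBINT t. avg a (h n) t * e t - avg b (h n) t * e t)"
   unfolding triple_iterated(1)[OF i1]
  proof (rule Bochner_Integration.integral_cong[OF refl])
   fix t
   have "(LBINT x. LBINT y. ?Z1 t x y) = chi' (h n) t * E t (v t)" by (simp add: E_def)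
   also have "... = chi' (h n) t * e t"
   proof (cases "a <= t \<and> t <= b + h n")
    case True
    then show ?thesis using h(2)[of n] by (simp add: e_def)
   next
    case False
    then show ?thesis using chi_outside(2)[OF h(1) False] by simp
   qed
   finally show "(LBINT x. LBINT y. ?Z1 t x y) = avg a (h n) t * e t - avg b (h n) t * e t"
    by (simp add: chi'_def algebra_simps)
  qed
  also have "... = (LBINT t. avg a (h n) t * e t) - (LBINT t. avg b (h n) t * e t)"
  proof (rule Bochner_Integration.integral_diff)
   have *: "integrable lborel (\<lambda>t. avg c (h n) t * e t)" for c
   proof (rule Bochner_Integration.integrable_bound)
    show "integrable lborel (\<lambda>t. avg c (h n) t * (2 * U * vol * vol))" by (rule integrable_mult_left[OF avg_integral(1)[OF h(1)]])
    have "norm (avg c (h n) t * e t) <= norm (avg c (h n) t * (2 * U * vol * vol))" for t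
     using mult_left_mono[OF order_trans[OF eB[of t] abs_ge_self] avg_nonneg[OF h(1)[of n], of c t]] avg_nonneg[OF h(1)[of n], of c t]
     by (simp add: abs_mult)
    then show "AE t in lborel. norm (avg c (h n) t * e t) <= norm (avg c (h n) t * (2 * U * vol * vol))" by simp
   qed measurable
   show "integrable lborel (\<lambda>t. avg a (h n) t * e t)" "integrable lborel (\<lambda>t. avg b (h n) t * e t)" by (rule *)+
  qed
  also have "(LINT z|lborel2. (\<lambda>((t, x), y). ?Z2 t x y) z) = (LBINT t. chi (h n) t * S t)"
   unfolding triple_iterated(1)[OF i2] by (simp add: S_def)
  also have "... <= (LBINT t. indicator {a..b} t * S t + MS * indicator {b..b + h n} t)"
  proof (rule Bochner_Integration.integral_mono)
   show "integrable lborel (\<lambda>t. chi (h n) t * S t)"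
    using triple_iterated(2)[OF i2] by (simp add: S_def)
   show "integrable lborel (\<lambda>t. indicator {a..b} t * S t + MS * indicator {b..b + h n} t)"
    by (intro Bochner_Integration.integrable_add iS integrable_mult_right iI)
   fix t
   show "chi (h n) t * S t <= indicator {a..b} t * S t + MS * indicator {b..b + h n} t"
   proof (cases "a <= t \<and> t <= b + h n")
    case True
    then have s: "0 <= S t" "S t <= MS" using SB[of t] h(2)[of n] by auto
    have "chi (h n) t * S t <= 1 * S t" using chi_bounds[OF h(1), of n t] s by (intro mult_right_mono) auto
    then show ?thesis using True s MS0 by (auto simp: indicator_def)
   next
    case False
    then show ?thesis using chi_outside(1)[OF h(1) False] ab h(1)[of n] by (auto simp: indicator_def)
   qed
  qed
  also have "... = (LBINT t. indicator {a..b} t * S t) + MS * h n"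
  proof -
   have "(LBINT t. indicator {a..b} t * S t + MS * indicator {b..b + h n} t) = (LBINT t. indicator {a..b} t * S t) + (LBINT t. MS * indicator {b..b + h n} t)"
    by (intro Bochner_Integration.integral_add iS integrable_mult_right iI)
   then show ?thesis using h(1)[of n] by simp
  qed
  finally show ?thesis by simp
 qed
 have lim_a: "(\<lambda>n. LBINT t. avg a (h n) t * e t) \<longlonglongrightarrow> E a ga"
 proof (rule avg_tendsto[OF _ eB _ h(1) hlim])
  fix \<epsilon> :: real assume \<epsilon>: "0 < \<epsilon>"
  obtain r where r: "0 < r" "AE t in lborel. a < t \<and> t < a + r --> \<bar>E t (v t) - E a ga\<bar> <= \<epsilon>"
   using E_tendsto[OF _ _ ga \<epsilon>] ab by auto
  show "\<exists>r>0. AE t in lborel. a < t \<and> t < a + r --> \<bar>e t - E a ga\<bar> <= \<epsilon>"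
   using r ab by (intro exI[of _ "min r (Te - a)"]) (auto simp: e_def elim!: eventually_mono)
 qed measurable
 have lim_b: "(\<lambda>n. LBINT t. avg b (h n) t * e t) \<longlonglongrightarrow> E b gb"
 proof (rule avg_tendsto[OF _ eB _ h(1) hlim])
  fix \<epsilon> :: real assume \<epsilon>: "0 < \<epsilon>"
  obtain r where r: "0 < r" "AE t in lborel. b < t \<and> t < b + r --> \<bar>E t (v t) - E b gb\<bar> <= \<epsilon>"
   using E_tendsto[OF _ _ gb \<epsilon>] ab by auto
  show "\<exists>r>0. AE t in lborel. b < t \<and> t < b + r --> \<bar>e t - E b gb\<bar> <= \<epsilon>"
   using r ab by (intro exI[of _ "min r (Te - b)"]) (auto simp: e_def elim!: eventually_mono)
 qed measurable
 have "(\<lambda>n. (LBINT t. avg a (h n) t * e t) - (LBINT t. avg b (h n) t * e t) + ((LBINT t. indicator {a..b} t * S t) + MS * h n))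
   \<longlonglongrightarrow> E a ga - E b gb + ((LBINT t. indicator {a..b} t * S t) + MS * 0)"
  by (intro tendsto_intros lim_a lim_b hlim)
 then have "0 <= E a ga - E b gb + ((LBINT t. indicator {a..b} t * S t) + MS * 0)"
  by (rule LIMSEQ_le_const) (use step in auto)
 then show ?thesis by simp
qed

section \<open>From the energy to the total variation\<close>

lemma nn_integral_Theta:
 fixes k :: "real ^ 'n => real ^ 'n => real"
 assumes [measurable]: "(\<lambda>(x, y). k x y) \<in> borel_measurable borel2" and "!!x y. \<bar>k x y\<bar> <= M"
  "!!x y. \<not> (norm x <= Rc \<and> norm y <= Rc + 1) ==> k x y = 0" "!!x y. 0 <= k x y"
 shows "ennreal (LBINT x. LBINT y. k x y) = (NBINT x. (NBINT y. ennreal (k x y)))"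
proof -
 have "ennreal (LBINT x. LBINT y. k x y) = ennreal (LINT z|lborel2. (\<lambda>(x, y). k x y) z)"
  using box_pair_bound(2)[OF assms(1-3)] by simp
 also have "... = (\<integral>\<^sup>+z. ennreal ((\<lambda>(x, y). k x y) z) \<partial>lborel2)"
  by (rule nn_integral_eq_integral[symmetric, OF box_pair_bound(1)[OF assms(1-3)]]) (use assms(4) in auto)
 also have "... = (NBINT x. (NBINT y. ennreal ((\<lambda>(x, y). k x y) (x, y))))"
  by (rule lborel.nn_integral_fst[symmetric]) measurable
 finally show ?thesis by simp
qed

lemma E_upper:
 assumes g [measurable]: "Borel g" and gU: "!!x. \<bar>g x\<bar> <= U" and t: "0 <= t"
  and e0: "norm (e0 :: real ^ 'n) = 1" and Rc: "0 <= Rc"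
 shows "ennreal (E t g) <= ennreal (exp (- K * t) * dir_moment (qt t) e0) * TV g"
proof -
 have qt1: "1 <= qt t" using qt_ge(1)[OF t] params by linarith
 have "ennreal (E t g) = (NBINT x. (NBINT y. ennreal (\<bar>g x - g y\<bar> * Theta t x y)))"
  unfolding E_def by (rule nn_integral_Theta[OF E_integrand[OF g gU t]]) (use Theta_bounds[OF t] in auto)
 also have "... <= (NBINT x. (NBINT y. ennreal (exp (- K * t)) * (indicator (cball 0 Rc) x * ennreal (\<bar>g x - g y\<bar> * bump (qt t) (x - y)))))"
 proof (intro nn_integral_mono)
  fix x y :: "real ^ 'n"
  show "ennreal (\<bar>g x - g y\<bar> * Theta t x y) <= ennreal (exp (- K * t)) * (indicator (cball 0 Rc) x * ennreal (\<bar>g x - g y\<bar> * bump (qt t) (x - y)))"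
  proof (cases "norm x <= Rc")
   case True
   have "\<bar>g x - g y\<bar> * Theta t x y <= \<bar>g x - g y\<bar> * (exp (- K * t) * bump (qt t) (x - y))"
    by (rule mult_left_mono[OF Theta_le]) simp
   then have "\<bar>g x - g y\<bar> * Theta t x y <= exp (- K * t) * (\<bar>g x - g y\<bar> * bump (qt t) (x - y))" by (simp add: mult_ac)
   then show ?thesis using True by (simp add: ennreal_mult[symmetric] ennreal_leI)
  next
   case False
   then have "Theta t x y = 0" using t by (intro Theta_outside) auto
   then show ?thesis by simp
  qed
 qed
 also have "... = ennreal (exp (- K * t)) * (NBINT x. (NBINT y. (indicator (cball 0 Rc) x * ennreal (\<bar>g x - g y\<bar> * bump (qt t) (x - y)))))"
 proof -
  have "(NBINT y. ennreal (exp (- K * t)) * (indicator (cball 0 Rc) x * ennreal (\<bar>g x - g y\<bar> * bump (qt t) (x - y))))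
    = ennreal (exp (- K * t)) * (NBINT y. (indicator (cball 0 Rc) x * ennreal (\<bar>g x - g y\<bar> * bump (qt t) (x - y))))" for x
   by (rule nn_integral_cmult) measurable
  then show ?thesis by (simp only:) (rule nn_integral_cmult, measurable)
 qed
 also have "... <= ennreal (exp (- K * t)) * (ennreal (dir_moment (qt t) e0) * TV g)"
  by (intro mult_left_mono TV_upper[OF g gU qt1 e0 Rc]) auto
 finally show ?thesis by (simp add: ennreal_mult mult.assoc)
qed

lemma E_lower:
 assumes g [measurable]: "Borel g" and gU: "!!x. \<bar>g x\<bar> <= U" and t: "0 <= t"
  and R: "L * t + R0 + 3 <= Rc"
 shows "ennreal (exp (- K * t)) * (NBINT x. (NBINT y. indicator (cball 0 (R0 + 1)) x * ennreal (\<bar>g x - g y\<bar> * bump (qt t) (x - y)))) <= ennreal (E t g)"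
proof -
 have "ennreal (exp (- K * t)) * (NBINT x. (NBINT y. indicator (cball 0 (R0 + 1)) x * ennreal (\<bar>g x - g y\<bar> * bump (qt t) (x - y))))
  = (NBINT x. (NBINT y. ennreal (exp (- K * t)) * (indicator (cball 0 (R0 + 1)) x * ennreal (\<bar>g x - g y\<bar> * bump (qt t) (x - y)))))"
 proof -
  have "(NBINT y. ennreal (exp (- K * t)) * (indicator (cball 0 (R0 + 1)) x * ennreal (\<bar>g x - g y\<bar> * bump (qt t) (x - y))))
    = ennreal (exp (- K * t)) * (NBINT y. (indicator (cball 0 (R0 + 1)) x * ennreal (\<bar>g x - g y\<bar> * bump (qt t) (x - y))))" for x
   by (rule nn_integral_cmult) measurable
  then show ?thesis by (simp only:) (rule nn_integral_cmult[symmetric], measurable)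
 qed
 also have "... <= (NBINT x. (NBINT y. ennreal (\<bar>g x - g y\<bar> * Theta t x y)))"
 proof (intro nn_integral_mono)
  fix x y :: "real ^ 'n"
  show "ennreal (exp (- K * t)) * (indicator (cball 0 (R0 + 1)) x * ennreal (\<bar>g x - g y\<bar> * bump (qt t) (x - y))) <= ennreal (\<bar>g x - g y\<bar> * Theta t x y)"
  proof (cases "norm x <= R0 + 1")
   case True
   have "sqrt (1 + x \<bullet> x) <= sqrt ((1 + norm x)\<^sup>2)"
    by (rule real_sqrt_le_mono) (simp add: power2_eq_square dot_square_norm algebra_simps)
   then have "sqrt (1 + x \<bullet> x) <= 1 + norm x" by simp
   then have "1 <= Rc - L * t - sqrt (1 + x \<bullet> x)" using True R by linarith
   then have "psi t x = 1" unfolding psi_def by (rule theta_ge_1)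
   then have X: "\<bar>g x - g y\<bar> * Theta t x y = exp (- K * t) * (\<bar>g x - g y\<bar> * bump (qt t) (x - y))"
    by (simp add: Theta_def mult_ac)
   have "ennreal (exp (- K * t)) * (indicator (cball 0 (R0 + 1)) x * ennreal (\<bar>g x - g y\<bar> * bump (qt t) (x - y))) = ennreal (exp (- K * t) * (\<bar>g x - g y\<bar> * bump (qt t) (x - y)))"
    using True by (simp add: ennreal_mult[symmetric])
   then show ?thesis unfolding X by simp
  qed simp
 qed
 also have "... = ennreal (E t g)"
  unfolding E_def by (rule nn_integral_Theta[OF E_integrand[OF g gU t], symmetric]) (use Theta_bounds[OF t] in auto)
 finally show ?thesis .
qed

lemma S_nonneg: "0 <= t ==> 0 <= S t"
 unfolding S_def G_diff_def using Theta_bounds(1)[of t] by (intro integral_nonneg_AE AE_I2 mult_nonneg_nonneg) auto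

lemma ennreal_S:
 assumes t: "a <= t" "t <= Te"
 shows "ennreal (S t) = (NBINT x. (NBINT y. ennreal (G_diff t x y * Theta t x y)))"
 unfolding S_def
 apply (rule G_integrand)
 subgoal premises G by (rule nn_integral_Theta[OF G(2-5)[OF t]])
 done

text \<open>A bound for the source difference that is linear in \<open>x - y\<close> and based at \<open>y\<close> integrates, for each \<open>y\<close>, to
the moment of the kernel in the direction \<open>m y\<close>. Hence no constant besides \<open>1\<close> appears in front of
\<open>\<integral> |m|\<close>.\<close>

lemma S_le:
 fixes m :: "real ^ 'n => real ^ 'n"
 assumes t: "a <= t" "t <= Te" and [measurable]: "Borel m" and om: "0 <= \<omega>" and e0: "norm (e0 :: real ^ 'n) = 1"
  and G: "!!x y. norm x <= Rc ==> norm (x - y) <= 1 / sqrt q ==> G_diff t x y <= \<bar>m y \<bullet> (x - y)\<bar> + \<omega> * norm (x - y)"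
 shows "ennreal (S t) <= ennreal (exp (- K * t) * dir_moment (qt t) e0) *
   ((NBINT y. indicator (cball 0 (Rc + 1)) y * ennreal (norm (m y))) + ennreal (\<omega> * real CARD('n) * vol))"
proof -
 have t0: "0 <= t" using t ab by simp
 have qt0: "0 < qt t" by (rule qt_ge)
 let ?c = "dir_moment (qt t) e0" and ?I = "\<lambda>y :: real ^ 'n. indicator (cball 0 (Rc + 1)) y :: ennreal"
 have "ennreal (S t) = (NBINT x. (NBINT y. ennreal (G_diff t x y * Theta t x y)))" by (rule ennreal_S[OF t])
 also have "... <= (NBINT x. (NBINT y. ennreal (exp (- K * t)) * (?I y * ennreal ((\<bar>m y \<bullet> (x - y)\<bar> + \<omega> * norm (x - y)) * bump (qt t) (x - y)))))"
 proof (intro nn_integral_mono)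
  fix x y :: "real ^ 'n"
  show "ennreal (G_diff t x y * Theta t x y) <= ennreal (exp (- K * t)) * (?I y * ennreal ((\<bar>m y \<bullet> (x - y)\<bar> + \<omega> * norm (x - y)) * bump (qt t) (x - y)))"
  proof (cases "norm x <= Rc \<and> norm y <= Rc + 1 \<and> norm (x - y) <= 1 / sqrt q")
   case True
   have "G_diff t x y * Theta t x y <= (\<bar>m y \<bullet> (x - y)\<bar> + \<omega> * norm (x - y)) * (exp (- K * t) * bump (qt t) (x - y))"
    using True Theta_bounds[OF t0] om by (intro mult_mono G Theta_le) auto
   then have "G_diff t x y * Theta t x y <= exp (- K * t) * ((\<bar>m y \<bullet> (x - y)\<bar> + \<omega> * norm (x - y)) * bump (qt t) (x - y))" by (simp add: mult_ac)
   then show ?thesis using True om by (simp add: ennreal_mult[symmetric] ennreal_leI)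
  next
   case False
   have "Theta t x y = 0"
   proof (cases "norm x <= Rc \<and> norm y <= Rc + 1")
    case True
    then have "norm (x - y) > 1 / sqrt q" using False by auto
    then show ?thesis using bump_qt_outside(1)[OF t0, of "x - y"] by (simp add: Theta_def)
   qed (use Theta_outside[OF t0] in auto)
   then show ?thesis by simp
  qed
 qed
 also have "... = (NBINT y. (NBINT x. ennreal (exp (- K * t)) * (?I y * ennreal ((\<bar>m y \<bullet> (x - y)\<bar> + \<omega> * norm (x - y)) * bump (qt t) (x - y)))))"
  by (rule lborel_pair.Fubini') measurable
 also have "... = (NBINT y. ennreal (exp (- K * t)) * (?I y * (NBINT z. ennreal ((\<bar>m y \<bullet> z\<bar> + \<omega> * norm z) * bump (qt t) z))))"
 proof (rule nn_integral_cong)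
  fix y :: "real ^ 'n"
  have "(NBINT x. ennreal (exp (- K * t)) * (?I y * ennreal ((\<bar>m y \<bullet> (x - y)\<bar> + \<omega> * norm (x - y)) * bump (qt t) (x - y))))
    = (NBINT z. ennreal (exp (- K * t)) * (?I y * ennreal ((\<bar>m y \<bullet> z\<bar> + \<omega> * norm z) * bump (qt t) z)))"
   using nn_integral_lborel_translation[of "\<lambda>z. ennreal (exp (- K * t)) * (?I y * ennreal ((\<bar>m y \<bullet> z\<bar> + \<omega> * norm z) * bump (qt t) z))" "- y"] by simp
  also have "... = ennreal (exp (- K * t)) * (NBINT z. ?I y * ennreal ((\<bar>m y \<bullet> z\<bar> + \<omega> * norm z) * bump (qt t) z))"
   by (rule nn_integral_cmult) measurable
  also have "(NBINT z. ?I y * ennreal ((\<bar>m y \<bullet> z\<bar> + \<omega> * norm z) * bump (qt t) z)) = ?I y * (NBINT z. ennreal ((\<bar>m y \<bullet> z\<bar> + \<omega> * norm z) * bump (qt t) z))"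
   by (rule nn_integral_cmult) measurable
  finally show "(NBINT x. ennreal (exp (- K * t)) * (?I y * ennreal ((\<bar>m y \<bullet> (x - y)\<bar> + \<omega> * norm (x - y)) * bump (qt t) (x - y))))
   = ennreal (exp (- K * t)) * (?I y * (NBINT z. ennreal ((\<bar>m y \<bullet> z\<bar> + \<omega> * norm z) * bump (qt t) z)))" .
 qed
 also have "... <= (NBINT y. ennreal (exp (- K * t) * ?c) * (?I y * ennreal (norm (m y)) + ?I y * ennreal (\<omega> * real CARD('n))))"
 proof (rule nn_integral_mono)
  fix y :: "real ^ 'n"
  have i1: "integrable lborel (\<lambda>z :: real ^ 'n. \<bar>z \<bullet> m y\<bar> * bump (qt t) z)" by (rule integrable_mult_bump[OF qt0]) (auto intro!: continuous_intros)
  have i2: "integrable lborel (\<lambda>z :: real ^ 'n. norm z * bump (qt t) z)" by (rule integrable_mult_bump[OF qt0]) (auto intro!: continuous_intros)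
  have eq: "(\<bar>m y \<bullet> z\<bar> + \<omega> * norm z) * bump (qt t) z = \<bar>z \<bullet> m y\<bar> * bump (qt t) z + \<omega> * (norm z * bump (qt t) z)" for z
   by (simp add: algebra_simps inner_commute)
  have "(NBINT z. ennreal ((\<bar>m y \<bullet> z\<bar> + \<omega> * norm z) * bump (qt t) z)) = ennreal (LBINT z. \<bar>z \<bullet> m y\<bar> * bump (qt t) z + \<omega> * (norm z * bump (qt t) z))"
   unfolding eq by (rule nn_integral_eq_integral) (use i1 i2 om in auto)
  also have "(LBINT z. \<bar>z \<bullet> m y\<bar> * bump (qt t) z + \<omega> * (norm z * bump (qt t) z)) = dir_moment (qt t) (m y) + \<omega> * (LBINT z. norm z * bump (qt t) (z :: real ^ 'n))"
   using i1 i2 by (simp add: dir_moment_def)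
  also have "... <= norm (m y) * ?c + \<omega> * (real CARD('n) * ?c)"
   using norm_moment_le[OF qt0 e0] om by (intro add_mono mult_left_mono) (auto simp: dir_moment_eq_norm[OF e0, of "qt t" "m y"])
  finally have "(NBINT z. ennreal ((\<bar>m y \<bullet> z\<bar> + \<omega> * norm z) * bump (qt t) z)) <= ennreal (?c * (norm (m y) + \<omega> * real CARD('n)))"
   by (simp add: ennreal_leI algebra_simps)
  then have "ennreal (exp (- K * t)) * (?I y * (NBINT z. ennreal ((\<bar>m y \<bullet> z\<bar> + \<omega> * norm z) * bump (qt t) z)))
    <= ennreal (exp (- K * t)) * (?I y * ennreal (?c * (norm (m y) + \<omega> * real CARD('n))))"
   by (intro mult_left_mono) auto
  also have "... = ennreal (exp (- K * t) * ?c) * (?I y * ennreal (norm (m y)) + ?I y * ennreal (\<omega> * real CARD('n)))"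
   using om by (simp add: ennreal_mult ennreal_plus algebra_simps)
  finally show "ennreal (exp (- K * t)) * (?I y * (NBINT z. ennreal ((\<bar>m y \<bullet> z\<bar> + \<omega> * norm z) * bump (qt t) z)))
   <= ennreal (exp (- K * t) * ?c) * (?I y * ennreal (norm (m y)) + ?I y * ennreal (\<omega> * real CARD('n)))" .
 qed
 also have "... = ennreal (exp (- K * t) * ?c) * (NBINT y. ?I y * ennreal (norm (m y)) + ?I y * ennreal (\<omega> * real CARD('n)))"
  by (rule nn_integral_cmult) measurable
 also have "(NBINT y. ?I y * ennreal (norm (m y)) + ?I y * ennreal (\<omega> * real CARD('n))) = (NBINT y. ?I y * ennreal (norm (m y))) + (NBINT y. ?I y * ennreal (\<omega> * real CARD('n)))"
  by (rule nn_integral_add) measurable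
 also have "(NBINT y. ?I y * ennreal (\<omega> * real CARD('n))) = ennreal (\<omega> * real CARD('n) * vol)"
 proof -
  have "(NBINT y. ?I y * ennreal (\<omega> * real CARD('n))) = emeasure lborel (cball (0 :: real ^ 'n) (Rc + 1)) * ennreal (\<omega> * real CARD('n))"
   by (simp add: nn_integral_multc)
  also have "emeasure lborel (cball (0 :: real ^ 'n) (Rc + 1)) = ennreal vol"
   unfolding vol_def using emeasure_bounded_finite[of "cball (0 :: real ^ 'n) (Rc + 1)"]
   by (intro emeasure_eq_ennreal_measure) auto
  finally show ?thesis using om vol_nonneg by (simp add: ennreal_mult[symmetric] mult_ac)
 qed
 finally show ?thesis .
qed

text \<open>The weight decreases in time, and moving from \<open>g\<close> to \<open>h\<close> costs an \<open>L\<^sup>1\<close> distance. This serves at a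
starting time close to \<open>0\<close>, where the weight of that time is replaced by the one of time \<open>0\<close>.\<close>

lemma E_le_initial:
 assumes g [measurable]: "Borel g" and gU: "!!x. \<bar>g x\<bar> <= U"
  and h [measurable]: "Borel h" and hU: "!!x. \<bar>h x\<bar> <= U" and t: "0 <= t"
 shows "E t g <= E 0 h + 2 * vol * (LBINT x. indicator (cball 0 (Rc + 1)) x * \<bar>g x - h x\<bar>)"
proof -
 have Et: "integrable lborel2 (\<lambda>(x, y). \<bar>h x - h y\<bar> * Theta t x y)"
  by (rule box_pair_bound(1)[OF E_integrand[OF h hU t]])
 have E0: "integrable lborel2 (\<lambda>(x, y). \<bar>h x - h y\<bar> * Theta 0 x y)"
  by (rule box_pair_bound(1)[OF E_integrand[OF h hU order_refl]])
 have "\<bar>E t g - E t h\<bar> <= 2 * vol * (LBINT x. indicator (cball 0 (Rc + 1)) x * \<bar>g x - h x\<bar>) + 2 * U * 0 * vol * vol"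
  by (rule E_diff[OF g gU h hU t t]) simp
 moreover have "E t h = (LINT z|lborel2. (\<lambda>(x, y). \<bar>h x - h y\<bar> * Theta t x y) z)"
  unfolding E_def by (rule box_pair_bound(2)[OF E_integrand[OF h hU t]])
 moreover have "E 0 h = (LINT z|lborel2. (\<lambda>(x, y). \<bar>h x - h y\<bar> * Theta 0 x y) z)"
  unfolding E_def by (rule box_pair_bound(2)[OF E_integrand[OF h hU order_refl]])
 moreover have "(LINT z|lborel2. (\<lambda>(x, y). \<bar>h x - h y\<bar> * Theta t x y) z) <= (LINT z|lborel2. (\<lambda>(x, y). \<bar>h x - h y\<bar> * Theta 0 x y) z)"
 proof (rule Bochner_Integration.integral_mono[OF Et E0])
  fix z :: "(real ^ 'n) \<times> (real ^ 'n)"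
  obtain x y where z: "z = (x, y)" by (cases z)
  have "qt 0 * ((x - y) \<bullet> (x - y)) <= qt t * ((x - y) \<bullet> (x - y))"
   using qt_ge(1)[OF t] by (intro mult_right_mono) (auto simp: qt_def)
  then have bu: "bump (qt t) (x - y) <= bump (qt 0) (x - y)" unfolding bump_def pos_sq_def by (intro power_mono max.mono) auto
  have p: "psi t x <= psi 0 x" unfolding psi_def using t params by (intro theta_mono) simp
  have p0: "0 <= psi t x" unfolding psi_def by (rule theta_bounds)
  have bp: "bump (qt t) (x - y) * psi t x <= bump (qt 0) (x - y) * psi 0 x"
   by (rule mult_mono[OF bu p]) (use p0 in auto)
  have e: "exp (- K * t) <= 1" using params t by simp
  have "exp (- K * t) * (bump (qt t) (x - y) * psi t x) <= 1 * (bump (qt 0) (x - y) * psi 0 x)"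
   by (rule mult_mono[OF e bp]) (use p0 in auto)
  then have "Theta t x y <= Theta 0 x y" by (simp add: Theta_def)
  then show "(\<lambda>(x, y). \<bar>h x - h y\<bar> * Theta t x y) z <= (\<lambda>(x, y). \<bar>h x - h y\<bar> * Theta 0 x y) z"
   by (simp add: z mult_left_mono)
 qed
 ultimately show ?thesis by linarith
qed

lemma kernel_weight:
 assumes "norm (e0 :: real ^ 'n) = 1"
 shows "exp (- K * t) * dir_moment (qt t) e0 = dir_moment q e0 * exp (- (K + (real CARD('n) + 1) * A) * t)"
proof -
 have "dir_moment (qt t) e0 = exp (- (real CARD('n) + 1) * (A * t)) * dir_moment q e0"
  using dir_moment_exp[of q "A * t" e0] params unfolding qt_def by (simp add: mult.assoc)
 then show ?thesis by (simp add: exp_add[symmetric] algebra_simps)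
qed

text \<open>Each side of the energy inequality carries the moment of the kernel at its own time; by
\<open>kernel_weight\<close> division by the moment at time \<open>0\<close> turns it into \<open>exp(-\<kappa> t)\<close>. The initial energy enters
through a parameter \<open>X\<close>, since it is estimated in two different ways.\<close>

theorem TV_energy:
 fixes J :: "real => ennreal"
 assumes ga: "Borel ga" "!!x. \<bar>ga x\<bar> <= U"
  "right_trace v a ga"
  and gb: "Borel gb" "!!x. \<bar>gb x\<bar> <= U"
  "right_trace v b gb"
  and R: "0 <= R0" "L * b + R0 + 3 <= Rc" and e0: "norm (e0 :: real ^ 'n) = 1"
  and low: "ennreal (dir_moment (qt b) e0 * lw) <= (NBINT x. (NBINT y. indicator (cball 0 (R0 + 1)) x * ennreal (\<bar>gb x - gb y\<bar> * bump (qt b) (x - y))))"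
  and J [measurable]: "Borel J"
  and SJ: "AE t in lborel. a <= t \<and> t <= b --> ennreal (S t) <= ennreal (exp (- K * t) * dir_moment (qt t) e0) * J t"
  and \<kappa>: "\<kappa> = K + (real CARD('n) + 1) * A"
  and X: "ennreal (E a ga) <= ennreal (dir_moment q e0) * X"
 shows "ennreal (exp (- \<kappa> * b) * lw) <= X + (NBINT t. indicator {a..b} t * (ennreal (exp (- \<kappa> * t)) * J t))"
proof -
 have q0: "0 < q" using params by simp
 have b0: "0 <= b" "0 <= a" using ab by auto
 define c where "c = dir_moment q e0"
 have c0: "0 < c" unfolding c_def by (rule dir_moment_pos[OF q0 e0])
 have w: "exp (- K * t) * dir_moment (qt t) e0 = c * exp (- \<kappa> * t)" for t
  unfolding c_def \<kappa> by (rule kernel_weight[OF e0])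
 have "ennreal (c * (exp (- \<kappa> * b) * lw)) = ennreal (exp (- K * b)) * ennreal (dir_moment (qt b) e0 * lw)"
  using w[of b] by (simp add: ennreal_mult'[symmetric] mult_ac)
 also have "... <= ennreal (exp (- K * b)) * (NBINT x. (NBINT y. indicator (cball 0 (R0 + 1)) x * ennreal (\<bar>gb x - gb y\<bar> * bump (qt b) (x - y))))"
  by (intro mult_left_mono low) auto
 also have "... <= ennreal (E b gb)" by (rule E_lower[OF gb(1,2) b0(1) R(2)])
 also have "... <= ennreal (E a ga + (LBINT t. indicator {a..b} t * S t))"
  by (intro ennreal_leI energy_inequality[OF ga gb])
 also have "... = ennreal (E a ga) + ennreal (LBINT t. indicator {a..b} t * S t)"
 proof (rule ennreal_plus)
  show "0 <= E a ga" unfolding E_def using Theta_bounds(1)[OF b0(2)] by (intro integral_nonneg_AE AE_I2 mult_nonneg_nonneg) auto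
  show "0 <= (LBINT t. indicator {a..b} t * S t)" using S_nonneg ab by (intro integral_nonneg_AE AE_I2) (auto simp: indicator_def)
 qed
 also have "ennreal (LBINT t. indicator {a..b} t * S t) <= (NBINT t. ennreal (indicator {a..b} t * S t))"
 proof (cases "integrable lborel (\<lambda>t. indicator {a..b} t * S t)")
  case True
  then show ?thesis using S_nonneg ab by (subst nn_integral_eq_integral) (auto simp: indicator_def)
 next
  case False
  then show ?thesis by (simp add: not_integrable_integral_eq)
 qed
 also have "(NBINT t. ennreal (indicator {a..b} t * S t)) <= (NBINT t. ennreal c * (indicator {a..b} t * (ennreal (exp (- \<kappa> * t)) * J t)))"
  using SJ
 proof (intro nn_integral_mono_AE, eventually_elim)
  case (elim t)
  then show ?case unfolding w using c0 by (auto simp: indicator_def ennreal_mult mult_ac)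
 qed
 also have "... = ennreal c * (NBINT t. indicator {a..b} t * (ennreal (exp (- \<kappa> * t)) * J t))"
  by (rule nn_integral_cmult) measurable
 also note X[folded c_def]
 finally have main: "ennreal (c * (exp (- \<kappa> * b) * lw)) <= ennreal c * (X + (NBINT t. indicator {a..b} t * (ennreal (exp (- \<kappa> * t)) * J t)))"
  by (simp add: distrib_left add_right_mono)
 have cancel: "ennreal (1 / c) * (ennreal c * X) = X" for X
  using c0 by (simp add: mult.assoc[symmetric] ennreal_mult[symmetric])
 have "ennreal (exp (- \<kappa> * b) * lw) = ennreal (1 / c) * ennreal (c * (exp (- \<kappa> * b) * lw))"
  using c0 by (simp add: ennreal_mult'[symmetric])
 also have "... <= ennreal (1 / c) * (ennreal c * (X + (NBINT t. indicator {a..b} t * (ennreal (exp (- \<kappa> * t)) * J t))))"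
  by (intro mult_left_mono main) auto
 finally show ?thesis unfolding cancel .
qed

end

section \<open>Regularity of the coefficients\<close>

definition trace :: "((real ^ 'n) \<Rightarrow>\<^sub>L (real ^ 'n)) => real" where
 "trace A = (\<Sum>i\<in>UNIV. blinfun_apply A (axis i 1) $ i)"

lemma abs_trace_le: "\<bar>trace A\<bar> <= real CARD('n) * norm (A :: (real ^ 'n) \<Rightarrow>\<^sub>L (real ^ 'n))"
proof -
 have "\<bar>blinfun_apply A (axis i 1) $ i\<bar> <= norm A" for i
  using order_trans[OF component_le_norm_cart norm_blinfun[of A "axis i 1"]] by simp
 then have "\<bar>trace A\<bar> <= (\<Sum>i\<in>(UNIV :: 'n set). norm A)"
  unfolding trace_def by (intro order_trans[OF sum_abs] sum_mono) auto
 then show ?thesis by simp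
qed

lemma bounded_linear_trace: "bounded_linear (trace :: _ => real)"
proof (rule bounded_linear_intro)
 show "trace (A + B) = trace A + trace (B :: (real ^ 'n) \<Rightarrow>\<^sub>L (real ^ 'n))" for A B
  by (simp add: trace_def blinfun.add_left sum.distrib)
 show "trace (r *\<^sub>R A) = r *\<^sub>R trace (A :: (real ^ 'n) \<Rightarrow>\<^sub>L (real ^ 'n))" for r A
  by (simp add: trace_def blinfun.scaleR_left sum_distrib_left)
 show "norm (trace A) <= norm A * real CARD('n)" for A :: "(real ^ 'n) \<Rightarrow>\<^sub>L (real ^ 'n)"
  using abs_trace_le[of A] by (simp add: mult.commute)
qed

lemma div_x_eq_trace: "div_x f t x w = trace (D_x f t x w)"
 by (simp add: div_x_def divergence_def trace_def D_x_def)

lemma deriv_at_works: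
 fixes g :: "'a::euclidean_space => 'b::real_normed_vector"
 assumes "g differentiable (at x)"
 shows "(g has_derivative blinfun_apply (deriv_at g x)) (at x)"
 using assms frechet_derivative_works[of g "at x"] deriv_at_eq by metis

lemma derivative_eq_inner_grad:
 fixes g :: "real ^ 'n => real"
 assumes "(g has_derivative g') (at x)"
 shows "g' h = grad g x \<bullet> h"
proof -
 interpret bounded_linear g' by (rule has_derivative_bounded_linear[OF assms])
 have "g' h = g' (\<Sum>i\<in>UNIV. (h $ i) *\<^sub>R axis i 1)" by (simp add: basis_expansion scalar_mult_eq_scaleR[symmetric])
 also have "... = (\<Sum>i\<in>UNIV. h $ i * g' (axis i 1))" by (simp add: sum scaleR)
 finally show ?thesis by (simp add: grad_def deriv_at_eq[OF assms] inner_vec_def mult.commute)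
qed

lemma vector_derivative_le_lipschitz:
 fixes g :: "real => 'b::real_normed_vector"
 assumes der: "(g has_vector_derivative D) (at w)" and r: "0 < r"
  and lip: "!!w'. \<bar>w' - w\<bar> < r ==> norm (g w' - g w) <= c * \<bar>w' - w\<bar>"
 shows "norm D <= c"
proof -
 have lim: "((\<lambda>h. norm (g (w + h) - g w - h *\<^sub>R D) / norm h) \<longlongrightarrow> 0) (at 0)"
  using der unfolding has_vector_derivative_def has_derivative_at by simp
 have "norm D - c <= 0"
 proof (rule tendsto_lowerbound[OF lim])
  show "\<forall>\<^sub>F h in at 0. norm D - c <= norm (g (w + h) - g w - h *\<^sub>R D) / norm h"
   unfolding eventually_at
  proof (intro exI[of _ r] conjI ballI impI)
   fix h :: real assume h: "h ~= 0 \<and> dist h 0 < r"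
   have "norm (h *\<^sub>R D) <= norm (g (w + h) - g w) + norm (g (w + h) - g w - h *\<^sub>R D)"
    by (metis norm_triangle_sub add.commute norm_minus_commute)
   also have "norm (g (w + h) - g w) <= c * \<bar>h\<bar>" using lip[of "w + h"] h by simp
   finally show "norm D - c <= norm (g (w + h) - g w - h *\<^sub>R D) / norm h"
    using h by (simp add: field_simps)
  qed (rule r)
 qed simp
 then show ?thesis by simp
qed

lemma vector_derivative_bound:
 fixes g :: "real => 'b::real_normed_vector"
 assumes W: "convex W" "w \<in> W" "w' \<in> W" and der: "!!\<omega>. \<omega> \<in> W ==> (g has_vector_derivative g' \<omega>) (at \<omega>)"
  and B: "!!\<omega>. \<omega> \<in> W ==> norm (g' \<omega>) <= B"
 shows "norm (g w' - g w) <= B * \<bar>w' - w\<bar>"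
proof -
 have "norm (g w' - g w) <= B * norm (w' - w)"
 proof (rule differentiable_bound[OF W(1) _ _ W(3,2)])
  fix \<omega> assume \<omega>: "\<omega> \<in> W"
  show "(g has_derivative (\<lambda>h. h *\<^sub>R g' \<omega>)) (at \<omega> within W)"
   using der[OF \<omega>] unfolding has_vector_derivative_def by (rule has_derivative_at_withinI)
  show "onorm (\<lambda>h. h *\<^sub>R g' \<omega>) <= B"
  proof (rule onorm_bound)
   show "0 <= B" using order_trans[OF norm_ge_zero B[OF \<omega>]] .
   show "norm (h *\<^sub>R g' \<omega>) <= B * norm h" for h
    using mult_left_mono[OF B[OF \<omega>] norm_ge_zero[of h]] by (simp add: mult.commute)
  qed
 qed
 then show ?thesis by simp
qed

lemma continuous_on_Omega:
 assumes "continuous_on Omega (\<lambda>(t, x, w). g t x w)" "continuous_on S a" "continuous_on S b" "continuous_on S c" "!!z. z \<in> S ==> 0 < a z"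
 shows "continuous_on S (\<lambda>z. g (a z) (b z) (c z))"
proof -
 have *: "continuous_on S (\<lambda>z. (a z, b z, c z))" "(\<lambda>z. (a z, b z, c z)) ` S \<subseteq> Omega"
  using assms by (auto intro!: continuous_intros simp: Omega_def)
 show ?thesis using continuous_on_compose2[OF assms(1) *] by simp
qed

lemma open_Omega: "open Omega"
 unfolding Omega_def by (intro open_Times) auto

locale flow =
 fixes f :: "real => real ^ 'n => real => real ^ 'n" and F :: "real => real ^ 'n => real => real"
 assumes H1: "H1_star f F" and H2: "H2_star f F"
begin

abbreviation "P \<equiv> D_u (D_x f)"
abbreviation "G \<equiv> F_minus_div f F"
abbreviation "d \<equiv> div_x f"

lemma cont:
 shows f_cont: "continuous_on Omega (\<lambda>(t, x, w). f t x w)"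
  and F_cont: "continuous_on Omega (\<lambda>(t, x, w). F t x w)"
  and fu_cont: "continuous_on Omega (\<lambda>(t, x, w). D_u f t x w)"
  and P_cont: "continuous_on Omega (\<lambda>(t, x, w). P t x w)"
  and fxx_cont: "continuous_on Omega (\<lambda>(t, x, w). D_x (D_x f) t x w)"
  and Fu_cont: "continuous_on Omega (\<lambda>(t, x, w). D_u F t x w)"
  and Fx_cont: "continuous_on Omega (\<lambda>(t, x, w). D_x F t x w)"
 using H1 unfolding H1_star_def has_continuous_D_u_def has_continuous_D_x_def by auto

lemma ders:
 assumes "0 < t"
 shows f_x: "((\<lambda>y. f t y w) has_derivative blinfun_apply (D_x f t x w)) (at x)"
  and f_xx: "((\<lambda>y. D_x f t y w) has_derivative blinfun_apply (D_x (D_x f) t x w)) (at x)"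
  and F_x: "((\<lambda>y. F t y w) has_derivative blinfun_apply (D_x F t x w)) (at x)"
  and f_u: "((\<lambda>w. f t x w) has_vector_derivative D_u f t x w) (at w)"
  and F_u: "((\<lambda>w. F t x w) has_vector_derivative D_u F t x w) (at w)"
  and f_xu: "((\<lambda>w. D_x f t x w) has_vector_derivative P t x w) (at w)"
proof -
 have O: "(t, x, w) \<in> Omega" using assms by (simp add: Omega_def)
 show "((\<lambda>y. f t y w) has_derivative blinfun_apply (D_x f t x w)) (at x)"
  "((\<lambda>y. D_x f t y w) has_derivative blinfun_apply (D_x (D_x f) t x w)) (at x)"
  "((\<lambda>y. F t y w) has_derivative blinfun_apply (D_x F t x w)) (at x)"
  using H1 O unfolding D_x_def[of _ t x w] H1_star_def has_continuous_D_x_def has_D_x_def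
  by (auto intro!: deriv_at_works)
 show "((\<lambda>w. f t x w) has_vector_derivative D_u f t x w) (at w)"
  "((\<lambda>w. F t x w) has_vector_derivative D_u F t x w) (at w)"
  "((\<lambda>w. D_x f t x w) has_vector_derivative P t x w) (at w)"
  using H1 O unfolding D_u_def[of _ t x w] H1_star_def has_continuous_D_u_def
  by (auto simp: vector_derivative_works[symmetric])
qed

text \<open>The difference quotients of \<open>f\<close> in \<open>x\<close> are jointly continuous, and the local bound on the second
derivative makes them converge locally uniformly.\<close>

lemma fx_cont: "continuous_on Omega (\<lambda>(t, x, w). D_x f t x w)"
proof -
 have "continuous_on Omega (\<lambda>p. blinfun_apply ((\<lambda>(t, x, w). D_x f t x w) p) e)" if e: "e \<in> Basis" for e
  unfolding continuous_on_eq_continuous_at[OF open_Omega]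
 proof
  fix p0 :: "real \<times> (real ^ 'n) \<times> real" assume p0: "p0 \<in> Omega"
  obtain t0 x0 w0 where p0': "p0 = (t0, x0, w0)" by (cases p0)
  have t0: "0 < t0" using p0 by (simp add: p0' Omega_def)
  define C where "C = {t0 / 2..2 * t0} \<times> cball x0 2 \<times> cball w0 1"
  have "compact C" unfolding C_def by (intro compact_Times) auto
  moreover have "continuous_on C (\<lambda>(t, x, w). D_x (D_x f) t x w)"
   by (rule continuous_on_subset[OF fxx_cont]) (use t0 in \<open>auto simp: C_def Omega_def\<close>)
  ultimately obtain M where M: "0 <= M" "!!p. p \<in> C ==> norm ((\<lambda>(t, x, w). D_x (D_x f) t x w) p) <= M"
   by (rule compact_norm_bound) (rule that)
  define C' where "C' = {t0 / 2<..<2 * t0} \<times> ball x0 1 \<times> ball w0 1"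
  define D where "D = (\<lambda>s (t, x, w). (f t (x + s *\<^sub>R e) w - f t x w) /\<^sub>R s)"
  have key: "norm (D s p - blinfun_apply ((\<lambda>(t, x, w). D_x f t x w) p) e) <= M * s" if s: "0 < s" "s <= 1" and p: "p \<in> C'" for s p
  proof -
   obtain t x w where p': "p = (t, x, w)" by (cases p)
   have t: "0 < t" using p t0 by (simp add: p' C'_def)
   have near: "(t, z, w) \<in> C" if "z \<in> cball x s" for z
   proof -
    have "dist x0 z <= dist x0 x + dist x z" by (rule dist_triangle)
    then show ?thesis using p s that by (auto simp: p' C'_def C_def)
   qed
   have lip: "norm (D_x f t z w - D_x f t x w) <= M * norm (z - x)" if "z \<in> cball x s" for z
    using f_xx[OF t] M(2)[OF near] that s
    by (intro differentiable_bound[of "cball x s"]) (auto intro: has_derivative_at_withinI simp: norm_blinfun.rep_eq[symmetric])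
   have "norm (f t (x + s *\<^sub>R e) w - f t x w - blinfun_apply (D_x f t x w) ((x + s *\<^sub>R e) - x)) <= norm ((x + s *\<^sub>R e) - x) * (M * s)"
   proof (rule differentiable_bound_linearization[where S="cball x s" and f'="\<lambda>z. blinfun_apply (D_x f t z w)"])
    show "x + r *\<^sub>R ((x + s *\<^sub>R e) - x) \<in> cball x s" if "r \<in> {0..1}" for r
     using that s e by (auto simp: dist_norm mult_left_le_one_le)
    show "((\<lambda>y. f t y w) has_derivative blinfun_apply (D_x f t z w)) (at z within cball x s)" for z
     by (rule has_derivative_at_withinI[OF f_x[OF t]])
    show "onorm (blinfun_apply (D_x f t z w) - blinfun_apply (D_x f t x w)) <= M * s" if z: "z \<in> cball x s" for z
    proof -
     have "norm (D_x f t z w - D_x f t x w) <= M * s"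
      using lip[OF z] z M(1) by (auto simp: dist_norm norm_minus_commute intro: order_trans mult_left_mono)
     moreover have "blinfun_apply (D_x f t z w - D_x f t x w) = blinfun_apply (D_x f t z w) - blinfun_apply (D_x f t x w)"
      by (simp add: fun_eq_iff blinfun.diff_left)
     ultimately show ?thesis by (simp add: norm_blinfun.rep_eq)
    qed
   qed (use s in auto)
   then have "norm (f t (x + s *\<^sub>R e) w - f t x w - s *\<^sub>R blinfun_apply (D_x f t x w) e) <= s * (M * s)"
    using s e by (simp add: blinfun.scaleR_right)
   moreover have "D s p - blinfun_apply (D_x f t x w) e = (f t (x + s *\<^sub>R e) w - f t x w - s *\<^sub>R blinfun_apply (D_x f t x w) e) /\<^sub>R s"
    using s by (simp add: D_def p' scaleR_diff_right)
   ultimately have "norm (D s p - blinfun_apply (D_x f t x w) e) <= (s * (M * s)) / s"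
    using s by (simp only: norm_scaleR) (simp add: divide_simps mult_ac)
   then show ?thesis using s by (simp add: p')
  qed
  have "continuous_on C' (\<lambda>p. blinfun_apply ((\<lambda>(t, x, w). D_x f t x w) p) e)"
  proof (rule uniform_limit_theorem[where F="at_right 0" and f=D])
   show "\<forall>\<^sub>F s in at_right 0. continuous_on C' (D s)"
    unfolding D_def split_beta using t0
    by (intro always_eventually allI continuous_intros continuous_on_Omega[OF f_cont]) (auto simp: C'_def)
   show "uniform_limit C' D (\<lambda>p. blinfun_apply ((\<lambda>(t, x, w). D_x f t x w) p) e) (at_right 0)"
   proof (rule uniform_limitI)
    fix \<epsilon> :: real assume \<epsilon>: "0 < \<epsilon>"
    define r where "r = min 1 (\<epsilon> / (M + 1))"
    have r: "0 < r" "r <= 1" using \<epsilon> M(1) by (auto simp: r_def)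
    have Mr: "M * s < \<epsilon>" if "0 < s" "s < r" for s
    proof -
     have "s < \<epsilon> / (M + 1)" using that by (simp add: r_def)
     then have "s * (M + 1) < \<epsilon>" using M(1) by (simp add: pos_less_divide_eq)
     then show ?thesis using that by (simp add: algebra_simps)
    qed
    have "\<forall>p\<in>C'. dist (D s p) (blinfun_apply ((\<lambda>(t, x, w). D_x f t x w) p) e) < \<epsilon>" if "0 < s" "s < r" for s
     using key[of s] Mr[OF that] that r by (auto simp: dist_norm intro: le_less_trans)
    then show "\<forall>\<^sub>F s in at_right 0. \<forall>p\<in>C'. dist (D s p) (blinfun_apply ((\<lambda>(t, x, w). D_x f t x w) p) e) < \<epsilon>"
     unfolding eventually_at_right[OF zero_less_one] using r by blast
   qed
  qed simp
  moreover have "open C'" "p0 \<in> C'" using t0 unfolding C'_def p0' by (auto intro!: open_Times)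
  ultimately show "isCont (\<lambda>p. blinfun_apply ((\<lambda>(t, x, w). D_x f t x w) p) e) p0"
   by (simp add: continuous_on_eq_continuous_at)
 qed
 then show ?thesis by (rule continuous_on_blinfun_componentwise)
qed

text \<open>Subtracting the bilinear function \<open>w P\<^sub>0 y\<close>, the mean value inequality is applied in \<open>u\<close> to
\<open>D\<^sub>xf\<close> and then in \<open>x\<close> to the increment of \<open>f\<close>. With \<open>P\<^sub>0 = 0\<close> this is the flux estimate of the
energy method, with \<open>P\<^sub>0 = P t x w\<close> it yields the symmetry of the mixed derivatives.\<close>

lemma second_difference:
 assumes t: "0 < t" and X: "convex X" "x \<in> X" "y \<in> X" and W: "convex W" "w \<in> W" "w' \<in> W"
  and M: "!!z \<omega>. z \<in> X ==> \<omega> \<in> W ==> norm (P t z \<omega> - P0) <= M"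
 shows "norm ((f t y w' - f t y w) - (f t x w' - f t x w) - (w' - w) *\<^sub>R blinfun_apply P0 (y - x)) <= M * \<bar>w' - w\<bar> * norm (y - x)"
  and "norm (D_x f t x w' - D_x f t x w - (w' - w) *\<^sub>R P0) <= M * \<bar>w' - w\<bar>"
proof -
 have 1: "norm (D_x f t z w' - D_x f t z w - (w' - w) *\<^sub>R P0) <= M * \<bar>w' - w\<bar>" if z: "z \<in> X" for z
 proof -
  have "((\<lambda>w. D_x f t z w - w *\<^sub>R P0) has_vector_derivative (P t z \<omega> - (\<omega> *\<^sub>R 0 + 1 *\<^sub>R P0))) (at \<omega>)" for \<omega>
   by (intro has_vector_derivative_diff f_xu[OF t] has_vector_derivative_scaleR DERIV_ident has_vector_derivative_const)
  then have "norm ((D_x f t z w' - w' *\<^sub>R P0) - (D_x f t z w - w *\<^sub>R P0)) <= M * \<bar>w' - w\<bar>"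
   by (intro vector_derivative_bound[OF W, of "\<lambda>w. D_x f t z w - w *\<^sub>R P0" "\<lambda>\<omega>. P t z \<omega> - P0"] M z) auto
  then show ?thesis by (simp add: algebra_simps)
 qed
 show "norm (D_x f t x w' - D_x f t x w - (w' - w) *\<^sub>R P0) <= M * \<bar>w' - w\<bar>" by (rule 1[OF X(2)])
 have "norm ((f t y w' - f t y w - (w' - w) *\<^sub>R blinfun_apply P0 y) - (f t x w' - f t x w - (w' - w) *\<^sub>R blinfun_apply P0 x)) <= M * \<bar>w' - w\<bar> * norm (y - x)"
 proof (rule differentiable_bound[OF X(1) _ _ X(3,2)])
  fix z assume z: "z \<in> X"
  show "((\<lambda>z. f t z w' - f t z w - (w' - w) *\<^sub>R blinfun_apply P0 z) has_derivative blinfun_apply (D_x f t z w' - D_x f t z w - (w' - w) *\<^sub>R P0)) (at z within X)"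
  proof (rule has_derivative_at_withinI)
   have "((\<lambda>z. f t z w' - f t z w - (w' - w) *\<^sub>R blinfun_apply P0 z) has_derivative
     (\<lambda>h. blinfun_apply (D_x f t z w') h - blinfun_apply (D_x f t z w) h - (w' - w) *\<^sub>R blinfun_apply P0 h)) (at z)"
    by (intro has_derivative_diff f_x[OF t] has_derivative_scaleR_right bounded_linear_imp_has_derivative blinfun.bounded_linear_right)
   then show "((\<lambda>z. f t z w' - f t z w - (w' - w) *\<^sub>R blinfun_apply P0 z) has_derivative blinfun_apply (D_x f t z w' - D_x f t z w - (w' - w) *\<^sub>R P0)) (at z)"
    by (rule has_derivative_eq_rhs) (simp add: fun_eq_iff blinfun.diff_left blinfun.scaleR_left)
  qed
  show "onorm (blinfun_apply (D_x f t z w' - D_x f t z w - (w' - w) *\<^sub>R P0)) <= M * \<bar>w' - w\<bar>"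
   using 1[OF z] by (simp add: norm_blinfun.rep_eq)
 qed
 then show "norm ((f t y w' - f t y w) - (f t x w' - f t x w) - (w' - w) *\<^sub>R blinfun_apply P0 (y - x)) <= M * \<bar>w' - w\<bar> * norm (y - x)"
  by (simp add: blinfun.diff_right scaleR_diff_right algebra_simps)
qed

text \<open>For \<open>w'\<close> near \<open>w\<close> the second difference of \<open>f\<close> is a Lipschitz function of \<open>w'\<close> with a small
constant, which bounds its derivative at \<open>w\<close>.\<close>

lemma f_ux:
 assumes t: "0 < t"
 shows "((\<lambda>y. D_u f t y w) has_derivative blinfun_apply (P t x w)) (at x)"
 unfolding has_derivative_at_alt
proof (intro conjI allI impI blinfun.bounded_linear_right)
 fix e :: real assume e: "0 < e"
 have "isCont (\<lambda>(t, x, w). P t x w) (t, x, w)"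
  using bspec[OF P_cont[unfolded continuous_on_eq_continuous_at[OF open_Omega]], of "(t, x, w)"] t by (simp add: Omega_def)
 then obtain r where r: "0 < r" "!!p. dist p (t, x, w) < r ==> dist ((\<lambda>(t, x, w). P t x w) p) (P t x w) < e"
  using e unfolding continuous_at_eps_delta by (metis (mono_tags, lifting) case_prod_conv)
 have P: "norm (P t z \<omega> - P t x w) <= e" if "z \<in> ball x (r / 2)" "\<omega> \<in> ball w (r / 2)" for z \<omega>
 proof -
  have "dist (t, z, \<omega>) (t, x, w) <= dist z x + dist \<omega> w"
   by (simp add: dist_Pair_Pair) (rule sqrt_sum_squares_le_sum, auto)
  then have "dist (t, z, \<omega>) (t, x, w) < r" using that by (simp add: dist_commute)
  from r(2)[OF this] show ?thesis by (simp add: dist_norm)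
 qed
 show "\<exists>da>0. \<forall>y. norm (y - x) < da --> norm (D_u f t y w - D_u f t x w - blinfun_apply (P t x w) (y - x)) <= e * norm (y - x)"
 proof (intro exI[of _ "r / 2"] conjI allI impI)
  fix y assume y: "norm (y - x) < r / 2"
  show "norm (D_u f t y w - D_u f t x w - blinfun_apply (P t x w) (y - x)) <= e * norm (y - x)"
  proof (rule vector_derivative_le_lipschitz[where r="r / 2" and g="\<lambda>w'. f t y w' - f t x w' - w' *\<^sub>R blinfun_apply (P t x w) (y - x)"])
   show "((\<lambda>w'. f t y w' - f t x w' - w' *\<^sub>R blinfun_apply (P t x w) (y - x)) has_vector_derivative
     (D_u f t y w - D_u f t x w - blinfun_apply (P t x w) (y - x))) (at w)"
    using f_u[OF t, of y w] f_u[OF t, of x w] by (auto intro!: derivative_eq_intros)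
   fix w' assume w': "\<bar>w' - w\<bar> < r / 2"
   then have w'': "\<bar>w - w'\<bar> < r / 2" by (simp add: abs_minus_commute)
   have "norm ((f t y w' - f t y w) - (f t x w' - f t x w) - (w' - w) *\<^sub>R blinfun_apply (P t x w) (y - x)) <= e * \<bar>w' - w\<bar> * norm (y - x)"
    by (rule second_difference(1)[where X="ball x (r / 2)" and W="ball w (r / 2)", OF t])
      (use P y w'' r in \<open>auto simp: dist_norm norm_minus_commute\<close>)
   then show "norm (f t y w' - f t x w' - w' *\<^sub>R blinfun_apply (P t x w) (y - x) - (f t y w - f t x w - w *\<^sub>R blinfun_apply (P t x w) (y - x)))
     <= e * norm (y - x) * \<bar>w' - w\<bar>" by (simp add: algebra_simps)
  qed (use r in simp)
 qed (use r in simp)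
qed

lemma D_x_D_u: "0 < t ==> D_x (D_u f) t x w = P t x w"
 using deriv_at_eq[OF f_ux, of t w x] unfolding D_x_def[of "D_u f"] by (simp add: blinfun_apply_inject)

lemma d_cont: "continuous_on Omega (\<lambda>(t, x, w). d t x w)"
 using bounded_linear.continuous_on[OF bounded_linear_trace fx_cont] unfolding div_x_eq_trace by (simp add: split_beta)

lemma G_x:
 assumes t: "0 < t"
 shows "((\<lambda>y. G t y w) has_derivative (\<lambda>h. blinfun_apply (D_x F t x w) h - trace (blinfun_apply (D_x (D_x f) t x w) h))) (at x)"
 unfolding F_minus_div_def div_x_eq_trace
 by (intro has_derivative_diff F_x[OF t] bounded_linear.has_derivative[OF bounded_linear_trace] f_xx[OF t])

lemma G_x_grad:
 assumes t: "0 < t"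
 shows "((\<lambda>y. G t y w) has_derivative (\<lambda>h. grad_x G t x w \<bullet> h)) (at x)"
 using G_x[OF t, of w x] derivative_eq_inner_grad[OF G_x[OF t, of w x]] unfolding grad_x_def by simp

lemma gradG_cont: "continuous_on Omega (\<lambda>(t, x, w). grad_x G t x w)"
proof -
 have "continuous_on Omega (\<lambda>p. \<chi> j. (\<lambda>(t, x, w). blinfun_apply (D_x F t x w) (axis j 1) - trace (blinfun_apply (D_x (D_x f) t x w) (axis j 1))) p)"
  unfolding split_beta
  by (intro continuous_on_vec_lambda continuous_intros bounded_linear.continuous_on[OF bounded_linear_trace]
    continuous_on_Omega[OF Fx_cont] continuous_on_Omega[OF fxx_cont]) (auto simp: Omega_def)
 then show ?thesis
  by (rule continuous_on_eq) (auto simp: Omega_def grad_x_def grad_def deriv_at_eq[OF G_x])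
qed

end

section \<open>Essential suprema of continuous functions\<close>

lemma AE_lebesgue_iff_lborel_Borel:
 assumes "A \<in> sets borel"
 shows "(AE z in lebesgue. z \<notin> A) \<longleftrightarrow> emeasure lborel A = 0"
proof -
 have "(AE z in lebesgue. z \<notin> A) \<longleftrightarrow> (AE z in lborel. z \<notin> A)"
  by (rule AE_completion_iff)
 also have "... \<longleftrightarrow> A \<in> null_sets lborel"
  by (rule AE_iff_null_sets[symmetric]) (simp add: assms)
 also have "... \<longleftrightarrow> emeasure lborel A = 0" using assms by (simp add: null_sets_def)
 finally show ?thesis .
qed

lemma emeasure_open_pos:
 assumes "open A" "A ~= {}"
 shows "emeasure lborel A ~= 0"
proof
 assume "emeasure lborel A = 0"
 then have "A \<in> null_sets lborel" using assms(1) by (simp add: null_sets_def)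
 then have "negligible A" unfolding negligible_iff_null_sets by (rule null_sets_completionI)
 then show False using open_not_negligible[OF assms] by contradiction
qed

lemma Linf_norm_AE: "AE p in lebesgue. p \<in> S --> ennreal (norm (g p)) <= Linf_norm S g"
proof -
 let ?A = "{C. AE p in lebesgue. p \<in> S --> ennreal (norm (g p)) <= C}"
 have "top \<in> ?A" by simp
 then have "?A ~= {}" by blast
 then obtain c :: "nat => ennreal" where "decseq c \<and> range c \<subseteq> ?A \<and> Inf ?A = (INF i. c i)"
  by (rule exE[OF ennreal_Inf_countable_INF])
 then have c: "range c \<subseteq> ?A" "Inf ?A = (INF i. c i)" by (blast+)
 have "AE p in lebesgue. \<forall>i. p \<in> S --> ennreal (norm (g p)) <= c i"
  unfolding AE_all_countable
 proof
  fix i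
  have "c i \<in> ?A" by (rule subsetD[OF c(1)]) simp
  then show "AE p in lebesgue. p \<in> S --> ennreal (norm (g p)) <= c i" by simp
 qed
 then show ?thesis unfolding Linf_norm_def c(2) by eventually_elim (auto intro: INF_greatest)
qed

lemma Linf_norm_mono: "S \<subseteq> T ==> Linf_norm S g <= Linf_norm T g"
 unfolding Linf_norm_def by (intro Inf_superset_mono subsetI CollectI, elim CollectE eventually_mono) blast

lemma Linf_norm_leI: "(AE p in lebesgue. p \<in> S --> ennreal (norm (g p)) <= C) ==> Linf_norm S g <= C"
 unfolding Linf_norm_def by (rule Inf_lower) simp

text \<open>A value of a continuous function is bounded by the essential supremum over \<open>S\<close> as soon as \<open>S\<close> is not
null near that point; \<open>p\<close> itself may lie outside \<open>S\<close>.\<close>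

lemma norm_le_Linf_norm:
 assumes "isCont g p" and S: "!!V. open V ==> p \<in> V ==> \<not> (AE z in lebesgue. z \<notin> V \<inter> S)"
 shows "ennreal (norm (g p)) <= Linf_norm S g"
proof (rule ccontr)
 assume "\<not> ?thesis"
 then have lt: "Linf_norm S g < ennreal (norm (g p))" by simp
 then obtain c where c: "Linf_norm S g = ennreal c" "0 <= c" by (cases "Linf_norm S g") auto
 have "c < norm (g p)" using lt c by (simp add: ennreal_less_iff)
 moreover have "((\<lambda>z. norm (g z)) \<longlongrightarrow> norm (g p)) (nhds p)"
  using assms(1) unfolding isCont_def by (intro tendsto_norm) (rule tendsto_at_iff_tendsto_nhds[THEN iffD1])
 ultimately have "\<forall>\<^sub>F z in nhds p. c < norm (g z)" by (rule order_tendstoD(1)[rotated])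
 then obtain A where A: "open A" "p \<in> A" "!!z. z \<in> A ==> c < norm (g z)" unfolding eventually_nhds by blast
 have big: "\<not> ennreal (norm (g z)) <= ennreal c" if "z \<in> A" for z using A(3)[OF that] c(2) by simp
 have "AE z in lebesgue. z \<notin> A \<inter> S"
  using Linf_norm_AE[of S g] unfolding c(1) by eventually_elim (use big in blast)
 then show False using S[OF A(1,2)] by blast
qed

lemma AE_ess_supp: "AE x in lebesgue. x \<notin> ess_supp g --> g x = 0"
proof -
 let ?F = "{V. open V \<and> (AE x in lebesgue. x \<in> V --> g x = 0)}"
 obtain F' where F': "F' \<subseteq> ?F" "countable F'" "\<Union>F' = \<Union>?F"
  using Lindelof[of ?F] by blast
 have "AE x in lebesgue. \<forall>V\<in>F'. x \<in> V --> g x = 0"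
  unfolding AE_ball_countable[OF F'(2)] using F'(1) by blast
 then show ?thesis unfolding ess_supp_def F'(3)[symmetric] by eventually_elim auto
qed

lemma ess_supp_not_null:
 assumes "x \<in> ess_supp g" "open V" "x \<in> V"
 shows "\<not> (AE y in lebesgue. y \<notin> V \<inter> ess_supp g)"
proof
 assume "AE y in lebesgue. y \<notin> V \<inter> ess_supp g"
 then have "AE y in lebesgue. y \<in> V --> g y = 0" using AE_ess_supp[of g] by eventually_elim auto
 then show False using assms unfolding ess_supp_def by blast
qed

lemma closed_ess_supp: "closed (ess_supp g)"
 unfolding ess_supp_def by (intro closed_Compl open_Union) auto

text \<open>The end points of the interval are limits of inner points; for \<open>U = 0\<close> the interval would be null and
its essential suprema without content.\<close>

lemma interval_inner_point:
 fixes p :: "'a::euclidean_space"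
 assumes "open A" "w \<in> A" "\<bar>w\<bar> <= U" "0 < U"
 shows "A \<inter> {-U<..<U :: real} ~= {}"
proof -
 have "w \<in> closure {-U<..<U}" using assms by auto
 then show ?thesis using assms(1,2) open_Int_closure_eq_empty[of A "{-U<..<U}"] by blast
qed

lemma Linf_norm_interval_ge:
 fixes g :: "real => 'b::real_normed_vector"
 assumes "isCont g w" "\<bar>w\<bar> <= U" "0 < U"
 shows "ennreal (norm (g w)) <= Linf_norm {-U..U} g"
proof (rule norm_le_Linf_norm[OF assms(1)])
 fix A :: "real set" assume A: "open A" "w \<in> A"
 show "\<not> (AE z in lebesgue. z \<notin> A \<inter> {-U..U})"
 proof
  assume "AE z in lebesgue. z \<notin> A \<inter> {-U..U}"
  then have "AE z in lebesgue. z \<notin> A \<inter> {-U<..<U}" by eventually_elim auto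
  then have "emeasure lborel (A \<inter> {-U<..<U}) = 0" using A by (subst (asm) AE_lebesgue_iff_lborel_Borel) auto
  then show False using emeasure_open_pos[OF open_Int[OF A(1) open_greaterThanLessThan] interval_inner_point[OF A assms(2,3)]] by blast
 qed
qed

lemma triple_box_not_null:
 fixes X :: "(real ^ 'n) set" and T :: "real set" and W :: "real set"
 assumes T: "open T" "T ~= {}" and W: "open W" "W ~= {}" and X: "X \<in> sets borel" "\<not> (AE y in lebesgue. y \<notin> X)"
 shows "\<not> (AE z in lebesgue. z \<notin> T \<times> X \<times> W)"
proof -
 have sets: "X \<times> W \<in> sets borel" "T \<times> X \<times> W \<in> sets borel" using T W X by (auto intro!: borel_Times)
 have "emeasure lborel (T \<times> X \<times> W) = emeasure lborel T * (emeasure lborel X * emeasure lborel W)"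
 proof -
  have [simp]: "T \<in> sets borel" "W \<in> sets borel" using T W by auto
  have "emeasure lborel (T \<times> X \<times> W) = emeasure lborel2 (T \<times> X \<times> W)" by (simp only: lborel_prod)
  also have "... = emeasure lborel T * emeasure lborel (X \<times> W)"
   using sets by (intro lborel.emeasure_pair_measure_Times) auto
  also have "emeasure lborel (X \<times> W) = emeasure lborel2 (X \<times> W)" by (simp only: lborel_prod)
  also have "... = emeasure lborel X * emeasure lborel W"
   using X by (intro lborel.emeasure_pair_measure_Times) auto
  finally show ?thesis .
 qed
 moreover have "emeasure lborel X ~= 0" using X by (simp add: AE_lebesgue_iff_lborel_Borel)
 ultimately show ?thesis unfolding AE_lebesgue_iff_lborel_Borel[OF sets(2)] using emeasure_open_pos[OF T] emeasure_open_pos[OF W] by simp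
qed

lemma Linf_norm_slab_ge:
 fixes g :: "real => real ^ 'n => real => 'b::real_normed_vector"
 assumes g: "continuous_on Omega (\<lambda>(t, x, w). g t x w)" and t: "0 < t" "t < T" and w: "\<bar>w\<bar> <= U" "0 < U"
  and X: "!!V. open V ==> x \<in> V ==> \<exists>Y\<subseteq>X \<inter> V. Y \<in> sets borel \<and> \<not> (AE y in lebesgue. y \<notin> Y)"
 shows "ennreal (norm (g t x w)) <= Linf_norm ({0..T} \<times> X \<times> {-U..U}) (\<lambda>(t, x, w). g t x w)"
proof -
 have "isCont (\<lambda>(t, x, w). g t x w) (t, x, w)"
  using bspec[OF g[unfolded continuous_on_eq_continuous_at[OF open_Omega]], of "(t, x, w)"] t by (simp add: Omega_def)
 then have "ennreal (norm ((\<lambda>(t, x, w). g t x w) (t, x, w))) <= Linf_norm ({0..T} \<times> X \<times> {-U..U}) (\<lambda>(t, x, w). g t x w)"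
 proof (rule norm_le_Linf_norm)
  fix A :: "(real \<times> (real ^ 'n) \<times> real) set" assume A: "open A" "(t, x, w) \<in> A"
  obtain A1 A' where 1: "open A1" "open A'" "t \<in> A1" "(x, w) \<in> A'" "A1 \<times> A' \<subseteq> A" by (rule open_prod_elim[OF A]) auto
  obtain A2 A3 where 2: "open A2" "open A3" "x \<in> A2" "w \<in> A3" "A2 \<times> A3 \<subseteq> A'" by (rule open_prod_elim[OF 1(2,4)]) auto
  obtain Y where Y: "Y \<subseteq> X \<inter> A2" "Y \<in> sets borel" "\<not> (AE y in lebesgue. y \<notin> Y)" using X[OF 2(1,3)] by blast
  have "\<not> (AE z in lebesgue. z \<notin> (A1 \<inter> {0<..<T}) \<times> Y \<times> (A3 \<inter> {-U<..<U}))"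
   using 1 2 t interval_inner_point[OF 2(2,4) w] by (intro triple_box_not_null Y) auto
  moreover have "(A1 \<inter> {0<..<T}) \<times> Y \<times> (A3 \<inter> {-U<..<U}) \<subseteq> A \<inter> ({0..T} \<times> X \<times> {-U..U})"
   using Y(1) 1(5) 2(5) by force
  ultimately show "\<not> (AE z in lebesgue. z \<notin> A \<inter> ({0..T} \<times> X \<times> {-U..U}))"
   using eventually_mono[of "\<lambda>z. z \<notin> A \<inter> ({0..T} \<times> X \<times> {-U..U})" "ae_filter lebesgue" "\<lambda>z. z \<notin> (A1 \<inter> {0<..<T}) \<times> Y \<times> (A3 \<inter> {-U<..<U})"] by blast
 qed
 then show ?thesis by simp
qed

lemma Linf_norm_Omega_box_ge:
 fixes g :: "real => real ^ 'n => real => 'b::real_normed_vector"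
 assumes "continuous_on Omega (\<lambda>(t, x, w). g t x w)" "0 < t" "t < T" "\<bar>w\<bar> <= U" "0 < U"
 shows "ennreal (norm (g t x w)) <= Linf_norm (Omega_box T U) (\<lambda>(t, x, w). g t x w)"
 unfolding Omega_box_def
proof (rule Linf_norm_slab_ge[OF assms])
 fix A :: "(real ^ 'n) set" assume A: "open A" "x \<in> A"
 show "\<exists>Y\<subseteq>UNIV \<inter> A. Y \<in> sets borel \<and> \<not> (AE y in lebesgue. y \<notin> Y)"
  using A emeasure_open_pos[OF A(1)] by (intro exI[of _ A]) (auto simp: AE_lebesgue_iff_lborel_Borel)
qed

text \<open>The union of the supports need not be measurable, but near each of its points it contains a piece of a
single support, which is closed and not null. The closure of the union may be taken for the same
reason.\<close>

lemma Linf_norm_Sigma_ge: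
 fixes g :: "real => real ^ 'n => real => 'b::real_normed_vector"
 assumes "continuous_on Omega (\<lambda>(t, x, w). g t x w)" "0 < t" "t < T0" "\<bar>w\<bar> <= U_max u T0" "0 < U_max u T0"
  and x: "x \<in> closure (supp_upto u T0)"
 shows "ennreal (norm (g t x w)) <= Linf_norm (Sigma_upto u T0) (\<lambda>(t, x, w). g t x w)"
 unfolding Sigma_upto_def
proof (rule Linf_norm_slab_ge[OF assms(1-5)])
 fix A :: "(real ^ 'n) set" assume A: "open A" "x \<in> A"
 then have "A \<inter> supp_upto u T0 ~= {}" using x open_Int_closure_eq_empty[of A "supp_upto u T0"] by blast
 then obtain s y where s: "s \<in> {0..T0}" "y \<in> ess_supp (u s)" "y \<in> A" unfolding supp_upto_def by blast
 show "\<exists>Y\<subseteq>supp_upto u T0 \<inter> A. Y \<in> sets borel \<and> \<not> (AE y in lebesgue. y \<notin> Y)"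
  using ess_supp_not_null[OF s(2) A(1) s(3)] s(1) A(1) closed_ess_supp[of "u s"]
  by (intro exI[of _ "A \<inter> ess_supp (u s)"]) (auto simp: supp_upto_def)
qed

context flow
begin

lemma H_bounds:
 assumes "0 < U" "0 < T"
 shows "Linf_norm (Omega_box T U) (\<lambda>(t, x, w). D_u f t x w) < \<infinity>"
  "Linf_norm (Omega_box T U) (\<lambda>(t, x, w). D_u F t x w) < \<infinity>"
  "Linf_norm (Omega_box T U) (\<lambda>(t, x, w). D_x (D_u f) t x w) < \<infinity>"
  "(\<integral>\<^sup>+ t \<in> {0..T}. (\<integral>\<^sup>+ x. Linf_norm {-U..U} (\<lambda>w. grad_x G t x w) \<partial>lebesgue) \<partial>lebesgue) < \<infinity>"
proof -
 have "\<forall>U>0. \<forall>T>0. Linf (Omega_box T U) (\<lambda>(t, x, w). D_u f t x w)" using H1 unfolding H1_star_def by simp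
 then show "Linf_norm (Omega_box T U) (\<lambda>(t, x, w). D_u f t x w) < \<infinity>" using assms unfolding Linf_def by blast
 show "Linf_norm (Omega_box T U) (\<lambda>(t, x, w). D_u F t x w) < \<infinity>"
  "Linf_norm (Omega_box T U) (\<lambda>(t, x, w). D_x (D_u f) t x w) < \<infinity>"
  "(\<integral>\<^sup>+ t \<in> {0..T}. (\<integral>\<^sup>+ x. Linf_norm {-U..U} (\<lambda>w. grad_x G t x w) \<partial>lebesgue) \<partial>lebesgue) < \<infinity>"
  using H2 assms unfolding H2_star_def Linf_def by simp_all
qed

lemma fxu_cont: "continuous_on Omega (\<lambda>(t, x, w). D_x (D_u f) t x w)"
 by (rule continuous_on_eq[OF P_cont]) (auto simp: D_x_D_u Omega_def)

lemma box_bounds: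
 assumes "0 < U" "0 < T"
 obtains L B M where "0 <= L" "0 <= B" "0 <= M"
  "!!t x w. 0 < t ==> t < T ==> \<bar>w\<bar> <= U ==> norm (D_u f t x w) <= L"
  "!!t x w. 0 < t ==> t < T ==> \<bar>w\<bar> <= U ==> norm (D_u F t x w) <= B"
  "!!t x w. 0 < t ==> t < T ==> \<bar>w\<bar> <= U ==> norm (P t x w) <= M"
proof -
 have fin: "ennreal r <= C ==> C < \<infinity> ==> r <= enn2real C" for r C
 proof (cases "0 <= r")
  case True
  assume "ennreal r <= C" "C < \<infinity>"
  then show ?thesis using enn2real_mono[of "ennreal r" C] True by simp
 next
  case False
  then show ?thesis using enn2real_nonneg[of C] by linarith
 qed
 show thesis
 proof (rule that)
  show "norm (D_u f t x w) <= enn2real (Linf_norm (Omega_box T U) (\<lambda>(t, x, w). D_u f t x w))" if "0 < t" "t < T" "\<bar>w\<bar> <= U" for t x w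
   by (rule fin[OF Linf_norm_Omega_box_ge[OF fu_cont that assms(1)] H_bounds(1)[OF assms]])
  show "norm (D_u F t x w) <= enn2real (Linf_norm (Omega_box T U) (\<lambda>(t, x, w). D_u F t x w))" if "0 < t" "t < T" "\<bar>w\<bar> <= U" for t x w
   by (rule fin[OF Linf_norm_Omega_box_ge[OF Fu_cont that assms(1)] H_bounds(2)[OF assms]])
  show "norm (P t x w) <= enn2real (Linf_norm (Omega_box T U) (\<lambda>(t, x, w). D_x (D_u f) t x w))" if "0 < t" "t < T" "\<bar>w\<bar> <= U" for t x w
   using fin[OF Linf_norm_Omega_box_ge[OF fxu_cont that assms(1)] H_bounds(3)[OF assms]] D_x_D_u[OF that(1)] by simp
 qed (rule enn2real_nonneg)+
qed

end

section \<open>Borel representatives of the solution\<close>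

lemma LINT_lebesgue_eq_lborel:
 fixes g h :: "'a::euclidean_space => real"
 assumes g: "Borel g" and ae: "AE p in lborel. h p = g p"
 shows "(LINT p|lebesgue. h p) = (LBINT p. g p)"
proof -
 have gl: "g \<in> borel_measurable lebesgue" using g by (simp add: measurable_completion)
 have ae': "AE p in lebesgue. h p = g p" by (rule AE_completion[OF ae])
 have hl: "h \<in> borel_measurable lebesgue" by (rule borel_measurable_AE[OF gl]) (use ae' in eventually_elim, simp)
 have "(LINT p|lebesgue. h p) = (LINT p|lebesgue. g p)" by (rule integral_cong_AE[OF hl gl ae'])
 also have "... = (LBINT p. g p)" by (rule integral_completion) (simp add: g)
 finally show ?thesis .
qed

lemma TV_cong_AE:
 fixes g h :: "real ^ 'n => real"
 assumes g [measurable]: "Borel g" and ae: "AE x in lborel. h x = g x"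
 shows "TV h = TV g"
proof -
 have "(LINT x|lebesgue. h x * divergence \<psi> x) = (LINT x|lebesgue. g x * divergence \<psi> x)" if "C1_c UNIV \<psi>" for \<psi> :: "real ^ 'n => real ^ 'n"
 proof -
  have [measurable]: "divergence \<psi> \<in> borel_measurable borel"
   using continuous_divergence[OF that] by (simp add: borel_measurable_continuous_onI)
  have "(LINT x|lebesgue. h x * divergence \<psi> x) = (LBINT x. g x * divergence \<psi> x)"
   by (rule LINT_lebesgue_eq_lborel) (use ae in \<open>measurable, eventually_elim, simp\<close>)
  also have "... = (LINT x|lebesgue. g x * divergence \<psi> x)"
   by (rule LINT_lebesgue_eq_lborel[symmetric]) auto
  finally show ?thesis .
 qed
 then show ?thesis unfolding TV_def by (intro SUP_cong) auto
qed

lemma L1_loc_measurable: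
 assumes "L1_loc (g :: real ^ 'n => real)"
 shows "g \<in> borel_measurable lebesgue"
proof (rule borel_measurable_LIMSEQ_real)
 show "(\<lambda>x. indicator (cball 0 (real i)) x *\<^sub>R g x) \<in> borel_measurable lebesgue" for i
  using assms unfolding L1_loc_def set_integrable_def by (intro borel_measurable_integrable) auto
 show "(\<lambda>i. indicator (cball 0 (real i)) x *\<^sub>R g x) \<longlonglongrightarrow> g x" for x
 proof (rule tendsto_eventually)
  obtain n :: nat where "norm x <= real n" using real_arch_simple by blast
  then have "indicator (cball 0 (real i)) x *\<^sub>R g x = g x" if "n <= i" for i
   using that by auto
  then show "\<forall>\<^sub>F i in sequentially. indicator (cball 0 (real i)) x *\<^sub>R g x = g x"
   unfolding eventually_sequentially by blast
 qed
qed

lemma Borel_representative: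
 assumes "g \<in> borel_measurable lebesgue" and bd: "AE x in lborel. \<bar>g x\<bar> <= (U :: real)" and U: "0 <= U"
 obtains h :: "'a::euclidean_space => real" where "Borel h" "!!x. \<bar>h x\<bar> <= U" "AE x in lborel. g x = h x"
proof -
 obtain h where h: "h \<in> borel_measurable lborel" "AE x in lborel. g x = h x"
  using completion_ex_borel_measurable_real[OF assms(1)] by (elim bexE)
 then have [measurable]: "Borel h" by simp
 show thesis
 proof (rule that)
  show "Borel (\<lambda>x. max (- U) (min U (h x)))" by measurable
  show "\<bar>max (- U) (min U (h x))\<bar> <= U" for x using U by auto
  show "AE x in lborel. g x = max (- U) (min U (h x))" using h(2) bd by eventually_elim auto
 qed
qed

text \<open>Upper integrals state the convergence without any joint measurability in time.\<close>

lemma tendsto_L1_loc_nn_integral: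
 assumes lim: "tendsto_L1_loc u g (at_right t)" and L1: "!!s. t < s ==> L1_loc (u s)" "L1_loc g" and e: "0 < e"
 shows "\<exists>r>0. \<forall>s. t < s \<and> s < t + r --> (NBINT x. ennreal (indicator (cball 0 R) x * \<bar>u s x - g x\<bar>)) <= ennreal e"
proof -
 let ?K = "cball (0 :: real ^ 'n) R"
 have "((\<lambda>s. LINT x:?K|lebesgue. \<bar>u s x - g x\<bar>) \<longlongrightarrow> 0) (at_right t)" using lim unfolding tendsto_L1_loc_def by simp
 then have "\<forall>\<^sub>F s in at_right t. (LINT x:?K|lebesgue. \<bar>u s x - g x\<bar>) < e" by (rule order_tendstoD(2)[OF _ e])
 then obtain b where b: "t < b" "!!s. t < s ==> s < b ==> (LINT x:?K|lebesgue. \<bar>u s x - g x\<bar>) < e"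
  unfolding eventually_at_right_field by blast
 have "(NBINT x. ennreal (indicator ?K x * \<bar>u s x - g x\<bar>)) <= ennreal e" if s: "t < s" "s < b" for s
 proof -
  have "set_integrable lebesgue ?K (u s)" "set_integrable lebesgue ?K g" using L1(1)[OF s(1)] L1(2) unfolding L1_loc_def by auto
  then have "set_integrable lebesgue ?K (\<lambda>x. \<bar>u s x - g x\<bar>)" by (intro set_integrable_abs set_integral_diff)
  then have i: "integrable lebesgue (\<lambda>x. indicator ?K x * \<bar>u s x - g x\<bar>)" by (simp add: set_integrable_def)
  have "(NBINT x. ennreal (indicator ?K x * \<bar>u s x - g x\<bar>)) = (\<integral>\<^sup>+x. ennreal (indicator ?K x * \<bar>u s x - g x\<bar>) \<partial>lebesgue)"
   by (simp only: nn_integral_completion)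
  also have "... = ennreal (LINT x|lebesgue. indicator ?K x * \<bar>u s x - g x\<bar>)"
   by (rule nn_integral_eq_integral[OF i]) auto
  also have "... <= ennreal e" using b(2)[OF s] by (intro ennreal_leI) (simp add: set_lebesgue_integral_def)
  finally show ?thesis .
 qed
 then show ?thesis using b(1) by (intro exI[of _ "b - t"]) auto
qed

lemma cball_measurable [measurable]: "cball (0 :: real ^ 'n) r \<in> sets borel" by simp

lemma AE_zero_from_balls:
 assumes [measurable]: "Borel g" and zero: "!!R e. 0 < e ==> (NBINT x. ennreal (indicator (cball (0 :: real ^ 'n) R) x * \<bar>g x\<bar>)) <= ennreal e"
 shows "AE x in lborel. g x = 0"
proof -
 have "AE x in lborel. \<forall>n. indicator (cball 0 (real n)) x * \<bar>g x\<bar> = 0"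
  unfolding AE_all_countable
 proof
  fix n :: nat
  have "(NBINT x. ennreal (indicator (cball (0 :: real ^ 'n) (real n)) x * \<bar>g x\<bar>)) <= 0"
   by (rule ennreal_le_epsilon) (use zero in simp)
  then have "AE x in lborel. ennreal (indicator (cball (0 :: real ^ 'n) (real n)) x * \<bar>g x\<bar>) = 0"
   by (subst nn_integral_0_iff_AE[symmetric]) auto
  then show "AE x in lborel. indicator (cball 0 (real n)) x * \<bar>g x\<bar> = 0"
   by eventually_elim (auto simp: indicator_def split: if_splits)
 qed
 then show ?thesis
 proof eventually_elim
  case (elim x)
  obtain n :: nat where "norm x <= real n" using real_arch_simple by blast
  then show ?case using elim by (auto dest: spec[of _ n])
 qed
qed

lemma C1_c_partial_derivatives:
 fixes \<phi> :: "real => real ^ 'n => real"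
 assumes "C1_c S (\<lambda>(t, x). \<phi> t x)"
 shows "vector_derivative (\<lambda>s. \<phi> s x) (at t) = blinfun_apply (deriv_at (\<lambda>(t, x). \<phi> t x) (t, x)) (1, 0)"
  and "grad (\<phi> t) x = (\<chi> j. blinfun_apply (deriv_at (\<lambda>(t, x). \<phi> t x) (t, x)) (0, axis j 1))"
proof -
 let ?D = "blinfun_apply (deriv_at (\<lambda>(t, x). \<phi> t x) (t, x))"
 have der: "((\<lambda>(t, x). \<phi> t x) has_derivative ?D) (at (t, x))" by (rule C1_cD(1)[OF assms])
 have "((\<lambda>s. (\<lambda>(t, x). \<phi> t x) (s, x)) has_derivative (\<lambda>h. ?D (h, 0))) (at t)"
  by (rule has_derivative_compose[where f="\<lambda>s. (s, x)" and x=t, OF _ der]) (auto intro!: derivative_eq_intros)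
 then have "((\<lambda>s. \<phi> s x) has_derivative (\<lambda>h. ?D (h, 0))) (at t)" by simp
 moreover have "(\<lambda>h. ?D (h, 0)) = (\<lambda>h. h *\<^sub>R ?D (1, 0))"
 proof
  fix h show "?D (h, 0) = h *\<^sub>R ?D (1, 0)"
   using blinfun.scaleR_right[of "deriv_at (\<lambda>(t, x). \<phi> t x) (t, x)" h "(1, 0)"] by simp
 qed
 ultimately have "((\<lambda>s. \<phi> s x) has_vector_derivative ?D (1, 0)) (at t)"
  unfolding has_vector_derivative_def by (rule has_derivative_eq_rhs)
 then show "vector_derivative (\<lambda>s. \<phi> s x) (at t) = ?D (1, 0)" by (rule vector_derivative_at)
 have "((\<lambda>y. (\<lambda>(t, x). \<phi> t x) (t, y)) has_derivative (\<lambda>h. ?D (0, h))) (at x)"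
  by (rule has_derivative_compose[where f="\<lambda>y. (t, y)" and x=x, OF _ der]) (auto intro!: derivative_eq_intros)
 then have "blinfun_apply (deriv_at (\<phi> t) x) = (\<lambda>h. ?D (0, h))" by (intro deriv_at_eq) simp
 then show "grad (\<phi> t) x = (\<chi> j. ?D (0, axis j 1))" by (simp add: grad_def)
qed

locale solution = flow f F for f :: "real => real ^ 'n => real => real ^ 'n" and F +
 fixes u0 :: "real ^ 'n => real" and u :: "real => real ^ 'n => real"
 assumes sol: "weak_entropy_solution f F u0 u" and u0_L1: "L1_loc u0"
begin

lemma u_L1: "0 <= t ==> L1_loc (u t)" and u_right: "0 <= t ==> tendsto_L1_loc u (u t) (at_right t)"
 using sol unfolding weak_entropy_solution_def by auto

lemma u_right_limit:
 assumes t: "0 <= t" and e: "0 < e"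
 shows "\<exists>r>0. \<forall>s. t < s \<and> s < t + r --> (NBINT x. ennreal (indicator (cball 0 R) x * \<bar>u s x - u t x\<bar>)) <= ennreal e"
 by (rule tendsto_L1_loc_nn_integral[OF u_right[OF t] _ _ e]) (use t u_L1 in auto)

text \<open>Almost every slice satisfies the bound by Fubini, and by right continuity every slice is a limit of such
slices.\<close>

lemma slice_bound:
 assumes bd: "AE p in lborel. fst p \<in> {0..T} --> \<bar>u (fst p) (snd p)\<bar> <= U" and t: "0 <= t" "t < T" and U: "0 <= U"
 shows "AE x in lborel. \<bar>u t x\<bar> <= U"
proof -
 have "AE p in lborel \<Otimes>\<^sub>M (lborel :: (real ^ 'n) measure). fst p \<in> {0..T} --> \<bar>u (fst p) (snd p)\<bar> <= U"
  unfolding lborel_prod by (rule bd)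
 from lborel_pair.AE_pair[OF this] have ae: "AE s in lborel. AE x in lborel. s \<in> {0..T} --> \<bar>u s x\<bar> <= U" by simp
 obtain g where g: "g \<in> borel_measurable lborel" "AE x in lborel. u t x = g x"
  using completion_ex_borel_measurable_real[OF L1_loc_measurable[OF u_L1[OF t(1)]]] by (elim bexE)
 then have [measurable]: "Borel g" by simp
 have "AE x in lborel. max 0 (\<bar>g x\<bar> - U) = 0"
 proof (rule AE_zero_from_balls)
  fix R e :: real assume e: "0 < e"
  obtain r where r: "0 < r" "!!s. t < s ==> s < t + r ==> (NBINT x. ennreal (indicator (cball 0 R) x * \<bar>u s x - u t x\<bar>)) <= ennreal e"
   using u_right_limit[OF t(1) e, of R] by blast
  obtain s where s: "t < s" "s < t + r" "s <= T" "AE x in lborel. \<bar>u s x\<bar> <= U"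
  proof -
   let ?I = "{t<..<min (t + r) T}"
   have "\<not> (AE s in lebesgue. s \<notin> ?I)"
   proof -
    have "open ?I" "?I ~= {}" "?I \<in> sets borel" using r(1) t(2) by auto
    then show ?thesis using emeasure_open_pos[of ?I] by (simp only: AE_lebesgue_iff_lborel_Borel) simp
   qed
   then have "\<not> (AE s in lborel. s \<notin> ?I)" by (auto dest: AE_completion)
   then have "\<exists>s\<in>?I. AE x in lborel. s \<in> {0..T} --> \<bar>u s x\<bar> <= U"
    using ae eventually_mono[OF ae, of "\<lambda>s. s \<notin> ?I"] by blast
   then obtain s where s: "s \<in> ?I" "AE x in lborel. s \<in> {0..T} --> \<bar>u s x\<bar> <= U" by (elim bexE)
   have "s \<in> {0..T}" using s(1) t by auto
   then show thesis using s by (intro that) auto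
  qed
  have "(NBINT x. ennreal (indicator (cball 0 R) x * \<bar>max 0 (\<bar>g x\<bar> - U)\<bar>)) <= (NBINT x. ennreal (indicator (cball 0 R) x * \<bar>u s x - u t x\<bar>))"
  proof (rule nn_integral_mono_AE)
   show "AE x in lborel. ennreal (indicator (cball 0 R) x * \<bar>max 0 (\<bar>g x\<bar> - U)\<bar>) <= ennreal (indicator (cball 0 R) x * \<bar>u s x - u t x\<bar>)"
    using s(4) g(2) by eventually_elim (auto simp: indicator_def intro!: ennreal_leI)
  qed
  also have "... <= ennreal e" by (rule r(2)[OF s(1,2)])
  finally show "(NBINT x. ennreal (indicator (cball 0 R) x * \<bar>max 0 (\<bar>g x\<bar> - U)\<bar>)) <= ennreal e" .
 qed measurable
 then show ?thesis using g(2) by eventually_elim auto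
qed

lemma u_initial: "AE x in lborel. u 0 x = u0 x"
proof -
 obtain g where g: "g \<in> borel_measurable lborel" "AE x in lborel. u 0 x = g x"
  using completion_ex_borel_measurable_real[OF L1_loc_measurable[OF u_L1[OF order_refl]]] by (elim bexE)
 obtain h where h: "h \<in> borel_measurable lborel" "AE x in lborel. u0 x = h x"
  using completion_ex_borel_measurable_real[OF L1_loc_measurable[OF u0_L1]] by (elim bexE)
 have [measurable]: "Borel g" "Borel h" using g h by simp_all
 have "AE x in lborel. g x - h x = 0"
 proof (rule AE_zero_from_balls)
  fix R e :: real assume e: "0 < e"
  have e2: "0 < e / 2" using e by simp
  have lim: "tendsto_L1_loc u u0 (at_right 0)" using sol unfolding weak_entropy_solution_def by auto
  obtain r1 where r1: "0 < r1" "!!s. 0 < s ==> s < 0 + r1 ==> (NBINT x. ennreal (indicator (cball 0 R) x * \<bar>u s x - u 0 x\<bar>)) <= ennreal (e / 2)"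
   using u_right_limit[OF order_refl e2, of R] by blast
  obtain r2 where r2: "0 < r2" "!!s. 0 < s ==> s < 0 + r2 ==> (NBINT x. ennreal (indicator (cball 0 R) x * \<bar>u s x - u0 x\<bar>)) <= ennreal (e / 2)"
   using tendsto_L1_loc_nn_integral[OF lim _ u0_L1 e2, of R] u_L1 by auto
  define s where "s = min r1 r2 / 2"
  have s: "0 < s" "s < 0 + r1" "s < 0 + r2" using r1 r2 by (auto simp: s_def)
  obtain k where k: "k \<in> borel_measurable lborel" "AE x in lborel. u s x = k x"
   using completion_ex_borel_measurable_real[OF L1_loc_measurable[OF u_L1]] s(1) by (meson less_imp_le)
  have [measurable]: "Borel k" using k by simp
  have "(NBINT x. ennreal (indicator (cball 0 R) x * \<bar>g x - h x\<bar>))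
   <= (NBINT x. ennreal (indicator (cball 0 R) x * \<bar>k x - g x\<bar>) + ennreal (indicator (cball 0 R) x * \<bar>k x - h x\<bar>))"
   by (intro nn_integral_mono) (auto simp: indicator_def ennreal_plus[symmetric] simp del: ennreal_plus intro!: ennreal_leI)
  also have "... = (NBINT x. ennreal (indicator (cball 0 R) x * \<bar>k x - g x\<bar>)) + (NBINT x. ennreal (indicator (cball 0 R) x * \<bar>k x - h x\<bar>))"
   by (rule nn_integral_add) auto
  also have "(NBINT x. ennreal (indicator (cball 0 R) x * \<bar>k x - g x\<bar>)) = (NBINT x. ennreal (indicator (cball 0 R) x * \<bar>u s x - u 0 x\<bar>))"
   by (rule nn_integral_cong_AE, use k(2) g(2) in eventually_elim) simp
  also have "(NBINT x. ennreal (indicator (cball 0 R) x * \<bar>k x - h x\<bar>)) = (NBINT x. ennreal (indicator (cball 0 R) x * \<bar>u s x - u0 x\<bar>))"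
   by (rule nn_integral_cong_AE, use k(2) h(2) in eventually_elim) simp
  also have "(NBINT x. ennreal (indicator (cball 0 R) x * \<bar>u s x - u 0 x\<bar>)) + (NBINT x. ennreal (indicator (cball 0 R) x * \<bar>u s x - u0 x\<bar>)) <= ennreal (e / 2) + ennreal (e / 2)"
   by (intro add_mono r1(2) r2(2) s)
  also have "... = ennreal e" using e by (simp add: ennreal_plus[symmetric] del: ennreal_plus)
  finally show "(NBINT x. ennreal (indicator (cball 0 R) x * \<bar>g x - h x\<bar>)) <= ennreal e" .
 qed measurable
 then show ?thesis using g(2) h(2) by eventually_elim simp
qed

lemma Linf_norm_u: "0 < T ==> Linf_norm ({0..T} \<times> UNIV) (\<lambda>(t, x). u t x) = ennreal (U_max u T)"
 and u_set_measurable: "0 < T ==> set_borel_measurable lebesgue ({0..T} \<times> UNIV) (\<lambda>(t, x). u t x)"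
 using sol unfolding weak_entropy_solution_def Linf_def U_max_def by auto

lemma U_max_nonneg: "0 <= U_max u T"
 by (simp add: U_max_def)

lemma U_max_AE:
 assumes "0 < T"
 shows "AE p in lborel. fst p \<in> {0..T} --> \<bar>u (fst p) (snd p)\<bar> <= U_max u T"
proof -
 have "AE p in lborel. p \<in> {0..T} \<times> UNIV --> ennreal (norm ((\<lambda>(t, x). u t x) p)) <= ennreal (U_max u T)"
  using Linf_norm_AE[of "{0..T} \<times> UNIV" "\<lambda>(t, x). u t x"] unfolding Linf_norm_u[OF assms] AE_completion_iff .
 then show ?thesis
 proof eventually_elim
  case (elim p)
  then show ?case by (cases p) (auto simp: ennreal_le_iff U_max_nonneg)
 qed
qed

lemma slice_le_U_max: "0 <= t ==> t < T ==> AE x in lborel. \<bar>u t x\<bar> <= U_max u T"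
 by (rule slice_bound[OF U_max_AE]) (auto simp: U_max_nonneg)

text \<open>The energy method evaluates the solution pointwise and integrates over products, hence the passage to a
Borel function. It vanishes off \<open>C\<close> without exception, so that \<open>v(t,x) \<noteq> v(t,y)\<close> places \<open>x\<close> or \<open>y\<close> in
\<open>C\<close>.\<close>

definition represents :: "(real => real ^ 'n => real) => real => real => (real ^ 'n) set => bool" where
 "represents v T U C \<longleftrightarrow> (\<lambda>(t, x). v t x) \<in> borel_measurable borel \<and> (\<forall>t x. \<bar>v t x\<bar> <= U) \<and> (\<forall>t x. x \<notin> C --> v t x = 0)
   \<and> (AE t in lborel. 0 < t \<and> t < T --> (AE x in lborel. v t x = u t x))
   \<and> (AE p in lborel. 0 < fst p \<and> fst p < T --> v (fst p) (snd p) = u (fst p) (snd p))"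

lemma ex_representative:
 assumes T: "0 < T" and C [measurable]: "C \<in> sets borel"
  and zero: "!!t. 0 < t ==> t < T ==> AE x in lborel. x \<notin> C --> u t x = 0"
 shows "\<exists>v. represents v T (U_max u T) C"
proof -
 let ?U = "U_max u T"
 have m: "(\<lambda>p. indicator ({0..T} \<times> UNIV) p *\<^sub>R (\<lambda>(t, x). u t x) p) \<in> borel_measurable lebesgue"
  using u_set_measurable[OF T] by (simp add: set_borel_measurable_def)
 obtain w where w: "w \<in> borel_measurable lborel" "AE p in lborel. indicator ({0..T} \<times> UNIV) p *\<^sub>R (\<lambda>(t, x). u t x) p = w p"
  using completion_ex_borel_measurable_real[OF m] by (elim bexE)
 have w_m [measurable]: "Borel w" using w(1) by simp
 have w_eq: "AE p in lborel. fst p \<in> {0..T} --> w p = u (fst p) (snd p)"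
  using w(2)
 proof eventually_elim
  case (elim p)
  then show ?case by (cases p) (auto simp: indicator_def split: if_splits)
 qed
 then have "AE p in lborel \<Otimes>\<^sub>M (lborel :: (real ^ 'n) measure). fst p \<in> {0..T} --> w p = u (fst p) (snd p)" unfolding lborel_prod .
 from lborel_pair.AE_pair[OF this] have w_sec: "AE t in lborel. AE x in lborel. t \<in> {0..T} --> w (t, x) = u t x" by simp
 define v where "v = (\<lambda>t x. if x \<in> C then max (- ?U) (min ?U (w (t, x))) else 0)"
 have v_sec: "AE t in lborel. 0 < t \<and> t < T --> (AE x in lborel. v t x = u t x)"
  using w_sec
 proof eventually_elim
  case (elim t)
  show ?case
  proof
   assume t: "0 < t \<and> t < T"
   then have "AE x in lborel. \<bar>u t x\<bar> <= ?U" by (intro slice_le_U_max) auto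
   moreover have "AE x in lborel. x \<notin> C --> u t x = 0" using zero t by blast
   ultimately show "AE x in lborel. v t x = u t x"
    using elim
   proof eventually_elim
    case (elim x)
    then show ?case using t by (auto simp: v_def)
   qed
  qed
 qed
 have w0: "AE t in lborel. AE x in lborel. 0 < fst (t, x) \<and> fst (t, x) < T \<and> snd (t, x) \<notin> C --> w (t, x) = 0"
  using w_sec
 proof eventually_elim
  case (elim t)
  show ?case
  proof (cases "0 < t \<and> t < T")
   case True
   then have "AE x in lborel. x \<notin> C --> u t x = 0" using zero by blast
   then show ?thesis using elim by eventually_elim (use True in auto)
  qed auto
 qed
 have "AE p in lborel \<Otimes>\<^sub>M (lborel :: (real ^ 'n) measure). 0 < fst p \<and> fst p < T \<and> snd p \<notin> C --> w p = 0"
 proof (rule lborel_pair.AE_pair_measure[OF _ w0])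
  have [measurable]: "w \<in> borel_measurable borel2" unfolding borel_prod by (rule w_m)
  show "{p \<in> space (lborel \<Otimes>\<^sub>M (lborel :: (real ^ 'n) measure)). 0 < fst p \<and> fst p < T \<and> snd p \<notin> C --> w p = 0} \<in> sets lborel2"
   by measurable
 qed
 then have w0': "AE p in lborel. 0 < fst p \<and> fst p < T \<and> snd p \<notin> C --> w p = 0" unfolding lborel_prod .
 have "(\<lambda>(t, x). v t x) \<in> borel_measurable borel2"
 proof -
  have [measurable]: "w \<in> borel_measurable borel2" unfolding borel_prod by (rule w_m)
  show ?thesis unfolding v_def split_beta by measurable
 qed
 moreover have "AE p in lborel. 0 < fst p \<and> fst p < T --> v (fst p) (snd p) = u (fst p) (snd p)"
  using w_eq w0' U_max_AE[OF T]
 proof eventually_elim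
  case (elim p)
  then show ?case by (auto simp: v_def)
 qed
 ultimately have "represents v T ?U C" unfolding represents_def borel_prod using v_sec U_max_nonneg[of T] by (auto simp: v_def)
 then show ?thesis by blast
qed

lemma slice_right_limit:
 assumes rep: "represents v T U C" and t: "0 <= t" "t < T" and g: "AE x in lborel. u t x = g x"
 shows "right_trace v t g"
proof (intro allI impI)
 fix R e :: real assume e: "0 < e"
 obtain r where r: "0 < r" "!!s. t < s ==> s < t + r ==> (NBINT x. ennreal (indicator (cball 0 R) x * \<bar>u s x - u t x\<bar>)) <= ennreal e"
  using u_right_limit[OF t(1) e, of R] by blast
 have v: "AE s in lborel. 0 < s \<and> s < T --> (AE x in lborel. v s x = u s x)" using rep by (simp add: represents_def)
 have "AE s in lborel. t < s \<and> s < t + min r (T - t) --> (LBINT y. indicator (cball 0 R) y * \<bar>v s y - g y\<bar>) <= e"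
  using v
 proof eventually_elim
  case (elim s)
  show ?case
  proof
   assume s: "t < s \<and> s < t + min r (T - t)"
   then have ae: "AE x in lborel. v s x = u s x" using elim t by auto
   have "(NBINT x. ennreal (indicator (cball 0 R) x * \<bar>v s x - g x\<bar>)) = (NBINT x. ennreal (indicator (cball 0 R) x * \<bar>u s x - u t x\<bar>))"
    by (rule nn_integral_cong_AE, use ae g in eventually_elim) simp
   also have "... <= ennreal e" using s by (intro r(2)) auto
   finally show "(LBINT y. indicator (cball 0 R) y * \<bar>v s y - g y\<bar>) <= e" using e by (intro integral_real_bounded) auto
  qed
 qed
 then show "\<exists>r>0. AE s in lborel. t < s \<and> s < t + r --> (LBINT y. indicator (cball 0 R) y * \<bar>v s y - g y\<bar>) <= e"
  using r(1) t(2) by (intro exI[of _ "min r (T - t)"]) auto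
qed

text \<open>The coefficients are continuous for positive times and arbitrary elsewhere; the extension by \<open>0\<close> is
Borel.\<close>

definition zero_before :: "(real => real ^ 'n => real => 'b::real_normed_vector) => real => real ^ 'n => real => 'b" where
 "zero_before g = (\<lambda>t x w. if 0 < t then g t x w else 0)"

lemma zero_before_eq: "0 < t ==> zero_before g t x w = g t x w"
 by (simp add: zero_before_def)

lemma zero_before_continuous_Borel:
 fixes g :: "real => real ^ 'n => real => 'b::real_normed_vector"
 assumes "continuous_on Omega (\<lambda>(t, x, w). g t x w)"
 shows "continuous_on Omega (\<lambda>(t, x, w). zero_before g t x w)" "Borel (\<lambda>(t, x, w). zero_before g t x w)"
proof -
 show "continuous_on Omega (\<lambda>(t, x, w). zero_before g t x w)"
  by (rule continuous_on_eq[OF assms]) (auto simp: Omega_def zero_before_def)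
 have "Borel (\<lambda>p. indicator Omega p *\<^sub>R (\<lambda>(t, x, w). g t x w) p)"
  by (rule borel_measurable_continuous_on_indicator[OF _ assms]) (simp add: open_Omega)
 also have "(\<lambda>p. indicator Omega p *\<^sub>R (\<lambda>(t, x, w). g t x w) p) = (\<lambda>(t, x, w). zero_before g t x w)"
  by (auto simp: Omega_def zero_before_def indicator_def fun_eq_iff)
 finally show "Borel (\<lambda>(t, x, w). zero_before g t x w)" .
qed

lemma entropy_core_representative:
 assumes T: "0 < T" and rep: "represents v T U C"
 shows "entropy_core (zero_before f) (zero_before F) (zero_before d) v T U"
proof
 have rep': "Borel (\<lambda>(t, x). v t x)" "!!t x. \<bar>v t x\<bar> <= U"
  and v_sec: "AE t in lborel. 0 < t \<and> t < T --> (AE x in lborel. v t x = u t x)"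
  and v_eq: "AE p in lborel. 0 < fst p \<and> fst p < T --> v (fst p) (snd p) = u (fst p) (snd p)"
  using rep by (auto simp: represents_def)
 show vm: "Borel (\<lambda>(t, x). v t x)" and "\<bar>v t x\<bar> <= U" for t x using rep' by auto
 show "continuous_on Omega (\<lambda>(t, x, w). zero_before f t x w)" and fm: "Borel (\<lambda>(t, x, w). zero_before f t x w)"
  by (rule zero_before_continuous_Borel[OF f_cont])+
 show "continuous_on Omega (\<lambda>(t, x, w). zero_before F t x w)" and Fm: "Borel (\<lambda>(t, x, w). zero_before F t x w)"
  by (rule zero_before_continuous_Borel[OF F_cont])+
 show "continuous_on Omega (\<lambda>(t, x, w). zero_before d t x w)" and dm: "Borel (\<lambda>(t, x, w). zero_before d t x w)"
  by (rule zero_before_continuous_Borel[OF d_cont])+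
 show "AE t in lborel. 0 < t \<and> t < T --> right_trace v t (v t)"
  using v_sec
 proof eventually_elim
  case (elim t)
  show ?case
  proof
   assume t: "0 < t \<and> t < T"
   then have "AE x in lborel. v t x = u t x" using elim by blast
   then have "AE x in lborel. u t x = v t x" by eventually_elim simp
   then show "right_trace v t (v t)" using t by (intro slice_right_limit[OF rep]) auto
  qed
 qed
 fix \<phi> :: "real => real ^ 'n => real" and k :: real assume \<phi>: "C1_c ({0<..<T} \<times> UNIV) (\<lambda>(t, x). \<phi> t x)" and pos: "!!t x. 0 <= \<phi> t x"
 define D where "D = (\<lambda>p h. blinfun_apply (deriv_at (\<lambda>(t, x). \<phi> t x) p) h)"
 have Dc: "continuous_on UNIV (\<lambda>p. D p h)" for h unfolding D_def by (rule C1_cD(2)[OF \<phi>])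
 have \<phi>c: "continuous_on UNIV (\<lambda>(t, x). \<phi> t x)" by (rule C1_cD(3)[OF \<phi>])
 have \<phi>0: "\<phi> t x = 0" "D (t, x) h = 0" if "\<not> (0 < t \<and> t < T)" for t x h
 proof -
  let ?Z = "- closure {p. (\<lambda>(t, x). \<phi> t x) p ~= 0}"
  have Z: "(t, x) \<in> ?Z" using \<phi> that unfolding C1_c_def by auto
  have z: "(\<lambda>(t, x). \<phi> t x) p = 0" if p: "p \<in> ?Z" for p
  proof (rule ccontr)
   assume "(\<lambda>(t, x). \<phi> t x) p ~= 0"
   then have "p \<in> {p. (\<lambda>(t, x). \<phi> t x) p ~= 0}" by (rule CollectI)
   from subsetD[OF closure_subset this] show False using p by (rule notE[rotated, OF _ ComplD])
  qed
  show "\<phi> t x = 0" using z[OF Z] by simp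
  have "((\<lambda>(t, x). \<phi> t x) has_derivative (\<lambda>_. 0)) (at (t, x))"
  proof (rule has_derivative_transform_within_open[OF has_derivative_const[of 0] _ Z])
   show "open ?Z" by (rule open_Compl) simp
   show "0 = (\<lambda>(t, x). \<phi> t x) p" if "p \<in> ?Z" for p using z[OF that] by (rule sym)
  qed
  then show "D (t, x) h = 0" unfolding D_def by (simp add: deriv_at_eq)
 qed
 define \<Phi> where "\<Phi> = (\<lambda>f F d v t x. ((v t x - k) * D (t, x) (1, 0)
     + (f t x (v t x) - f t x k) \<bullet> (\<chi> j. D (t, x) (0, axis j 1)) + (F t x (v t x) - d t x k) * \<phi> t x) * sgn (v t x - k) :: real)"
 have eq: "(LINT p|lebesgue. indicator ({0<..} \<times> UNIV) p *\<^sub>R (\<lambda>(t, x). \<Phi> f F d u t x) p) = (LBINT p. (\<lambda>(t, x). \<Phi> (zero_before f) (zero_before F) (zero_before d) v t x) p)"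
 proof (rule LINT_lebesgue_eq_lborel)
  have v1 [measurable]: "Borel (\<lambda>p. v (fst p) (snd p))" using vm unfolding case_prod_beta' .
  have f1: "Borel (\<lambda>p. zero_before f (fst p) (snd p) (c p))"
   and F1: "Borel (\<lambda>p. zero_before F (fst p) (snd p) (c p))"
   and d1: "Borel (\<lambda>p. zero_before d (fst p) (snd p) (c p))" if [measurable]: "Borel c" for c
  proof -
   have *: "Borel (\<lambda>p. (fst p, snd p, c p))" by (intro borel_measurable_Pair borel_measurable_continuous_onI continuous_intros that)
   show "Borel (\<lambda>p. zero_before f (fst p) (snd p) (c p))" using measurable_compose[OF * fm] by simp
   show "Borel (\<lambda>p. zero_before F (fst p) (snd p) (c p))" using measurable_compose[OF * Fm] by simp
   show "Borel (\<lambda>p. zero_before d (fst p) (snd p) (c p))" using measurable_compose[OF * dm] by simp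
  qed
  have [measurable]: "Borel (\<lambda>p. D (fst p, snd p) h)" for h
   using Dc[of h] by (simp add: borel_measurable_continuous_onI)
  have g [measurable]: "Borel (\<lambda>p. \<chi> j. D (fst p, snd p) (0, axis j 1))"
   using Dc by (intro borel_measurable_continuous_onI continuous_on_vec_lambda) simp
  have [measurable]: "Borel (\<lambda>p. \<phi> (fst p) (snd p))"
   using \<phi>c unfolding case_prod_beta' by (rule borel_measurable_continuous_onI)
  note [measurable] = f1[OF v1] f1[OF borel_measurable_const] F1[OF v1] d1[OF borel_measurable_const]
  show "Borel (\<lambda>(t, x). \<Phi> (zero_before f) (zero_before F) (zero_before d) v t x)"
   unfolding \<Phi>_def split_beta by measurable
  show "AE p in lborel. indicator ({0<..} \<times> UNIV) p *\<^sub>R (\<lambda>(t, x). \<Phi> f F d u t x) p = (\<lambda>(t, x). \<Phi> (zero_before f) (zero_before F) (zero_before d) v t x) p"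
   using v_eq
  proof eventually_elim
   case (elim p)
   obtain t x where p: "p = (t, x)" by (cases p)
   show ?case
   proof (cases "0 < t \<and> t < T")
    case True
    then show ?thesis using elim by (simp add: p \<Phi>_def zero_before_eq)
   next
    case False
    have "(\<chi> j. D (t, x) (0, axis j 1)) = (0 :: real ^ 'n)" using \<phi>0(2)[OF False] by (simp add: vec_eq_iff)
    then show ?thesis using \<phi>0[OF False] by (simp add: p \<Phi>_def)
   qed
  qed
 qed
 have "C1_c ({0<..} \<times> UNIV) (\<lambda>(t, x). \<phi> t x)" using \<phi> unfolding C1_c_def by auto
 then have "entropy_inequality f F u k \<phi>" using sol pos unfolding weak_entropy_solution_def by blast
 then have "0 <= (LINT p|lebesgue. indicator ({0<..} \<times> UNIV) p *\<^sub>R (\<lambda>(t, x). \<Phi> f F d u t x) p)"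
  unfolding entropy_inequality_def set_lebesgue_integral_def C1_c_partial_derivatives[OF \<phi>] \<Phi>_def D_def .
 then show "0 <= (LBINT (t, x). ((v t x - k) * vector_derivative (\<lambda>s. \<phi> s x) (at t)
     + (zero_before f t x (v t x) - zero_before f t x k) \<bullet> grad (\<phi> t) x + (zero_before F t x (v t x) - zero_before d t x k) * \<phi> t x) * sgn (v t x - k))"
  unfolding eq C1_c_partial_derivatives[OF \<phi>] unfolding \<Phi>_def D_def .
qed

end

section \<open>The estimate away from the initial time\<close>

lemma uniform_on_slab:
 fixes g :: "real => real ^ 'n => real => 'b::real_normed_vector"
 assumes g: "continuous_on Omega (\<lambda>(t, x, w). g t x w)" and a: "0 < a" and e: "0 < e"
 obtains r where "0 < r" "!!t x z w. a <= t ==> t <= b ==> \<bar>w\<bar> <= U ==> norm x <= R ==> norm z <= R ==> norm (x - z) <= r ==> norm (g t x w - g t z w) <= e"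
proof -
 let ?C = "{a..b} \<times> cball (0 :: real ^ 'n) R \<times> {-U..U}"
 have "uniformly_continuous_on ?C (\<lambda>(t, x, w). g t x w)"
  using a by (intro compact_uniformly_continuous continuous_on_subset[OF g] compact_Times) (auto simp: Omega_def)
 then obtain r where r: "0 < r" "!!p p'. p \<in> ?C ==> p' \<in> ?C ==> dist p' p < r ==> dist ((\<lambda>(t, x, w). g t x w) p') ((\<lambda>(t, x, w). g t x w) p) < e"
  using e unfolding uniformly_continuous_on_def by metis
 show thesis
 proof (rule that[of "r / 2"])
  fix t w :: real and x z :: "real ^ 'n" assume *: "a <= t" "t <= b" "\<bar>w\<bar> <= U" "norm x <= R" "norm z <= R" "norm (x - z) <= r / 2"
  have "dist (t, x, w) (t, z, w) = norm (x - z)" by (simp add: dist_Pair_Pair dist_norm)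
  then have "dist (t, x, w) (t, z, w) < r" using * r(1) by simp
  moreover have "(t, x, w) \<in> ?C" "(t, z, w) \<in> ?C" using * by auto
  ultimately show "norm (g t x w - g t z w) <= e" using r(2)[of "(t, z, w)" "(t, x, w)"] by (simp add: dist_norm)
 qed (use r in simp)
qed

context flow
begin

lemma G_increment:
 assumes t: "0 < t" and X: "convex X" "x \<in> X" "y \<in> X" and m: "!!z. z \<in> X ==> norm (grad_x G t z w - m) <= e"
 shows "\<bar>G t x w - G t y w - m \<bullet> (x - y)\<bar> <= e * norm (x - y)"
proof -
 have "norm ((G t x w - m \<bullet> x) - (G t y w - m \<bullet> y)) <= e * norm (x - y)"
 proof (rule differentiable_bound[OF X(1) _ _ X(2,3)])
  fix z assume z: "z \<in> X"
  have "((\<lambda>z. G t z w - m \<bullet> z) has_derivative (\<lambda>h. grad_x G t z w \<bullet> h - m \<bullet> h)) (at z)"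
   by (intro has_derivative_diff G_x_grad[OF t] bounded_linear_imp_has_derivative bounded_linear_inner_right)
  then show "((\<lambda>z. G t z w - m \<bullet> z) has_derivative (\<lambda>h. grad_x G t z w \<bullet> h - m \<bullet> h)) (at z within X)"
   by (rule has_derivative_at_withinI)
  show "onorm (\<lambda>h. grad_x G t z w \<bullet> h - m \<bullet> h) <= e"
  proof (rule onorm_bound)
   show "0 <= e" using order_trans[OF norm_ge_zero m[OF z]] .
   show "norm (grad_x G t z w \<bullet> h - m \<bullet> h) <= e * norm h" for h
    using order_trans[OF Cauchy_Schwarz_ineq2 mult_right_mono[OF m[OF z] norm_ge_zero[of h]]] by (simp add: inner_diff_left)
  qed
 qed
 then show ?thesis by (simp add: inner_diff_right algebra_simps)
qed

end

context solution
begin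

definition source :: "(real => real ^ 'n => real) => real => ennreal" where
 "source v t = (NBINT y. ennreal (norm (zero_before (grad_x G) t y (v t y))))"

lemma gradG_representative_measurable:
 assumes "represents v T U C"
 shows "(\<lambda>(t, y). zero_before (grad_x G) t y (v t y)) \<in> borel_measurable borel2"
proof -
 have [measurable]: "(\<lambda>p. v (fst p) (snd p)) \<in> borel_measurable borel2"
  using assms unfolding represents_def case_prod_beta' borel_prod by blast
 have *: "(\<lambda>p. (fst p, snd p, v (fst p) (snd p))) \<in> borel_measurable borel2" by (intro borel_measurable_Pair) auto
 show ?thesis using measurable_compose[OF * zero_before_continuous_Borel(2)[OF gradG_cont]] by (simp add: split_beta)
qed

lemma source_measurable:
 assumes "represents v T U C"
 shows "Borel (source v)"
proof -
 have [measurable]: "(\<lambda>p. zero_before (grad_x G) (fst p) (snd p) (v (fst p) (snd p))) \<in> borel_measurable borel2"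
  using gradG_representative_measurable[OF assms] unfolding case_prod_beta' .
 have "Borel (\<lambda>t. (NBINT y. ennreal (norm (zero_before (grad_x G) (fst (t, y)) (snd (t, y)) (v (fst (t, y)) (snd (t, y)))))))"
  by measurable
 then show ?thesis unfolding source_def[abs_def] by simp
qed

text \<open>Bounds for the derivatives along the segment from \<open>x\<close> to \<open>y\<close> give the hypotheses of the energy
method. The divergence is a trace, whence \<open>N A\<close>.\<close>

lemma energy_representative:
 assumes rep: "represents v T U C" and ab: "0 < a" "a < b" "b < Te" "Te < T" and pos: "0 <= A" "0 <= B" "0 <= L" "1 <= q"
  and L: "!!t x w. 0 < t ==> t < T ==> \<bar>w\<bar> <= U ==> norm (D_u f t x w) <= L"
  and Pb: "!!t x y z w. a <= t ==> t <= Te ==> norm x <= Rc ==> norm (x - y) <= 1 / sqrt q ==> v t x ~= v t y ==> z \<in> closed_segment x y ==> \<bar>w\<bar> <= U ==> norm (P t z w) <= A"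
  and Fb: "!!t x y z w. a <= t ==> t <= Te ==> norm x <= Rc ==> norm (x - y) <= 1 / sqrt q ==> v t x ~= v t y ==> z \<in> closed_segment x y ==> \<bar>w\<bar> <= U ==> norm (D_u F t z w) <= B"
 shows "energy (zero_before f) (zero_before F) (zero_before d) v T U a b Te A (B + real CARD('n) * A) L q Rc"
proof (rule energy.intro[OF entropy_core_representative[OF _ rep]], unfold_locales)
 let ?N = "real CARD('n)"
 show "0 < T" "0 < a" "a < b" "b < Te" "Te < T" "0 <= A" "0 <= B + ?N * A" "0 <= L" "1 <= q" using ab pos by auto
 fix t :: real and x y :: "real ^ 'n"
 assume H: "a <= t" "t <= Te" "norm x <= Rc" "norm (x - y) <= 1 / sqrt q" "v t x ~= v t y"
 have t: "0 < t" "t < T" using H ab by auto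
 have "\<bar>v t x\<bar> <= U" "\<bar>v t y\<bar> <= U" using rep by (auto simp: represents_def)
 then have mm: "max (v t x) (v t y) \<in> {-U..U}" "min (v t x) (v t y) \<in> {-U..U}" "\<bar>max (v t x) (v t y) - min (v t x) (v t y)\<bar> = \<bar>v t x - v t y\<bar>"
  by (auto simp: max_def min_def abs_le_iff)
 let ?w' = "max (v t x) (v t y)" and ?w = "min (v t x) (v t y)"
 have sx: "x \<in> closed_segment x y" "y \<in> closed_segment x y" by auto
 have sd: "norm ((f t x ?w' - f t x ?w) - (f t y ?w' - f t y ?w) - (?w' - ?w) *\<^sub>R blinfun_apply 0 (x - y)) <= A * \<bar>?w' - ?w\<bar> * norm (x - y)"
  by (rule second_difference(1)[OF t(1) convex_closed_segment sx(2,1) convex_real_interval(5) mm(2,1)]) (use Pb[OF H] in auto)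
 then show "norm ((zero_before f t x ?w' - zero_before f t x ?w) - (zero_before f t y ?w' - zero_before f t y ?w)) <= A * norm (x - y) * \<bar>v t x - v t y\<bar>"
  unfolding mm(3) by (simp add: zero_before_eq[OF t(1)] mult_ac)
 have "norm (f t x ?w' - f t x ?w) <= L * \<bar>?w' - ?w\<bar>"
  by (rule vector_derivative_bound[OF convex_real_interval(5) mm(2,1) f_u[OF t(1)]]) (use L[OF t] in auto)
 then show "norm (zero_before f t x ?w' - zero_before f t x ?w) <= L * \<bar>v t x - v t y\<bar>"
  unfolding mm(3) by (simp add: zero_before_eq[OF t(1)])
 have "norm (F t x ?w' - F t x ?w) <= B * \<bar>?w' - ?w\<bar>"
  by (rule vector_derivative_bound[OF convex_real_interval(5) mm(2,1) F_u[OF t(1)]]) (use Fb[OF H sx(1)] in auto)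
 moreover have "norm (D_x f t y ?w' - D_x f t y ?w - (?w' - ?w) *\<^sub>R 0) <= A * \<bar>?w' - ?w\<bar>"
  by (rule second_difference(2)[OF t(1) convex_closed_segment sx(2,1) convex_real_interval(5) mm(2,1)]) (use Pb[OF H] in auto)
 then have "?N * norm (D_x f t y ?w' - D_x f t y ?w) <= ?N * (A * \<bar>?w' - ?w\<bar>)" by (intro mult_left_mono) auto
 then have "\<bar>trace (D_x f t y ?w' - D_x f t y ?w)\<bar> <= ?N * (A * \<bar>?w' - ?w\<bar>)" by (rule order_trans[OF abs_trace_le])
 moreover have "trace (D_x f t y ?w' - D_x f t y ?w) = d t y ?w' - d t y ?w"
  unfolding div_x_eq_trace by (rule linear_diff[OF bounded_linear.linear[OF bounded_linear_trace]])
 ultimately have "(F t x ?w' - F t x ?w) + (d t y ?w' - d t y ?w) <= B * \<bar>?w' - ?w\<bar> + ?N * (A * \<bar>?w' - ?w\<bar>)"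
  by (simp add: abs_le_iff)
 then show "(zero_before F t x ?w' - zero_before F t x ?w) + (zero_before d t y ?w' - zero_before d t y ?w) <= (B + ?N * A) * \<bar>v t x - v t y\<bar>"
  unfolding mm(3) by (simp add: zero_before_eq[OF t(1)] algebra_simps)
qed

text \<open>By uniform continuity the bounds \<open>M\<close>, \<open>B\<close> on \<open>C\<close> hold up to \<open>e\<close> near \<open>C\<close>, and \<open>G\<close> is linear up to \<open>e |x - y|\<close>.
Both need the kernel to be small, depending on \<open>e\<close>, on the compact set in which the cone lives and on
\<open>a > 0\<close>. The constant \<open>c\<close> is independent of \<open>e\<close>.\<close>

lemma TV_step_eps:
 assumes rep: "represents v T U C" and ab: "0 < a" "a < b" "b < T"
  and MB: "0 <= M" "0 <= B" "!!t x w. 0 < t ==> t < T ==> x \<in> C ==> \<bar>w\<bar> <= U ==> norm (P t x w) <= M"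
   "!!t x w. 0 < t ==> t < T ==> x \<in> C ==> \<bar>w\<bar> <= U ==> norm (D_u F t x w) <= B"
  and ga: "Borel ga" "!!x. \<bar>ga x\<bar> <= U" "AE x in lborel. u a x = ga x"
  and gb: "Borel gb" "!!x. \<bar>gb x\<bar> <= U" "AE x in lborel. u b x = gb x"
  and \<phi>: "C1_c UNIV \<phi>" "!!x. norm (\<phi> x) <= 1" "!!x. norm x > R0 ==> \<phi> x = 0" "0 <= R0"
  and \<kappa>: "\<kappa> = (2 * real CARD('n) + 1) * M + B"
 shows "\<exists>c\<ge>0. \<forall>e>0. ennreal (exp (- (\<kappa> + (2 * real CARD('n) + 2) * e) * b) * ((LBINT x. gb x * divergence \<phi> x) - e))
   <= ennreal (exp (- \<kappa> * a)) * TV ga + (NBINT t. indicator {a..b} t * (ennreal (exp (- \<kappa> * t)) * source v t)) + ennreal (e * c)"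
proof -
 let ?N = "real CARD('n)"
 have rep': "\<bar>v t x\<bar> <= U" "x \<notin> C ==> v t x = 0" for t x using rep by (auto simp: represents_def)
 have U0: "0 <= U" using order_trans[OF abs_ge_zero rep'(1)] .
 have T0: "0 < T" using ab by simp
 obtain L B' M' where L: "0 <= L" "!!t x w. 0 < t ==> t < T ==> \<bar>w\<bar> <= U + 1 ==> norm (D_u f t x w) <= L"
  by (rule box_bounds[of "U + 1" T]) (use U0 T0 in auto)
 define Te where "Te = (b + T) / 2"
 have Te: "b < Te" "Te < T" using ab by (auto simp: Te_def)
 define Rc where "Rc = L * b + R0 + 3"
 have Rc: "0 <= Rc" using L ab \<phi>(4) by (simp add: Rc_def)
 define vol where "vol = measure lborel (cball (0 :: real ^ 'n) (Rc + 1))"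
 have vol0: "0 <= vol" by (simp add: vol_def)
 define i0 :: 'n where "i0 = undefined"
 define e0 :: "real ^ 'n" where "e0 = axis i0 1"
 have e0: "norm e0 = 1" by (simp add: e0_def)
 have \<kappa>0: "0 <= \<kappa>" using MB by (simp add: \<kappa>)
 have srcm [measurable]: "Borel (source v)" by (rule source_measurable[OF rep])
 show ?thesis
 proof (intro exI[of _ "?N * vol * (b - a)"] conjI allI impI)
  show "0 <= ?N * vol * (b - a)" using vol0 ab by simp
  fix e :: real assume e: "0 < e"
  define A where "A = M + e"
  define K where "K = B + e + ?N * A"
  have AK: "0 <= A" "0 <= K" using MB e by (auto simp: A_def K_def)
  obtain r1 where r1: "0 < r1" "!!t x z w. a <= t ==> t <= Te ==> \<bar>w\<bar> <= U ==> norm x <= Rc + 1 ==> norm z <= Rc + 1 ==> norm (x - z) <= r1 ==> norm (P t x w - P t z w) <= e"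
   by (rule uniform_on_slab[OF P_cont ab(1) e, where b=Te and U=U and R="Rc + 1"]) (rule that)
  obtain r2 where r2: "0 < r2" "!!t x z w. a <= t ==> t <= Te ==> \<bar>w\<bar> <= U ==> norm x <= Rc + 1 ==> norm z <= Rc + 1 ==> norm (x - z) <= r2 ==> norm (D_u F t x w - D_u F t z w) <= e"
   by (rule uniform_on_slab[OF Fu_cont ab(1) e, where b=Te and U=U and R="Rc + 1"]) (rule that)
  obtain r3 where r3: "0 < r3" "!!t x z w. a <= t ==> t <= Te ==> \<bar>w\<bar> <= U ==> norm x <= Rc + 1 ==> norm z <= Rc + 1 ==> norm (x - z) <= r3 ==> norm (grad_x G t x w - grad_x G t z w) <= e"
   by (rule uniform_on_slab[OF gradG_cont ab(1) e, where b=Te and U=U and R="Rc + 1"]) (rule that)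
  obtain q0 where q0: "0 < q0" "!!q. q0 <= q ==> ennreal (dir_moment q e0 * ((LBINT x. gb x * divergence \<phi> x) - e))
    <= (NBINT x. (NBINT y. indicator (cball 0 (R0 + 1)) x * ennreal (\<bar>gb x - gb y\<bar> * bump q (x - y))))"
   using TV_lower[OF gb(1,2) \<phi>(1-3) e0 e] by blast
  define s where "s = min 1 (min r1 (min r2 r3))"
  have s: "0 < s" "s <= 1" "s <= r1" "s <= r2" "s <= r3" using r1 r2 r3 by (auto simp: s_def)
  (* Large enough for TV_lower and for the kernel to have radius at most s. *)
  define q where "q = max q0 (1 / s\<^sup>2)"
  have "1 <= 1 / s\<^sup>2" using s by (simp add: power_le_one)
  then have q1: "1 <= q" unfolding q_def by (rule max.coboundedI2)
  have q: "q0 <= q" "1 / sqrt q <= s"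
  proof -
   show "q0 <= q" by (simp add: q_def)
   have "sqrt (1 / s\<^sup>2) <= sqrt q" by (simp add: q_def)
   then have "1 / s <= sqrt q" using s by (simp add: real_sqrt_divide)
   then show "1 / sqrt q <= s" using s q1 by (simp add: field_simps)
  qed
  (* One of x and y lies in C, and every point of the segment is within s of it. *)
  have near: "norm z <= Rc + 1 \<and> (\<exists>p\<in>C. norm p <= Rc + 1 \<and> norm (z - p) <= s)"
   if "norm x <= Rc" "norm (x - y) <= 1 / sqrt q" "v t x ~= v t y" "z \<in> closed_segment x y" for t x y z
  proof -
   have xy: "norm (x - y) <= s" using that(2) q(2) by simp
   have zx: "norm (z - x) <= s" and zy: "norm (z - y) <= s"
    using segment_bound[OF that(4)] xy by (auto simp: norm_minus_commute)
   have n: "norm z <= Rc + 1" "norm y <= Rc + 1"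
    using that(1) zx xy s(2) norm_triangle_sub[of z x] norm_triangle_sub[of y x] by (auto simp: norm_minus_commute)
   show ?thesis
   proof (cases "x \<in> C")
    case True
    then show ?thesis using n zx that(1) by (intro conjI bexI[of _ x]) auto
   next
    case False
    then have "y \<in> C" using rep'(2)[of x t] rep'(2)[of y t] that(3) by metis
    then show ?thesis using n zy by (intro conjI bexI[of _ y]) auto
   qed
  qed
  have Pb: "norm (P t z w) <= A" and Fb: "norm (D_u F t z w) <= B + e"
   if H: "a <= t" "t <= Te" "norm x <= Rc" "norm (x - y) <= 1 / sqrt q" "v t x ~= v t y" and z: "z \<in> closed_segment x y" and w: "\<bar>w\<bar> <= U" for t x y z w
  proof -
   have t: "0 < t" "t < T" using H ab Te by auto
   obtain p where p: "p \<in> C" "norm p <= Rc + 1" "norm (z - p) <= s" "norm z <= Rc + 1" using near[OF H(3-5) z] by blast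
   have "norm (P t z w - P t p w) <= e" using H w p s by (intro r1(2)) auto
   moreover have "norm (P t p w) <= M" using t p(1) w by (rule MB(3))
   ultimately show "norm (P t z w) <= A" using norm_triangle_sub[of "P t z w" "P t p w"] by (simp add: A_def)
   have "norm (D_u F t z w - D_u F t p w) <= e" using H w p s by (intro r2(2)) auto
   moreover have "norm (D_u F t p w) <= B" using t p(1) w by (rule MB(4))
   ultimately show "norm (D_u F t z w) <= B + e" using norm_triangle_sub[of "D_u F t z w" "D_u F t p w"] by simp
  qed
  interpret E: energy "zero_before f" "zero_before F" "zero_before d" v T U a b Te A K L q Rc
   unfolding K_def
  proof (rule energy_representative[OF rep ab(1,2) Te AK(1) _ L(1) q1 _ Pb Fb])
   show "0 <= B + e" using e MB(2) by simp
   show "norm (D_u f t x w) <= L" if "0 < t" "t < T" "\<bar>w\<bar> <= U" for t x w using that by (intro L(2)) auto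
  qed
  define \<kappa>' where "\<kappa>' = K + (?N + 1) * A"
  have \<kappa>': "\<kappa>' = \<kappa> + (2 * ?N + 2) * e" by (simp add: \<kappa>'_def \<kappa> K_def A_def algebra_simps)
  have \<kappa>le: "exp (- \<kappa>' * t) <= exp (- \<kappa> * t)" if "0 <= t" for t
  proof -
   have "\<kappa> <= \<kappa>'" using e by (simp add: \<kappa>')
   from mult_right_mono[OF this that] show ?thesis by simp
  qed
  let ?m = "\<lambda>t y. zero_before (grad_x G) t y (v t y)"
  have mmeas [measurable]: "(\<lambda>p. ?m (fst p) (snd p)) \<in> borel_measurable borel2"
   using gradG_representative_measurable[OF rep] unfolding case_prod_beta' .
  have m1: "Borel (?m t)" for t
   using measurable_compose[OF _ mmeas, of "\<lambda>y. (t, y)" borel] by simp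
  define J where "J = (\<lambda>t. (NBINT y. indicator (cball 0 (Rc + 1)) y * ennreal (norm (?m t y))) + ennreal (e * ?N * vol))"
  have "Borel (\<lambda>t. (NBINT y. (indicator (cball 0 (Rc + 1)) (snd (t, y)) :: ennreal) * ennreal (norm (?m (fst (t, y)) (snd (t, y))))))"
   by measurable
  then have Jm: "Borel J" unfolding J_def by simp
  have Jle: "J t <= source v t + ennreal (e * ?N * vol)" for t
   unfolding J_def source_def by (intro add_right_mono nn_integral_mono) (auto simp: indicator_def)
  have SJ: "ennreal (E.S t) <= ennreal (exp (- K * t) * dir_moment (E.qt t) e0) * J t" if t: "a <= t" "t <= b" for t
   unfolding J_def vol_def E.vol_def[symmetric]
  proof (rule E.S_le[OF t(1) _ m1 _ e0])
   show "t <= Te" using t Te by simp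
   show "0 <= e" using e by simp
   fix x y :: "real ^ 'n" assume x: "norm x <= Rc" and xy: "norm (x - y) <= 1 / sqrt q"
   have t0: "0 < t" using t ab by simp
   have "\<bar>G t x (v t y) - G t y (v t y) - grad_x G t y (v t y) \<bullet> (x - y)\<bar> <= e * norm (x - y)"
   proof (rule G_increment[OF t0 convex_closed_segment])
    fix z assume z: "z \<in> closed_segment x y"
    have "norm (z - x) <= s" "norm (z - y) <= s" "norm (x - y) <= s"
     using segment_bound[OF z] xy q(2) by (auto simp: norm_minus_commute)
    then have "norm z <= Rc + 1" "norm y <= Rc + 1" "norm (z - y) <= r3"
     using x s norm_triangle_sub[of z x] norm_triangle_sub[of y x] by (auto simp: norm_minus_commute)
    then show "norm (grad_x G t z (v t y) - grad_x G t y (v t y)) <= e" using t Te rep' by (intro r3(2)) auto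
   qed auto
   then show "E.G_diff t x y <= \<bar>?m t y \<bullet> (x - y)\<bar> + e * norm (x - y)"
    unfolding E.G_diff_def zero_before_eq[OF t0] F_minus_div_def by linarith
  qed
  have "ennreal (exp (- \<kappa>' * b) * ((LBINT x. gb x * divergence \<phi> x) - e)) <= ennreal (exp (- \<kappa>' * a)) * TV ga + (NBINT t. indicator {a..b} t * (ennreal (exp (- \<kappa>' * t)) * J t))"
  proof (rule E.TV_energy[OF ga(1,2) _ gb(1,2) _ \<phi>(4) _ e0 _ Jm _ \<kappa>'_def])
   show "right_trace v a ga"
    by (rule slice_right_limit[OF rep _ _ ga(3)]) (use ab in auto)
   show "right_trace v b gb"
    by (rule slice_right_limit[OF rep _ _ gb(3)]) (use ab in auto)
   show "L * b + R0 + 3 <= Rc" by (simp add: Rc_def)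
   show "ennreal (dir_moment (E.qt b) e0 * ((LBINT x. gb x * divergence \<phi> x) - e))
    <= (NBINT x. (NBINT y. indicator (cball 0 (R0 + 1)) x * ennreal (\<bar>gb x - gb y\<bar> * bump (E.qt b) (x - y))))"
    using E.qt_ge(1)[of b] ab q(1) by (intro q0(2)) auto
   show "AE t in lborel. a <= t \<and> t <= b --> ennreal (E.S t) <= ennreal (exp (- K * t) * dir_moment (E.qt t) e0) * J t"
    using SJ by simp
   have "ennreal (E.E a ga) <= ennreal (exp (- K * a) * dir_moment (E.qt a) e0) * TV ga"
    using ab Rc by (intro E.E_upper[OF ga(1,2) _ e0]) auto
   then show "ennreal (E.E a ga) <= ennreal (dir_moment q e0) * (ennreal (exp (- \<kappa>' * a)) * TV ga)"
    unfolding E.kernel_weight[OF e0] \<kappa>'_def[symmetric] using dir_moment_pos[of q e0] e0 q1 by (simp add: ennreal_mult mult.assoc)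
  qed
  also have "... <= ennreal (exp (- \<kappa> * a)) * TV ga + (NBINT t. indicator {a..b} t * (ennreal (exp (- \<kappa> * t)) * source v t) + indicator {a..b} t * ennreal (e * ?N * vol))"
  proof (intro add_mono mult_right_mono ennreal_leI \<kappa>le nn_integral_mono)
   fix t :: real
   show "indicator {a..b} t * (ennreal (exp (- \<kappa>' * t)) * J t) <= indicator {a..b} t * (ennreal (exp (- \<kappa> * t)) * source v t) + indicator {a..b} t * ennreal (e * ?N * vol)"
   proof (cases "t \<in> {a..b}")
    case True
    have t0: "0 <= t" using True ab by simp
    have "ennreal (exp (- \<kappa>' * t)) * J t <= ennreal (exp (- \<kappa> * t)) * (source v t + ennreal (e * ?N * vol))"
     using Jle \<kappa>le[OF t0] by (intro mult_mono ennreal_leI) auto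
    also have "... = ennreal (exp (- \<kappa> * t)) * source v t + ennreal (exp (- \<kappa> * t)) * ennreal (e * ?N * vol)"
     by (rule distrib_left)
    also have "... <= ennreal (exp (- \<kappa> * t)) * source v t + 1 * ennreal (e * ?N * vol)"
     using \<kappa>0 t0 by (intro add_left_mono mult_right_mono) auto
    finally show ?thesis using True by simp
   qed simp
  qed (use ab in auto)
  also have "(NBINT t. indicator {a..b} t * (ennreal (exp (- \<kappa> * t)) * source v t) + indicator {a..b} t * ennreal (e * ?N * vol))
    = (NBINT t. indicator {a..b} t * (ennreal (exp (- \<kappa> * t)) * source v t)) + (NBINT t. indicator {a..b} t * ennreal (e * ?N * vol))"
   by (rule nn_integral_add) measurable
  also have "(NBINT t. indicator {a..b} t * ennreal (e * ?N * vol)) = ennreal (e * (?N * vol * (b - a)))"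
   using ab e vol0 by (simp add: nn_integral_multc ennreal_mult[symmetric] mult_ac)
  finally show "ennreal (exp (- (\<kappa> + (2 * ?N + 2) * e) * b) * ((LBINT x. gb x * divergence \<phi> x) - e))
   <= ennreal (exp (- \<kappa> * a)) * TV ga + (NBINT t. indicator {a..b} t * (ennreal (exp (- \<kappa> * t)) * source v t)) + ennreal (e * (?N * vol * (b - a)))"
   unfolding \<kappa>' by (simp add: add.assoc)
 qed
qed

end

lemma exp_limit_le:
 fixes X :: ennreal
 assumes c: "0 <= c" and le: "!!e. 0 < e ==> ennreal (exp (- (\<kappa> + k * e) * b) * (l - e)) <= X + ennreal (e * c)"
 shows "ennreal (exp (- \<kappa> * b) * l) <= X"
proof (cases X)
 case (real x)
 have "exp (- (\<kappa> + k * e) * b) * (l - e) <= x + e * c" if "0 < e" for e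
 proof -
  have "ennreal (exp (- (\<kappa> + k * e) * b) * (l - e)) <= ennreal (x + e * c)"
   using le[OF that] real c that by (simp add: ennreal_plus)
  moreover have "0 <= x + e * c" using real c that by simp
  ultimately show ?thesis by (simp only: ennreal_le_iff)
 qed
 then have "\<forall>\<^sub>F e in at_right 0. exp (- (\<kappa> + k * e) * b) * (l - e) <= x + e * c"
  by (auto simp: eventually_at_filter)
 moreover have "((\<lambda>e. x + e * c) \<longlongrightarrow> x + 0 * c) (at_right 0)" by (intro tendsto_intros)
 moreover have "((\<lambda>e. exp (- (\<kappa> + k * e) * b) * (l - e)) \<longlongrightarrow> exp (- (\<kappa> + k * 0) * b) * (l - 0)) (at_right 0)"
  by (intro tendsto_intros)
 ultimately have "exp (- (\<kappa> + k * 0) * b) * (l - 0) <= x + 0 * c"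
  by (intro tendsto_le[of "at_right 0"]) auto
 then show ?thesis using real by (simp add: ennreal_leI)
qed simp

context energy
begin

text \<open>Writing the source difference as an integral over the segment, Fubini and a translation for each
position \<open>r\<close> on the segment give the first moment of the kernel times \<open>\<integral> H\<close>, without smallness of the
kernel. The price is the factor \<open>N\<close> of \<open>norm_moment_le\<close>.\<close>

lemma S_le_segment:
 fixes H :: "real ^ 'n => ennreal"
 assumes t: "a <= t" "t <= Te" and H [measurable]: "Borel H" and e0: "norm (e0 :: real ^ 'n) = 1"
  and G: "!!x y. norm x <= Rc ==> ennreal (G_diff t x y) <= ennreal (norm (x - y)) * (NBINT r. indicator {0..1} r * H (y + r *\<^sub>R (x - y)))"
 shows "ennreal (S t) <= ennreal (exp (- K * t) * dir_moment (qt t) e0) * (ennreal (real CARD('n)) * (NBINT y. H y))"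
proof -
 have t0: "0 <= t" using t ab by simp
 have qt0: "0 < qt t" by (rule qt_ge)
 let ?k = "\<lambda>z :: real ^ 'n. ennreal (exp (- K * t)) * ennreal (norm z * bump (qt t) z)"
 have bump_m [measurable]: "bump (qt t) \<in> borel_measurable (borel :: (real ^ 'n) measure)" by measurable
 have "ennreal (S t) = (NBINT x. (NBINT y. ennreal (G_diff t x y * Theta t x y)))" by (rule ennreal_S[OF t])
 also have "... <= (NBINT x. (NBINT y. ?k (x - y) * (NBINT r. indicator {0..1} r * H (y + r *\<^sub>R (x - y)))))"
 proof (intro nn_integral_mono)
  fix x y :: "real ^ 'n"
  let ?h = "(NBINT r. indicator {0..1} r * H (y + r *\<^sub>R (x - y)))"
  show "ennreal (G_diff t x y * Theta t x y) <= ?k (x - y) * ?h"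
  proof (cases "norm x <= Rc")
   case True
   have "ennreal (G_diff t x y * Theta t x y) = ennreal (G_diff t x y) * ennreal (Theta t x y)"
    using Theta_bounds[OF t0] by (intro ennreal_mult) (auto simp: G_diff_def)
   also have "... <= (ennreal (norm (x - y)) * ?h) * ennreal (exp (- K * t) * bump (qt t) (x - y))"
    by (rule mult_mono[OF G[OF True] ennreal_leI[OF Theta_le]]) auto
   also have "... = ?k (x - y) * ?h" by (simp add: ennreal_mult mult_ac)
   finally show ?thesis .
  next
   case False
   then have "Theta t x y = 0" using t0 by (intro Theta_outside) auto
   then show ?thesis by simp
  qed
 qed
 also have "... = (NBINT y. (NBINT x. ?k (x - y) * (NBINT r. indicator {0..1} r * H (y + r *\<^sub>R (x - y)))))"
  by (rule lborel_pair.Fubini') measurable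
 also have "... = (NBINT y. (NBINT z. ?k z * (NBINT r. indicator {0..1} r * H (y + r *\<^sub>R z))))"
  using nn_integral_lborel_translation[of "\<lambda>z. ?k z * (NBINT r. indicator {0..1} r * H (y + r *\<^sub>R z))" "- y" for y]
  by simp
 also have "... = (NBINT z. (NBINT y. ?k z * (NBINT r. indicator {0..1} r * H (y + r *\<^sub>R z))))"
  by (rule lborel_pair.Fubini') measurable
 also have "... = (NBINT z. ?k z * (NBINT y. H y))"
 proof (rule nn_integral_cong)
  fix z :: "real ^ 'n"
  have "(NBINT y. ?k z * (NBINT r. indicator {0..1} r * H (y + r *\<^sub>R z)))
   = ?k z * (NBINT y. (NBINT r. indicator {0..1} r * H (y + r *\<^sub>R z)))"
   by (rule nn_integral_cmult) measurable
  also have "(NBINT y. (NBINT r. indicator {0..1} r * H (y + r *\<^sub>R z))) = (NBINT r. (NBINT y. indicator {0..1} r * H (y + r *\<^sub>R z)))"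
   by (rule lborel_pair.Fubini') measurable
  also have "... = (NBINT r. indicator {0..1 :: real} r * (NBINT y. H y))"
  proof (rule nn_integral_cong)
   fix r :: real
   have "(NBINT y. indicator {0..1} r * H (y + r *\<^sub>R z)) = indicator {0..1} r * (NBINT y. H (y + r *\<^sub>R z))"
    by (rule nn_integral_cmult) measurable
   also have "(NBINT y. H (y + r *\<^sub>R z)) = (NBINT y. H y)"
    using nn_integral_lborel_translation[OF H, of "r *\<^sub>R z"] by (simp add: add.commute)
   finally show "(NBINT y. indicator {0..1} r * H (y + r *\<^sub>R z)) = indicator {0..1} r * (NBINT y. H y)" .
  qed
  also have "... = (NBINT y. H y)" by (simp add: nn_integral_multc)
  finally show "(NBINT y. ?k z * (NBINT r. indicator {0..1} r * H (y + r *\<^sub>R z))) = ?k z * (NBINT y. H y)" .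
 qed
 also have "... = (NBINT z. ?k z) * (NBINT y. H y)"
  by (rule nn_integral_multc) measurable
 also have "(NBINT z. ?k z) = ennreal (exp (- K * t)) * (NBINT z. ennreal (norm z * bump (qt t) (z :: real ^ 'n)))"
  by (rule nn_integral_cmult) measurable
 also have "(NBINT z. ennreal (norm z * bump (qt t) (z :: real ^ 'n))) = ennreal (LBINT z. norm z * bump (qt t) (z :: real ^ 'n))"
  by (rule nn_integral_eq_integral[OF integrable_mult_bump[OF qt0]]) (auto intro!: continuous_intros)
 also have "ennreal (exp (- K * t)) * ennreal (LBINT z. norm z * bump (qt t) (z :: real ^ 'n)) * (NBINT y. H y)
  <= ennreal (exp (- K * t)) * ennreal (real CARD('n) * dir_moment (qt t) e0) * (NBINT y. H y)"
  by (intro mult_right_mono mult_left_mono ennreal_leI norm_moment_le[OF qt0 e0]) auto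
 also have "... = ennreal (exp (- K * t) * dir_moment (qt t) e0) * (ennreal (real CARD('n)) * (NBINT y. H y))"
  using dir_moment_pos[OF qt0 e0] by (simp add: ennreal_mult mult_ac)
 finally show ?thesis .
qed

end

context solution
begin

lemma slice_representative:
 assumes "0 <= t" "t < T"
 obtains g where "Borel g" "!!x. \<bar>g x\<bar> <= U_max u T" "AE x in lborel. u t x = g x" "TV (u t) = TV g"
proof -
 obtain g where g: "Borel g" "!!x. \<bar>g x\<bar> <= U_max u T" "AE x in lborel. u t x = g x"
  by (rule Borel_representative[OF L1_loc_measurable[OF u_L1[OF assms(1)]] slice_le_U_max[OF assms] U_max_nonneg]) (rule that)
 then show thesis using TV_cong_AE[OF g(1,3)] by (rule that)
qed

lemma TV_leI:
 assumes g: "Borel g"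
  and le: "!!\<phi> R0. C1_c UNIV \<phi> ==> (!!x. norm (\<phi> x) <= 1) ==> (!!x. norm x > R0 ==> \<phi> x = 0) ==> 0 <= R0 ==> ennreal (LBINT x. g x * divergence \<phi> x) <= X"
 shows "TV (g :: real ^ 'n => real) <= X"
 unfolding TV_def
proof (rule SUP_least, elim CollectE conjE)
 fix \<phi> :: "real ^ 'n => real ^ 'n" assume \<phi>: "C1_c UNIV \<phi>" "\<forall>x. norm (\<phi> x) <= 1"
 have [measurable]: "divergence \<phi> \<in> borel_measurable borel"
  using continuous_divergence[OF \<phi>(1)] by (simp add: borel_measurable_continuous_onI)
 obtain R where R: "!!x. norm x > R ==> \<phi> x = 0" using C1_cD(4)[OF \<phi>(1)] by blast
 have "(LINT x|lebesgue. g x * divergence \<phi> x) = (LBINT x. g x * divergence \<phi> x)"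
  by (rule LINT_lebesgue_eq_lborel) (use g in measurable)
 also have "ennreal ... <= X" by (rule le[OF \<phi>(1), of "max 0 R"]) (use \<phi> R in auto)
 finally show "ennreal (LINT x|lebesgue. g x * divergence \<phi> x) <= X" .
qed

theorem TV_step:
 assumes rep: "represents v T (U_max u T) C" and ab: "0 < a" "a < b" "b < T"
  and MB: "0 <= M" "0 <= B" "!!t x w. 0 < t ==> t < T ==> x \<in> C ==> \<bar>w\<bar> <= U_max u T ==> norm (P t x w) <= M"
   "!!t x w. 0 < t ==> t < T ==> x \<in> C ==> \<bar>w\<bar> <= U_max u T ==> norm (D_u F t x w) <= B"
  and \<kappa>: "\<kappa> = (2 * real CARD('n) + 1) * M + B"
 shows "TV (u b) <= ennreal (exp (\<kappa> * (b - a))) * TV (u a) + (NBINT t. indicator {a..b} t * (ennreal (exp (\<kappa> * (b - t))) * source v t))"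
proof -
 have ab': "0 <= a" "a < T" "0 <= b" using ab by auto
 obtain ga where ga: "Borel ga" "!!x. \<bar>ga x\<bar> <= U_max u T" "AE x in lborel. u a x = ga x" "TV (u a) = TV ga"
  by (rule slice_representative[OF ab'(1,2)]) (rule that)
 obtain gb where gb: "Borel gb" "!!x. \<bar>gb x\<bar> <= U_max u T" "AE x in lborel. u b x = gb x" "TV (u b) = TV gb"
  by (rule slice_representative[OF ab'(3) ab(3)]) (rule that)
 have srcm [measurable]: "Borel (source v)" by (rule source_measurable[OF rep])
 let ?X = "ennreal (exp (- \<kappa> * a)) * TV ga + (NBINT t. indicator {a..b} t * (ennreal (exp (- \<kappa> * t)) * source v t))"
 have eX: "ennreal (exp (\<kappa> * b)) * ?X = ennreal (exp (\<kappa> * (b - a))) * TV (u a) + (NBINT t. indicator {a..b} t * (ennreal (exp (\<kappa> * (b - t))) * source v t))"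
 proof -
  have e: "ennreal (exp (\<kappa> * (b - s))) = ennreal (exp (\<kappa> * b)) * ennreal (exp (- \<kappa> * s))" for s
   by (simp add: ennreal_mult[symmetric] exp_add[symmetric] algebra_simps)
  have "(NBINT t. indicator {a..b} t * (ennreal (exp (\<kappa> * (b - t))) * source v t))
   = (NBINT t. ennreal (exp (\<kappa> * b)) * (indicator {a..b} t * (ennreal (exp (- \<kappa> * t)) * source v t)))"
   unfolding e by (simp add: mult_ac)
  also have "... = ennreal (exp (\<kappa> * b)) * (NBINT t. indicator {a..b} t * (ennreal (exp (- \<kappa> * t)) * source v t))"
   by (rule nn_integral_cmult) measurable
  finally show ?thesis unfolding e by (simp add: distrib_left mult.assoc ga(4))
 qed
 have "TV gb <= ennreal (exp (\<kappa> * b)) * ?X"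
 proof (rule TV_leI[OF gb(1)])
  fix \<phi> :: "real ^ 'n => real ^ 'n" and R0
  assume \<phi>: "C1_c UNIV \<phi>" "!!x. norm (\<phi> x) <= 1" "!!x. norm x > R0 ==> \<phi> x = 0" "0 <= R0"
  let ?l = "LBINT x. gb x * divergence \<phi> x"
  obtain c where c: "0 <= c" "!!e. 0 < e ==> ennreal (exp (- (\<kappa> + (2 * real CARD('n) + 2) * e) * b) * (?l - e)) <= ?X + ennreal (e * c)"
   using TV_step_eps[OF rep ab MB ga(1-3) gb(1-3) \<phi> \<kappa>] by blast
  have "ennreal (exp (- \<kappa> * b) * ?l) <= ?X" by (rule exp_limit_le[OF c])
  then have "ennreal (exp (\<kappa> * b)) * ennreal (exp (- \<kappa> * b) * ?l) <= ennreal (exp (\<kappa> * b)) * ?X" by (rule mult_left_mono) simp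
  then show "ennreal ?l <= ennreal (exp (\<kappa> * b)) * ?X"
   by (simp add: ennreal_mult'[symmetric] mult.assoc[symmetric] exp_add[symmetric])
 qed
 then show ?thesis unfolding gb(4) eX .
qed

end

context flow
begin

section \<open>A coarse estimate from the initial time\<close>

lemma G_difference_le_segment:
 fixes H :: "real ^ 'n => ennreal"
 assumes t: "0 < t" and H [measurable]: "Borel H" and le: "!!z. ennreal (norm (grad_x G t z w)) <= H z"
 shows "ennreal \<bar>G t x w - G t y w\<bar> <= ennreal (norm (x - y)) * (NBINT r. indicator {0..1} r * H (y + r *\<^sub>R (x - y)))"
proof -
 let ?\<phi> = "\<lambda>r. G t (y + r *\<^sub>R (x - y)) w" and ?D = "\<lambda>r. grad_x G t (y + r *\<^sub>R (x - y)) w \<bullet> (x - y)"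
 have der: "(?\<phi> has_real_derivative ?D r) (at r)" for r
 proof -
  have "((\<lambda>r. y + r *\<^sub>R (x - y)) has_derivative (\<lambda>h. h *\<^sub>R (x - y))) (at r)" by (auto intro!: derivative_eq_intros)
  from has_derivative_compose[OF this G_x_grad[OF t]] show ?thesis
   unfolding has_field_derivative_def by (rule has_derivative_eq_rhs) (simp add: fun_eq_iff)
 qed
 have cD: "continuous_on UNIV ?D"
  using t by (intro continuous_intros continuous_on_Omega[OF gradG_cont]) auto
 have "has_bochner_integral lborel (\<lambda>r. ?D r * indicator {0..1} r) (?\<phi> 1 - ?\<phi> 0)"
  by (rule has_bochner_integral_FTC_Icc_real) (use der cD in \<open>auto simp: continuous_on_eq_continuous_at\<close>)
 then have i: "integrable lborel (\<lambda>r. ?D r * indicator {0..1} r)" "(LBINT r. ?D r * indicator {0..1} r) = G t x w - G t y w"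
  by (auto simp: has_bochner_integral_iff)
 have "ennreal \<bar>G t x w - G t y w\<bar> <= (NBINT r. ennreal (norm (?D r * indicator {0..1} r)))"
  using integral_norm_bound_ennreal[OF i(1)] unfolding i(2) by simp
 also have "... <= (NBINT r. ennreal (norm (x - y)) * (indicator {0..1} r * H (y + r *\<^sub>R (x - y))))"
 proof (rule nn_integral_mono)
  fix r :: real
  have "ennreal (norm (?D r)) <= ennreal (norm (grad_x G t (y + r *\<^sub>R (x - y)) w) * norm (x - y))"
   by (rule ennreal_leI) (simp add: Cauchy_Schwarz_ineq2)
  also have "... = ennreal (norm (grad_x G t (y + r *\<^sub>R (x - y)) w)) * ennreal (norm (x - y))" by (simp add: ennreal_mult)
  also have "... <= H (y + r *\<^sub>R (x - y)) * ennreal (norm (x - y))" by (rule mult_right_mono[OF le]) simp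
  finally show "ennreal (norm (?D r * indicator {0..1} r)) <= ennreal (norm (x - y)) * (indicator {0..1} r * H (y + r *\<^sub>R (x - y)))"
   by (simp add: indicator_def mult.commute)
 qed
 also have "... = ennreal (norm (x - y)) * (NBINT r. indicator {0..1} r * H (y + r *\<^sub>R (x - y)))"
  by (rule nn_integral_cmult) measurable
 finally show ?thesis .
qed

end

context solution
begin

text \<open>The kernel is now fixed while the starting time \<open>a\<close> tends to \<open>0\<close>: \<open>E_le_initial\<close> replaces \<open>u(a)\<close> by
\<open>u(0)\<close>. Uniform continuity of the coefficients, which may fail at \<open>t = 0\<close>, is avoided by global bounds
and by \<open>S_le_segment\<close>.\<close>

theorem TV_initial:
 fixes H :: "real => real ^ 'n => ennreal"
 assumes b: "0 < b" "b < T"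
  and MB: "0 <= M" "0 <= B" "!!t x w. 0 < t ==> t < T ==> \<bar>w\<bar> <= U_max u T ==> norm (P t x w) <= M"
   "!!t x w. 0 < t ==> t < T ==> \<bar>w\<bar> <= U_max u T ==> norm (D_u F t x w) <= B"
  and H [measurable]: "(\<lambda>p. H (fst p) (snd p)) \<in> borel_measurable borel2"
  and HG: "!!t x w. 0 < t ==> t < T ==> \<bar>w\<bar> <= U_max u T ==> ennreal (norm (grad_x G t x w)) <= H t x"
  and \<kappa>: "\<kappa> = (2 * real CARD('n) + 1) * M + B"
 shows "TV (u b) <= ennreal (exp (\<kappa> * b)) * (TV (u 0) + ennreal (real CARD('n)) * (NBINT t. indicator {0..b} t * (NBINT x. H t x)))"
proof -
 let ?N = "real CARD('n)" and ?U = "U_max u T"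
 have T0: "0 < T" using b by simp
 obtain v where rep: "represents v T ?U UNIV" using ex_representative[OF T0, of UNIV] by auto
 have rep': "\<bar>v t x\<bar> <= ?U" for t x using rep by (auto simp: represents_def)
 have U0: "0 <= ?U" by (rule U_max_nonneg)
 obtain g0 where g0: "Borel g0" "!!x. \<bar>g0 x\<bar> <= ?U" "AE x in lborel. u 0 x = g0 x" "TV (u 0) = TV g0"
  by (rule slice_representative[OF order_refl T0]) (rule that)
 obtain gb where gb: "Borel gb" "!!x. \<bar>gb x\<bar> <= ?U" "AE x in lborel. u b x = gb x" "TV (u b) = TV gb"
  by (rule slice_representative[OF less_imp_le[OF b(1)] b(2)]) (rule that)
 obtain L B' M' where L: "0 <= L" "!!t x w. 0 < t ==> t < T ==> \<bar>w\<bar> <= ?U + 1 ==> norm (D_u f t x w) <= L"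
  by (rule box_bounds[of "?U + 1" T]) (use U0 T0 in auto)
 define Te where "Te = (b + T) / 2"
 have Te: "b < Te" "Te < T" using b by (auto simp: Te_def)
 define K where "K = B + ?N * M"
 have K0: "0 <= K" using MB by (simp add: K_def)
 have \<kappa>K: "\<kappa> = K + (?N + 1) * M" by (simp add: \<kappa> K_def algebra_simps)
 have \<kappa>0: "0 <= \<kappa>" using MB by (simp add: \<kappa>)
 define i0 :: 'n where "i0 = undefined"
 define e0 :: "real ^ 'n" where "e0 = axis i0 1"
 have e0: "norm e0 = 1" by (simp add: e0_def)
 have H1: "Borel (H t)" for t
  using measurable_compose[OF _ H, of "\<lambda>x. (t, x)" borel] by simp
 define h where "h = (\<lambda>t. (NBINT x. H t x))"
 have "Borel (\<lambda>t. (NBINT x. H (fst (t, x)) (snd (t, x))))" by measurable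
 then have h [measurable]: "Borel h" by (simp add: h_def)
 let ?X = "TV g0 + ennreal ?N * (NBINT t. indicator {0..b} t * h t)"
 have "TV gb <= ennreal (exp (\<kappa> * b)) * ?X"
 proof (rule TV_leI[OF gb(1)])
  fix \<phi> :: "real ^ 'n => real ^ 'n" and R0
  assume \<phi>: "C1_c UNIV \<phi>" "!!x. norm (\<phi> x) <= 1" "!!x. norm x > R0 ==> \<phi> x = 0" "0 <= R0"
  let ?l = "LBINT x. gb x * divergence \<phi> x"
  define Rc where "Rc = L * b + R0 + 3"
  have Rc: "0 <= Rc" using L b \<phi>(4) by (simp add: Rc_def)
  have "ennreal (exp (- (\<kappa> + 0 * e) * b) * (?l - e)) <= ?X + ennreal (e * 1)" if e: "0 < e" for e
  proof -
   obtain q0 where q0: "0 < q0" "!!q. q0 <= q ==> ennreal (dir_moment q e0 * (?l - e))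
     <= (NBINT x. (NBINT y. indicator (cball 0 (R0 + 1)) x * ennreal (\<bar>gb x - gb y\<bar> * bump q (x - y))))"
    using TV_lower[OF gb(1,2) \<phi>(1-3) e0 e] by blast
   define q where "q = max q0 1"
   have q: "q0 <= q" "1 <= q" by (auto simp: q_def)
   define c where "c = dir_moment q e0"
   have c: "0 < c" unfolding c_def using q by (intro dir_moment_pos e0) simp
   define vol where "vol = measure lborel (cball (0 :: real ^ 'n) (Rc + 1))"
   have vol0: "0 <= vol" by (simp add: vol_def)
   define \<eta> where "\<eta> = e * c / (2 * vol + 1)"
   have \<eta>: "0 < \<eta>" "2 * vol * \<eta> <= c * e" using e c vol0 by (auto simp: \<eta>_def field_simps)
   obtain r where r: "0 < r" "!!s. 0 < s ==> s < 0 + r ==> (NBINT x. ennreal (indicator (cball 0 (Rc + 1)) x * \<bar>u s x - u 0 x\<bar>)) <= ennreal \<eta>"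
    using u_right_limit[OF order_refl \<eta>(1), of "Rc + 1"] by blast
   (* The starting time depends on q: close to 0 the L1 distance of u a and u 0 must be small compared with the moment c. *)
   define a where "a = min r b / 2"
   have a: "0 < a" "a < 0 + r" "a < b" using r b by (auto simp: a_def)
   have aT: "0 <= a" "a < T" using a b by auto
   obtain ga where ga: "Borel ga" "!!x. \<bar>ga x\<bar> <= ?U" "AE x in lborel. u a x = ga x" "TV (u a) = TV ga"
    by (rule slice_representative[OF aT]) (rule that)
   have close: "(LBINT x. indicator (cball 0 (Rc + 1)) x * \<bar>ga x - g0 x\<bar>) <= \<eta>"
   proof (rule integral_real_bounded)
    have "(NBINT x. ennreal (indicator (cball 0 (Rc + 1)) x * \<bar>ga x - g0 x\<bar>)) = (NBINT x. ennreal (indicator (cball 0 (Rc + 1)) x * \<bar>u a x - u 0 x\<bar>))"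
     by (rule nn_integral_cong_AE, use ga(3) g0(3) in eventually_elim) simp
    also have "... <= ennreal \<eta>" by (rule r(2)[OF a(1,2)])
    finally show "(NBINT x. ennreal (indicator (cball 0 (Rc + 1)) x * \<bar>ga x - g0 x\<bar>)) <= ennreal \<eta>" .
   qed (use \<eta> in simp)
   interpret E: energy "zero_before f" "zero_before F" "zero_before d" v T ?U a b Te M K L q Rc
    unfolding K_def
   proof (rule energy_representative[OF rep a(1,3) Te MB(1,2) L(1) q(2)])
    show "norm (D_u f t x w) <= L" if "0 < t" "t < T" "\<bar>w\<bar> <= ?U" for t x w using that by (intro L(2)) auto
    fix t z w assume H: "a <= t" "t <= Te" "\<bar>w\<bar> <= ?U"
    then have t: "0 < t" "t < T" using a Te by auto
    show "norm (P t z w) <= M" by (rule MB(3)[OF t H(3)])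
    show "norm (D_u F t z w) <= B" by (rule MB(4)[OF t H(3)])
   qed
   have SJ: "ennreal (E.S t) <= ennreal (exp (- K * t) * dir_moment (E.qt t) e0) * (ennreal ?N * h t)" if t: "a <= t" "t <= b" for t
    unfolding h_def
   proof (rule E.S_le_segment[OF t(1) _ H1 e0])
    show "t <= Te" using t Te by simp
    fix x y :: "real ^ 'n"
    have t0: "0 < t" "t < T" using t a b by auto
    show "ennreal (E.G_diff t x y) <= ennreal (norm (x - y)) * (NBINT r. indicator {0..1} r * H t (y + r *\<^sub>R (x - y)))"
    proof -
     have "ennreal \<bar>G t x (v t y) - G t y (v t y)\<bar> <= ennreal (norm (x - y)) * (NBINT r. indicator {0..1} r * H t (y + r *\<^sub>R (x - y)))"
      by (rule G_difference_le_segment[OF t0(1) H1 HG[OF t0 rep']])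
     then show ?thesis unfolding E.G_diff_def zero_before_eq[OF t0(1)] F_minus_div_def .
    qed
   qed
   have up: "ennreal (E.E a ga) <= ennreal (dir_moment q e0) * (TV g0 + ennreal e)"
   proof -
    have "E.E a ga <= E.E 0 g0 + 2 * vol * (LBINT x. indicator (cball 0 (Rc + 1)) x * \<bar>ga x - g0 x\<bar>)"
     unfolding vol_def E.vol_def[symmetric] by (rule E.E_le_initial[OF ga(1,2) g0(1,2)]) (use a in simp)
    also have "... <= E.E 0 g0 + 2 * vol * \<eta>" using close vol0 by (intro add_left_mono mult_left_mono) auto
    also have "... <= E.E 0 g0 + c * e" using \<eta>(2) by simp
    finally have "ennreal (E.E a ga) <= ennreal (E.E 0 g0 + c * e)" by (rule ennreal_leI)
    also have "... <= ennreal (E.E 0 g0) + ennreal (c * e)"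
     using c e by (cases "0 <= E.E 0 g0") (auto simp: ennreal_plus[symmetric] ennreal_neg intro!: ennreal_leI simp del: ennreal_plus)
    also have "ennreal (E.E 0 g0) <= ennreal (exp (- K * 0) * dir_moment (E.qt 0) e0) * TV g0"
     by (rule E.E_upper[OF g0(1,2) order_refl e0 Rc])
    also have "... = ennreal c * TV g0" by (simp add: E.qt_def c_def)
    finally show ?thesis using c e by (simp add: c_def[symmetric] ennreal_mult distrib_left)
   qed
   have "ennreal (exp (- \<kappa> * b) * (?l - e)) <= (TV g0 + ennreal e) + (NBINT t. indicator {a..b} t * (ennreal (exp (- \<kappa> * t)) * (ennreal ?N * h t)))"
   proof (rule E.TV_energy[OF ga(1,2) _ gb(1,2) _ \<phi>(4) _ e0 _ _ _ \<kappa>K up])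
    show "right_trace v a ga"
     by (rule slice_right_limit[OF rep aT ga(3)])
    show "right_trace v b gb"
     by (rule slice_right_limit[OF rep _ _ gb(3)]) (use b in auto)
    show "L * b + R0 + 3 <= Rc" by (simp add: Rc_def)
    show "ennreal (dir_moment (E.qt b) e0 * (?l - e))
     <= (NBINT x. (NBINT y. indicator (cball 0 (R0 + 1)) x * ennreal (\<bar>gb x - gb y\<bar> * bump (E.qt b) (x - y))))"
     using E.qt_ge(1)[of b] b q(1) by (intro q0(2)) auto
    show "Borel (\<lambda>t. ennreal ?N * h t)" by measurable
    show "AE t in lborel. a <= t \<and> t <= b --> ennreal (E.S t) <= ennreal (exp (- K * t) * dir_moment (E.qt t) e0) * (ennreal ?N * h t)"
     using SJ by simp
   qed
   also have "(NBINT t. indicator {a..b} t * (ennreal (exp (- \<kappa> * t)) * (ennreal ?N * h t))) <= (NBINT t. ennreal ?N * (indicator {0..b} t * h t))"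
   proof (rule nn_integral_mono)
    fix t :: real
    show "indicator {a..b} t * (ennreal (exp (- \<kappa> * t)) * (ennreal ?N * h t)) <= ennreal ?N * (indicator {0..b} t * h t)"
    proof (cases "t \<in> {a..b}")
     case True
     then have "0 <= t" using a by simp
     then have "ennreal (exp (- \<kappa> * t)) * (ennreal ?N * h t) <= 1 * (ennreal ?N * h t)"
      using \<kappa>0 by (intro mult_right_mono) auto
     then show ?thesis using True a by simp
    qed simp
   qed
   also have "(NBINT t. ennreal ?N * (indicator {0..b} t * h t)) = ennreal ?N * (NBINT t. indicator {0..b} t * h t)"
    by (rule nn_integral_cmult) measurable
   finally show ?thesis by (simp add: add_ac)
  qed
  then have "ennreal (exp (- \<kappa> * b) * ?l) <= ?X" by (rule exp_limit_le[OF zero_le_one])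
  then have "ennreal (exp (\<kappa> * b)) * ennreal (exp (- \<kappa> * b) * ?l) <= ennreal (exp (\<kappa> * b)) * ?X" by (rule mult_left_mono) simp
  then show "ennreal ?l <= ennreal (exp (\<kappa> * b)) * ?X"
   by (simp add: ennreal_mult'[symmetric] mult.assoc[symmetric] exp_add[symmetric])
 qed
 then show ?thesis unfolding gb(4) g0(4) h_def .
qed

end

section \<open>Short time intervals\<close>

lemma le_limit_right:
 fixes X R :: ennreal
 assumes e1: "0 < e1" and c: "0 <= c" and le: "!!e. 0 < e ==> e < e1 ==> X <= ennreal (exp (k * e)) * (R + ennreal (c * e))"
 shows "X <= R"
proof (cases R)
 case (real r)
 have le': "X <= ennreal (exp (k * e) * (r + c * e))" if "0 < e" "e < e1" for e
  using le[OF that] real c that by (simp add: ennreal_mult ennreal_plus)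
 have "X ~= top" using le'[of "e1 / 2"] e1 by (auto simp: top_unique)
 then obtain x where x: "X = ennreal x" "0 <= x" by (cases X) auto
 have "x <= exp (k * e) * (r + c * e)" if "0 < e" "e < e1" for e
 proof -
  have "0 <= exp (k * e) * (r + c * e)" using real c that by simp
  then show ?thesis using le'[OF that] unfolding x(1) by (simp only: ennreal_le_iff)
 qed
 then have "\<forall>\<^sub>F e in at_right 0. x <= exp (k * e) * (r + c * e)"
  unfolding eventually_at_right_field using e1 by blast
 moreover have "((\<lambda>e. exp (k * e) * (r + c * e)) \<longlongrightarrow> exp (k * 0) * (r + c * 0)) (at_right 0)" by (intro tendsto_intros)
 ultimately have "x <= exp (k * 0) * (r + c * 0)" by (intro tendsto_lowerbound[of _ _ "at_right 0"]) auto
 then show ?thesis using real x by (simp add: ennreal_leI)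
qed simp

text \<open>Truncating the integrand leaves a small remainder, and the integral of the bounded truncation over a
short interval is small.\<close>

lemma nn_integral_short_interval:
 fixes h :: "real => ennreal"
 assumes h [measurable]: "Borel h" and fin: "(NBINT t. h t) < \<infinity>" and e: "0 < e"
 obtains r where "0 < r" "!!c c'. c' - c <= r ==> (NBINT t. indicator {c..c'} t * h t) <= ennreal e"
proof -
 define m where "m = (\<lambda>n t. min (h t) (of_nat n))"
 have [measurable]: "Borel (m n)" for n unfolding m_def by measurable
 have supm: "(SUP n. m n t) = h t" for t
 proof (rule antisym)
  show "(SUP n. m n t) <= h t" by (rule SUP_least) (simp add: m_def)
  show "h t <= (SUP n. m n t)"
  proof (cases "h t = top")
   case True
   then have "m n t = of_nat n" for n by (simp add: m_def)
   then have "(SUP n. m n t) = top" by (simp only: ennreal_SUP_of_nat_eq_top)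
   then show ?thesis by (simp only: top_greatest)
  next
   case False
   then obtain x where x: "h t = ennreal x" by (cases "h t") auto
   obtain n :: nat where "x <= real n" using real_arch_simple by blast
   then have "h t <= of_nat n" by (simp add: x ennreal_of_nat_eq_real_of_nat ennreal_leI)
   then have "h t = m n t" by (simp add: m_def)
   then show ?thesis using SUP_upper[of n UNIV "\<lambda>n. m n t"] by simp
  qed
 qed
 have "(SUP n. (NBINT t. m n t)) = (NBINT t. (SUP n. m n t))"
  by (rule nn_integral_monotone_convergence_SUP[symmetric]) (auto simp: m_def incseq_def le_fun_def min.coboundedI2)
 then have sup: "(SUP n. (NBINT t. m n t)) = (NBINT t. h t)" by (simp only: supm)
 obtain n where n: "(NBINT t. h t) <= (NBINT t. m n t) + ennreal (e / 2)"
 proof (cases "(NBINT t. h t) = 0")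
  case True
  then show thesis by (intro that[of 0]) simp
 next
  case False
  have "(NBINT t. h t) - ennreal (e / 2) < (NBINT t. h t)"
   using False fin e by (intro ennreal_between) (auto simp: zero_less_iff_neq_zero)
  then obtain n where "(NBINT t. h t) - ennreal (e / 2) < (NBINT t. m n t)"
   using sup less_SUP_iff[of "(NBINT t. h t) - ennreal (e / 2)" "\<lambda>n. (NBINT t. m n t)" UNIV] by auto
  then show thesis by (intro that[of n]) (metis add.commute ennreal_minus_le_iff less_imp_le)
 qed
 have finm: "(NBINT t. m n t) < \<infinity>"
  using fin by (rule le_less_trans[rotated]) (auto intro!: nn_integral_mono simp: m_def)
 show thesis
 proof (rule that[of "e / (2 * (real n + 1))"])
  show "0 < e / (2 * (real n + 1))" using e by simp
  fix c c' :: real assume cc: "c' - c <= e / (2 * (real n + 1))"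
  let ?I = "\<lambda>t. indicator {c..c'} t :: ennreal" and ?J = "\<lambda>t. indicator (- {c..c'}) t :: ennreal"
  have split: "(NBINT t. g t) = (NBINT t. ?I t * g t) + (NBINT t. ?J t * g t)"
   if [measurable]: "Borel g" for g :: "real => ennreal"
  proof -
   have "(NBINT t. ?I t * g t + ?J t * g t) = (NBINT t. ?I t * g t) + (NBINT t. ?J t * g t)"
    by (rule nn_integral_add) measurable
   moreover have "(NBINT t. ?I t * g t + ?J t * g t) = (NBINT t. g t)"
    by (intro nn_integral_cong) (auto simp: indicator_def)
   ultimately show ?thesis by simp
  qed
  have Jfin: "(NBINT t. ?J t * m n t) < \<infinity>"
   using finm by (rule le_less_trans[rotated]) (auto intro!: nn_integral_mono simp: indicator_def)
  have "(NBINT t. ?J t * m n t) + (NBINT t. ?I t * h t) <= (NBINT t. ?J t * h t) + (NBINT t. ?I t * h t)"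
   by (intro add_right_mono nn_integral_mono mult_left_mono) (auto simp: m_def)
  also have "... = (NBINT t. h t)" by (simp add: split[OF h] add.commute)
  also have "... <= (NBINT t. m n t) + ennreal (e / 2)" by (rule n)
  also have "... = (NBINT t. ?J t * m n t) + ((NBINT t. ?I t * m n t) + ennreal (e / 2))"
   by (subst split[of "m n"]) (auto simp: add_ac)
  finally have "(NBINT t. ?I t * h t) <= (NBINT t. ?I t * m n t) + ennreal (e / 2)"
   using Jfin by (auto simp: ennreal_add_left_cancel_le)
  also have "(NBINT t. ?I t * m n t) <= (NBINT t. ?I t * of_nat n)"
   by (intro nn_integral_mono mult_left_mono) (auto simp: m_def)
  also have "... <= ennreal (e / 2)"
  proof (cases "c <= c'")
   case True
   have "(NBINT t. ?I t * of_nat n) = ennreal (c' - c) * ennreal (real n)"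
    using True by (simp add: nn_integral_multc ennreal_of_nat_eq_real_of_nat)
   also have "... = ennreal ((c' - c) * real n)" using True by (simp add: ennreal_mult)
   also have "... <= ennreal (e / 2)"
   proof (rule ennreal_leI)
    have "(c' - c) * real n <= (e / (2 * (real n + 1))) * real n" using cc by (rule mult_right_mono) simp
    also have "... <= e / 2" using e by (simp add: field_simps)
    finally show "(c' - c) * real n <= e / 2" .
   qed
   finally show ?thesis .
  qed simp
  finally show "(NBINT t. ?I t * h t) <= ennreal e" using e by (simp add: ennreal_plus[symmetric] add_right_mono del: ennreal_plus)
 qed
qed

lemma continuous_le_SUP_Rats:
 fixes h :: "real => ennreal"
 assumes "isCont h w"
 shows "h w <= (SUP r\<in>\<rat>. h r)"
proof (rule ccontr)
 assume "\<not> ?thesis"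
 then have "(SUP r\<in>\<rat>. h r) < h w" by simp
 moreover have "(h \<longlongrightarrow> h w) (nhds w)" using assms unfolding isCont_def by (rule tendsto_at_iff_tendsto_nhds[THEN iffD1])
 ultimately have "\<forall>\<^sub>F z in nhds w. (SUP r\<in>\<rat>. h r) < h z" by (rule order_tendstoD(1)[rotated])
 then obtain e where e: "0 < e" "!!z. dist z w < e ==> (SUP r\<in>\<rat>. h r) < h z" unfolding eventually_nhds_metric by blast
 obtain r where r: "r \<in> \<rat>" "w < r" "r < w + e" using Rats_dense_in_real[of w "w + e"] e(1) by auto
 have "(SUP r\<in>\<rat>. h r) < h r" using r by (intro e(2)) (simp add: dist_real_def)
 then show False using SUP_upper[OF r(1), of h] by simp
qed

context solution
begin

text \<open>The supremum of \<open>|\<nabla>G(t,x,w)|\<close> over \<open>|w| \<le> U\<close>. By continuity rational \<open>w\<close> suffice, and a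
countable supremum is Borel in \<open>(t, x)\<close>.\<close>

definition sup_gradG :: "real => real => real ^ 'n => ennreal" where
 "sup_gradG U t x = (SUP r\<in>\<rat>. ennreal (norm (zero_before (grad_x G) t x (max (- U) (min U r)))))"

lemma sup_gradG_measurable: "(\<lambda>p. sup_gradG U (fst p) (snd p)) \<in> borel_measurable borel2"
 unfolding sup_gradG_def
proof (rule borel_measurable_SUP[OF countable_rat])
 fix r :: real
 have *: "(\<lambda>p. (fst p, snd p, max (- U) (min U r))) \<in> borel_measurable ((borel :: real measure) \<Otimes>\<^sub>M (borel :: (real ^ 'n) measure))" by (intro borel_measurable_Pair) auto
 have [measurable]: "(\<lambda>p. zero_before (grad_x G) (fst p) (snd p) (max (- U) (min U r))) \<in> borel_measurable borel2"
  using measurable_compose[OF * zero_before_continuous_Borel(2)[OF gradG_cont]] by simp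
 show "(\<lambda>p. ennreal (norm (zero_before (grad_x G) (fst p) (snd p) (max (- U) (min U r))))) \<in> borel_measurable borel2"
  by measurable
qed

lemma norm_gradG_le_sup:
 assumes t: "0 < t" and w: "\<bar>w\<bar> <= U"
 shows "ennreal (norm (grad_x G t x w)) <= sup_gradG U t x"
proof -
 have "continuous_on UNIV (\<lambda>r. grad_x G t x (max (- U) (min U r)))"
  using t by (intro continuous_on_Omega[OF gradG_cont] continuous_intros) auto
 then have "continuous_on UNIV (\<lambda>r. ennreal (norm (grad_x G t x (max (- U) (min U r)))))"
  by (intro continuous_on_ennreal continuous_on_norm)
 then have "isCont (\<lambda>r. ennreal (norm (grad_x G t x (max (- U) (min U r))))) w"
  by (simp add: continuous_on_eq_continuous_at)
 moreover have "max (- U) (min U w) = w" using w by auto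
 ultimately show ?thesis
  using continuous_le_SUP_Rats[of w "\<lambda>r. ennreal (norm (grad_x G t x (max (- U) (min U r))))"]
  unfolding sup_gradG_def zero_before_eq[OF t] by simp
qed

lemma isCont_gradG: "0 < t ==> isCont (\<lambda>w. grad_x G t x w) w"
 using continuous_on_Omega[OF gradG_cont, of UNIV "\<lambda>_. t" "\<lambda>_. x" "\<lambda>w. w"] by (simp add: continuous_on_eq_continuous_at)

lemma sup_gradG_le_Linf:
 assumes t: "0 < t" and U: "0 < U"
 shows "sup_gradG U t x <= Linf_norm {-U..U} (\<lambda>w. grad_x G t x w)"
 unfolding sup_gradG_def zero_before_eq[OF t]
 by (rule SUP_least, rule Linf_norm_interval_ge[OF isCont_gradG[OF t] _ U]) (use U in auto)

definition source_bound :: "real => real => real => ennreal" where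
 "source_bound T U t = indicator {0<..T} t * (NBINT x. sup_gradG U t x)"

lemma source_bound_measurable [measurable]: "Borel (source_bound T U)"
proof -
 have [measurable]: "(\<lambda>p. sup_gradG U (fst p) (snd p)) \<in> borel_measurable borel2" by (rule sup_gradG_measurable)
 have "Borel (\<lambda>t. (NBINT x. sup_gradG U (fst (t, x)) (snd (t, x))))" by measurable
 then have [measurable]: "Borel (\<lambda>t. (NBINT x. sup_gradG U t x))" by simp
 show ?thesis unfolding source_bound_def[abs_def] by measurable
qed

lemma source_bound_finite:
 assumes "0 < T" "0 < U"
 shows "(NBINT t. source_bound T U t) < \<infinity>"
proof -
 have "(NBINT t. source_bound T U t) <= (\<integral>\<^sup>+t. (\<integral>\<^sup>+x. Linf_norm {-U..U} (\<lambda>w. grad_x G t x w) \<partial>lebesgue) * indicator {0..T} t \<partial>lborel)"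
 proof (rule nn_integral_mono)
  fix t :: real
  show "source_bound T U t <= (\<integral>\<^sup>+x. Linf_norm {-U..U} (\<lambda>w. grad_x G t x w) \<partial>lebesgue) * indicator {0..T} t"
  proof (cases "t \<in> {0<..T}")
   case True
   have "(NBINT x. sup_gradG U t x) <= (NBINT x. Linf_norm {-U..U} (\<lambda>w. grad_x G t x w))"
    using True assms by (intro nn_integral_mono sup_gradG_le_Linf) auto
   then show ?thesis using True by (simp add: source_bound_def nn_integral_completion)
  qed (simp add: source_bound_def)
 qed
 also have "... < \<infinity>" using H_bounds(4)[OF assms(2,1)] by (simp only: nn_integral_completion)
 finally show ?thesis .
qed

lemma source_le_bound:
 assumes "represents v T' U' C" "0 < t" "t <= T" "U' <= U"
 shows "source v t <= source_bound T U t"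
proof -
 have v: "\<bar>v t x\<bar> <= U" for x using assms unfolding represents_def by (meson order_trans)
 have "source v t <= (NBINT x. sup_gradG U t x)"
  unfolding source_def zero_before_eq[OF assms(2)] by (intro nn_integral_mono norm_gradG_le_sup assms(2) v)
 then show ?thesis using assms by (simp add: source_bound_def)
qed

section \<open>The estimate with the constants of the solution\<close>

text \<open>The constants are those of the whole slab: in general larger than \<open>\<kappa>\<^sub>0\<^sup>*\<close>, but valid from time \<open>0\<close> on and beyond
\<open>T\<^sub>0\<close> if \<open>T > T\<^sub>0\<close>.\<close>

lemma TV_coarse:
 assumes T: "0 < T"
 obtains k where "0 <= k"
  "!!a b. 0 < a ==> a < b ==> b < T ==> TV (u b) <= ennreal (exp (k * (b - a))) * (TV (u a) + (NBINT t. indicator {a..b} t * source_bound T (U_max u T + 1) t))"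
  "!!b. 0 < b ==> b < T ==> TV (u b) <= ennreal (exp (k * b)) * (TV (u 0) + ennreal (real CARD('n)) * (NBINT t. indicator {0..b} t * source_bound T (U_max u T + 1) t))"
proof -
 let ?U = "U_max u T" and ?h = "source_bound T (U_max u T + 1)"
 have U1: "0 < ?U + 1" using U_max_nonneg[of T] by simp
 obtain L B M where MB: "0 <= L" "0 <= B" "0 <= M"
  "!!t x w. 0 < t ==> t < T ==> \<bar>w\<bar> <= ?U + 1 ==> norm (D_u f t x w) <= L"
  "!!t x w. 0 < t ==> t < T ==> \<bar>w\<bar> <= ?U + 1 ==> norm (D_u F t x w) <= B"
  "!!t x w. 0 < t ==> t < T ==> \<bar>w\<bar> <= ?U + 1 ==> norm (P t x w) <= M"
  by (rule box_bounds[OF U1 T]) (rule that)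
 have Mb: "norm (P t x w) <= M" and Bb: "norm (D_u F t x w) <= B" if "0 < t" "t < T" "\<bar>w\<bar> <= ?U" for t x w
  using MB(5)[OF that(1,2)] MB(6)[OF that(1,2)] that(3) by auto
 define k where "k = (2 * real CARD('n) + 1) * M + B"
 have k: "0 <= k" using MB by (simp add: k_def)
 obtain v where rep: "represents v T ?U UNIV" using ex_representative[OF T, of UNIV] by auto
 show thesis
 proof (rule that[OF k])
  fix a b :: real assume ab: "0 < a" "a < b" "b < T"
  have "TV (u b) <= ennreal (exp (k * (b - a))) * TV (u a) + (NBINT t. indicator {a..b} t * (ennreal (exp (k * (b - t))) * source v t))"
   by (rule TV_step[OF rep ab MB(3,2) Mb Bb k_def])
  also have "(NBINT t. indicator {a..b} t * (ennreal (exp (k * (b - t))) * source v t)) <= (NBINT t. ennreal (exp (k * (b - a))) * (indicator {a..b} t * ?h t))"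
  proof (rule nn_integral_mono)
   fix t :: real
   show "indicator {a..b} t * (ennreal (exp (k * (b - t))) * source v t) <= ennreal (exp (k * (b - a))) * (indicator {a..b} t * ?h t)"
   proof (cases "t \<in> {a..b}")
    case True
    have "source v t <= ?h t" by (rule source_le_bound[OF rep]) (use True ab in auto)
    moreover have "exp (k * (b - t)) <= exp (k * (b - a))" using True k by (simp add: mult_left_mono)
    ultimately show ?thesis using True by (simp add: mult_mono ennreal_leI)
   qed simp
  qed
  also have "... = ennreal (exp (k * (b - a))) * (NBINT t. indicator {a..b} t * ?h t)"
   by (rule nn_integral_cmult) measurable
  finally show "TV (u b) <= ennreal (exp (k * (b - a))) * (TV (u a) + (NBINT t. indicator {a..b} t * ?h t))"
   by (simp add: distrib_left add_left_mono)
 next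
  fix b :: real assume b: "0 < b" "b < T"
  have "(NBINT t. indicator {0..b} t * (NBINT x. sup_gradG (?U + 1) t x)) = (NBINT t. indicator {0..b} t * ?h t)"
  proof (rule nn_integral_cong_AE, use AE_lborel_singleton[of "0 :: real"] in eventually_elim)
   case (elim t)
   then show ?case using b by (auto simp: source_bound_def indicator_def)
  qed
  moreover have "TV (u b) <= ennreal (exp (k * b)) * (TV (u 0) + ennreal (real CARD('n)) * (NBINT t. indicator {0..b} t * (NBINT x. sup_gradG (?U + 1) t x)))"
   by (rule TV_initial[OF b MB(3,2) Mb Bb sup_gradG_measurable norm_gradG_le_sup k_def]) auto
  ultimately show "TV (u b) <= ennreal (exp (k * b)) * (TV (u 0) + ennreal (real CARD('n)) * (NBINT t. indicator {0..b} t * ?h t))"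
   by simp
 qed
qed

lemma TV_initial_eq: "TV (u 0) = TV u0"
proof -
 obtain g where g: "Borel g" "!!x. \<bar>g x\<bar> <= U_max u 1" "AE x in lborel. u 0 x = g x" "TV (u 0) = TV g"
  by (rule slice_representative[of 0 1]) auto
 have "AE x in lborel. u0 x = g x" using u_initial g(3) by eventually_elim simp
 from TV_cong_AE[OF g(1) this] show ?thesis using g(4) by simp
qed

lemma TV_finite:
 assumes "TV u0 < \<infinity>" "0 <= t"
 shows "TV (u t) < \<infinity>"
proof (cases "t = 0")
 case True
 then show ?thesis using assms by (simp add: TV_initial_eq)
next
 case False
 then have T: "0 < t + 1" "0 < t" "t < t + 1" using assms by auto
 obtain k where k: "TV (u t) <= ennreal (exp (k * t)) * (TV (u 0) + ennreal (real CARD('n)) * (NBINT s. indicator {0..t} s * source_bound (t + 1) (U_max u (t + 1) + 1) s))"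
  by (rule TV_coarse[OF T(1)]) (use T in blast)
 have "(NBINT s. indicator {0..t} s * source_bound (t + 1) (U_max u (t + 1) + 1) s) <= (NBINT s. source_bound (t + 1) (U_max u (t + 1) + 1) s)"
  by (intro nn_integral_mono) (auto simp: indicator_def)
 also have "... < \<infinity>" by (rule source_bound_finite[OF T(1)]) (use U_max_nonneg[of "t + 1"] in simp)
 finally have "ennreal (exp (k * t)) * (TV (u 0) + ennreal (real CARD('n)) * (NBINT s. indicator {0..t} s * source_bound (t + 1) (U_max u (t + 1) + 1) s)) < \<infinity>"
  using assms by (simp add: TV_initial_eq ennreal_mult_less_top)
 then show ?thesis using k by (rule le_less_trans[rotated])
qed

lemma kappa0_star_bounds:
 assumes "0 < T0" and U: "0 < U_max u T0"
 shows "0 < t ==> t < T0 ==> x \<in> closure (supp_upto u T0) ==> \<bar>w\<bar> <= U_max u T0 ==>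
   norm (P t x w) <= enn2real (Linf_norm (Sigma_upto u T0) (\<lambda>(t, x, w). D_x (D_u f) t x w))"
  and "0 < t ==> t < T0 ==> x \<in> closure (supp_upto u T0) ==> \<bar>w\<bar> <= U_max u T0 ==>
   norm (D_u F t x w) <= enn2real (Linf_norm (Sigma_upto u T0) (\<lambda>(t, x, w). D_u F t x w))"
proof -
 have sub: "Sigma_upto u T0 \<subseteq> Omega_box T0 (U_max u T0)" by (auto simp: Sigma_upto_def Omega_box_def)
 have fin: "r <= enn2real C" if "ennreal r <= C" "C < \<infinity>" "0 <= r" for r C
  using enn2real_mono[of "ennreal r" C] that by simp
 assume H: "0 < t" "t < T0" "x \<in> closure (supp_upto u T0)" "\<bar>w\<bar> <= U_max u T0"
 show "norm (P t x w) <= enn2real (Linf_norm (Sigma_upto u T0) (\<lambda>(t, x, w). D_x (D_u f) t x w))"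
  unfolding D_x_D_u[OF H(1), symmetric]
  by (rule fin[OF Linf_norm_Sigma_ge[OF fxu_cont H(1,2,4) U H(3)] le_less_trans[OF Linf_norm_mono[OF sub] H_bounds(3)[OF U assms(1)]]]) simp
 show "norm (D_u F t x w) <= enn2real (Linf_norm (Sigma_upto u T0) (\<lambda>(t, x, w). D_u F t x w))"
  by (rule fin[OF Linf_norm_Sigma_ge[OF Fu_cont H(1,2,4) U H(3)] le_less_trans[OF Linf_norm_mono[OF sub] H_bounds(2)[OF U assms(1)]]]) simp
qed

lemma kappa0_star_nonneg: "0 <= kappa0_star f F u T0"
 by (simp add: kappa0_star_def)

text \<open>If \<open>u\<close> vanishes up to time \<open>T\<^sub>0\<close>, then \<open>\<Sigma>\<close> is a null set and says nothing about the coefficients; the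
empty set then serves as the carrier of \<open>v\<close>.\<close>

lemma TV_fine:
 assumes T0: "0 < T0"
 obtains v C where "represents v T0 (U_max u T0) C"
  "!!a b. 0 < a ==> a < b ==> b < T0 ==> TV (u b) <= ennreal (exp (kappa0_star f F u T0 * (b - a))) * TV (u a)
    + (NBINT t. indicator {a..b} t * (ennreal (exp (kappa0_star f F u T0 * (b - t))) * source v t))"
proof -
 define C where "C = (if U_max u T0 = 0 then {} else closure (supp_upto u T0))"
 have "C \<in> sets borel" by (simp add: C_def)
 moreover have "AE x in lborel. x \<notin> C --> u t x = 0" if t: "0 < t" "t < T0" for t
 proof (cases "U_max u T0 = 0")
  case True
  have "AE x in lborel. \<bar>u t x\<bar> <= U_max u T0" using t by (intro slice_le_U_max) auto
  then show ?thesis by eventually_elim (simp add: True)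
 next
  case False
  have sub: "ess_supp (u t) \<subseteq> C" using t False closure_subset unfolding C_def supp_upto_def by fastforce
  have "AE x in lborel. x \<notin> ess_supp (u t) --> u t x = 0" using AE_ess_supp[of "u t"] unfolding AE_completion_iff .
  then show ?thesis by eventually_elim (use sub in auto)
 qed
 ultimately obtain v where rep: "represents v T0 (U_max u T0) C" using ex_representative[OF T0, of C] by blast
 have U: "0 < U_max u T0" "x \<in> closure (supp_upto u T0)" if "x \<in> C" for x
  using that U_max_nonneg[of T0] by (auto simp: C_def split: if_splits)
 show thesis
 proof (rule that[OF rep])
  fix a b :: real assume ab: "0 < a" "a < b" "b < T0"
  show "TV (u b) <= ennreal (exp (kappa0_star f F u T0 * (b - a))) * TV (u a)
    + (NBINT t. indicator {a..b} t * (ennreal (exp (kappa0_star f F u T0 * (b - t))) * source v t))"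
   by (rule TV_step[OF rep ab _ _ _ _ kappa0_star_def])
     (use kappa0_star_bounds[OF T0 U(1)] U(2) in auto)
 qed
qed

definition fine_source :: "(real => real ^ 'n => real) => real => real => real => ennreal" where
 "fine_source v \<kappa> s T = (NBINT t. indicator {s..T} t * (ennreal (exp (\<kappa> * (T - t))) * source v t))"

lemma fine_source_mono:
 assumes "0 <= \<kappa>" "s' <= s" "T <= T'"
 shows "fine_source v \<kappa> s T <= fine_source v \<kappa> s' T'"
 unfolding fine_source_def
proof (rule nn_integral_mono)
 fix t :: real
 have "exp (\<kappa> * (T - t)) <= exp (\<kappa> * (T' - t))" using assms by (simp add: mult_left_mono)
 then have "ennreal (exp (\<kappa> * (T - t))) * source v t <= ennreal (exp (\<kappa> * (T' - t))) * source v t"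
  by (intro mult_right_mono ennreal_leI) auto
 then show "indicator {s..T} t * (ennreal (exp (\<kappa> * (T - t))) * source v t) <= indicator {s'..T'} t * (ennreal (exp (\<kappa> * (T' - t))) * source v t)"
  using assms by (auto simp: indicator_def)
qed

text \<open>The fine estimate on \<open>[s, b]\<close> is followed by the coarse one on \<open>[b, T]\<close>, and preceded by it on \<open>[0, a]\<close>
if \<open>s = 0\<close>. On an interval of length at most \<open>e\<close> the factor \<open>exp(k e)\<close> and the source tend to \<open>1\<close> and \<open>0\<close>.\<close>

lemma TV_between:
 assumes T0: "0 < T0"
 obtains v C where "represents v T0 (U_max u T0) C"
  "!!s T. 0 <= s ==> s < T ==> T <= T0 ==> TV (u T) <= ennreal (exp (kappa0_star f F u T0 * (T - s))) * TV (u s) + fine_source v (kappa0_star f F u T0) s T"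
proof -
 let ?\<kappa> = "kappa0_star f F u T0" and ?N = "real CARD('n)"
 have \<kappa>: "0 <= ?\<kappa>" by (rule kappa0_star_nonneg)
 obtain v C where rep: "represents v T0 (U_max u T0) C"
  and fine: "!!a b. 0 < a ==> a < b ==> b < T0 ==> TV (u b) <= ennreal (exp (?\<kappa> * (b - a))) * TV (u a) + fine_source v ?\<kappa> a b"
  by (rule TV_fine[OF T0, folded fine_source_def]) (rule that)
 have T1: "0 < T0 + 1" using T0 by simp
 define h where "h = source_bound (T0 + 1) (U_max u (T0 + 1) + 1)"
 have hm: "Borel h" unfolding h_def by (rule source_bound_measurable)
 have hfin: "(NBINT t. h t) < \<infinity>" unfolding h_def by (rule source_bound_finite[OF T1]) (use U_max_nonneg[of "T0 + 1"] in simp)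
 obtain k where k: "0 <= k"
  "!!a b. 0 < a ==> a < b ==> b < T0 + 1 ==> TV (u b) <= ennreal (exp (k * (b - a))) * (TV (u a) + (NBINT t. indicator {a..b} t * h t))"
  "!!b. 0 < b ==> b < T0 + 1 ==> TV (u b) <= ennreal (exp (k * b)) * (TV (u 0) + ennreal ?N * (NBINT t. indicator {0..b} t * h t))"
  by (rule TV_coarse[OF T1, folded h_def]) (rule that)
 have ek: "ennreal (exp (k * r)) <= ennreal (exp (k * e))" if "r <= e" for r e
  using that k(1) by (intro ennreal_leI) (simp add: mult_left_mono)
 have pos: "TV (u T) <= ennreal (exp (?\<kappa> * (T - s))) * TV (u s) + fine_source v ?\<kappa> s T" if s: "0 < s" "s < T" "T <= T0" for s T
 proof (rule le_limit_right[of 1 1 _ k])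
  fix e :: real assume e: "0 < e"
  obtain r where r: "0 < r" "!!c c'. c' - c <= r ==> (NBINT t. indicator {c..c'} t * h t) <= ennreal e"
   by (rule nn_integral_short_interval[OF hm hfin e]) (rule that)
  define b where "b = T - min r (min e ((T - s) / 2))"
  have b: "T - b <= r" "T - b <= e" "b < T" using r(1) e s by (auto simp: b_def)
  have sb: "s < b"
  proof -
   have "min r (min e ((T - s) / 2)) <= (T - s) / 2" by (rule min.coboundedI2[OF min.cobounded2])
   then show ?thesis using s by (simp add: b_def field_simps)
  qed
  have "TV (u b) <= ennreal (exp (?\<kappa> * (b - s))) * TV (u s) + fine_source v ?\<kappa> s b"
   by (rule fine) (use s sb b in auto)
  also have "... <= ennreal (exp (?\<kappa> * (T - s))) * TV (u s) + fine_source v ?\<kappa> s T"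
   using \<kappa> b by (intro add_mono mult_right_mono ennreal_leI fine_source_mono) (auto intro: mult_left_mono)
  finally have 1: "TV (u b) <= ennreal (exp (?\<kappa> * (T - s))) * TV (u s) + fine_source v ?\<kappa> s T" .
  have "TV (u T) <= ennreal (exp (k * (T - b))) * (TV (u b) + (NBINT t. indicator {b..T} t * h t))"
   by (rule k(2)) (use s sb b in auto)
  also have "... <= ennreal (exp (k * e)) * ((ennreal (exp (?\<kappa> * (T - s))) * TV (u s) + fine_source v ?\<kappa> s T) + ennreal e)"
   by (rule mult_mono[OF ek[OF b(2)] add_mono[OF 1 r(2)[OF b(1)]]]) auto
  finally show "TV (u T) <= ennreal (exp (k * e)) * ((ennreal (exp (?\<kappa> * (T - s))) * TV (u s) + fine_source v ?\<kappa> s T) + ennreal (1 * e))"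
   by simp
 qed auto
 have zero: "TV (u T) <= ennreal (exp (?\<kappa> * T)) * TV (u 0) + fine_source v ?\<kappa> 0 T" if T: "0 < T" "T <= T0" for T
 proof (rule le_limit_right[of 1 "exp (?\<kappa> * T) * ?N" _ k])
  fix e :: real assume e: "0 < e"
  let ?E = "ennreal (exp (?\<kappa> * T))"
  obtain r where r: "0 < r" "!!c c'. c' - c <= r ==> (NBINT t. indicator {c..c'} t * h t) <= ennreal e"
   by (rule nn_integral_short_interval[OF hm hfin e]) (rule that)
  define a where "a = min r (min e (T / 2))"
  have a: "0 < a" "a <= r" "a <= e" "a < T" using r(1) e T by (auto simp: a_def min_def)
  have ek1: "1 <= ennreal (exp (k * e))" using k(1) e by simp
  have "TV (u a) <= ennreal (exp (k * a)) * (TV (u 0) + ennreal ?N * (NBINT t. indicator {0..a} t * h t))"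
   by (rule k(3)) (use a T in auto)
  also have "... <= ennreal (exp (k * e)) * (TV (u 0) + ennreal ?N * ennreal e)"
   by (rule mult_mono[OF ek[OF a(3)] add_left_mono[OF mult_left_mono[OF r(2)]]]) (use a in auto)
  finally have 1: "TV (u a) <= ennreal (exp (k * e)) * (TV (u 0) + ennreal ?N * ennreal e)" .
  have "TV (u T) <= ennreal (exp (?\<kappa> * (T - a))) * TV (u a) + fine_source v ?\<kappa> a T"
   by (rule pos) (use a T in auto)
  also have "... <= ?E * (ennreal (exp (k * e)) * (TV (u 0) + ennreal ?N * ennreal e)) + ennreal (exp (k * e)) * fine_source v ?\<kappa> 0 T"
  proof (rule add_mono)
   have "exp (?\<kappa> * (T - a)) <= exp (?\<kappa> * T)" using \<kappa> a by (simp add: mult_left_mono)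
   then show "ennreal (exp (?\<kappa> * (T - a))) * TV (u a) <= ?E * (ennreal (exp (k * e)) * (TV (u 0) + ennreal ?N * ennreal e))"
    by (intro mult_mono[OF ennreal_leI 1]) auto
   have "fine_source v ?\<kappa> a T <= 1 * fine_source v ?\<kappa> 0 T" using fine_source_mono[OF \<kappa>, of 0 a T T v] a by simp
   also have "... <= ennreal (exp (k * e)) * fine_source v ?\<kappa> 0 T" by (rule mult_right_mono[OF ek1]) simp
   finally show "fine_source v ?\<kappa> a T <= ennreal (exp (k * e)) * fine_source v ?\<kappa> 0 T" .
  qed
  also have "... = ennreal (exp (k * e)) * ((?E * TV (u 0) + fine_source v ?\<kappa> 0 T) + ennreal (exp (?\<kappa> * T) * ?N * e))"
   using e by (simp add: ennreal_mult algebra_simps)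
  finally show "TV (u T) <= ennreal (exp (k * e)) * ((?E * TV (u 0) + fine_source v ?\<kappa> 0 T) + ennreal (exp (?\<kappa> * T) * ?N * e))" .
 qed auto
 show thesis
 proof (rule that[OF rep])
  fix s T :: real assume s: "0 <= s" "s < T" "T <= T0"
  show "TV (u T) <= ennreal (exp (?\<kappa> * (T - s))) * TV (u s) + fine_source v ?\<kappa> s T"
   using pos[of s T] zero[of T] s by (cases "s = 0") auto
 qed
qed

lemma AE_slice_le_U_at:
 assumes "0 <= t"
 shows "AE x in lborel. \<bar>u t x\<bar> <= U_at u t"
proof -
 have "AE x in lebesgue. x \<in> UNIV --> ennreal (norm (u t x)) <= Linf_norm UNIV (u t)" by (rule Linf_norm_AE)
 then have ae: "AE x in lborel. ennreal (norm (u t x)) <= Linf_norm UNIV (u t)" unfolding AE_completion_iff by simp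
 have "AE x in lborel. \<bar>u t x\<bar> <= U_max u (t + 1)" using assms by (intro slice_le_U_max) auto
 then have "AE x in lborel. x \<in> UNIV --> ennreal (norm (u t x)) <= ennreal (U_max u (t + 1))" by eventually_elim (simp add: ennreal_leI)
 then have "AE x in lebesgue. x \<in> UNIV --> ennreal (norm (u t x)) <= ennreal (U_max u (t + 1))" by (rule AE_completion)
 then have "Linf_norm UNIV (u t) <= ennreal (U_max u (t + 1))" by (rule Linf_norm_leI)
 then have "Linf_norm UNIV (u t) = ennreal (U_at u t)" unfolding U_at_def by (cases "Linf_norm UNIV (u t)") (auto simp: top_unique)
 with ae have "AE x in lborel. ennreal (norm (u t x)) <= ennreal (U_at u t)" by (simp only:)
 moreover have "0 <= U_at u t" by (simp add: U_at_def)
 ultimately show ?thesis by simp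
qed

lemma TV_zero_slice:
 assumes "0 <= t" "U_at u t = 0"
 shows "TV (u t) = 0"
proof -
 have "AE x in lborel. u t x = 0" using AE_slice_le_U_at[OF assms(1)] by eventually_elim (simp add: assms(2))
 then have "TV (u t) = TV (\<lambda>x :: real ^ 'n. 0)" by (intro TV_cong_AE) auto
 also have "... = 0" unfolding TV_def by (intro antisym SUP_least) auto
 finally show ?thesis .
qed

lemma source_le_Linf:
 assumes rep: "represents v T0 U C"
 shows "AE t in lborel. 0 < t \<and> t < T0 \<and> 0 < U_at u t --> source v t <= (\<integral>\<^sup>+x. Linf_norm {- U_at u t..U_at u t} (\<lambda>w. grad_x G t x w) \<partial>lebesgue)"
proof -
 have "AE t in lborel. 0 < t \<and> t < T0 --> (AE x in lborel. v t x = u t x)" using rep by (simp add: represents_def)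
 then show ?thesis
 proof eventually_elim
  case (elim t)
  show ?case
  proof
   assume t: "0 < t \<and> t < T0 \<and> 0 < U_at u t"
   then have t0: "0 < t" and ae: "AE x in lborel. v t x = u t x" using elim by auto
   have le: "AE x in lborel. \<bar>u t x\<bar> <= U_at u t" using t0 by (intro AE_slice_le_U_at) simp
   have "source v t <= (NBINT x. Linf_norm {- U_at u t..U_at u t} (\<lambda>w. grad_x G t x w))"
    unfolding source_def zero_before_eq[OF t0]
   proof (rule nn_integral_mono_AE)
    show "AE x in lborel. ennreal (norm (grad_x G t x (v t x))) <= Linf_norm {- U_at u t..U_at u t} (\<lambda>w. grad_x G t x w)"
     using ae le by eventually_elim (intro Linf_norm_interval_ge isCont_gradG t0, use t in auto)
   qed
   then show "source v t <= (\<integral>\<^sup>+x. Linf_norm {- U_at u t..U_at u t} (\<lambda>w. grad_x G t x w) \<partial>lebesgue)" by (simp only: nn_integral_completion)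
  qed
 qed
qed

text \<open>If \<open>\<sigma>\<close> is the supremum of the times at which \<open>u\<close> vanishes, the estimate starts at such times \<open>s\<close> close to
\<open>\<sigma>\<close> with \<open>TV (u s) = 0\<close>, and the source between \<open>s\<close> and \<open>\<sigma>\<close> is negligible. After \<open>\<sigma>\<close> the interval
\<open>[-U\<^sub>t, U\<^sub>t]\<close> has inner points, so the essential supremum dominates the source.\<close>

lemma TV_bound_Linf:
 assumes T0: "0 < T0" and T: "0 <= T" "T <= T0"
 shows "TV (u T) <= TV u0 * ennreal (exp (kappa0_star f F u T0 * T))
    + (\<integral>\<^sup>+ t \<in> {0..T}. ennreal (exp (kappa0_star f F u T0 * (T - t)))
      * (\<integral>\<^sup>+ x. Linf_norm {- U_at u t..U_at u t} (\<lambda>w. grad_x G t x w) \<partial>lebesgue) \<partial>lebesgue)"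
proof -
 let ?\<kappa> = "kappa0_star f F u T0"
 let ?I = "\<lambda>t. \<integral>\<^sup>+ x. Linf_norm {- U_at u t..U_at u t} (\<lambda>w. grad_x G t x w) \<partial>lebesgue"
 let ?R = "\<integral>\<^sup>+ t \<in> {0..T}. ennreal (exp (?\<kappa> * (T - t))) * ?I t \<partial>lborel"
 have \<kappa>: "0 <= ?\<kappa>" by (rule kappa0_star_nonneg)
 obtain v C where rep: "represents v T0 (U_max u T0) C"
  and main: "!!s T. 0 <= s ==> s < T ==> T <= T0 ==> TV (u T) <= ennreal (exp (?\<kappa> * (T - s))) * TV (u s) + fine_source v ?\<kappa> s T"
  by (rule TV_between[OF T0]) (rule that)
 have src: "fine_source v ?\<kappa> s T <= ?R" if s: "0 <= s" "s <= T" "!!t. s < t ==> t < T ==> 0 < U_at u t" for s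
  unfolding fine_source_def
 proof (rule nn_integral_mono_AE)
  show "AE t in lborel. indicator {s..T} t * (ennreal (exp (?\<kappa> * (T - t))) * source v t) <= ennreal (exp (?\<kappa> * (T - t))) * ?I t * indicator {0..T} t"
   using source_le_Linf[OF rep] AE_lborel_singleton[of s] AE_lborel_singleton[of T]
  proof eventually_elim
   case (elim t)
   show ?case
   proof (cases "t \<in> {s..T}")
    case True
    then have "s < t" "t < T" using elim by auto
    then have "source v t <= ?I t" using elim(1) s T by auto
    then have "ennreal (exp (?\<kappa> * (T - t))) * source v t <= ennreal (exp (?\<kappa> * (T - t))) * ?I t" by (rule mult_left_mono) simp
    then show ?thesis using True s by simp
   qed simp
  qed
 qed
 define Z where "Z = {t \<in> {0..T}. U_at u t = 0}"
 have Uat: "0 < U_at u t" if "t \<in> {0..T}" "t \<notin> Z" for t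
  using that by (simp add: Z_def U_at_def less_le)
 consider "T = 0" | "T \<in> Z" | "0 < T" "Z = {}" | "0 < T" "T \<notin> Z" "Z ~= {}" using T by fastforce
 then have "TV (u T) <= TV u0 * ennreal (exp (?\<kappa> * T)) + ?R"
 proof cases
  case 1
  then show ?thesis by (simp add: TV_initial_eq)
 next
  case 2
  then have "TV (u T) = 0" unfolding Z_def by (intro TV_zero_slice) auto
  then show ?thesis by simp
 next
  case 3
  have "fine_source v ?\<kappa> 0 T <= ?R" using 3 Uat by (intro src) auto
  then have "TV (u T) <= ennreal (exp (?\<kappa> * T)) * TV (u 0) + ?R"
   using main[of 0 T] 3 T by (simp add: order_trans add_left_mono)
  then show ?thesis by (simp add: TV_initial_eq mult.commute)
 next
  case 4
  define \<sigma> where "\<sigma> = Sup Z"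
  have bdd: "bdd_above Z" unfolding Z_def by (rule bdd_aboveI[of _ T]) auto
  have Zle: "t <= \<sigma>" if "t \<in> Z" for t unfolding \<sigma>_def by (rule cSup_upper[OF that bdd])
  have \<sigma>T: "\<sigma> <= T" unfolding \<sigma>_def by (rule cSup_least[OF 4(3)]) (auto simp: Z_def)
  have \<sigma>0: "0 <= \<sigma>"
  proof -
   obtain t where "t \<in> Z" using 4(3) by blast
   then have "0 <= t" by (simp add: Z_def)
   then show ?thesis using Zle[OF \<open>t \<in> Z\<close>] by simp
  qed
  define h where "h = source_bound T0 (U_max u T0 + 1)"
  have hm [measurable]: "Borel h" unfolding h_def by (rule source_bound_measurable)
  have hfin: "(NBINT t. h t) < \<infinity>" unfolding h_def by (rule source_bound_finite[OF T0]) (use U_max_nonneg[of T0] in simp)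
  have srcm [measurable]: "Borel (source v)" by (rule source_measurable[OF rep])
  have "TV (u T) <= fine_source v ?\<kappa> \<sigma> T"
  proof (rule le_limit_right[of 1 "exp (?\<kappa> * T)" _ 0])
   fix e :: real assume e: "0 < e"
   obtain r where r: "0 < r" "!!c c'. c' - c <= r ==> (NBINT t. indicator {c..c'} t * h t) <= ennreal e"
    by (rule nn_integral_short_interval[OF hm hfin e]) (rule that)
   obtain s where s: "s \<in> Z" "\<sigma> - r < s"
    using less_cSup_iff[OF 4(3) bdd, of "\<sigma> - r"] r(1) by (auto simp: \<sigma>_def)
   have s': "0 <= s" "s < T" "U_at u s = 0" "s <= \<sigma>" using s(1) 4(2) Zle by (auto simp: Z_def less_le)
   have "TV (u T) <= fine_source v ?\<kappa> s T"
    using main[OF s'(1,2) T(2)] TV_zero_slice[OF s'(1,3)] by simp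
   also have "... <= (NBINT t. indicator {\<sigma>..T} t * (ennreal (exp (?\<kappa> * (T - t))) * source v t) + ennreal (exp (?\<kappa> * T)) * (indicator {s..\<sigma>} t * h t))"
    unfolding fine_source_def
   proof (rule nn_integral_mono_AE, use AE_lborel_singleton[of "0 :: real"] in eventually_elim)
    case (elim t)
    show ?case
    proof (cases "t \<in> {s..<\<sigma>}")
     case True
     then have "source v t <= h t" unfolding h_def using elim s' \<sigma>T T by (intro source_le_bound[OF rep]) auto
     moreover have "exp (?\<kappa> * (T - t)) <= exp (?\<kappa> * T)" using True s' \<kappa> by (simp add: mult_left_mono)
     ultimately have "ennreal (exp (?\<kappa> * (T - t))) * source v t <= ennreal (exp (?\<kappa> * T)) * h t"
      by (intro mult_mono ennreal_leI) auto
     then show ?thesis using True \<sigma>T by (simp add: indicator_def)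
    next
     case False
     then have "indicator {s..T} t * (ennreal (exp (?\<kappa> * (T - t))) * source v t) <= indicator {\<sigma>..T} t * (ennreal (exp (?\<kappa> * (T - t))) * source v t)"
      by (auto simp: indicator_def)
     then show ?thesis by (rule order_trans) simp
    qed
   qed
   also have "... = fine_source v ?\<kappa> \<sigma> T + (NBINT t. ennreal (exp (?\<kappa> * T)) * (indicator {s..\<sigma>} t * h t))"
    unfolding fine_source_def by (rule nn_integral_add) measurable
   also have "(NBINT t. ennreal (exp (?\<kappa> * T)) * (indicator {s..\<sigma>} t * h t)) = ennreal (exp (?\<kappa> * T)) * (NBINT t. indicator {s..\<sigma>} t * h t)"
    by (rule nn_integral_cmult) measurable
   also have "... <= ennreal (exp (?\<kappa> * T)) * ennreal e" using s(2) by (intro mult_left_mono r(2)) auto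
   finally show "TV (u T) <= ennreal (exp (0 * e)) * (fine_source v ?\<kappa> \<sigma> T + ennreal (exp (?\<kappa> * T) * e))"
    using e by (simp add: ennreal_mult)
  qed auto
  also have "... <= ?R"
  proof (rule src[OF \<sigma>0 \<sigma>T])
   fix t assume t: "\<sigma> < t" "t < T"
   then have "t \<notin> Z" using Zle[of t] by auto
   then show "0 < U_at u t" using t \<sigma>0 by (intro Uat) auto
  qed
  finally show ?thesis by (rule order_trans) simp
 qed
 then show ?thesis by (simp only: nn_integral_completion)
qed

end

theorem theorem2p2:
  fixes f :: "real \<Rightarrow> real ^ 'n \<Rightarrow> real \<Rightarrow> real ^ 'n"
    and F :: "real \<Rightarrow> real ^ 'n \<Rightarrow> real \<Rightarrow> real"
    and u0 :: "real ^ 'n \<Rightarrow> real"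
    and u :: "real \<Rightarrow> real ^ 'n \<Rightarrow> real"
  assumes H1: "H1_star f F"
    and H2: "H2_star f F"
    and u0: "Linf UNIV u0" "integrable lebesgue u0" "BV u0"
    and u: "weak_entropy_solution f F u0 u"
  shows "(\<forall>t>0. BV (u t)) \<and>
    (\<forall>T0>0. \<forall>T\<in>{0..T0}.
       TV (u T) \<le> TV u0 * ennreal (exp (kappa0_star f F u T0 * T))
         + ennreal (real CARD('n) * W_const CARD('n))
           * (\<integral>\<^sup>+ t \<in> {0..T}. ennreal (exp (kappa0_star f F u T0 * (T - t)))
                * (\<integral>\<^sup>+ x. Linf_norm {- U_at u t..U_at u t}
                       (\<lambda>w. grad_x (F_minus_div f F) t x w) \<partial>lebesgue) \<partial>lebesgue))"
proof -
 interpret solution f F u0 u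
  using H1 H2 u u0(3) by unfold_locales (auto simp: BV_def)
 have "BV (u t)" if "0 < t" for t
  using u_L1[of t] TV_finite[of t] that u0(3) by (simp add: BV_def)
 moreover have "TV (u T) <= TV u0 * ennreal (exp (kappa0_star f F u T0 * T))
     + ennreal (real CARD('n) * W_const CARD('n))
      * (\<integral>\<^sup>+ t \<in> {0..T}. ennreal (exp (kappa0_star f F u T0 * (T - t)))
        * (\<integral>\<^sup>+ x. Linf_norm {- U_at u t..U_at u t}
            (\<lambda>w. grad_x (F_minus_div f F) t x w) \<partial>lebesgue) \<partial>lebesgue)" if T: "0 < T0" "T \<in> {0..T0}" for T0 T
 proof -
  have W: "1 <= ennreal (real CARD('n) * W_const CARD('n))"
   using one_le_W_const[of "CARD('n)"] by simp
  have T': "0 <= T" "T <= T0" using T by auto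
  show ?thesis
   using mult_right_mono[OF W zero_le] by (intro order_trans[OF TV_bound_Linf[OF T(1) T'] add_left_mono]) simp
 qed
 ultimately show ?thesis by blast
qed

end
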